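(* Let $M$ be a Riemann surface. There is a one-to-one correspondence between (1) almost complex maps $F:M\to S^6$ with image not contained in a totally geodesic $S^2$, and (2) strongly conformal harmonic maps $\varphi:M\to G_2/\mathrm{SO}(4)$ with (a) $\varphi^\perp$ strongly conformal, (b) $\mathrm{rank}\,G'(\varphi)=1$ and (c) $G'(\varphi^\perp)\times G''(\varphi^\perp)$ a non-constant subbundle, given by $$F\mapsto\varphi=G''(f)\oplus f\oplus G'(f)\quad\text{with inverse}\quad\varphi\mapsto F=\mathrm i\,\overline L\times L/|L|^2;$$ here $f=\mathrm{span}\{F\}$ and $L$ is any nowhere zero (local) section of $G''(\varphi^\perp)$.
   Context: $\mathbb{O}$ is the algebra of octonions, $\mathrm{Im}\,\mathbb{O}\cong\mathbb{R}^7$ its imaginary part with the standard Euclidean inner product $(\cdot,\cdot)$ and vector product $v\times w=$ imaginary part of $v\cdot w$; both are extended complex-bilinearly to $\mathbb{C}^7=\mathrm{Im}\,\mathbb{O}\otimes\mathbb{C}$. Orthogonality in $\mathbb{C}^7$ and $|\cdot|$ are with respect to the Hermitian inner product $(v,\overline w)$. A real 3-dimensional subspace of $\mathrm{Im}\,\mathbb{O}$ is associative if it is the imaginary part of a subalgebra isomorphic to the quaternions; $G_2/\mathrm{SO}(4)$, $G_2=\mathrm{Aut}(\mathbb{O})$, is the symmetric space of all associative 3-dimensional subspaces (identified with their complexifications). A Riemann surface is a connected (not necessarily compact) one-dimensional complex manifold. $S^6$ is the unit sphere in $\mathrm{Im}\,\mathbb{O}$, with almost complex structure $J_Fv=F\times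 v$ ($v\in T_FS^6=\{F\}^\perp$). A smooth map $F:M\to S^6$ is almost complex if its differential intertwines the complex structure of $M$ with $J$; such maps are harmonic. Maps into Grassmannians of $\mathbb{C}^7$ (in particular into $G_2/\mathrm{SO}(4)$) are identified with subbundles of $M\times\mathbb{C}^7$; $f=\mathrm{span}\{F\}$ is a line subbundle. For a subbundle $\varphi$ and local complex coordinate $z$, $A'_\varphi,A''_\varphi:\varphi\to\varphi^\perp$ are the bundle maps $A'_\varphi(v)=\pi_{\varphi^\perp}(\partial_zv)$, $A''_\varphi(v)=\pi_{\varphi^\perp}(\partial_{\bar z}v)$ ($v\in\Gamma(\varphi)$), where $\pi_V$ is orthogonal projection onto $V$. If $\varphi$ is harmonic (so that $\varphi^\perp$ is too), $G'(\varphi)$ and $G''(\varphi)$ are the subbundles given by the images of $A'_\varphi$ and $A''_\varphi$, extended over the isolated points where the rank drops. A harmonic map $\varphi$ is strongly conformal if $G'(\varphi)\perp G''(\varphi)$. *)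

theory Defs
  imports "HOL-Analysis.Analysis"
begin

section \<open>Octonions, vector product, associative subspaces\<close>

text \<open>
  An octonion is a pair of its real and its imaginary part.  The imaginary units are indexed by
  the integers modulo 7 (the index type of \<^typ>\<open>real^7\<close>), with e(i) e(i+1) = e(i+3) and its
  cyclic rotations, and e(i) e(i) = -1.  The scalars are kept arbitrary: \<^typ>\<open>real\<close> gives the
  octonions, \<^typ>\<open>complex\<close> their complexification.
\<close>

type_synonym 'a octonion = "'a \<times> ('a^7)"

definition oct_mult :: "'a::comm_ring_1 octonion \<Rightarrow> 'a octonion \<Rightarrow> 'a octonion" where
  "oct_mult x y =
     (fst x * fst y - (\<Sum>i\<in>UNIV. snd x $ i * snd y $ i),
      (\<chi> k. fst x * snd y $ k + fst y * snd x $ k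
         + (snd x $ (k+1) * snd y $ (k+3) - snd x $ (k+3) * snd y $ (k+1))
         + (snd x $ (k+2) * snd y $ (k+6) - snd x $ (k+6) * snd y $ (k+2))
         + (snd x $ (k+4) * snd y $ (k+5) - snd x $ (k+5) * snd y $ (k+4))))"

definition cross7 :: "'a::comm_ring_1^7 \<Rightarrow> 'a^7 \<Rightarrow> 'a^7" where
  "cross7 v w = snd (oct_mult (0, v) (0, w))"

type_synonym quaternion = "real \<times> (real^3)"

definition quat_mult :: "quaternion \<Rightarrow> quaternion \<Rightarrow> quaternion" where
  "quat_mult x y =
     (fst x * fst y - snd x \<bullet> snd y,
      fst x *\<^sub>R snd y + fst y *\<^sub>R snd x + cross3 (snd x) (snd y))"

text \<open>An injective \<open>h\<close> below is automatically unital, as the octonions have no zero divisors.\<close>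

definition quaternion_subalgebra :: "real octonion set \<Rightarrow> bool" where
  "quaternion_subalgebra A \<longleftrightarrow>
     (\<exists>h :: quaternion \<Rightarrow> real octonion. linear h \<and> inj h
        \<and> (\<forall>x y. h (quat_mult x y) = oct_mult (h x) (h y)) \<and> A = range h)"

definition associative_subspace :: "(real^7) set \<Rightarrow> bool" where
  "associative_subspace V \<longleftrightarrow> subspace V \<and> dim V = 3
     \<and> (\<exists>A. quaternion_subalgebra A \<and> V = snd ` A)"

definition cvec :: "real^'n \<Rightarrow> complex^'n" where
  "cvec v = (\<chi> i. complex_of_real (v $ i))"

definition complexification :: "(real^'n) set \<Rightarrow> (complex^'n) set" where
  "complexification V = {cvec u + \<i> *s cvec v | u v. u \<in> V \<and> v \<in> V}"

definition G2_SO4 :: "(complex^7) set set" where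
  "G2_SO4 = complexification ` {V. associative_subspace V}"

section \<open>Hermitian geometry of complex coordinate space\<close>

definition vec_cnj :: "complex^'n \<Rightarrow> complex^'n" where
  "vec_cnj v = (\<chi> i. cnj (v $ i))"

definition hermitian :: "complex^'n \<Rightarrow> complex^'n \<Rightarrow> complex" where
  "hermitian v w = (\<Sum>i\<in>UNIV. v $ i * cnj (w $ i))"

definition orth_compl :: "(complex^'n) set \<Rightarrow> (complex^'n) set" where
  "orth_compl V = {w. \<forall>v\<in>V. hermitian w v = 0}"

definition orth_proj :: "(complex^'n) set \<Rightarrow> complex^'n \<Rightarrow> complex^'n" where
  "orth_proj V v = (THE w. w \<in> V \<and> v - w \<in> orth_compl V)"

definition Grassmannian :: "nat \<Rightarrow> (complex^'n) set set" where
  "Grassmannian k = {V. vec.subspace V \<and> vec.dim V = k}"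

text \<open>
  Grassmannians and their submanifolds carry the smooth structure and the metric induced by
  \<open>V \<mapsto> proj_matrix V\<close>, an equivariant embedding into the Euclidean space of matrices with inner
  product Re tr(A B*).  The induced metric is invariant, hence on these irreducible symmetric
  spaces it is the standard one up to a constant factor, which does not affect harmonicity.
\<close>

definition proj_matrix :: "(complex^'n) set \<Rightarrow> complex^'n^'n" where
  "proj_matrix V = matrix (orth_proj V)"

section \<open>Differential calculus\<close>

primrec times_differentiable_on ::
    "nat \<Rightarrow> 'a::real_normed_vector set \<Rightarrow> ('a \<Rightarrow> 'b::real_normed_vector) \<Rightarrow> bool" where
  "times_differentiable_on 0 S g \<longleftrightarrow> continuous_on S g"
| "times_differentiable_on (Suc k) S g \<longleftrightarrow>
     (\<forall>x\<in>S. g differentiable (at x)) \<and>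
     (\<forall>v. times_differentiable_on k S (\<lambda>x. frechet_derivative g (at x) v))"

text \<open>Meant for open sets.\<close>

definition smooth_on :: "'a::real_normed_vector set \<Rightarrow> ('a \<Rightarrow> 'b::real_normed_vector) \<Rightarrow> bool" where
  "smooth_on S g \<longleftrightarrow> (\<forall>k. times_differentiable_on k S g)"

definition d_z :: "(complex \<Rightarrow> complex^'n) \<Rightarrow> complex \<Rightarrow> complex^'n" where
  "d_z g w = (1/2) *s (frechet_derivative g (at w) 1 - \<i> *s frechet_derivative g (at w) \<i>)"

definition d_zbar :: "(complex \<Rightarrow> complex^'n) \<Rightarrow> complex \<Rightarrow> complex^'n" where
  "d_zbar g w = (1/2) *s (frechet_derivative g (at w) 1 + \<i> *s frechet_derivative g (at w) \<i>)"

definition laplacian :: "(complex \<Rightarrow> 'b::real_normed_vector) \<Rightarrow> complex \<Rightarrow> 'b" where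
  "laplacian g w =
     frechet_derivative (\<lambda>x. frechet_derivative g (at x) 1) (at w) 1
   + frechet_derivative (\<lambda>x. frechet_derivative g (at x) \<i>) (at w) \<i>"

definition tangent_vectors :: "'b::real_normed_vector set \<Rightarrow> 'b \<Rightarrow> 'b set" where
  "tangent_vectors N p = {v. \<exists>\<gamma> e. e > 0 \<and> smooth_on {-e<..<e} \<gamma> \<and> \<gamma> ` {-e<..<e} \<subseteq> N
      \<and> \<gamma> 0 = p \<and> (\<gamma> has_vector_derivative v) (at (0::real))}"

text \<open>
  A 2-sphere in the unit sphere which contains every geodesic tangent to it; the curves in the last
  clause are the unit speed geodesics.  These are exactly the great 2-spheres, see
  \<open>totally_geodesic_S2_iff_great_sphere\<close> below.
\<close>

definition totally_geodesic_S2 :: "'b::euclidean_space set \<Rightarrow> bool" where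
  "totally_geodesic_S2 S \<longleftrightarrow>
     S \<subseteq> sphere 0 1 \<and> S homeomorphic (sphere 0 1 :: (real^3) set) \<and>
     (\<forall>p\<in>S. subspace (tangent_vectors S p) \<and> dim (tangent_vectors S p) = 2 \<and>
        (\<forall>v\<in>tangent_vectors S p. norm v = 1 \<longrightarrow> (\<forall>t. cos t *\<^sub>R p + sin t *\<^sub>R v \<in> S)))"

section \<open>Riemann surfaces\<close>

type_synonym 'a chart = "'a set \<times> ('a \<Rightarrow> complex)"

record 'a surface =
  surf_top :: "'a topology"
  atlas :: "'a chart set"

abbreviation points :: "'a surface \<Rightarrow> 'a set" where
  "points M \<equiv> topspace (surf_top M)"

definition in_chart :: "'a chart \<Rightarrow> ('a \<Rightarrow> 'b) \<Rightarrow> complex \<Rightarrow> 'b" where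
  "in_chart c s = s \<circ> inv_into (fst c) (snd c)"

text \<open>The atlas need not be maximal.  Second countability is automatic (Rado).\<close>

definition riemann_surface :: "'a surface \<Rightarrow> bool" where
  "riemann_surface M \<longleftrightarrow>
     points M \<noteq> {} \<and> Hausdorff_space (surf_top M) \<and> connected_space (surf_top M)
   \<and> (\<Union>(fst ` atlas M)) = points M
   \<and> (\<forall>(U, z) \<in> atlas M. openin (surf_top M) U \<and> open (z ` U)
        \<and> homeomorphic_map (subtopology (surf_top M) U) (top_of_set (z ` U)) z)
   \<and> (\<forall>(U, z) \<in> atlas M. \<forall>(V, w) \<in> atlas M. in_chart (U, z) w holomorphic_on z ` (U \<inter> V))"

definition smooth_map_on :: "'a surface \<Rightarrow> 'a set \<Rightarrow> ('a \<Rightarrow> 'b::real_normed_vector) \<Rightarrow> bool" where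
  "smooth_map_on M U s \<longleftrightarrow> (\<forall>c\<in>atlas M. smooth_on (snd c ` (U \<inter> fst c)) (in_chart c s))"

text \<open>
  Maps into a submanifold \<open>N\<close> of a Euclidean space: the tension field is the tangential part of
  the Laplacian.  On a surface its vanishing depends on the conformal structure only, so the flat
  Laplacian of any chart may be used.
\<close>

definition harmonic_map :: "'a surface \<Rightarrow> 'b::euclidean_space set \<Rightarrow> ('a \<Rightarrow> 'b) \<Rightarrow> bool" where
  "harmonic_map M N g \<longleftrightarrow> smooth_map_on M (points M) g \<and> g ` points M \<subseteq> N
     \<and> (\<forall>c\<in>atlas M. \<forall>p\<in>fst c. \<forall>v\<in>tangent_vectors N (g p).
          laplacian (in_chart c g) (snd c p) \<bullet> v = 0)"

section \<open>Subbundles and Gauss bundles\<close>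

text \<open>
  A bundle is the family of its fibres over \<^term>\<open>points M\<close> (\<^term>\<open>undefined\<close> elsewhere, so that
  bundles over \<open>M\<close> are equal iff their fibres are).  The rank is constant since \<open>M\<close> is connected.
\<close>

definition smooth_subbundle :: "'a surface \<Rightarrow> ('a \<Rightarrow> (complex^'n) set) \<Rightarrow> bool" where
  "smooth_subbundle M \<psi> \<longleftrightarrow> \<psi> \<in> extensional (points M)
     \<and> (\<forall>p\<in>points M. vec.subspace (\<psi> p)) \<and> smooth_map_on M (points M) (\<lambda>p. proj_matrix (\<psi> p))"

definition smooth_section ::
    "'a surface \<Rightarrow> ('a \<Rightarrow> (complex^'n) set) \<Rightarrow> 'a set \<Rightarrow> ('a \<Rightarrow> complex^'n) \<Rightarrow> bool" where
  "smooth_section M \<phi> U s \<longleftrightarrow>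
     openin (surf_top M) U \<and> smooth_map_on M U s \<and> (\<forall>q\<in>U. s q \<in> \<phi> q)"

definition perp_bundle ::
    "'a surface \<Rightarrow> ('a \<Rightarrow> (complex^'n) set) \<Rightarrow> 'a \<Rightarrow> (complex^'n) set" where
  "perp_bundle M \<phi> = (\<lambda>p\<in>points M. orth_compl (\<phi> p))"

definition A' :: "('a \<Rightarrow> (complex^'n) set) \<Rightarrow> 'a chart \<Rightarrow> ('a \<Rightarrow> complex^'n) \<Rightarrow> 'a \<Rightarrow> complex^'n" where
  "A' \<phi> c v p = orth_proj (orth_compl (\<phi> p)) (d_z (in_chart c v) (snd c p))"

definition A'' :: "('a \<Rightarrow> (complex^'n) set) \<Rightarrow> 'a chart \<Rightarrow> ('a \<Rightarrow> complex^'n) \<Rightarrow> 'a \<Rightarrow> complex^'n" where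
  "A'' \<phi> c v p = orth_proj (orth_compl (\<phi> p)) (d_zbar (in_chart c v) (snd c p))"

text \<open>
  The image in the fibre over \<open>p\<close> of a bundle map given on sections of \<open>\<phi>\<close>.
\<close>

definition image_at ::
    "'a surface \<Rightarrow> ('a \<Rightarrow> (complex^'n) set) \<Rightarrow> (('a \<Rightarrow> complex^'n) \<Rightarrow> 'a \<Rightarrow> complex^'n) \<Rightarrow> 'a
      \<Rightarrow> (complex^'n) set" where
  "image_at M \<phi> A p = {A v p | U v. p \<in> U \<and> smooth_section M \<phi> U v}"

text \<open>
  The subbundle that agrees with the images of \<open>A c\<close> in every chart \<open>c\<close>, except at isolated points.
\<close>

definition filled_image ::
    "'a surface \<Rightarrow> ('a \<Rightarrow> (complex^'n) set) \<Rightarrow> ('a chart \<Rightarrow> ('a \<Rightarrow> complex^'n) \<Rightarrow> 'a \<Rightarrow> complex^'n)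
      \<Rightarrow> 'a \<Rightarrow> (complex^'n) set" where
  "filled_image M \<phi> A = (THE \<psi>. smooth_subbundle M \<psi> \<and>
     (surf_top M) derived_set_of
        {p \<in> points M. \<exists>c\<in>atlas M. p \<in> fst c \<and> \<psi> p \<noteq> image_at M \<phi> (A c) p} = {})"

definition G' :: "'a surface \<Rightarrow> ('a \<Rightarrow> (complex^'n) set) \<Rightarrow> 'a \<Rightarrow> (complex^'n) set" where
  "G' M \<phi> = filled_image M \<phi> (A' \<phi>)"

definition G'' :: "'a surface \<Rightarrow> ('a \<Rightarrow> (complex^'n) set) \<Rightarrow> 'a \<Rightarrow> (complex^'n) set" where
  "G'' M \<phi> = filled_image M \<phi> (A'' \<phi>)"

definition harmonic_bundle ::
    "'a surface \<Rightarrow> (complex^'n) set set \<Rightarrow> ('a \<Rightarrow> (complex^'n) set) \<Rightarrow> bool" where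
  "harmonic_bundle M N \<phi> \<longleftrightarrow> \<phi> \<in> points M \<rightarrow>\<^sub>E N
     \<and> harmonic_map M (proj_matrix ` N) (\<lambda>p. proj_matrix (\<phi> p))"

definition strongly_conformal ::
    "'a surface \<Rightarrow> (complex^'n) set set \<Rightarrow> ('a \<Rightarrow> (complex^'n) set) \<Rightarrow> bool" where
  "strongly_conformal M N \<phi> \<longleftrightarrow> harmonic_bundle M N \<phi>
     \<and> (\<forall>p\<in>points M. \<forall>v\<in>G' M \<phi> p. \<forall>w\<in>G'' M \<phi> p. hermitian v w = 0)"

definition has_rank :: "'a surface \<Rightarrow> ('a \<Rightarrow> (complex^'n) set) \<Rightarrow> nat \<Rightarrow> bool" where
  "has_rank M \<psi> k \<longleftrightarrow> (\<forall>p\<in>points M. vec.dim (\<psi> p) = k)"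

definition nonconstant_subbundle :: "'a surface \<Rightarrow> ('a \<Rightarrow> (complex^'n) set) \<Rightarrow> bool" where
  "nonconstant_subbundle M \<psi> \<longleftrightarrow> smooth_subbundle M \<psi> \<and> \<not> (\<exists>W. \<forall>p\<in>points M. \<psi> p = W)"

definition bundle_cross ::
    "'a surface \<Rightarrow> ('a \<Rightarrow> (complex^7) set) \<Rightarrow> ('a \<Rightarrow> (complex^7) set) \<Rightarrow> 'a \<Rightarrow> (complex^7) set" where
  "bundle_cross M \<phi> \<psi> = (\<lambda>p\<in>points M. vec.span {cross7 v w | v w. v \<in> \<phi> p \<and> w \<in> \<psi> p})"

definition bundle_sum ::
    "'a surface \<Rightarrow> ('a \<Rightarrow> (complex^'n) set) \<Rightarrow> ('a \<Rightarrow> (complex^'n) set) \<Rightarrow> 'a \<Rightarrow> (complex^'n) set" where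
  "bundle_sum M \<phi> \<psi> = (\<lambda>p\<in>points M. {v + w | v w. v \<in> \<phi> p \<and> w \<in> \<psi> p})"

section \<open>The two sides of the correspondence\<close>

definition almost_complex_map :: "'a surface \<Rightarrow> ('a \<Rightarrow> real^7) \<Rightarrow> bool" where
  "almost_complex_map M F \<longleftrightarrow> F \<in> points M \<rightarrow>\<^sub>E sphere 0 1 \<and> smooth_map_on M (points M) F
     \<and> (\<forall>c\<in>atlas M. \<forall>p\<in>fst c. \<forall>\<xi>.
          frechet_derivative (in_chart c F) (at (snd c p)) (\<i> * \<xi>)
          = cross7 (F p) (frechet_derivative (in_chart c F) (at (snd c p)) \<xi>))"

definition almost_complex_maps :: "'a surface \<Rightarrow> ('a \<Rightarrow> real^7) set" where
  "almost_complex_maps M = {F. almost_complex_map M F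
     \<and> \<not> (\<exists>S. totally_geodesic_S2 S \<and> F ` points M \<subseteq> S)}"

definition conformal_G2_maps :: "'a surface \<Rightarrow> ('a \<Rightarrow> (complex^7) set) set" where
  "conformal_G2_maps M = {\<phi>. strongly_conformal M G2_SO4 \<phi>
     \<and> strongly_conformal M (Grassmannian 4) (perp_bundle M \<phi>)
     \<and> has_rank M (G' M \<phi>) 1
     \<and> nonconstant_subbundle M
         (bundle_cross M (G' M (perp_bundle M \<phi>)) (G'' M (perp_bundle M \<phi>)))}"

definition line_bundle_of :: "'a surface \<Rightarrow> ('a \<Rightarrow> real^7) \<Rightarrow> 'a \<Rightarrow> (complex^7) set" where
  "line_bundle_of M F = (\<lambda>p\<in>points M. vec.span {cvec (F p)})"

definition to_G2_map :: "'a surface \<Rightarrow> ('a \<Rightarrow> real^7) \<Rightarrow> 'a \<Rightarrow> (complex^7) set" where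
  "to_G2_map M F = (let f = line_bundle_of M F in
     bundle_sum M (bundle_sum M (G'' M f) f) (G' M f))"

definition nonvanishing_section ::
    "'a surface \<Rightarrow> ('a \<Rightarrow> (complex^'n) set) \<Rightarrow> 'a set \<Rightarrow> ('a \<Rightarrow> complex^'n) \<Rightarrow> bool" where
  "nonvanishing_section M \<phi> U L \<longleftrightarrow> smooth_section M \<phi> U L \<and> (\<forall>q\<in>U. L q \<noteq> 0)"

section \<open>Consistency checks\<close>

lemma UNIV_7: "(UNIV :: 7 set) = {0,1,2,3,4,5,6}"
proof -
  have "x \<in> {0,1,2,3,4,5,6}" for x :: 7
  proof (cases x)
    case (of_int z)
    then have "z \<in> {0..<7}" by simp
    also have "{0..<7} = {0,1,2,3,4,5,6::int}" by auto
    finally show ?thesis unfolding of_int(1) by auto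
  qed
  then show ?thesis by auto
qed

lemma sum_7: "sum f (UNIV :: 7 set) = f 0 + f 1 + f 2 + f 3 + f 4 + f 5 + f 6"
  unfolding UNIV_7 by (simp add: add.assoc)

lemma index_7: "(7::7) = 0" "(8::7) = 1" "(9::7) = 2" "(10::7) = 3" "(11::7) = 4" "(12::7) = 5"
  by simp_all

lemma norm_octonion:
  "(norm (x :: real octonion))\<^sup>2 = (fst x)\<^sup>2 + (\<Sum>i\<in>UNIV. (snd x $ i)\<^sup>2)"
  by (simp add: norm_prod_def norm_vec_def L2_set_def sum_nonneg)

text \<open>So \<^const>\<open>oct_mult\<close> is the multiplication of the 8-dimensional real composition algebra.\<close>

lemma norm_oct_mult: "norm (oct_mult x y) = norm x * norm (y :: real octonion)"
proof -
  have "(norm (oct_mult x y))\<^sup>2 = (norm x)\<^sup>2 * (norm y)\<^sup>2"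
    unfolding norm_octonion oct_mult_def sum_7 by (simp add: index_7) algebra
  then have "(norm (oct_mult x y))\<^sup>2 = (norm x * norm y)\<^sup>2"
    by (simp only: power_mult_distrib)
  then show ?thesis
    by (simp only: power2_eq_iff_nonneg norm_ge_zero mult_nonneg_nonneg)
qed

lemma smooth_on_circle:
  "smooth_on S (\<lambda>t::real. cos (c * t) *\<^sub>R a + sin (c * t) *\<^sub>R (b::'b::real_normed_vector))"
proof -
  have "times_differentiable_on k S (\<lambda>t::real. cos (c * t) *\<^sub>R a + sin (c * t) *\<^sub>R b)"
    for k and a b :: 'b
  proof (induction k arbitrary: a b)
    case 0
    show ?case by (auto intro!: continuous_intros)
  next
    case (Suc k)
    have D: "((\<lambda>t::real. cos (c * t) *\<^sub>R a + sin (c * t) *\<^sub>R b) has_derivative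
        (\<lambda>v. cos (c * x) *\<^sub>R ((v * c) *\<^sub>R b) + sin (c * x) *\<^sub>R ((- v * c) *\<^sub>R a))) (at x)" for x
      by (auto intro!: derivative_eq_intros simp: algebra_simps)
    have "(\<lambda>t::real. cos (c * t) *\<^sub>R a + sin (c * t) *\<^sub>R b) differentiable (at x)" for x
      using D differentiable_def by blast
    then show ?case
      using Suc by (simp only: times_differentiable_on.simps frechet_derivative_at[OF D, symmetric]) simp_all?
  qed
  then show ?thesis by (simp add: smooth_on_def)
qed

lemma norm_circle:
  fixes p u :: "'b::euclidean_space"
  assumes "norm p = 1" "norm u = 1 \<or> u = 0 \<and> sin t = 0" "p \<bullet> u = 0"
  shows "norm (cos t *\<^sub>R p + sin t *\<^sub>R u) = 1"
proof -
  have "(norm (cos t *\<^sub>R p + sin t *\<^sub>R u))\<^sup>2 = (cos t)\<^sup>2 * (p \<bullet> p) + (sin t)\<^sup>2 * (u \<bullet> u)"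
    using assms(3) unfolding power2_norm_eq_inner
    by (simp add: inner_add_left inner_add_right inner_commute power2_eq_square)
  also have "\<dots> = 1"
    using assms(1,2) sin_cos_squared_add[of t] by (elim disjE) (auto simp: dot_square_norm)
  finally show ?thesis
    using norm_ge_zero[of "cos t *\<^sub>R p + sin t *\<^sub>R u"] by (auto simp: power2_eq_1_iff simp del: norm_ge_zero)
qed

lemma has_derivative_eventually_const:
  assumes "(f has_derivative f') (at x)" "\<forall>\<^sub>F t in nhds x. f t = c"
  shows "f' = (\<lambda>h. 0)"
proof -
  have "((\<lambda>_. c) has_derivative f') (at x)"
    using assms(1)
  proof (rule has_derivative_transform_eventually)
    show "\<forall>\<^sub>F x' in at x. f x' = c" using assms(2) by (auto simp: eventually_at_filter elim: eventually_mono)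
    show "f x = c" using assms(2) by (rule eventually_nhds_x_imp_x)
  qed simp
  then show ?thesis by (rule has_derivative_unique) (rule has_derivative_const)
qed

lemma tangent_vectors_mono: "S \<subseteq> T \<Longrightarrow> tangent_vectors S p \<subseteq> tangent_vectors T p"
  unfolding tangent_vectors_def by blast

lemma tangent_vectors_great_sphere:
  fixes V :: "'b::euclidean_space set"
  assumes V: "subspace V" and p: "p \<in> V" "norm p = 1"
  shows "tangent_vectors (V \<inter> sphere 0 1) p = {v \<in> V. p \<bullet> v = 0}"
proof (intro equalityI subsetI)
  fix v assume "v \<in> tangent_vectors (V \<inter> sphere 0 1) p"
  then obtain \<gamma> e where e: "e > 0" and im: "\<gamma> ` {-e<..<e} \<subseteq> V \<inter> sphere 0 1" and 0: "\<gamma> 0 = p"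
    and D: "(\<gamma> has_vector_derivative v) (at (0::real))"
    by (auto simp: tangent_vectors_def)
  have ev: "\<forall>\<^sub>F t in nhds 0. \<gamma> t \<in> V \<and> norm (\<gamma> t) = 1"
    unfolding eventually_nhds using im e
    by (intro exI[of _ "{-e<..<e}"]) (auto simp: image_subset_iff)
  have orth: "w \<bullet> v = 0" if "\<forall>\<^sub>F t in nhds 0. w \<bullet> \<gamma> t = 0" for w
  proof -
    have "((\<lambda>t. w \<bullet> \<gamma> t) has_derivative (\<lambda>h. w \<bullet> (h *\<^sub>R v))) (at 0)"
      using D unfolding has_vector_derivative_def by (rule has_derivative_inner_right)
    from has_derivative_eventually_const[OF this that] have "(\<lambda>h. w \<bullet> (h *\<^sub>R v)) = (\<lambda>h. 0)" .
    from fun_cong[OF this, of 1] show ?thesis by simp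
  qed
  have "v \<in> V"
  proof -
    have "v \<in> span V"
    proof (rule ccontr)
      assume "v \<notin> span V"
      obtain x y where xy: "x \<in> span V" "\<And>w. w \<in> span V \<Longrightarrow> orthogonal y w" "v = x + y"
        using orthogonal_subspace_decomp_exists[of V v] by metis
      have "\<forall>\<^sub>F t in nhds 0. y \<bullet> \<gamma> t = 0"
        using ev xy(2) by (auto elim!: eventually_mono simp: orthogonal_def span_base)
      then have "y \<bullet> v = 0" by (rule orth)
      then have "y \<bullet> y = 0" using xy(1,2) unfolding xy(3) by (simp add: inner_add_right orthogonal_def)
      then show False using xy \<open>v \<notin> span V\<close> by simp
    qed
    then show ?thesis using V by (simp add: span_eq_iff[THEN iffD2])
  qed
  moreover have "p \<bullet> v = 0"
  proof -
    have "((\<lambda>t. \<gamma> t \<bullet> \<gamma> t) has_derivative (\<lambda>h. \<gamma> 0 \<bullet> (h *\<^sub>R v) + (h *\<^sub>R v) \<bullet> \<gamma> 0)) (at 0)"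
      using D[unfolded has_vector_derivative_def] D[unfolded has_vector_derivative_def]
      by (rule has_derivative_inner)
    moreover have "\<forall>\<^sub>F t in nhds 0. \<gamma> t \<bullet> \<gamma> t = 1"
      using ev by (rule eventually_mono) (simp add: dot_square_norm)
    ultimately have "(\<lambda>h. \<gamma> 0 \<bullet> (h *\<^sub>R v) + (h *\<^sub>R v) \<bullet> \<gamma> 0) = (\<lambda>h. 0)"
      by (rule has_derivative_eventually_const)
    from fun_cong[OF this, of 1] show ?thesis using 0 by (simp add: inner_commute)
  qed
  ultimately show "v \<in> {v \<in> V. p \<bullet> v = 0}" by simp
next
  fix v assume v: "v \<in> {v \<in> V. p \<bullet> v = 0}"
  define \<gamma> where "\<gamma> = (\<lambda>t. cos (norm v * t) *\<^sub>R p + sin (norm v * t) *\<^sub>R sgn v)"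
  have sgn: "sgn v \<in> V" "p \<bullet> sgn v = 0"
    using v V by (auto simp: sgn_div_norm subspace_scale)
  have D: "(\<gamma> has_vector_derivative v) (at 0)"
    unfolding \<gamma>_def has_vector_derivative_def
    by (cases "v = 0") (auto intro!: derivative_eq_intros simp: sgn_div_norm)
  have "\<gamma> t \<in> V \<inter> sphere 0 1" for t
  proof -
    have "norm (\<gamma> t) = 1" unfolding \<gamma>_def
      using p sgn by (intro norm_circle) (auto simp: norm_sgn)
    then show ?thesis
      using V sgn p by (auto simp: \<gamma>_def intro!: subspace_add subspace_scale)
  qed
  moreover have "smooth_on {-1<..<1} \<gamma>" unfolding \<gamma>_def by (rule smooth_on_circle)
  moreover have "\<gamma> 0 = p" by (simp add: \<gamma>_def)
  ultimately show "v \<in> tangent_vectors (V \<inter> sphere 0 1) p"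
    unfolding tangent_vectors_def using D by (intro CollectI exI[of _ \<gamma>] exI[of _ 1]) auto
qed

lemma sphere2_subset_eq:
  assumes S: "S homeomorphic (sphere 0 1 :: (real^3) set)"
    and T: "T homeomorphic (sphere 0 1 :: (real^3) set)" and "T \<subseteq> S"
  shows "T = S"
proof (rule ccontr)
  assume "T \<noteq> S"
  then obtain s where s: "s \<in> S" "s \<notin> T" using \<open>T \<subseteq> S\<close> by auto
  obtain h h' where h: "homeomorphism S (sphere 0 1 :: (real^3) set) h h'"
    using S by (auto simp: homeomorphic_def)
  obtain k k' where k: "homeomorphism (sphere 0 1 :: (real^3) set) T k k'"
    using T by (meson homeomorphic_def homeomorphic_sym)
  have injh: "inj_on h S" and injk: "inj_on k (sphere 0 1)"
    using h k by (auto simp: homeomorphism_def intro: inj_on_inverseI)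
  have "h s \<in> sphere 0 1" using h s by (auto simp: homeomorphism_def)
  then have "(sphere 0 1 - {h s}) homeomorphic (UNIV :: (real^2) set)"
    by (intro homeomorphic_punctured_sphere_affine) auto
  then obtain g g' where g: "homeomorphism (sphere 0 1 - {h s}) (UNIV :: (real^2) set) g g'"
    by (auto simp: homeomorphic_def)
  have injg: "inj_on g (sphere 0 1 - {h s})"
    using g by (auto simp: homeomorphism_def intro: inj_on_inverseI)
  have kim: "k ` sphere 0 1 \<subseteq> S - {s}" using k s \<open>T \<subseteq> S\<close> by (auto simp: homeomorphism_def)
  have him: "h ` (S - {s}) \<subseteq> sphere 0 1 - {h s}"
    using h injh s by (auto simp: homeomorphism_def inj_on_def)
  have hk: "(h \<circ> k) ` sphere 0 1 \<subseteq> sphere 0 1 - {h s}"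
    using image_mono[OF kim, of h] him unfolding image_comp by (rule subset_trans)
  have "continuous_on (sphere 0 1) (g \<circ> (h \<circ> k))"
  proof (intro continuous_on_compose)
    show "continuous_on (sphere 0 1) k" using k by (simp add: homeomorphism_def)
    show "continuous_on (k ` sphere 0 1) h"
      using h kim by (auto simp: homeomorphism_def intro: continuous_on_subset)
    show "continuous_on ((h \<circ> k) ` sphere 0 1) g"
      using homeomorphism_cont1[OF g] hk by (rule continuous_on_subset)
  qed
  moreover have "inj_on (g \<circ> (h \<circ> k)) (sphere 0 1)"
  proof (intro comp_inj_on injk)
    show "inj_on h (k ` sphere 0 1)" using injh kim by (meson inj_on_subset subset_trans Diff_subset)
    show "inj_on g ((h \<circ> k) ` sphere 0 1)" using injg hk by (rule inj_on_subset)
  qed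
  ultimately have "DIM(real^3) \<le> DIM(real^2)"
    by (rule no_embedding_sphere_lowdim) simp
  then show False by simp
qed

lemma homeomorphic_great_sphere:
  fixes V :: "'b::euclidean_space set"
  assumes V: "subspace V" "dim V = 3"
  shows "(V \<inter> sphere 0 1) homeomorphic (sphere 0 1 :: (real^3) set)"
proof -
  obtain f g where fg: "linear f" "linear g" "f ` V = (UNIV :: (real^3) set)" "g ` UNIV = V"
      "\<And>x. x \<in> V \<Longrightarrow> norm (f x) = norm x" "\<And>x. norm (g x) = norm x"
      "\<And>x. x \<in> V \<Longrightarrow> g (f x) = x" "\<And>x. f (g x) = x"
    using isometries_subspaces[OF V(1) subspace_UNIV[where 'a="real^3"]] V(2) by auto
  show ?thesis
    unfolding homeomorphic_def homeomorphism_def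
  proof (intro exI[of _ f] exI[of _ g] conjI)
    show "f ` (V \<inter> sphere 0 1) = sphere 0 1"
    proof (intro equalityI subsetI)
      fix y :: "real^3" assume "y \<in> sphere 0 1"
      then show "y \<in> f ` (V \<inter> sphere 0 1)"
        using fg(4,6,8) by (intro image_eqI[of _ _ "g y"]) auto
    qed (use fg(5) in auto)
    show "g ` sphere 0 1 = V \<inter> sphere 0 1"
    proof (intro equalityI subsetI)
      fix y assume "y \<in> V \<inter> sphere 0 1"
      then show "y \<in> g ` sphere 0 1"
        using fg(5,7) by (intro image_eqI[of _ _ "f y"]) auto
    qed (use fg(4,6) in auto)
  qed (use fg in \<open>auto intro!: linear_continuous_on simp: linear_conv_bounded_linear\<close>)
qed

lemma totally_geodesic_S2_iff_great_sphere:
  fixes S :: "'b::euclidean_space set"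
  shows "totally_geodesic_S2 S \<longleftrightarrow> (\<exists>V. subspace V \<and> dim V = 3 \<and> S = V \<inter> sphere 0 1)"
proof
  assume "\<exists>V. subspace V \<and> dim V = 3 \<and> S = V \<inter> sphere 0 1"
  then obtain V where V: "subspace V" "dim V = 3" and S: "S = V \<inter> sphere 0 1" by auto
  have T: "tangent_vectors S p = {v \<in> V. p \<bullet> v = 0}" if "p \<in> S" for p
    using tangent_vectors_great_sphere[OF V(1), of p] that unfolding S by auto
  have "subspace {v \<in> V. p \<bullet> v = 0}" for p
    using V(1) by (auto simp: subspace_def inner_add_right)
  moreover have "dim {v \<in> V. p \<bullet> v = 0} = 2" if "p \<in> S" for p
  proof -
    have p: "p \<in> V" "p \<noteq> 0" using that S by auto
    have "{y \<in> V. \<forall>x \<in> span {p}. orthogonal x y} = {v \<in> V. p \<bullet> v = 0}"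
      by (auto simp: span_singleton orthogonal_def)
    moreover have "dim (span {p}) = 1" using p by (simp add: dim_singleton)
    ultimately show ?thesis
      using dim_subspace_orthogonal_to_vectors[of "span {p}" V] V p
      by (simp add: span_minimal)
  qed
  moreover have "cos t *\<^sub>R p + sin t *\<^sub>R v \<in> S"
    if "p \<in> S" "v \<in> V" "p \<bullet> v = 0" "norm v = 1" for p v t
    using that V(1) norm_circle[of p v t] by (auto simp: S intro!: subspace_add subspace_scale)
  ultimately show "totally_geodesic_S2 S"
    unfolding totally_geodesic_S2_def using T homeomorphic_great_sphere[OF V] by (auto simp: S)
next
  assume "totally_geodesic_S2 S"
  then have sub: "S \<subseteq> sphere 0 1" and hom: "S homeomorphic (sphere 0 1 :: (real^3) set)"
    and tan: "\<And>p. p \<in> S \<Longrightarrow> subspace (tangent_vectors S p)"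
      "\<And>p. p \<in> S \<Longrightarrow> dim (tangent_vectors S p) = 2"
    and geo: "\<And>p v t. p \<in> S \<Longrightarrow> v \<in> tangent_vectors S p \<Longrightarrow> norm v = 1
        \<Longrightarrow> cos t *\<^sub>R p + sin t *\<^sub>R v \<in> S"
    unfolding totally_geodesic_S2_def by auto
  have "(sphere 0 1 :: (real^3) set) \<noteq> {}" by simp
  then have "S \<noteq> {}" using hom homeomorphic_empty by metis
  then obtain p where p: "p \<in> S" by auto
  define T where "T = tangent_vectors S p"
  have np: "norm p = 1" using p sub by auto
  have "T \<subseteq> tangent_vectors (UNIV \<inter> sphere 0 1) p"
    unfolding T_def using sub by (intro tangent_vectors_mono) auto
  then have orth: "p \<bullet> v = 0" if "v \<in> T" for v
    using tangent_vectors_great_sphere[OF subspace_UNIV, of p] np that by auto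
  have T: "subspace T" "dim T = 2" using tan p by (auto simp: T_def)
  define V where "V = span (insert p T)"
  have "p \<notin> span T"
    using orth[of p] np T(1) by (auto simp: span_eq_iff[THEN iffD2])
  then have V: "subspace V" "dim V = 3"
    using T by (auto simp: V_def dim_insert)
  have "V \<inter> sphere 0 1 \<subseteq> S"
  proof
    fix x assume x: "x \<in> V \<inter> sphere 0 1"
    then obtain a where "x - a *\<^sub>R p \<in> span T"
      by (auto simp: V_def span_insert)
    then have "x - a *\<^sub>R p \<in> T"
      using T(1) by (simp only: span_eq_iff[THEN iffD2])
    then obtain v where v: "v \<in> T" "x = a *\<^sub>R p + v"
      by (intro that[of "x - a *\<^sub>R p"]) simp_all
    have "1 = x \<bullet> x" using x by (simp add: dot_square_norm)
    also have "\<dots> = a\<^sup>2 + (norm v)\<^sup>2"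
      using orth[OF v(1)] np unfolding v(2) power2_norm_eq_inner
      by (simp add: inner_add_left inner_add_right inner_commute norm_eq_1 power2_eq_square)
    finally obtain t where t: "a = cos t" "norm v = sin t"
      using sincos_total_pi[of "norm v" a] by auto
    show "x \<in> S"
    proof (cases "v = 0")
      case False
      have "sgn v \<in> T" using v T by (auto simp: sgn_div_norm subspace_scale)
      then have "cos t *\<^sub>R p + sin t *\<^sub>R sgn v \<in> S"
        using geo[OF p] False by (auto simp: T_def norm_sgn)
      then show ?thesis using False by (simp add: v(2) t(1) flip: t(2)) (simp add: sgn_div_norm)
    next
      case True
      obtain u where u: "u \<in> T" "u \<noteq> 0"
      proof (rule ccontr)
        assume "\<not> thesis"
        then have "T \<subseteq> {0}" using that by blast
        then show False using T(2) dim_eq_0[of T] by simp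
      qed
      then have "sgn u \<in> T" using T by (auto simp: sgn_div_norm subspace_scale)
      then have "cos t *\<^sub>R p + sin t *\<^sub>R sgn u \<in> S"
        using geo[OF p] u by (auto simp: T_def norm_sgn)
      then show ?thesis using True t by (simp add: v(2))
    qed
  qed
  then have "V \<inter> sphere 0 1 = S"
    using sphere2_subset_eq[OF hom homeomorphic_great_sphere[OF V]] by simp
  then show "\<exists>V. subspace V \<and> dim V = 3 \<and> S = V \<inter> sphere 0 1" using V by blast
qed

end

theory Submission
  imports Defs "HOL-Complex_Analysis.Complex_Analysis"
begin

text \<open>
  If \<open>F\<close> is almost complex, then \<open>F_z\<close> spans (after division by a power of the coordinate at its zeros) a line
  bundle with local sections \<open>L\<close> such that \<open>F \<times> L = \<i> L\<close>. The latter makes \<open>L\<close> isotropic and gives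
  \<open>cnj L \<times> L = -\<i> |L|^2 F\<close>, so \<open>\<phi> = span {L, F, cnj L}\<close> is associative, and the component \<open>Q\<close> of \<open>L_z\<close>
  orthogonal to \<open>\<phi>\<close> spans \<open>G'(\<phi>)\<close>. It satisfies \<open>F \<times> Q = \<i> Q\<close> as well, which makes \<open>\<phi>\<close> strongly conformal, and
  it vanishes identically only if \<open>\<phi>\<close> is constant, in which case \<open>F\<close> maps into the great sphere of \<open>\<phi>\<close>.

  Conversely, up to sign \<open>A''\<close> of the orthogonal complement of \<open>\<phi>\<close> is the adjoint of \<open>A'\<close> of \<open>\<phi>\<close>, so it has rank one and its image
  is spanned by an isotropic \<open>L\<close> in \<open>\<phi>\<close>. With \<open>F = \<i> cnj L \<times> L / |L|^2\<close> the kernel of \<open>A'\<close> is spanned by \<open>F\<close> and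
  \<open>cnj L\<close>, hence \<open>F_z = p L + q cnj L\<close>, and comparing mixed derivatives shows \<open>q = 0\<close>, which means that \<open>F\<close>
  is almost complex.
\<close>

section \<open>Smooth functions\<close>

text \<open>The analytic obstacle is that Gauss bundles exist only after the zeros of F_z and of Q
  have been divided out, and these functions are merely smooth. Both solve an equation g_zbar = (g,
  X) Y which, with X and Y held fixed, is linear in g. Hence the equation passes to the quotient g /
  z and the division can be repeated. A maximum principle for a weighted |h|^2 bounds all quotients
  by their values on one fixed circle, so that a zero of infinite order makes g vanish nearby. On a
  connected surface this leaves two cases: identically zero, or isolated zeros. A second obstacle is
  logical. \<open>G'\<close> and \<open>G''\<close> are definite descriptions, so in the converse
  direction the existence of the bundles has to be drawn from the hypotheses: rank one does this for
  \<phi>, and (c) for its complement. Even then a bundle is known to be the image of A' or A'' only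
  off isolated points, so everything is shown at generic points of a disc and carried to the centre
  by continuity. Condition (c) enters once more: the product bundle in it is the line of F, so F is
  not constant.\<close>

lemma times_differentiable_on_Suc_imp:
  "times_differentiable_on (Suc k) S g \<Longrightarrow> times_differentiable_on k S g"
proof (induction k arbitrary: g)
  case 0
  then show ?case
    by (auto intro!: continuous_at_imp_continuous_on differentiable_imp_continuous_within)
next
  case (Suc k)
  have "\<forall>x\<in>S. g differentiable (at x)"
    "\<And>v. times_differentiable_on (Suc k) S (\<lambda>x. frechet_derivative g (at x) v)"
    using Suc.prems unfolding times_differentiable_on.simps(2)[of "Suc k" S g] by blast+
  with Suc.IH show ?case unfolding times_differentiable_on.simps(2)[of k S g] by blast
qed

lemma times_differentiable_on_subset:
  "times_differentiable_on k S g \<Longrightarrow> T \<subseteq> S \<Longrightarrow> times_differentiable_on k T g"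
  by (induction k arbitrary: g) (auto intro: continuous_on_subset)

lemma times_differentiable_on_cong:
  assumes "open S" "\<And>x. x \<in> S \<Longrightarrow> f x = g x" "times_differentiable_on k S f"
  shows "times_differentiable_on k S g"
  using assms(2,3)
proof (induction k arbitrary: f g)
  case 0
  then show ?case using continuous_on_cong[of S S f g] by simp
next
  case (Suc k)
  have D: "(g has_derivative frechet_derivative f (at x)) (at x)" if "x \<in> S" for x
  proof (rule has_derivative_transform_within_open[OF _ assms(1) that])
    show "(f has_derivative frechet_derivative f (at x)) (at x)"
      using Suc.prems(2) that by (simp add: frechet_derivative_works[symmetric])
  qed (rule Suc.prems(1))
  have "times_differentiable_on k S (\<lambda>x. frechet_derivative g (at x) v)" for v
  proof (rule Suc.IH)
    show "frechet_derivative f (at x) v = frechet_derivative g (at x) v" if "x \<in> S" for x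
      by (simp only: frechet_derivative_at[OF D[OF that]])
    show "times_differentiable_on k S (\<lambda>x. frechet_derivative f (at x) v)"
      using Suc.prems(2) by simp
  qed
  then show ?case using differentiableI[OF D] by simp
qed

text \<open>Induction steps below supply the derivative by a formula. On the open set it agrees with
  \<open>frechet_derivative\<close>, so regularity can be checked on the formula.\<close>

lemma times_differentiable_on_SucI:
  assumes "open S" "\<And>x. x \<in> S \<Longrightarrow> (g has_derivative g' x) (at x)"
    "\<And>v. times_differentiable_on k S (\<lambda>x. g' x v)"
  shows "times_differentiable_on (Suc k) S g"
proof -
  have "times_differentiable_on k S (\<lambda>x. frechet_derivative g (at x) v)" for v
    by (intro times_differentiable_on_cong[OF assms(1) _ assms(3)[of v]])
       (simp add: frechet_derivative_at[OF assms(2)])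
  then show ?thesis using differentiableI[OF assms(2)] by auto
qed

lemma times_differentiable_on_SucD:
  assumes "times_differentiable_on (Suc k) S g"
  shows "\<And>x. x \<in> S \<Longrightarrow> (g has_derivative frechet_derivative g (at x)) (at x)"
    "\<And>v. times_differentiable_on k S (\<lambda>x. frechet_derivative g (at x) v)"
  using assms by (auto simp: frechet_derivative_works[THEN iffD1])

lemma times_differentiable_on_const [simp]: "open S \<Longrightarrow> times_differentiable_on k S (\<lambda>x. c)"
proof (induction k arbitrary: c)
  case (Suc k)
  then show ?case by (intro times_differentiable_on_SucI[where g'="\<lambda>x v. 0"]) auto
qed simp

lemma times_differentiable_on_add:
  assumes "open S" "times_differentiable_on k S f" "times_differentiable_on k S g"
  shows "times_differentiable_on k S (\<lambda>x. f x + g x)"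
  using assms(2,3)
proof (induction k arbitrary: f g)
  case 0
  then show ?case by (auto intro: continuous_intros)
next
  case (Suc k)
  note D = times_differentiable_on_SucD[OF Suc.prems(1)] times_differentiable_on_SucD[OF Suc.prems(2)]
  show ?case
    by (rule times_differentiable_on_SucI[OF assms(1) has_derivative_add[OF D(1,3)] Suc.IH[OF D(2,4)]])
qed

lemma times_differentiable_on_linear:
  assumes "open S" "times_differentiable_on k S f" "bounded_linear T"
  shows "times_differentiable_on k S (\<lambda>x. T (f x))"
  using assms(2)
proof (induction k arbitrary: f)
  case 0
  then show ?case using assms(3) by (auto intro: bounded_linear.continuous_on)
next
  case (Suc k)
  note D = times_differentiable_on_SucD[OF Suc.prems(1)]
  show ?case
    by (rule times_differentiable_on_SucI[OF assms(1) bounded_linear.has_derivative[OF assms(3) D(1)] Suc.IH[OF D(2)]])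
qed

text \<open>The product rule pairs a derivative with an undifferentiated factor, so one order of
  differentiability of that factor is given up before the induction hypothesis applies.\<close>

lemma times_differentiable_on_bilinear:
  assumes "open S" "times_differentiable_on k S f" "times_differentiable_on k S g" "bounded_bilinear B"
  shows "times_differentiable_on k S (\<lambda>x. B (f x) (g x))"
  using assms(2,3)
proof (induction k arbitrary: f g)
  case 0
  then show ?case using assms(4) by (auto intro: bounded_bilinear.continuous_on)
next
  case (Suc k)
  note D = times_differentiable_on_SucD[OF Suc.prems(1)] times_differentiable_on_SucD[OF Suc.prems(2)]
  show ?case
    by (rule times_differentiable_on_SucI[OF assms(1) bounded_bilinear.FDERIV[OF assms(4) D(1,3)]
        times_differentiable_on_add[OF assms(1)
          Suc.IH[OF times_differentiable_on_Suc_imp[OF Suc.prems(1)] D(4)]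
          Suc.IH[OF D(2) times_differentiable_on_Suc_imp[OF Suc.prems(2)]]]])
qed

lemma times_differentiable_on_local:
  assumes "\<And>x. x \<in> S \<Longrightarrow> \<exists>T. open T \<and> x \<in> T \<and> times_differentiable_on k T g"
  shows "times_differentiable_on k S g"
  using assms
proof (induction k arbitrary: g)
  case 0
  have "isCont g x" if x: "x \<in> S" for x
  proof -
    obtain T where "open T" "x \<in> T" "continuous_on T g" using 0[OF x] by auto
    then show ?thesis by (simp add: continuous_on_eq_continuous_at)
  qed
  then show ?case by (simp add: continuous_at_imp_continuous_on)
next
  case (Suc k)
  have "g differentiable (at x)" if "x \<in> S" for x
    using Suc.prems[OF that] by auto
  moreover have "times_differentiable_on k S (\<lambda>x. frechet_derivative g (at x) v)" for v
  proof (rule Suc.IH)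
    fix x assume "x \<in> S"
    from Suc.prems[OF this]
    show "\<exists>T. open T \<and> x \<in> T \<and> times_differentiable_on k T (\<lambda>x. frechet_derivative g (at x) v)"
      by auto
  qed
  ultimately show ?case by simp
qed

lemma complex_linear_decomp:
  assumes "linear (D :: complex \<Rightarrow> 'b::real_vector)"
  shows "D v = Re v *\<^sub>R D 1 + Im v *\<^sub>R D \<i>"
proof -
  have "v = Re v *\<^sub>R 1 + Im v *\<^sub>R \<i>" by (simp add: complex_eq_iff)
  then have "D v = D (Re v *\<^sub>R 1 + Im v *\<^sub>R \<i>)" by (rule arg_cong)
  then show ?thesis using assms by (simp add: linear_add linear_scale)
qed

text \<open>The chain rule evaluates the derivative of g in the moving direction f' x v. Expressed
  by its values in the fixed directions 1 and \<i> it becomes a sum of products that the induction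
  can treat; this is why the middle space is the complex plane.\<close>

lemma times_differentiable_on_compose:
  fixes g :: "complex \<Rightarrow> 'b::real_normed_vector" and f :: "'a::real_normed_vector \<Rightarrow> complex"
  assumes "open S" "f ` S \<subseteq> T" "times_differentiable_on k S f" "times_differentiable_on k T g"
  shows "times_differentiable_on k S (\<lambda>x. g (f x))"
  using assms(3,4)
proof (induction k arbitrary: g)
  case 0
  then show ?case using assms(2) by (auto intro: continuous_on_compose2)
next
  case (Suc k)
  note D = times_differentiable_on_SucD[OF Suc.prems(1)] times_differentiable_on_SucD[OF Suc.prems(2)]
  let ?f' = "\<lambda>x. frechet_derivative f (at x)"
  let ?g' = "\<lambda>x. frechet_derivative g (at x)"
  have kf: "times_differentiable_on k S f" by (rule times_differentiable_on_Suc_imp) fact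
  show ?case
  proof (rule times_differentiable_on_SucI[OF assms(1)])
    fix x assume x: "x \<in> S"
    have g': "(g has_derivative ?g' (f x)) (at (f x))" using D(3) x assms(2) by auto
    have "((\<lambda>x. g (f x)) has_derivative (\<lambda>v. ?g' (f x) (?f' x v))) (at x)"
      using diff_chain_at[OF D(1)[OF x] g'] by (simp only: o_def)
    moreover have "?g' (f x) (?f' x v) = Re (?f' x v) *\<^sub>R ?g' (f x) 1 + Im (?f' x v) *\<^sub>R ?g' (f x) \<i>" for v
      using g' by (intro complex_linear_decomp has_derivative_linear)
    ultimately show "((\<lambda>x. g (f x)) has_derivative
        (\<lambda>v. Re (?f' x v) *\<^sub>R ?g' (f x) 1 + Im (?f' x v) *\<^sub>R ?g' (f x) \<i>)) (at x)"
      by (simp only:)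
  next
    fix v
    show "times_differentiable_on k S
        (\<lambda>x. Re (?f' x v) *\<^sub>R ?g' (f x) 1 + Im (?f' x v) *\<^sub>R ?g' (f x) \<i>)"
    proof (rule times_differentiable_on_add[OF assms(1)])
      have *: "times_differentiable_on k S (\<lambda>x. ?g' (f x) c)" for c
        by (rule Suc.IH[OF kf D(4)])
      have Re: "times_differentiable_on k S (\<lambda>x. Re (?f' x v))"
        by (rule times_differentiable_on_linear[OF assms(1) D(2) bounded_linear_Re])
      have Im: "times_differentiable_on k S (\<lambda>x. Im (?f' x v))"
        by (rule times_differentiable_on_linear[OF assms(1) D(2) bounded_linear_Im])
      show "times_differentiable_on k S (\<lambda>x. Re (?f' x v) *\<^sub>R ?g' (f x) 1)"
        by (rule times_differentiable_on_bilinear[OF assms(1) Re * bounded_bilinear_scaleR])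
      show "times_differentiable_on k S (\<lambda>x. Im (?f' x v) *\<^sub>R ?g' (f x) \<i>)"
        by (rule times_differentiable_on_bilinear[OF assms(1) Im * bounded_bilinear_scaleR])
    qed
  qed
qed

lemma times_differentiable_on_holomorphic:
  assumes "open S" "f holomorphic_on S"
  shows "times_differentiable_on k S f"
  using assms(2)
proof (induction k arbitrary: f)
  case 0
  then show ?case by (simp add: holomorphic_on_imp_continuous_on)
next
  case (Suc k)
  show ?case
  proof (rule times_differentiable_on_SucI[OF assms(1)])
    show "(f has_derivative (*) (deriv f x)) (at x)" if "x \<in> S" for x
      using holomorphic_derivI[OF Suc.prems assms(1) that] by (simp add: has_field_derivative_def)
    show "times_differentiable_on k S (\<lambda>x. deriv f x * v)" for v
      by (rule times_differentiable_on_bilinear[OF assms(1) Suc.IH[OF holomorphic_deriv[OF Suc.prems assms(1)]]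
          times_differentiable_on_const[OF assms(1)] bounded_bilinear_mult])
  qed
qed

section \<open>Closure properties of smooth maps\<close>

lemma smooth_on_subset: "smooth_on S g \<Longrightarrow> T \<subseteq> S \<Longrightarrow> smooth_on T g"
  using times_differentiable_on_subset[of _ S g T] by (simp add: smooth_on_def)

lemma smooth_on_cong: "open S \<Longrightarrow> smooth_on S f \<Longrightarrow> (\<And>x. x \<in> S \<Longrightarrow> f x = g x) \<Longrightarrow> smooth_on S g"
  using times_differentiable_on_cong[of S f g] by (simp add: smooth_on_def)

lemma smooth_on_const [simp]: "open S \<Longrightarrow> smooth_on S (\<lambda>x. c)"
  by (simp add: smooth_on_def)

lemma smooth_on_add: "open S \<Longrightarrow> smooth_on S f \<Longrightarrow> smooth_on S g \<Longrightarrow> smooth_on S (\<lambda>x. f x + g x)"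
  by (simp add: smooth_on_def times_differentiable_on_add)

lemma smooth_on_linear: "open S \<Longrightarrow> smooth_on S f \<Longrightarrow> bounded_linear T \<Longrightarrow> smooth_on S (\<lambda>x. T (f x))"
  by (simp add: smooth_on_def times_differentiable_on_linear)

lemma smooth_on_minus: "open S \<Longrightarrow> smooth_on S f \<Longrightarrow> smooth_on S (\<lambda>x. - f x)"
  by (rule smooth_on_linear[OF _ _ bounded_linear_minus[OF bounded_linear_ident]])

lemma smooth_on_diff: "open S \<Longrightarrow> smooth_on S f \<Longrightarrow> smooth_on S g \<Longrightarrow> smooth_on S (\<lambda>x. f x - g x)"
  using smooth_on_add[of S f "\<lambda>x. - g x"] smooth_on_minus[of S g] by simp

lemma smooth_on_bilinear:
  "open S \<Longrightarrow> smooth_on S f \<Longrightarrow> smooth_on S g \<Longrightarrow> bounded_bilinear B \<Longrightarrow> smooth_on S (\<lambda>x. B (f x) (g x))"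
  by (simp add: smooth_on_def times_differentiable_on_bilinear)

lemma smooth_on_mult:
  fixes f g :: "'a::real_normed_vector \<Rightarrow> 'b::real_normed_algebra"
  shows "open S \<Longrightarrow> smooth_on S f \<Longrightarrow> smooth_on S g \<Longrightarrow> smooth_on S (\<lambda>x. f x * g x)"
  by (rule smooth_on_bilinear[OF _ _ _ bounded_bilinear_mult])

lemma smooth_on_local:
  assumes "\<And>x. x \<in> S \<Longrightarrow> \<exists>T. open T \<and> x \<in> T \<and> smooth_on T g"
  shows "smooth_on S g"
  unfolding smooth_on_def
proof
  fix k
  show "times_differentiable_on k S g"
    using assms by (intro times_differentiable_on_local) (auto simp: smooth_on_def)
qed

lemma smooth_on_compose:
  fixes g :: "complex \<Rightarrow> 'b::real_normed_vector" and f :: "'a::real_normed_vector \<Rightarrow> complex"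
  shows "open S \<Longrightarrow> f ` S \<subseteq> T \<Longrightarrow> smooth_on S f \<Longrightarrow> smooth_on T g \<Longrightarrow> smooth_on S (\<lambda>x. g (f x))"
  by (simp add: smooth_on_def times_differentiable_on_compose)

lemma smooth_on_holomorphic: "open S \<Longrightarrow> f holomorphic_on S \<Longrightarrow> smooth_on S f"
  by (simp add: smooth_on_def times_differentiable_on_holomorphic)

lemma smooth_on_ident: "open S \<Longrightarrow> smooth_on S (\<lambda>z::complex. z)"
  by (intro smooth_on_holomorphic holomorphic_on_ident)

lemma smooth_on_inverse:
  fixes f :: "'a::real_normed_vector \<Rightarrow> complex"
  assumes "open S" "smooth_on S f" "\<And>x. x \<in> S \<Longrightarrow> f x \<noteq> 0"
  shows "smooth_on S (\<lambda>x. inverse (f x))"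
proof (rule smooth_on_compose[OF assms(1) _ assms(2)])
  show "f ` S \<subseteq> - {0}" using assms(3) by auto
  show "smooth_on (- {0}) (inverse :: complex \<Rightarrow> complex)"
    by (rule smooth_on_holomorphic) (auto intro: holomorphic_intros)
qed

lemma smooth_on_frechet: "smooth_on S g \<Longrightarrow> smooth_on S (\<lambda>x. frechet_derivative g (at x) v)"
  using times_differentiable_on_SucD(2)[of _ S g] by (simp add: smooth_on_def)

lemma smooth_on_imp_derivative:
  "smooth_on S g \<Longrightarrow> x \<in> S \<Longrightarrow> (g has_derivative frechet_derivative g (at x)) (at x)"
  using times_differentiable_on_SucD(1)[of 0 S g x] unfolding smooth_on_def by blast

lemma smooth_on_imp_continuous_on: "smooth_on S g \<Longrightarrow> continuous_on S g"
  unfolding smooth_on_def using times_differentiable_on.simps(1)[of S g] by blast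

lemma smooth_on_imp_isCont: "smooth_on S g \<Longrightarrow> x \<in> S \<Longrightarrow> isCont g x"
  by (rule has_derivative_continuous[OF smooth_on_imp_derivative])

text \<open>Symmetry of second derivatives, by two applications of the mean value theorem to the second
  difference of \<open>f\<close>.\<close>

lemma second_difference:
  fixes f :: "'a::real_normed_vector \<Rightarrow> real"
  assumes S: "times_differentiable_on 2 S f" and st: "s > 0" "t > 0"
    and sub: "\<And>x y. 0 \<le> x \<Longrightarrow> x \<le> s \<Longrightarrow> 0 \<le> y \<Longrightarrow> y \<le> t \<Longrightarrow> a + x *\<^sub>R v + y *\<^sub>R w \<in> S"
  shows "\<exists>x y. 0 < x \<and> x < s \<and> 0 < y \<and> y < t \<and>
    f (a + s *\<^sub>R v + t *\<^sub>R w) - f (a + s *\<^sub>R v) - f (a + t *\<^sub>R w) + f a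
     = s * t * frechet_derivative (\<lambda>z. frechet_derivative f (at z) v) (at (a + x *\<^sub>R v + y *\<^sub>R w)) w"
proof -
  have S': "times_differentiable_on (Suc (Suc 0)) S f" using S by (simp only: numeral_2_eq_2)
  note D1 = times_differentiable_on_SucD[OF S']
  note D2 = times_differentiable_on_SucD(1)[OF D1(2)]
  have lin: "linear (frechet_derivative f (at z))" if "z \<in> S" for z
    using D1(1)[OF that] has_derivative_linear by blast
  have lin2: "linear (frechet_derivative (\<lambda>z. frechet_derivative f (at z) v) (at z))" if "z \<in> S" for z
    using D2[OF that] has_derivative_linear by blast
  define \<phi> where "\<phi> = (\<lambda>x. f (a + x *\<^sub>R v + t *\<^sub>R w) - f (a + x *\<^sub>R v))"
  have d1: "((\<lambda>x. f (a + x *\<^sub>R v + y *\<^sub>R w)) has_real_derivative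
      frechet_derivative f (at (a + x *\<^sub>R v + y *\<^sub>R w)) v) (at x)"
    if "0 \<le> x" "x \<le> s" "0 \<le> y" "y \<le> t" for x y
  proof -
    have "((\<lambda>x. a + x *\<^sub>R v + y *\<^sub>R w) has_derivative (\<lambda>h. h *\<^sub>R v)) (at x)"
      by (auto intro!: derivative_eq_intros)
    from diff_chain_at[OF this D1(1)[OF sub[OF that]]]
    show ?thesis using lin[OF sub[OF that]]
      by (simp add: o_def has_field_derivative_def linear_scale mult_commute_abs)
  qed
  have "(\<phi> has_real_derivative frechet_derivative f (at (a + x *\<^sub>R v + t *\<^sub>R w)) v
       - frechet_derivative f (at (a + x *\<^sub>R v)) v) (at x)" if "0 \<le> x" "x \<le> s" for x
    unfolding \<phi>_def using d1[of x t] d1[of x 0] that st by (intro DERIV_diff) auto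
  from MVT2[OF st(1) this] obtain x where x: "0 < x" "x < s" and
    e1: "\<phi> s - \<phi> 0 = s * (frechet_derivative f (at (a + x *\<^sub>R v + t *\<^sub>R w)) v
       - frechet_derivative f (at (a + x *\<^sub>R v)) v)" by auto
  have "((\<lambda>y. frechet_derivative f (at (a + x *\<^sub>R v + y *\<^sub>R w)) v) has_real_derivative
      frechet_derivative (\<lambda>z. frechet_derivative f (at z) v) (at (a + x *\<^sub>R v + y *\<^sub>R w)) w) (at y)"
    if "0 \<le> y" "y \<le> t" for y
  proof -
    have z: "a + x *\<^sub>R v + y *\<^sub>R w \<in> S" using sub x that by auto
    have "((\<lambda>y. a + x *\<^sub>R v + y *\<^sub>R w) has_derivative (\<lambda>h. h *\<^sub>R w)) (at y)"
      by (auto intro!: derivative_eq_intros)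
    from diff_chain_at[OF this D2[OF z, of v]]
    show ?thesis using lin2[OF z]
      by (simp add: o_def has_field_derivative_def linear_scale mult_commute_abs)
  qed
  from MVT2[OF st(2) this] obtain y where y: "0 < y" "y < t" and
    e2: "frechet_derivative f (at (a + x *\<^sub>R v + t *\<^sub>R w)) v - frechet_derivative f (at (a + x *\<^sub>R v)) v
      = t * frechet_derivative (\<lambda>z. frechet_derivative f (at z) v) (at (a + x *\<^sub>R v + y *\<^sub>R w)) w"
    by auto
  show ?thesis using x y e1 e2 unfolding \<phi>_def by (intro exI[of _ x] exI[of _ y]) (auto simp: algebra_simps)
qed

text \<open>The second difference is symmetric in v and w, so the two mixed derivatives take a
  common value at two points arbitrarily close to a; continuity does the rest.\<close>

lemma frechet_derivative_commute_real:
  fixes f :: "'a::real_normed_vector \<Rightarrow> real"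
  assumes "open S" "a \<in> S" "smooth_on S f"
  shows "frechet_derivative (\<lambda>z. frechet_derivative f (at z) v) (at a) w
       = frechet_derivative (\<lambda>z. frechet_derivative f (at z) w) (at a) v"
proof -
  let ?D = "\<lambda>v w z. frechet_derivative (\<lambda>z. frechet_derivative f (at z) v) (at z) w"
  have c: "isCont (?D v w) a" for v w
    by (rule smooth_on_imp_isCont[OF smooth_on_frechet[OF smooth_on_frechet[OF assms(3)]] assms(2)])
  obtain r where r: "r > 0" "ball a r \<subseteq> S" using assms open_contains_ball by blast
  have "\<bar>?D v w a - ?D w v a\<bar> < e" if "e > 0" for e
  proof -
    obtain d1 where d1: "d1 > 0" "\<And>z. dist z a < d1 \<Longrightarrow> dist (?D v w z) (?D v w a) < e/2"
      using c[of v w] \<open>e > 0\<close> unfolding continuous_at_eps_delta by (metis half_gt_zero)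
    obtain d2 where d2: "d2 > 0" "\<And>z. dist z a < d2 \<Longrightarrow> dist (?D w v z) (?D w v a) < e/2"
      using c[of w v] \<open>e > 0\<close> unfolding continuous_at_eps_delta by (metis half_gt_zero)
    define d where "d = min r (min d1 d2)"
    \<comment> \<open>t is so small that |x v + y w| \<le> t (|v| + |w|) < d on the whole
      parallelogram; the added 1 keeps the denominator positive when v = w = 0.\<close>
    define t where "t = d / (2 * (norm v + norm w + 1))"
    have d: "d > 0" using r d1 d2 by (auto simp: d_def)
    have t: "t > 0" using d by (auto simp: t_def add_nonneg_pos)
    have near: "dist (a + x *\<^sub>R v + y *\<^sub>R w) a < d" if "0 \<le> x" "x \<le> t" "0 \<le> y" "y \<le> t" for x y
    proof -
      have "dist (a + x *\<^sub>R v + y *\<^sub>R w) a \<le> x * norm v + y * norm w"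
        using that norm_triangle_ineq[of "x *\<^sub>R v" "y *\<^sub>R w"] by (simp add: dist_norm)
      also have "\<dots> \<le> t * norm v + t * norm w" using that by (intro add_mono mult_right_mono) auto
      also have "\<dots> < 2 * t * (norm v + norm w + 1)" 
      proof -
        have "t * norm v \<ge> 0" "t * norm w \<ge> 0" using t by auto
        then show ?thesis using t unfolding distrib_left by linarith
      qed
      also have "\<dots> = d"
      proof -
        have "norm v + norm w + 1 \<noteq> 0" using norm_ge_zero[of v] norm_ge_zero[of w] by linarith
        moreover have "2 * (d / (2 * K)) * K = d" if "K \<noteq> 0" for K :: real using that by simp
        ultimately show ?thesis unfolding t_def by blast
      qed
      finally show ?thesis .
    qed
    have near': "dist (a + y *\<^sub>R w + x *\<^sub>R v) a < d" if "0 \<le> x" "x \<le> t" "0 \<le> y" "y \<le> t" for x y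
      using near[OF that] by (simp add: add.assoc add.commute[of "x *\<^sub>R v"])
    have S2: "times_differentiable_on 2 S f" using assms by (simp add: smooth_on_def)
    have sub: "z \<in> S" if "dist z a < d" for z
      using that r unfolding d_def by (auto simp: dist_commute)
    obtain x y where xy: "0 < x" "x < t" "0 < y" "y < t"
      "f (a + t *\<^sub>R v + t *\<^sub>R w) - f (a + t *\<^sub>R v) - f (a + t *\<^sub>R w) + f a
       = t * t * ?D v w (a + x *\<^sub>R v + y *\<^sub>R w)"
      using second_difference[OF S2 t t, of a v w] near sub by blast
    obtain y' x' where xy': "0 < y'" "y' < t" "0 < x'" "x' < t"
      "f (a + t *\<^sub>R w + t *\<^sub>R v) - f (a + t *\<^sub>R w) - f (a + t *\<^sub>R v) + f a
       = t * t * ?D w v (a + y' *\<^sub>R w + x' *\<^sub>R v)"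
      using second_difference[OF S2 t t, of a w v] near' sub by blast
    have "t * t * ?D v w (a + x *\<^sub>R v + y *\<^sub>R w) = t * t * ?D w v (a + y' *\<^sub>R w + x' *\<^sub>R v)"
      using xy(5) xy'(5) by (simp add: algebra_simps)
    then have eq: "?D v w (a + x *\<^sub>R v + y *\<^sub>R w) = ?D w v (a + y' *\<^sub>R w + x' *\<^sub>R v)" using t by simp
    have "dist (?D v w (a + x *\<^sub>R v + y *\<^sub>R w)) (?D v w a) < e/2"
      using near[of x y] xy d_def by (intro d1) auto
    moreover have "dist (?D w v (a + y' *\<^sub>R w + x' *\<^sub>R v)) (?D w v a) < e/2"
      using near'[of x' y'] xy' d_def by (intro d2) auto
    ultimately show ?thesis using eq unfolding dist_real_def by linarith
  qed
  then have "\<not> \<bar>?D v w a - ?D w v a\<bar> > 0" by blast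
  then show ?thesis by simp
qed

lemma frechet_derivative_linear_comp:
  assumes "smooth_on S f" "x \<in> S" "bounded_linear T"
  shows "frechet_derivative (\<lambda>z. T (f z)) (at x) v = T (frechet_derivative f (at x) v)"
  using bounded_linear.has_derivative[OF assms(3) smooth_on_imp_derivative[OF assms(1,2)]]
  by (metis frechet_derivative_at)

lemma frechet_derivative_cong_open:
  assumes "open S" "x \<in> S" "\<And>z. z \<in> S \<Longrightarrow> f z = g z"
  shows "frechet_derivative f (at x) = frechet_derivative g (at x)"
proof -
  have "(f has_derivative D) (at x) \<longleftrightarrow> (g has_derivative D) (at x)" for D
    using assms has_derivative_transform_within_open[of f D x UNIV S g]
      has_derivative_transform_within_open[of g D x UNIV S f] by auto
  then show ?thesis unfolding frechet_derivative_def by simp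
qed

lemma frechet_derivative_commute:
  fixes f :: "'a::real_normed_vector \<Rightarrow> 'b::euclidean_space"
  assumes "open S" "a \<in> S" "smooth_on S f"
  shows "frechet_derivative (\<lambda>z. frechet_derivative f (at z) v) (at a) w
       = frechet_derivative (\<lambda>z. frechet_derivative f (at z) w) (at a) v"
proof (rule euclidean_eqI)
  fix b :: 'b assume "b \<in> Basis"
  have *: "frechet_derivative (\<lambda>z. frechet_derivative (\<lambda>z. f z \<bullet> b) (at z) v) (at a) w
      = frechet_derivative (\<lambda>z. frechet_derivative f (at z) v) (at a) w \<bullet> b" for v w
  proof -
    have "frechet_derivative (\<lambda>z. frechet_derivative (\<lambda>z. f z \<bullet> b) (at z) v) (at a) w
        = frechet_derivative (\<lambda>z. frechet_derivative f (at z) v \<bullet> b) (at a) w"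
      using frechet_derivative_linear_comp[OF assms(3) _ bounded_linear_inner_left]
      by (intro fun_cong[OF frechet_derivative_cong_open[OF assms(1,2)]])
    also have "\<dots> = frechet_derivative (\<lambda>z. frechet_derivative f (at z) v) (at a) w \<bullet> b"
      by (rule frechet_derivative_linear_comp[OF smooth_on_frechet[OF assms(3)] assms(2) bounded_linear_inner_left])
    finally show ?thesis .
  qed
  have "smooth_on S (\<lambda>z. f z \<bullet> b)" by (rule smooth_on_linear[OF assms(1,3) bounded_linear_inner_left])
  from frechet_derivative_commute_real[OF assms(1,2) this, of v w]
  show "frechet_derivative (\<lambda>z. frechet_derivative f (at z) v) (at a) w \<bullet> b
     = frechet_derivative (\<lambda>z. frechet_derivative f (at z) w) (at a) v \<bullet> b" unfolding * .
qed

section \<open>Hermitian and octonionic algebra\<close>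

lemma norm_vector_scalar: "norm (c *s v) = norm c * norm (v :: complex^'n)"
  by (simp add: norm_vec_def norm_mult L2_set_right_distrib)

lemma linear_vector_scalar_right: "linear (\<lambda>v :: complex^'n. c *s v)"
  by (rule linearI) (simp_all add: vec_eq_iff algebra_simps)

lemma bounded_bilinear_vector_scalar: "bounded_bilinear (\<lambda>c v :: complex^'n. c *s v)"
proof
  show "\<exists>K. \<forall>a b. norm (a *s (b :: complex^'n)) \<le> norm a * norm b * K"
    by (intro exI[of _ 1]) (simp add: norm_vector_scalar)
qed (simp_all add: vec_eq_iff algebra_simps)

lemma hermitian_linear [simp]:
  "hermitian (a + b) c = hermitian a c + hermitian b c"
  "hermitian c (a + b) = hermitian c a + hermitian c b"
  "hermitian (a - b) c = hermitian a c - hermitian b c"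
  "hermitian c (a - b) = hermitian c a - hermitian c b"
  "hermitian (- a) c = - hermitian a c"
  "hermitian c (- a) = - hermitian c a"
  "hermitian (k *s a) c = k * hermitian a c"
  "hermitian c (k *s a) = cnj k * hermitian c a"
  "hermitian 0 c = 0" "hermitian c 0 = 0"
  by (simp_all add: hermitian_def algebra_simps sum.distrib sum_subtractf sum_negf sum_distrib_left)

lemma hermitian_cnj: "cnj (hermitian v w) = hermitian w v"
  by (simp add: hermitian_def mult.commute)

lemma hermitian_zero_commute: "hermitian v w = 0 \<longleftrightarrow> hermitian w v = 0"
  by (metis hermitian_cnj complex_cnj_zero)

lemma hermitian_self: "hermitian v v = complex_of_real ((norm v)\<^sup>2)"
  by (simp add: hermitian_def norm_vec_def L2_set_def sum_nonneg complex_norm_square[symmetric])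

lemma hermitian_self_eq_0 [simp]: "hermitian v v = 0 \<longleftrightarrow> v = 0"
  by (simp add: hermitian_self)

lemma bounded_bilinear_hermitian: "bounded_bilinear (hermitian :: complex^'n \<Rightarrow> _)"
proof (rule bilinear_conv_bounded_bilinear[THEN iffD1])
  show "bilinear (hermitian :: complex^'n \<Rightarrow> _)"
    unfolding bilinear_def
    by (intro conjI allI linearI) (simp_all add: hermitian_def sum.distrib algebra_simps sum_distrib_left scaleR_sum_right)
qed

lemma norm_hermitian_le: "norm (hermitian v w) \<le> norm v * norm w"
proof -
  have "norm (hermitian v w) \<le> (\<Sum>i\<in>UNIV. norm (v $ i) * norm (w $ i))"
    unfolding hermitian_def by (rule norm_sum[THEN order_trans]) (simp add: norm_mult)
  also have "\<dots> \<le> norm v * norm w"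
    using L2_set_mult_ineq[of "\<lambda>i. norm (v $ i)" "\<lambda>i. norm (w $ i)" UNIV] by (simp add: norm_vec_def)
  finally show ?thesis .
qed

lemma Re_hermitian_ge: "- (norm v * norm w) \<le> Re (hermitian v w)"
  using norm_hermitian_le[of v w] abs_Re_le_cmod[of "hermitian v w"] by linarith

lemma vec_cnj_simps [simp]:
  "vec_cnj (vec_cnj v) = v" "vec_cnj (v + w) = vec_cnj v + vec_cnj w" "vec_cnj (v - w) = vec_cnj v - vec_cnj w"
  "vec_cnj (- v) = - vec_cnj v" "vec_cnj (k *s v) = cnj k *s vec_cnj v" "vec_cnj 0 = 0" "norm (vec_cnj v) = norm v"
  by (simp_all add: vec_cnj_def vec_eq_iff norm_vec_def)

lemma vec_cnj_eq_0 [simp]: "vec_cnj v = 0 \<longleftrightarrow> v = 0"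
  by (metis vec_cnj_simps(1,6))

lemma vec_cnj_cvec [simp]: "vec_cnj (cvec v) = cvec v"
  by (simp add: vec_cnj_def cvec_def vec_eq_iff)

lemma bounded_linear_vec_cnj: "bounded_linear (vec_cnj :: complex^'n \<Rightarrow> _)"
  unfolding linear_conv_bounded_linear[symmetric]
  by (rule linearI) (simp_all add: vec_cnj_def vec_eq_iff)

lemma hermitian_vec_cnj: "hermitian (vec_cnj v) (vec_cnj w) = cnj (hermitian v w)"
  by (simp add: hermitian_def vec_cnj_def)

lemma hermitian_vec_cnj': "hermitian (vec_cnj v) w = cnj (hermitian v (vec_cnj w))"
  "hermitian v (vec_cnj w) = hermitian w (vec_cnj v)"
  by (simp_all add: hermitian_def vec_cnj_def mult.commute)

lemma cvec_simps [simp]: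
  "cvec (v + w) = cvec v + cvec w" "cvec (v - w) = cvec v - cvec w" "cvec (- v) = - cvec v"
  "cvec (r *\<^sub>R v) = complex_of_real r *s cvec v" "cvec 0 = 0" "norm (cvec v) = norm v"
  by (simp_all add: cvec_def vec_eq_iff norm_vec_def)

lemma cvec_eq_iff [simp]: "cvec v = cvec w \<longleftrightarrow> v = w"
  by (simp add: cvec_def vec_eq_iff)

lemma bounded_linear_cvec: "bounded_linear (cvec :: real^'n \<Rightarrow> _)"
  unfolding linear_conv_bounded_linear[symmetric]
  by (rule linearI) (simp_all add: cvec_def vec_eq_iff scaleR_conv_of_real[where 'a=complex])

lemma hermitian_cvec: "hermitian (cvec v) (cvec w) = complex_of_real (v \<bullet> w)"
  by (simp add: hermitian_def cvec_def inner_vec_def)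

lemma scaleR_vector_scalar: "r *\<^sub>R v = complex_of_real r *s (v :: complex^'n)"
  by (simp add: vec_eq_iff scaleR_conv_of_real[where 'a=complex])

section \<open>Identities of the vector product over a commutative ring\<close>

lemma cross7_nth:
  fixes v w :: "'a::comm_ring_1^7"
  shows "cross7 v w $ k = (v $ (k+1) * w $ (k+3) - v $ (k+3) * w $ (k+1))
         + (v $ (k+2) * w $ (k+6) - v $ (k+6) * w $ (k+2))
         + (v $ (k+4) * w $ (k+5) - v $ (k+5) * w $ (k+4))"
  by (simp add: cross7_def oct_mult_def)

lemma forall_7: "(\<forall>i::7. P i) \<longleftrightarrow> P 0 \<and> P 1 \<and> P 2 \<and> P 3 \<and> P 4 \<and> P 5 \<and> P 6"
  using UNIV_7 by (metis (mono_tags) UNIV_I insertE singletonD)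

lemma cross7_simps [simp]:
  fixes v w u :: "'a::comm_ring_1^7"
  shows "cross7 (u + v) w = cross7 u w + cross7 v w" "cross7 w (u + v) = cross7 w u + cross7 w v"
  "cross7 (u - v) w = cross7 u w - cross7 v w" "cross7 w (u - v) = cross7 w u - cross7 w v"
  "cross7 (- u) w = - cross7 u w" "cross7 w (- u) = - cross7 w u"
  "cross7 (k *s u) w = k *s cross7 u w" "cross7 w (k *s u) = k *s cross7 w u"
  "cross7 0 w = 0" "cross7 w 0 = 0" "cross7 v v = 0"
  by (simp_all add: vec_eq_iff cross7_nth algebra_simps)

lemma cross7_commute: "cross7 v w = - cross7 w (v :: 'a::comm_ring_1^7)"
  by (simp add: vec_eq_iff cross7_nth algebra_simps)

lemma cross7_cvec: "cross7 (cvec v) (cvec w) = cvec (cross7 v w)"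
  by (simp add: vec_eq_iff cross7_nth cvec_def)

lemma vec_cnj_cross7: "vec_cnj (cross7 v w) = cross7 (vec_cnj v) (vec_cnj w)"
  by (simp add: vec_eq_iff cross7_nth vec_cnj_def)

lemma bounded_bilinear_cross7: "bounded_bilinear (cross7 :: complex^7 \<Rightarrow> _)"
proof (rule bilinear_conv_bounded_bilinear[THEN iffD1])
  show "bilinear (cross7 :: complex^7 \<Rightarrow> _)"
    unfolding bilinear_def
    by (intro conjI allI linearI) (simp_all add: scaleR_vector_scalar)
qed

text \<open>The bilinear extension of the Euclidean inner product. It is defined over any
  commutative ring so that the polynomial identities below serve the real and the complex vector
  product at once.\<close>

definition bilin :: "'a::comm_ring_1^7 \<Rightarrow> 'a^7 \<Rightarrow> 'a" where
  "bilin v w = (\<Sum>i\<in>UNIV. v $ i * w $ i)"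

lemma bilin_hermitian: "bilin v w = hermitian v (vec_cnj w)"
  by (simp add: bilin_def hermitian_def vec_cnj_def)

lemma bilin_inner: "bilin v w = v \<bullet> w" for v w :: "real^7"
  by (simp add: bilin_def inner_vec_def)

lemma cross7_orthogonal:
  fixes v w :: "'a::comm_ring_1^7"
  shows "bilin v (cross7 v w) = 0" "bilin w (cross7 v w) = 0"
  unfolding bilin_def sum_7 by (simp_all add: cross7_nth index_7 algebra_simps)

text \<open>The alternative law v (v w) = (v v) w of the octonions, read on imaginary parts.\<close>

lemma cross7_cross7_left:
  fixes v w :: "'a::comm_ring_1^7"
  shows "cross7 v (cross7 v w) = bilin v w *s v - bilin v v *s w"
  unfolding vec_eq_iff forall_7 bilin_def sum_7 by (simp add: cross7_nth index_7 algebra_simps)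

text \<open>This is what produces isotropy: if u \<times> a = \<i> a and u \<times> b = \<i> b, then
  \<open>bilin a b\<close> equals its own negative.\<close>

lemma bilin_cross7_swap:
  fixes u v w :: "'a::comm_ring_1^7"
  shows "bilin (cross7 u v) w = - bilin v (cross7 u w)"
  unfolding bilin_def sum_7 by (simp add: cross7_nth index_7 algebra_simps)

section \<open>Wirtinger derivatives\<close>

text \<open>Carries both Wirtinger derivatives as data together with real differentiability, so that
  calculus rules compose without separate differentiability premises; \<open>d_z\<close> and
  \<open>d_zbar\<close> are read off at the end.\<close>

definition has_wirtinger :: "(complex \<Rightarrow> complex^'n) \<Rightarrow> complex^'n \<Rightarrow> complex^'n \<Rightarrow> complex \<Rightarrow> bool" where
  "has_wirtinger g a b w \<longleftrightarrow> (g has_derivative (\<lambda>v. v *s a + cnj v *s b)) (at w)"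

definition has_wirtinger1 :: "(complex \<Rightarrow> complex) \<Rightarrow> complex \<Rightarrow> complex \<Rightarrow> complex \<Rightarrow> bool" where
  "has_wirtinger1 f a b w \<longleftrightarrow> (f has_derivative (\<lambda>v. v * a + cnj v * b)) (at w)"

lemma has_wirtinger_d:
  assumes "has_wirtinger g a b w"
  shows "d_z g w = a" "d_zbar g w = b" "g differentiable (at w)"
    "frechet_derivative g (at w) = (\<lambda>v. v *s a + cnj v *s b)"
proof -
  have D: "(g has_derivative (\<lambda>v. v *s a + cnj v *s b)) (at w)" using assms by (simp add: has_wirtinger_def)
  show F: "frechet_derivative g (at w) = (\<lambda>v. v *s a + cnj v *s b)"
    using frechet_derivative_at[OF D] by simp
  show "d_z g w = a" "d_zbar g w = b"
    unfolding d_z_def d_zbar_def F by (simp_all add: vec_eq_iff algebra_simps)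
  show "g differentiable (at w)" using D by (rule differentiableI)
qed

lemma has_wirtinger_unique:
  "has_wirtinger g a b w \<Longrightarrow> has_wirtinger g a' b' w \<Longrightarrow> a = a' \<and> b = b'"
  using has_wirtinger_d(1,2)[of g a b w] has_wirtinger_d(1,2)[of g a' b' w] by simp

lemma has_wirtingerI:
  assumes "g differentiable (at w)"
  shows "has_wirtinger g (d_z g w) (d_zbar g w) w"
proof -
  let ?D = "frechet_derivative g (at w)"
  have D: "(g has_derivative ?D) (at w)" using assms by (simp add: frechet_derivative_works)
  have "?D v = v *s d_z g w + cnj v *s d_zbar g w" for v
  proof -
    have "?D v = Re v *\<^sub>R ?D 1 + Im v *\<^sub>R ?D \<i>"
      by (intro complex_linear_decomp has_derivative_linear[OF D])
    then show ?thesis unfolding d_z_def d_zbar_def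
      by (simp add: vec_eq_iff complex_eq_iff field_simps)
  qed
  then have "?D = (\<lambda>v. v *s d_z g w + cnj v *s d_zbar g w)" by (rule ext)
  then show ?thesis using D unfolding has_wirtinger_def by simp
qed

lemma smooth_on_has_wirtinger:
  "smooth_on S g \<Longrightarrow> w \<in> S \<Longrightarrow> has_wirtinger g (d_z g w) (d_zbar g w) w"
  by (intro has_wirtingerI differentiableI) (rule smooth_on_imp_derivative)

lemma smooth_on_has_wirtinger1:
  assumes "smooth_on S f" "w \<in> S"
  obtains a b where "has_wirtinger1 f a b w"
proof -
  let ?D = "frechet_derivative f (at w)"
  have D: "(f has_derivative ?D) (at w)" using assms by (rule smooth_on_imp_derivative)
  define a b where "a = (?D 1 - \<i> * ?D \<i>) / 2" and "b = (?D 1 + \<i> * ?D \<i>) / 2"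
  have "?D v = v * a + cnj v * b" for v
  proof -
    have "?D v = Re v *\<^sub>R ?D 1 + Im v *\<^sub>R ?D \<i>"
      by (intro complex_linear_decomp has_derivative_linear[OF D])
    then show ?thesis unfolding a_def b_def
      by (simp add: complex_eq_iff field_simps)
  qed
  then have "?D = (\<lambda>v. v * a + cnj v * b)" by (rule ext)
  then show ?thesis using that D unfolding has_wirtinger1_def by simp
qed

lemma has_wirtinger_cong:
  assumes "open S" "w \<in> S" "\<And>z. z \<in> S \<Longrightarrow> f z = g z" "has_wirtinger f a b w"
  shows "has_wirtinger g a b w"
  using assms(4) unfolding has_wirtinger_def
  by (rule has_derivative_transform_within_open[OF _ assms(1,2)]) (rule assms(3))

lemma d_cong:
  assumes "open S" "w \<in> S" "\<And>z. z \<in> S \<Longrightarrow> f z = g z"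
  shows "d_z f w = d_z g w" "d_zbar f w = d_zbar g w"
  unfolding d_z_def d_zbar_def using frechet_derivative_cong_open[OF assms] by simp_all

lemma has_wirtinger1_cong:
  assumes "open S" "w \<in> S" "\<And>z. z \<in> S \<Longrightarrow> f z = g z" "has_wirtinger1 f a b w"
  shows "has_wirtinger1 g a b w"
  using assms(4) unfolding has_wirtinger1_def
  by (rule has_derivative_transform_within_open[OF _ assms(1,2)]) (rule assms(3))

lemma has_wirtinger1_unique:
  assumes "has_wirtinger1 f a b w" "has_wirtinger1 f a' b' w"
  shows "a = a'" "b = b'"
proof -
  have "(\<lambda>v. v * a + cnj v * b) = (\<lambda>v. v * a' + cnj v * b')"
    using assms unfolding has_wirtinger1_def by (rule has_derivative_unique)
  from fun_cong[OF this, of 1] fun_cong[OF this, of \<i>]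
  have "a + b = a' + b'" "a - b = a' - b'" by (simp_all add: complex_eq_iff)
  then show "a = a'" "b = b'" by (simp_all add: complex_eq_iff)
qed

lemma has_wirtinger1_const: "has_wirtinger1 (\<lambda>z. c) 0 0 w"
  unfolding has_wirtinger1_def by simp

lemma has_wirtinger1_ident: "has_wirtinger1 (\<lambda>z. z) 1 0 w"
  unfolding has_wirtinger1_def by simp

lemma has_wirtinger1_cnj: "has_wirtinger1 f a b w \<Longrightarrow> has_wirtinger1 (\<lambda>z. cnj (f z)) (cnj b) (cnj a) w"
  unfolding has_wirtinger1_def
  by (drule bounded_linear.has_derivative[OF bounded_linear_cnj]) (simp add: add.commute)

lemma has_wirtinger_add:
  "has_wirtinger f a b w \<Longrightarrow> has_wirtinger g a' b' w \<Longrightarrow> has_wirtinger (\<lambda>z. f z + g z) (a + a') (b + b') w"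
  unfolding has_wirtinger_def
  by (drule (1) has_derivative_add) (simp add: vector_add_ldistrib algebra_simps)

lemma has_wirtinger_diff:
  "has_wirtinger f a b w \<Longrightarrow> has_wirtinger g a' b' w \<Longrightarrow> has_wirtinger (\<lambda>z. f z - g z) (a - a') (b - b') w"
  unfolding has_wirtinger_def
  by (drule (1) has_derivative_diff) (simp add: vector_sub_rdistrib[symmetric] vector_ssub_ldistrib algebra_simps)

lemma has_wirtinger1_add:
  "has_wirtinger1 f a b w \<Longrightarrow> has_wirtinger1 g a' b' w \<Longrightarrow> has_wirtinger1 (\<lambda>z. f z + g z) (a + a') (b + b') w"
  unfolding has_wirtinger1_def
  by (drule (1) has_derivative_add) (simp add: algebra_simps)

lemma has_wirtinger1_mult:
  "has_wirtinger1 f a b w \<Longrightarrow> has_wirtinger1 g a' b' w \<Longrightarrow>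
    has_wirtinger1 (\<lambda>z. f z * g z) (a * g w + f w * a') (b * g w + f w * b') w"
  unfolding has_wirtinger1_def
  by (drule (1) has_derivative_mult) (simp add: algebra_simps)

lemma has_wirtinger_smult:
  assumes "has_wirtinger1 f a b w" "has_wirtinger g a' b' w"
  shows "has_wirtinger (\<lambda>z. f z *s g z) (a *s g w + f w *s a') (b *s g w + f w *s b') w"
proof -
  have "((\<lambda>z. f z *s g z) has_derivative
      (\<lambda>v. f w *s (v *s a' + cnj v *s b') + (v * a + cnj v * b) *s g w)) (at w)"
    using bounded_bilinear.FDERIV[OF bounded_bilinear_vector_scalar] assms
    unfolding has_wirtinger_def has_wirtinger1_def by blast
  moreover have "f w *s (v *s a' + cnj v *s b') + (v * a + cnj v * b) *s g w
     = v *s (a *s g w + f w *s a') + cnj v *s (b *s g w + f w *s b')" for v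
    by (simp add: vec_eq_iff algebra_simps)
  ultimately show ?thesis unfolding has_wirtinger_def by (simp only:)
qed

lemma has_wirtinger1_hermitian:
  assumes "has_wirtinger f a b w" "has_wirtinger g a' b' w"
  shows "has_wirtinger1 (\<lambda>z. hermitian (f z) (g z))
    (hermitian a (g w) + hermitian (f w) b') (hermitian b (g w) + hermitian (f w) a') w"
proof -
  have "((\<lambda>z. hermitian (f z) (g z)) has_derivative
      (\<lambda>v. hermitian (f w) (v *s a' + cnj v *s b') + hermitian (v *s a + cnj v *s b) (g w))) (at w)"
    using bounded_bilinear.FDERIV[OF bounded_bilinear_hermitian] assms
    unfolding has_wirtinger_def by blast
  moreover have "hermitian (f w) (v *s a' + cnj v *s b') + hermitian (v *s a + cnj v *s b) (g w)
     = v * (hermitian a (g w) + hermitian (f w) b') + cnj v * (hermitian b (g w) + hermitian (f w) a')" for v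
    by (simp add: algebra_simps)
  ultimately show ?thesis unfolding has_wirtinger1_def by (simp only:)
qed

lemma has_wirtinger_cross7:
  assumes "has_wirtinger f a b w" "has_wirtinger g a' b' w"
  shows "has_wirtinger (\<lambda>z. cross7 (f z) (g z))
    (cross7 a (g w) + cross7 (f w) a') (cross7 b (g w) + cross7 (f w) b') w"
proof -
  have "((\<lambda>z. cross7 (f z) (g z)) has_derivative
      (\<lambda>v. cross7 (f w) (v *s a' + cnj v *s b') + cross7 (v *s a + cnj v *s b) (g w))) (at w)"
    using bounded_bilinear.FDERIV[OF bounded_bilinear_cross7] assms
    unfolding has_wirtinger_def by blast
  moreover have "cross7 (f w) (v *s a' + cnj v *s b') + cross7 (v *s a + cnj v *s b) (g w)
     = v *s (cross7 a (g w) + cross7 (f w) a') + cnj v *s (cross7 b (g w) + cross7 (f w) b')" for v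
    by (simp add: vec_eq_iff algebra_simps)
  ultimately show ?thesis unfolding has_wirtinger_def by (simp only:)
qed

lemma has_wirtinger_vec_cnj:
  assumes "has_wirtinger f a b w"
  shows "has_wirtinger (\<lambda>z. vec_cnj (f z)) (vec_cnj b) (vec_cnj a) w"
  using bounded_linear.has_derivative[OF bounded_linear_vec_cnj] assms
  unfolding has_wirtinger_def by (fastforce simp: add.commute)

lemma has_wirtinger_compose:
  assumes "has_wirtinger g a b (h w)" "(h has_field_derivative c) (at w)"
  shows "has_wirtinger (\<lambda>z. g (h z)) (c *s a) (cnj c *s b) w"
proof -
  have "(g \<circ> h has_derivative (\<lambda>v. v *s a + cnj v *s b) \<circ> (\<lambda>v. c * v)) (at w)"
    using assms unfolding has_wirtinger_def has_field_derivative_def by (intro diff_chain_at)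
  moreover have "(\<lambda>v. v *s a + cnj v *s b) \<circ> (\<lambda>v. c * v) = (\<lambda>v. v *s (c *s a) + cnj v *s (cnj c *s b))"
    by (rule ext) (simp add: vec_eq_iff algebra_simps)
  ultimately show ?thesis unfolding has_wirtinger_def by (simp add: o_def)
qed

lemma has_wirtinger1_compose:
  assumes "has_wirtinger1 g a b (h w)" "(h has_field_derivative c) (at w)"
  shows "has_wirtinger1 (\<lambda>z. g (h z)) (c * a) (cnj c * b) w"
proof -
  have "(g \<circ> h has_derivative (\<lambda>v. v * a + cnj v * b) \<circ> (\<lambda>v. c * v)) (at w)"
    using assms unfolding has_wirtinger1_def has_field_derivative_def by (intro diff_chain_at)
  moreover have "(\<lambda>v. v * a + cnj v * b) \<circ> (\<lambda>v. c * v) = (\<lambda>v. v * (c * a) + cnj v * (cnj c * b))"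
    by (rule ext) (simp add: algebra_simps)
  ultimately show ?thesis unfolding has_wirtinger1_def by (simp add: o_def)
qed

lemma has_wirtinger1_holomorphic:
  "(f has_field_derivative c) (at w) \<Longrightarrow> has_wirtinger1 f c 0 w"
  using has_wirtinger1_compose[OF has_wirtinger1_ident, of f c w] by simp

lemma has_wirtinger1_inverse:
  assumes "has_wirtinger1 f a b w" "f w \<noteq> 0"
  shows "has_wirtinger1 (\<lambda>z. inverse (f z)) (- a * inverse (f w) ^ 2) (- b * inverse (f w) ^ 2) w"
proof -
  have "((\<lambda>z. inverse (f z)) has_derivative
      (\<lambda>v. - (inverse (f w) * (v * a + cnj v * b) * inverse (f w)))) (at w)"
    using assms(1) unfolding has_wirtinger1_def by (rule Deriv.has_derivative_inverse[where f = f and x = w, OF assms(2)])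
  moreover have "- (inverse (f w) * (v * a + cnj v * b) * inverse (f w))
    = v * (- a * inverse (f w) ^ 2) + cnj v * (- b * inverse (f w) ^ 2)" for v
    by (simp add: algebra_simps power2_eq_square)
  ultimately show ?thesis unfolding has_wirtinger1_def by (simp only:)
qed

section \<open>Smoothness of vector operations and of Wirtinger derivatives\<close>

lemma bounded_linear_vector_scalar_right: "bounded_linear (\<lambda>v :: complex^'n. c *s v)"
  using linear_vector_scalar_right linear_conv_bounded_linear by blast

lemma smooth_on_vector_scalar:
  "open S \<Longrightarrow> smooth_on S f \<Longrightarrow> smooth_on S g \<Longrightarrow> smooth_on S (\<lambda>x. f x *s (g x :: complex^'n))"
  by (rule smooth_on_bilinear[OF _ _ _ bounded_bilinear_vector_scalar])

lemma smooth_on_hermitian: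
  "open S \<Longrightarrow> smooth_on S f \<Longrightarrow> smooth_on S g \<Longrightarrow> smooth_on S (\<lambda>x. hermitian (f x) (g x))"
  by (rule smooth_on_bilinear[OF _ _ _ bounded_bilinear_hermitian])

lemma smooth_on_cross7:
  fixes f g :: "'a::real_normed_vector \<Rightarrow> complex^7"
  shows "open S \<Longrightarrow> smooth_on S f \<Longrightarrow> smooth_on S g \<Longrightarrow> smooth_on S (\<lambda>x. cross7 (f x) (g x))"
  by (rule smooth_on_bilinear[OF _ _ _ bounded_bilinear_cross7])

lemma smooth_on_vec_cnj: "open S \<Longrightarrow> smooth_on S f \<Longrightarrow> smooth_on S (\<lambda>x. vec_cnj (f x))"
  by (rule smooth_on_linear[OF _ _ bounded_linear_vec_cnj])

lemma smooth_on_cnj: "open S \<Longrightarrow> smooth_on S f \<Longrightarrow> smooth_on S (\<lambda>x. cnj (f x))"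
  by (rule smooth_on_linear[OF _ _ bounded_linear_cnj])

lemma smooth_on_d:
  assumes "open S" "smooth_on S g"
  shows "smooth_on S (d_z g)" "smooth_on S (d_zbar g)"
  unfolding d_z_def[abs_def] d_zbar_def[abs_def]
  by (rule smooth_on_linear[OF assms(1) _ bounded_linear_vector_scalar_right],
      rule smooth_on_diff smooth_on_add, fact, rule smooth_on_frechet, fact,
      rule smooth_on_linear[OF assms(1) _ bounded_linear_vector_scalar_right], rule smooth_on_frechet, fact)+

text \<open>Both sides are a quarter of the Laplacian, by the symmetry of second
  derivatives.\<close>

lemma d_zbar_d_z:
  assumes "open S" "w \<in> S" "smooth_on S g"
  shows "d_zbar (d_z g) w = d_z (d_zbar g) w"
proof -
  let ?g = "\<lambda>v z. frechet_derivative g (at z) v"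
  have D: "(?g v has_derivative frechet_derivative (?g v) (at w)) (at w)" for v
    by (rule smooth_on_imp_derivative[OF smooth_on_frechet[OF assms(3)] assms(2)])
  have L: "((\<lambda>z. \<i> *s ?g \<i> z) has_derivative (\<lambda>v. \<i> *s frechet_derivative (?g \<i>) (at w) v)) (at w)"
    by (rule bounded_linear.has_derivative[OF bounded_linear_vector_scalar_right D])
  have 1: "(d_z g has_derivative (\<lambda>v. (1/2) *s
      (frechet_derivative (?g 1) (at w) v - \<i> *s frechet_derivative (?g \<i>) (at w) v))) (at w)"
    unfolding d_z_def[abs_def]
    by (rule bounded_linear.has_derivative[OF bounded_linear_vector_scalar_right has_derivative_diff[OF D L]])
  have 2: "(d_zbar g has_derivative (\<lambda>v. (1/2) *s
      (frechet_derivative (?g 1) (at w) v + \<i> *s frechet_derivative (?g \<i>) (at w) v))) (at w)"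
    unfolding d_zbar_def[abs_def]
    by (rule bounded_linear.has_derivative[OF bounded_linear_vector_scalar_right has_derivative_add[OF D L]])
  have C: "frechet_derivative (?g 1) (at w) \<i> = frechet_derivative (?g \<i>) (at w) 1"
    by (rule frechet_derivative_commute[OF assms])
  show ?thesis
    unfolding d_z_def[of "d_zbar g"] d_zbar_def[of "d_z g"] frechet_derivative_at[OF 1, symmetric]
      frechet_derivative_at[OF 2, symmetric] C
    by (simp add: vec_eq_iff field_simps)
qed

section \<open>Division by a holomorphic coordinate\<close>

text \<open>The coefficient functions of Hadamard's lemma. Each differentiation brings out a factor
  t, so the weight t^m makes the family closed under differentiation.\<close>

definition radial_integral :: "nat \<Rightarrow> (complex \<Rightarrow> 'b::euclidean_space) \<Rightarrow> complex \<Rightarrow> 'b" where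
  "radial_integral m u z = integral {0..1} (\<lambda>t. t ^ m *\<^sub>R u (t *\<^sub>R z))"

lemma scaled_in_ball: "z \<in> ball 0 R \<Longrightarrow> t \<in> {0..1} \<Longrightarrow> t *\<^sub>R (z::complex) \<in> ball 0 R"
  by (auto intro: le_less_trans[OF mult_left_le_one_le])

lemma radial_integrable:
  fixes u :: "complex \<Rightarrow> 'b::euclidean_space"
  assumes "continuous_on (ball 0 R) u" "z \<in> ball 0 R"
  shows "(\<lambda>t. t ^ m *\<^sub>R u (t *\<^sub>R z)) integrable_on {0..1}"
proof -
  have "continuous_on {0..1} (\<lambda>t::real. u (t *\<^sub>R z))"
    using scaled_in_ball[OF assms(2)] by (intro continuous_on_compose2[OF assms(1)] continuous_intros) blast
  then show ?thesis by (intro integrable_continuous_real continuous_intros)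
qed

text \<open>Differentiation under the integral sign along the segment from 0 to z.\<close>

lemma radial_integral_derivative:
  fixes u :: "complex \<Rightarrow> 'b::euclidean_space"
  assumes u: "smooth_on (ball 0 R) u" and z: "z \<in> ball 0 R"
  shows "(radial_integral m u has_derivative
    (\<lambda>v. radial_integral (Suc m) (\<lambda>x. frechet_derivative u (at x) v) z)) (at z)"
proof -
  define D where "D = (\<lambda>v x. frechet_derivative u (at x) v)"
  define R1 where "R1 = Blinfun Re"
  define I1 where "I1 = Blinfun Im"
  have [simp]: "blinfun_apply R1 v = Re v" "blinfun_apply I1 v = Im v" for v
    unfolding R1_def I1_def by (simp_all add: bounded_linear_Blinfun_apply bounded_linear_Re bounded_linear_Im)
  \<comment> \<open>The Leibniz rule asks for a derivative that is jointly continuous as a bounded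
    linear map. Through its values at 1 and \<i> this reduces to the continuity of two vector
    functions.\<close>
  define B where "B = (\<lambda>x (t::real). t ^ Suc m *\<^sub>R
     ((blinfun_scaleR_left (D 1 (t *\<^sub>R x)) o\<^sub>L R1) + (blinfun_scaleR_left (D \<i> (t *\<^sub>R x)) o\<^sub>L I1)))"
  have DD: "(u has_derivative (\<lambda>v. D v x)) (at x)" if "x \<in> ball 0 R" for x
    unfolding D_def by (rule smooth_on_imp_derivative[OF u that])
  have Dlin: "D v x = Re v *\<^sub>R D 1 x + Im v *\<^sub>R D \<i> x" if "x \<in> ball 0 R" for v x
    by (rule complex_linear_decomp[OF has_derivative_linear[OF DD[OF that]]])
  have Bapp: "blinfun_apply (B x t) v = t ^ Suc m *\<^sub>R D v (t *\<^sub>R x)" if "x \<in> ball 0 R" "t \<in> {0..1}" for x t v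
    using Dlin[OF scaled_in_ball[OF that], of v] unfolding B_def by (simp add: blinfun.bilinear_simps)
  have Dc: "continuous_on (ball 0 R) (D v)" for v
    unfolding D_def by (rule smooth_on_imp_continuous_on[OF smooth_on_frechet[OF u]])
  have Dc2: "continuous_on (ball 0 R \<times> {0..1}) (\<lambda>(x, t). D v (t *\<^sub>R x))" for v
    unfolding split_beta
    by (rule continuous_on_compose2[OF Dc], intro continuous_intros)
       (use scaled_in_ball in auto)
  have "((\<lambda>x. integral (cbox 0 1) (\<lambda>t. t ^ m *\<^sub>R u (t *\<^sub>R x))) has_derivative integral (cbox 0 1) (B z))
      (at z within ball 0 R)"
  proof (rule leibniz_rule[where fx = B])
    fix x :: complex and t :: real assume x: "x \<in> ball 0 R" and "t \<in> cbox 0 1"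
    then have t: "t \<in> {0..1}" by simp
    have "((\<lambda>x. t *\<^sub>R x) has_derivative (\<lambda>v. t *\<^sub>R v)) (at x)" by (auto intro!: derivative_eq_intros)
    from diff_chain_at[OF this DD[OF scaled_in_ball[OF x t]]]
    have "((\<lambda>x. u (t *\<^sub>R x)) has_derivative (\<lambda>v. D (t *\<^sub>R v) (t *\<^sub>R x))) (at x)" by (simp add: o_def)
    then have "((\<lambda>x. t ^ m *\<^sub>R u (t *\<^sub>R x)) has_derivative (\<lambda>v. t ^ m *\<^sub>R D (t *\<^sub>R v) (t *\<^sub>R x))) (at x)"
      by (rule has_derivative_scaleR_right)
    moreover have "t ^ m *\<^sub>R D (t *\<^sub>R v) (t *\<^sub>R x) = blinfun_apply (B x t) v" for v
      unfolding Bapp[OF x t] using linear_scale[OF has_derivative_linear[OF DD[OF scaled_in_ball[OF x t]]]] by simp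
    ultimately show "((\<lambda>x. t ^ m *\<^sub>R u (t *\<^sub>R x)) has_derivative blinfun_apply (B x t)) (at x within ball 0 R)"
      by (simp add: has_derivative_at_withinI)
  next
    show "(\<lambda>t. t ^ m *\<^sub>R u (t *\<^sub>R x)) integrable_on cbox 0 1" if "x \<in> ball 0 R" for x
      using radial_integrable[OF smooth_on_imp_continuous_on[OF u] that] by simp
  next
    have c: "continuous_on (ball 0 R \<times> {0..1}) (\<lambda>(x, t). blinfun_scaleR_left (D v (t *\<^sub>R x)) o\<^sub>L T)" for v T
      using Dc2[of v] unfolding split_beta
      by (intro continuous_intros bounded_linear.continuous_on[OF bounded_linear_blinfun_scaleR_left])
    show "continuous_on (ball 0 R \<times> cbox 0 1) (\<lambda>(x, t). B x t)"
      unfolding B_def split_beta box_real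
      by (rule continuous_on_scaleR[OF _ continuous_on_add[OF c[of 1 R1, unfolded split_beta] c[of \<i> I1, unfolded split_beta]]])
         (intro continuous_intros)
  qed (use z in auto)
  moreover have "at z within ball 0 R = at z" by (rule at_within_open[OF z open_ball])
  moreover have "blinfun_apply (integral (cbox 0 1) (B z)) = (\<lambda>v. radial_integral (Suc m) (D v) z)"
  proof
    fix v
    have cB: "continuous_on {0..1} (B z)"
    proof -
      have "continuous_on {0..1} (\<lambda>t::real. D v (t *\<^sub>R z))" for v
        using scaled_in_ball[OF z] by (intro continuous_on_compose2[OF Dc] continuous_intros) blast
      then have c: "continuous_on {0..1} (\<lambda>t::real. blinfun_scaleR_left (D v (t *\<^sub>R z)) o\<^sub>L T)" for v T
        by (intro continuous_intros bounded_linear.continuous_on[OF bounded_linear_blinfun_scaleR_left])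
      show ?thesis unfolding B_def
        by (rule continuous_on_scaleR[OF _ continuous_on_add[OF c[of 1 R1] c[of \<i> I1]]]) (intro continuous_intros)
    qed
    have "blinfun_apply (integral (cbox 0 1) (B z)) v = integral {0..1} (\<lambda>t. blinfun_apply (B z t) v)"
      using integrable_continuous_real[OF cB] by (simp add: blinfun_apply_integral)
    also have "\<dots> = radial_integral (Suc m) (D v) z"
      unfolding radial_integral_def by (rule integral_cong) (rule Bapp[OF z])
    finally show "blinfun_apply (integral (cbox 0 1) (B z)) v = radial_integral (Suc m) (D v) z" .
  qed
  moreover have "radial_integral m u = (\<lambda>x. integral (cbox 0 1) (\<lambda>t. t ^ m *\<^sub>R u (t *\<^sub>R x)))"
    by (rule ext) (simp add: radial_integral_def)
  ultimately show ?thesis unfolding D_def by (simp only:)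
qed

text \<open>A derivative of a radial integral is again one, with another m and u, so the induction
  runs over all m and u simultaneously.\<close>

lemma smooth_on_radial_integral:
  assumes "smooth_on (ball 0 R) u"
  shows "smooth_on (ball 0 R) (radial_integral m u)"
proof -
  have "times_differentiable_on k (ball 0 R) (radial_integral m u)" 
    if "smooth_on (ball 0 R) u" for k m and u :: "complex \<Rightarrow> 'a"
    using that
  proof (induction k arbitrary: m u)
    case 0
    have "isCont (radial_integral m u) z" if "z \<in> ball 0 R" for z
      by (rule has_derivative_continuous[OF radial_integral_derivative[OF 0 that]])
    then show ?case by (simp add: continuous_at_imp_continuous_on)
  next
    case (Suc k)
    show ?case
      by (rule times_differentiable_on_SucI[OF open_ball radial_integral_derivative[OF Suc.prems]
            Suc.IH[OF smooth_on_frechet[OF Suc.prems]]])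
  qed
  then show ?thesis using assms by (simp add: smooth_on_def)
qed

text \<open>The fundamental theorem of calculus on the segment from 0 to z.\<close>

lemma hadamard:
  fixes g :: "complex \<Rightarrow> complex^'n"
  assumes g: "smooth_on (ball 0 R) g" and g0: "g 0 = 0" and z: "z \<in> ball 0 R"
  shows "g z = z *s radial_integral 0 (d_z g) z + cnj z *s radial_integral 0 (d_zbar g) z"
proof -
  have "((\<lambda>t. g (t *\<^sub>R z)) has_vector_derivative z *s d_z g (t *\<^sub>R z) + cnj z *s d_zbar g (t *\<^sub>R z)) (at t within {0..1})"
    if t: "t \<in> {0..1}" for t
  proof -
    have D: "(g has_derivative (\<lambda>v. v *s d_z g (t *\<^sub>R z) + cnj v *s d_zbar g (t *\<^sub>R z))) (at (t *\<^sub>R z))"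
      using smooth_on_has_wirtinger[OF g scaled_in_ball[OF z t]] unfolding has_wirtinger_def .
    have "((\<lambda>t. t *\<^sub>R z) has_derivative (\<lambda>s. s *\<^sub>R z)) (at t)"
      by (auto intro!: derivative_eq_intros)
    from diff_chain_at[OF this D]
    have "((\<lambda>t. g (t *\<^sub>R z)) has_derivative
        (\<lambda>s. (s *\<^sub>R z) *s d_z g (t *\<^sub>R z) + cnj (s *\<^sub>R z) *s d_zbar g (t *\<^sub>R z))) (at t)"
      by (simp add: o_def)
    then have "((\<lambda>t. g (t *\<^sub>R z)) has_derivative
        (\<lambda>s. s *\<^sub>R (z *s d_z g (t *\<^sub>R z) + cnj z *s d_zbar g (t *\<^sub>R z)))) (at t)"
      by (simp add: scaleR_vector_scalar scaleR_conv_of_real[where 'a=complex] vector_add_ldistrib)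
    then show ?thesis unfolding has_vector_derivative_def by (rule has_derivative_at_withinI)
  qed
  from fundamental_theorem_of_calculus[OF _ this]
  have "((\<lambda>t. z *s d_z g (t *\<^sub>R z) + cnj z *s d_zbar g (t *\<^sub>R z)) has_integral (g z)) {0..1}"
    using g0 by simp
  then have 1: "g z = integral {0..1} (\<lambda>t. z *s d_z g (t *\<^sub>R z) + cnj z *s d_zbar g (t *\<^sub>R z))"
    by (rule integral_unique[symmetric])
  have i: "(\<lambda>t. d_z g (t *\<^sub>R z)) integrable_on {0..1}" "(\<lambda>t. d_zbar g (t *\<^sub>R z)) integrable_on {0..1}"
    using radial_integrable[OF smooth_on_imp_continuous_on[OF smooth_on_d(1)[OF open_ball g]] z, of 0]
      radial_integrable[OF smooth_on_imp_continuous_on[OF smooth_on_d(2)[OF open_ball g]] z, of 0] by simp_all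
  show ?thesis unfolding 1 radial_integral_def
    using integrable_linear[OF i(1) bounded_linear_vector_scalar_right[of z]]
      integrable_linear[OF i(2) bounded_linear_vector_scalar_right[of "cnj z"]]
      integral_linear[OF i(1) bounded_linear_vector_scalar_right[of z]]
      integral_linear[OF i(2) bounded_linear_vector_scalar_right[of "cnj z"]]
    by (simp add: integral_add o_def)
qed

text \<open>The \<open>\<partial>\<close>-bar equation of a section that is holomorphic for a connection. All Taylor
  coefficients of a solution with \<open>g 0 = 0\<close> in pure powers of \<open>cnj z\<close> vanish, which is why \<open>g\<close> is
  divisible by \<open>z\<close>.\<close>

definition dbar_eq :: "complex set \<Rightarrow> (complex \<Rightarrow> complex^'n) \<Rightarrow> (complex \<Rightarrow> complex^'n) \<Rightarrow>
    (complex \<Rightarrow> complex^'n) \<Rightarrow> bool" where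
  "dbar_eq S X Y g \<longleftrightarrow> smooth_on S g \<and> (\<forall>z\<in>S. d_zbar g z = hermitian (g z) (X z) *s Y z)"

text \<open>In Hadamard's formula g_zbar may be replaced by (g, X) Y, which is linear in g.
  Inserting the expansion of order N there, the part from G keeps its factor z, and the part from H
  has cnj z^N, which the leading cnj z of the formula raises to N + 1.\<close>

lemma dbar_eq_expansion:
  fixes g :: "complex \<Rightarrow> complex^'n"
  assumes X: "smooth_on (ball 0 R) X" and Y: "smooth_on (ball 0 R) Y"
    and eq: "dbar_eq (ball 0 R) X Y g" and g0: "g 0 = 0"
  shows "\<exists>G H. smooth_on (ball 0 R) G \<and> smooth_on (ball 0 R) H \<and>
    (\<forall>z\<in>ball 0 R. g z = z *s G z + cnj z ^ N *s H z)"
proof (induction N)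
  case 0
  show ?case using eq by (intro exI[of _ "\<lambda>z. 0"] exI[of _ g]) (auto simp: dbar_eq_def)
next
  case (Suc N)
  then obtain G H where G: "smooth_on (ball 0 R) G" and H: "smooth_on (ball 0 R) H"
    and GH: "\<And>z. z \<in> ball 0 R \<Longrightarrow> g z = z *s G z + cnj z ^ N *s H z" by blast
  have g: "smooth_on (ball 0 R) g" using eq by (simp add: dbar_eq_def)
  define T where "T = (\<lambda>u z. hermitian (u z) (X z) *s Y z)"
  have sT: "smooth_on (ball 0 R) (T u)" if "smooth_on (ball 0 R) u" for u
    unfolding T_def by (rule smooth_on_vector_scalar[OF open_ball smooth_on_hermitian[OF open_ball that X] Y])
  let ?G = "\<lambda>z. radial_integral 0 (d_z g) z + cnj z *s radial_integral 1 (T G) z"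
  let ?H = "radial_integral N (T H)"
  have "smooth_on (ball 0 R) ?G"
    by (rule smooth_on_add[OF open_ball smooth_on_radial_integral[OF smooth_on_d(1)[OF open_ball g]]
        smooth_on_vector_scalar[OF open_ball smooth_on_cnj[OF open_ball smooth_on_ident[OF open_ball]]
          smooth_on_radial_integral[OF sT[OF G]]]])
  moreover have "smooth_on (ball 0 R) ?H" by (rule smooth_on_radial_integral[OF sT[OF H]])
  moreover have "g z = z *s ?G z + cnj z ^ Suc N *s ?H z" if z: "z \<in> ball 0 R" for z
  proof -
    have "radial_integral 0 (d_zbar g) z
        = integral {0..1} (\<lambda>t. z *s (t ^ 1 *\<^sub>R T G (t *\<^sub>R z)) + cnj z ^ N *s (t ^ N *\<^sub>R T H (t *\<^sub>R z)))"
      unfolding radial_integral_def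
    proof (rule integral_cong)
      fix t :: real assume t: "t \<in> {0..1}"
      have "d_zbar g (t *\<^sub>R z) = T g (t *\<^sub>R z)"
        using eq scaled_in_ball[OF z t] by (simp add: dbar_eq_def T_def)
      then show "t ^ 0 *\<^sub>R d_zbar g (t *\<^sub>R z)
          = z *s (t ^ 1 *\<^sub>R T G (t *\<^sub>R z)) + cnj z ^ N *s (t ^ N *\<^sub>R T H (t *\<^sub>R z))"
        unfolding T_def GH[OF scaled_in_ball[OF z t]]
        by (simp add: scaleR_vector_scalar scaleR_conv_of_real[where 'a=complex] power_mult_distrib
            vec_eq_iff algebra_simps)
    qed
    also have "\<dots> = z *s radial_integral 1 (T G) z + cnj z ^ N *s radial_integral N (T H) z"
    proof -
      have i: "(\<lambda>t. t ^ m *\<^sub>R T u (t *\<^sub>R z)) integrable_on {0..1}" if "smooth_on (ball 0 R) u" for u m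
        by (rule radial_integrable[OF smooth_on_imp_continuous_on[OF sT[OF that]] z])
      show ?thesis unfolding radial_integral_def
        using integrable_linear[OF i[OF G, of 1] bounded_linear_vector_scalar_right[of z]]
          integrable_linear[OF i[OF H, of N] bounded_linear_vector_scalar_right[of "cnj z ^ N"]]
          integral_linear[OF i[OF G, of 1] bounded_linear_vector_scalar_right[of z]]
          integral_linear[OF i[OF H, of N] bounded_linear_vector_scalar_right[of "cnj z ^ N"]]
        by (simp add: integral_add o_def)
    qed
    finally show ?thesis using hadamard[OF g g0 z]
      by (simp add: vec_eq_iff algebra_simps)
  qed
  ultimately show ?case by blast
qed

section \<open>Dividing a solution by the coordinate\<close>

lemma norm_cnj_power_div: "norm (cnj z ^ (b + d) / z ^ b) \<le> norm z ^ d" for z :: complex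
proof (cases "z = 0")
  case False
  then show ?thesis by (simp add: norm_divide norm_mult norm_power power_add)
next
  case True
  then show ?thesis by (cases b) (auto simp: norm_power)
qed

text \<open>The modulus is |z|^(a - b) and each derivative lowers this exponent by one, so k
  derivatives remain continuous, with value 0 at the origin, as long as a - b exceeds k.\<close>

lemma times_differentiable_on_cnj_power_div:
  "b + k < a \<Longrightarrow> times_differentiable_on k UNIV (\<lambda>z. cnj z ^ a / z ^ b)"
proof (induction k arbitrary: a b)
  case 0
  then have ab: "0 < a - b" by simp
  have bd: "norm (cnj z ^ a / z ^ b) \<le> norm z ^ (a - b)" for z :: complex
    using norm_cnj_power_div[of z b "a - b"] 0 by simp
  have "isCont (\<lambda>z. cnj z ^ a / z ^ b) z" for z :: complex
  proof (cases "z = 0")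
    case True
    have "((\<lambda>z::complex. norm z ^ (a - b)) \<longlongrightarrow> 0 ^ (a - b)) (at 0)"
      using tendsto_power[OF tendsto_norm[OF tendsto_ident_at[of "0::complex" UNIV]], of "a - b"] by simp
    then have "((\<lambda>z::complex. cnj z ^ a / z ^ b) \<longlongrightarrow> 0) (at 0)"
      using ab by (intro Lim_null_comparison[OF always_eventually[OF allI[OF bd]]]) (simp add: zero_power)
    then show ?thesis using True 0 by (simp add: isCont_def zero_power)
  next
    case False
    then show ?thesis
      by (intro isCont_divide isCont_power isCont_cnj continuous_ident) simp
  qed
  then show ?case by (simp add: continuous_at_imp_continuous_on)
next
  case (Suc k)
  let ?q = "\<lambda>a b (z::complex). cnj z ^ a / z ^ b"
  have D: "(?q a b has_derivative
      (\<lambda>v. ?q (a - 1) b z * (of_nat a * cnj v) + ?q a (Suc b) z * (- of_nat b * v))) (at z)" for z :: complex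
  proof (cases "z = 0")
    case True
    have a0: "0 < a" "0 < a - 1" using Suc.prems by simp_all
    \<comment> \<open>At 0 the derivative is 0: the difference quotient is bounded by |z|^(a - b -
      1), whose exponent is still positive.\<close>
    have bd: "norm (norm (?q a b z) / norm z) \<le> norm z ^ (a - b - 1)" for z :: complex
    proof -
      have "a = b + Suc (a - b - 1)" using Suc.prems by simp
      then have "norm (?q a b z) \<le> norm z ^ Suc (a - b - 1)"
        using norm_cnj_power_div[of z b "Suc (a - b - 1)"] by metis
      then show ?thesis by (cases "z = 0") (simp_all add: divide_le_eq mult.commute)
    qed
    have "((\<lambda>z::complex. norm z ^ (a - b - 1)) \<longlongrightarrow> 0 ^ (a - b - 1)) (at 0)"
      using tendsto_power[OF tendsto_norm[OF tendsto_ident_at[of "0::complex" UNIV]], of "a - b - 1"] by simp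
    then have "((\<lambda>z. norm (?q a b z) / norm z) \<longlongrightarrow> 0) (at 0)"
      using Suc.prems by (intro Lim_null_comparison[OF always_eventually[OF allI[OF bd]]]) (simp add: zero_power)
    then have "(?q a b has_derivative (\<lambda>v. 0)) (at 0)"
      unfolding has_derivative_iff_norm using a0 by (simp add: zero_power)
    then show ?thesis using True a0 by (simp add: zero_power)
  next
    case False
    have p: "((\<lambda>z. z ^ n) has_field_derivative of_nat n * z ^ (n - 1)) (at z)" for n
      by (auto intro!: derivative_eq_intros)
    have 1: "has_wirtinger1 (\<lambda>z. cnj (z ^ a)) (cnj 0) (cnj (of_nat a * z ^ (a - 1))) z"
      by (rule has_wirtinger1_cnj[OF has_wirtinger1_holomorphic[OF p]])
    have 2: "has_wirtinger1 (\<lambda>z. inverse (z ^ b)) (- (of_nat b * z ^ (b - 1)) * inverse (z ^ b) ^ 2)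
        (- 0 * inverse (z ^ b) ^ 2) z"
      by (rule has_wirtinger1_inverse[OF has_wirtinger1_holomorphic[OF p]]) (use False in simp)
    have e: "of_nat b * z ^ (b - 1) * inverse (z ^ b) ^ 2 = of_nat b / z ^ Suc b"
    proof (cases b)
      case (Suc c)
      then show ?thesis using False by (simp add: field_simps power2_eq_square)
    qed simp
    show ?thesis using has_wirtinger1_mult[OF 1 2]
      unfolding has_wirtinger1_def mult_minus_left e by (simp add: divide_inverse mult_ac)
  qed
  have m: "times_differentiable_on k UNIV (\<lambda>z. ?q a' b' z * c)" if "b' + k < a'" for a' b' c
    by (rule times_differentiable_on_linear[OF open_UNIV Suc.IH[OF that] bounded_linear_mult_left])
  show ?case
    by (rule times_differentiable_on_SucI[where g' = "\<lambda>z v. ?q (a - 1) b z * (of_nat a * cnj v)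
        + ?q a (Suc b) z * (- of_nat b * v)", OF open_UNIV D])
       (rule times_differentiable_on_add[OF open_UNIV m m], use Suc.prems in auto)
qed

text \<open>The means by which identities known off an exceptional centre are carried into
  it.\<close>

lemma continuous_on_punctured_eq:
  fixes f g :: "complex \<Rightarrow> 'b::real_normed_vector"
  assumes "open S" "w \<in> S" "isCont f w" "isCont g w" "\<And>z. z \<in> S \<Longrightarrow> z \<noteq> w \<Longrightarrow> f z = g z"
  shows "f w = g w"
proof -
  have "(f \<longlongrightarrow> f w) (at w)" "(g \<longlongrightarrow> g w) (at w)" using assms by (simp_all add: isCont_def)
  moreover have "\<forall>\<^sub>F z in at w. f z = g z"
    using assms unfolding eventually_at_topological by blast
  ultimately have "(g \<longlongrightarrow> f w) (at w)" using tendsto_cong by metis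
  then show ?thesis using \<open>(g \<longlongrightarrow> g w) (at w)\<close> by (metis tendsto_unique trivial_limit_at)
qed

text \<open>The expansion of order N shows that g / z, filled in at 0, has k continuous derivatives
  once N > k + 1. All orders give the same quotient off 0, and by continuity also at 0, so this one
  function is smooth.\<close>

lemma dbar_eq_divide:
  fixes g :: "complex \<Rightarrow> complex^'n"
  assumes X: "smooth_on (ball 0 R) X" and Y: "smooth_on (ball 0 R) Y" and R: "R > 0"
    and eq: "dbar_eq (ball 0 R) X Y g" and g0: "g 0 = 0"
  obtains h where "dbar_eq (ball 0 R) X Y h" "\<And>z. z \<in> ball 0 R \<Longrightarrow> g z = z *s h z"
proof -
  let ?B = "ball (0::complex) R"
  have "\<forall>N. \<exists>G H. smooth_on ?B G \<and> smooth_on ?B H \<and> (\<forall>z\<in>?B. g z = z *s G z + cnj z ^ N *s H z)"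
    using dbar_eq_expansion[OF X Y eq g0] by blast
  then obtain G H where GH: "\<And>N. smooth_on ?B (G N)" "\<And>N. smooth_on ?B (H N)"
    "\<And>N z. z \<in> ?B \<Longrightarrow> g z = z *s G N z + cnj z ^ N *s H N z" by metis
  define h where "h = (\<lambda>N z. G N z + (cnj z ^ N / z ^ 1) *s H N z)"
  have td: "times_differentiable_on k ?B (h N)" if "k + 1 < N" for k N
  proof -
    have G: "times_differentiable_on k ?B (G N)" and H: "times_differentiable_on k ?B (H N)"
      using GH by (auto simp: smooth_on_def)
    have "times_differentiable_on k ?B (\<lambda>z. cnj z ^ N / z ^ 1)"
      by (rule times_differentiable_on_subset[OF times_differentiable_on_cnj_power_div]) (use that in auto)
    then show ?thesis unfolding h_def
      by (rule times_differentiable_on_add[OF open_ball G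
          times_differentiable_on_bilinear[OF open_ball _ H bounded_bilinear_vector_scalar]])
  qed
  have hg: "h N z = (1 / z) *s g z" if "z \<in> ?B" "z \<noteq> 0" for N z
    unfolding h_def GH(3)[OF that(1), of N] using that by (simp add: vec_eq_iff field_simps)
  have c: "isCont (h N) 0" if "1 < N" for N
    using td[of 0 N] that R by (simp add: continuous_on_eq_continuous_at)
  \<comment> \<open>\<open>h 2\<close> represents the quotient, 2 being the least order for which
    \<open>td\<close> gives continuity at 0.\<close>
  have h0: "h N 0 = h 2 0" if "1 < N" for N
    by (rule continuous_on_punctured_eq[of ?B]) (use R c that hg in auto)
  have hN: "h N z = h 2 z" if "1 < N" "z \<in> ?B" for N z
    using h0[OF that(1)] hg[of z N] hg[of z 2] that by (cases "z = 0") auto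
  have sh: "smooth_on ?B (h 2)" unfolding smooth_on_def
  proof
    fix k
    show "times_differentiable_on k ?B (h 2)"
      by (rule times_differentiable_on_cong[OF open_ball _ td[of k "k + 2"]]) (auto intro: hN)
  qed
  have gh: "g z = z *s h 2 z" if "z \<in> ?B" for z
    using hg[OF that, of 2] g0 by (cases "z = 0") (auto simp: vec_eq_iff)
  \<comment> \<open>Since 1 / z is holomorphic and the equation is linear in the unknown, the
    quotient inherits it off 0; at 0 both sides are continuous.\<close>
  have off: "d_zbar (h 2) z = hermitian (h 2 z) (X z) *s Y z" if z: "z \<in> ?B" "z \<noteq> 0" for z
  proof -
    have o: "open (?B - {0})" "z \<in> ?B - {0}" using z by auto
    have s: "smooth_on ?B g" using eq by (simp add: dbar_eq_def)
    have "has_wirtinger1 (\<lambda>z. inverse z) (- 1 * inverse z ^ 2) (- 0 * inverse z ^ 2) z"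
      by (rule has_wirtinger1_inverse[OF has_wirtinger1_ident]) fact
    from has_wirtinger_smult[OF this smooth_on_has_wirtinger[OF s z(1)]]
    have "d_zbar (\<lambda>z. inverse z *s g z) z = inverse z *s d_zbar g z"
      using has_wirtinger_d(2) by fastforce
    moreover have "d_zbar (h 2) z = d_zbar (\<lambda>z. inverse z *s g z) z"
      by (rule d_cong(2)[OF o]) (use hg in \<open>auto simp: inverse_eq_divide\<close>)
    ultimately show ?thesis using eq z hg[OF z, of 2]
      by (simp add: dbar_eq_def inverse_eq_divide)
  qed
  have "d_zbar (h 2) 0 = hermitian (h 2 0) (X 0) *s Y 0"
  proof (rule continuous_on_punctured_eq[of ?B])
    show "isCont (d_zbar (h 2)) 0"
      by (rule smooth_on_imp_isCont[OF smooth_on_d(2)[OF open_ball sh]]) (use R in auto)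
    show "isCont (\<lambda>z. hermitian (h 2 z) (X z) *s Y z) 0"
      by (rule smooth_on_imp_isCont[OF smooth_on_vector_scalar[OF open_ball smooth_on_hermitian[OF open_ball sh X] Y]])
         (use R in auto)
  qed (use R off in auto)
  then have "dbar_eq ?B X Y (h 2)" using off sh unfolding dbar_eq_def by metis
  then show ?thesis using that gh by blast
qed

section \<open>Unique continuation\<close>

text \<open>A positive second derivative would make \<phi>' positive just to the right of 0, and
  \<phi> would exceed its maximum there.\<close>

lemma second_derivative_max:
  fixes \<phi> \<phi>' :: "real \<Rightarrow> real"
  assumes e: "e > 0" and D: "\<And>t. \<bar>t\<bar> < e \<Longrightarrow> (\<phi> has_real_derivative \<phi>' t) (at t)"
    and D2: "(\<phi>' has_real_derivative c) (at 0)" and max: "\<And>t. \<bar>t\<bar> < e \<Longrightarrow> \<phi> t \<le> \<phi> 0"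
  shows "\<phi>' 0 = 0" "c \<le> 0"
proof -
  show 0: "\<phi>' 0 = 0"
    using DERIV_local_max[OF D[of 0] e] max e by auto
  show "c \<le> 0"
  proof (rule ccontr)
    assume "\<not> c \<le> 0"
    then obtain d where d: "d > 0" "\<And>h. 0 < h \<Longrightarrow> h < d \<Longrightarrow> \<phi>' 0 < \<phi>' (0 + h)"
      using DERIV_pos_inc_right[OF D2] by auto
    define t where "t = min (d/2) (e/2)"
    have t: "0 < t" "t < d" "t < e" using d e by (auto simp: t_def)
    have "(\<phi> has_real_derivative \<phi>' x) (at x)" if "0 \<le> x" "x \<le> t" for x using D that t by auto
    from MVT2[OF t(1) this] obtain x where x: "0 < x" "x < t" "\<phi> t - \<phi> 0 = (t - 0) * \<phi>' x" by auto
    have "\<phi>' x > 0" using d(2)[of x] x t 0 by simp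
    then have "\<phi> t > \<phi> 0" using x t by (simp add: zero_less_mult_iff algebra_simps)
    then show False using max[of t] t by simp
  qed
qed

text \<open>Here \<beta> = u_zbar and \<gamma> is its z-derivative, so Re \<gamma> is a quarter of
  the Laplacian of u. Restriction to the lines in the directions 1 and \<i> gives two
  second-derivative inequalities, in whose sum \<delta> cancels.\<close>

lemma wirtinger_max:
  fixes u :: "complex \<Rightarrow> real"
  assumes S: "open S" "w \<in> S" and u: "\<And>z. z \<in> S \<Longrightarrow> has_wirtinger1 (\<lambda>z. of_real (u z)) (cnj (\<beta> z)) (\<beta> z) z"
    and \<beta>: "has_wirtinger1 \<beta> \<gamma> \<delta> w" and max: "\<And>z. z \<in> S \<Longrightarrow> u z \<le> u w"
  shows "\<beta> w = 0" "Re \<gamma> \<le> 0"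
proof -
  obtain e where e: "e > 0" "ball w e \<subseteq> S" using S open_contains_ball by blast
  have line: "Re (cnj v * \<beta> w) = 0 \<and> Re (cnj v * (v * \<gamma> + cnj v * \<delta>)) \<le> 0" if v: "norm v = 1" for v
  proof -
    have inS: "w + of_real t * v \<in> S" if "\<bar>t\<bar> < e" for t
      using e(2) that v by (auto simp: dist_norm norm_mult)
    have l: "((\<lambda>t. w + of_real t * v) has_derivative (\<lambda>s. of_real s * v)) (at t)" for t
      by (auto intro!: derivative_eq_intros)
    have D: "((\<lambda>t. u (w + of_real t * v)) has_real_derivative 2 * Re (cnj v * \<beta> (w + of_real t * v))) (at t)"
      if "\<bar>t\<bar> < e" for t
    proof -
      have "((\<lambda>t. of_real (u (w + of_real t * v)) :: complex) has_derivative
          (\<lambda>s. (of_real s * v) * cnj (\<beta> (w + of_real t * v)) + cnj (of_real s * v) * \<beta> (w + of_real t * v))) (at t)"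
        using diff_chain_at[OF l u[OF inS[OF that], unfolded has_wirtinger1_def]] by (simp add: o_def)
      from bounded_linear.has_derivative[OF bounded_linear_Re this]
      have "((\<lambda>t. u (w + of_real t * v)) has_derivative
         (\<lambda>s. Re ((of_real s * v) * cnj (\<beta> (w + of_real t * v)) + cnj (of_real s * v) * \<beta> (w + of_real t * v)))) (at t)"
        by simp
      moreover have "Re ((of_real s * v) * cnj b + cnj (of_real s * v) * b) = 2 * Re (cnj v * b) * s" for s b
        by (simp add: algebra_simps)
      ultimately show ?thesis unfolding has_field_derivative_def by (simp only:)
    qed
    have D2: "((\<lambda>t. 2 * Re (cnj v * \<beta> (w + of_real t * v))) has_real_derivative
        2 * Re (cnj v * (v * \<gamma> + cnj v * \<delta>))) (at 0)"
    proof -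
      have "((\<lambda>t. \<beta> (w + of_real t * v)) has_derivative (\<lambda>s. (of_real s * v) * \<gamma> + cnj (of_real s * v) * \<delta>)) (at 0)"
      proof -
        have "(\<beta> has_derivative (\<lambda>v. v * \<gamma> + cnj v * \<delta>)) (at (w + of_real 0 * v))"
          using \<beta> by (simp add: has_wirtinger1_def)
        from diff_chain_at[OF l this] show ?thesis by (simp add: o_def)
      qed
      then have "((\<lambda>t. 2 * Re (cnj v * \<beta> (w + of_real t * v))) has_derivative
          (\<lambda>s. 2 * Re (cnj v * ((of_real s * v) * \<gamma> + cnj (of_real s * v) * \<delta>)))) (at 0)"
        by (intro has_derivative_mult_right bounded_linear.has_derivative[OF bounded_linear_Re])
      moreover have "2 * Re (cnj v * ((of_real s * v) * \<gamma> + cnj (of_real s * v) * \<delta>))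
         = 2 * Re (cnj v * (v * \<gamma> + cnj v * \<delta>)) * s" for s
        by (simp add: algebra_simps)
      ultimately show ?thesis unfolding has_field_derivative_def by (simp only:)
    qed
    have mx: "u (w + of_real t * v) \<le> u (w + of_real 0 * v)" if "\<bar>t\<bar> < e" for t
      using max[OF inS[OF that]] by simp
    from second_derivative_max[OF e(1) D D2 mx] show ?thesis by simp
  qed
  from line[of 1] line[of \<i>] show "\<beta> w = 0" by (simp add: complex_eq_iff)
  from line[of 1] line[of \<i>] show "Re \<gamma> \<le> 0" by (simp add: algebra_simps)
qed

text \<open>The weight makes \<open>|h|^2\<close> strictly subharmonic where \<open>h\<close> does not vanish.\<close>

lemma dbar_eq_no_interior_max:
  fixes h :: "complex \<Rightarrow> complex^'n"
  assumes S: "open S" "w \<in> S" and X: "smooth_on S X" and Y: "smooth_on S Y" and eq: "dbar_eq S X Y h"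
    and a: "norm (X w) * norm (Y w) \<le> a"
    and M: "norm (d_zbar X w) * norm (Y w) + norm (X w) * norm (d_z Y w) \<le> M"
    and C: "C = 4 * (a\<^sup>2 + 2 * M) + 1" and r: "C * (norm w)\<^sup>2 \<le> 1 / 8"
    and max: "\<And>z. z \<in> S \<Longrightarrow> (norm (h z))\<^sup>2 * (1 + C * (norm z)\<^sup>2) \<le> (norm (h w))\<^sup>2 * (1 + C * (norm w)\<^sup>2)"
  shows "h w = 0"
proof (rule ccontr)
  assume h0: "h w \<noteq> 0"
  have sh: "smooth_on S h" using eq by (simp add: dbar_eq_def)
  define T where "T = (\<lambda>z. hermitian (h z) (X z) *s Y z)"
  define k where "k = d_z h"
  have sT: "smooth_on S T" unfolding T_def
    by (rule smooth_on_vector_scalar[OF S(1) smooth_on_hermitian[OF S(1) sh X] Y])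
  have hw: "has_wirtinger h (k z) (T z) z" if "z \<in> S" for z
    using smooth_on_has_wirtinger[OF sh that] eq that by (simp add: dbar_eq_def T_def k_def)
  have sk: "smooth_on S k" unfolding k_def by (rule smooth_on_d(1)[OF S(1) sh])
  \<comment> \<open>By the equation, the mixed second derivative of h is a first derivative of
    \<open>T\<close>, so it is controlled by h and its first derivative \<open>k\<close>.\<close>
  have kz: "d_zbar k w = d_z T w"
  proof -
    have "d_zbar k w = d_z (d_zbar h) w" unfolding k_def by (rule d_zbar_d_z[OF S sh])
    also have "\<dots> = d_z T w" by (rule d_cong(1)[OF S]) (use eq in \<open>simp add: dbar_eq_def T_def\<close>)
    finally show ?thesis .
  qed
  define s where "s = d_z T w"
  define U where "U = (\<lambda>z. hermitian (h z) (h z) * (1 + of_real C * (z * cnj z)))"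
  have U: "U z = of_real ((norm (h z))\<^sup>2 * (1 + C * (norm z)\<^sup>2))" for z
    by (simp add: U_def hermitian_self complex_norm_square[symmetric])
  define \<beta> where "\<beta> = (\<lambda>z. (hermitian (T z) (h z) + hermitian (h z) (k z)) * (1 + of_real C * (z * cnj z))
     + hermitian (h z) (h z) * (of_real C * z))"
  have wt: "has_wirtinger1 (\<lambda>z. 1 + of_real C * (z * cnj z)) (of_real C * cnj z) (of_real C * z) z" for z
    using has_wirtinger1_add[OF has_wirtinger1_const[of 1] has_wirtinger1_mult[OF has_wirtinger1_const[of "of_real C"]
      has_wirtinger1_mult[OF has_wirtinger1_ident has_wirtinger1_cnj[OF has_wirtinger1_ident]]]] by simp
  have wU: "has_wirtinger1 (\<lambda>z. of_real ((norm (h z))\<^sup>2 * (1 + C * (norm z)\<^sup>2))) (cnj (\<beta> z)) (\<beta> z) z" if "z \<in> S" for z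
    using has_wirtinger1_mult[OF has_wirtinger1_hermitian[OF hw[OF that] hw[OF that]] wt]
    unfolding U_def[symmetric] U by (simp add: \<beta>_def hermitian_cnj algebra_simps)
  have wk: "has_wirtinger k (d_z k w) s w"
    using smooth_on_has_wirtinger[OF sk S(2)] kz by (simp add: s_def)
  have wT: "has_wirtinger T s (d_zbar T w) w"
    using smooth_on_has_wirtinger[OF sT S(2)] by (simp add: s_def)
  define P where "P = (norm (h w))\<^sup>2"
  define W where "W = 1 + C * (norm w)\<^sup>2"
  define q where "q = hermitian s (h w) + hermitian (T w) (T w) + hermitian (k w) (k w) + hermitian (h w) s"
  define b where "b = hermitian (T w) (h w) + hermitian (h w) (k w)"
  have Pp: "P > 0" using h0 by (simp add: P_def)
  have wz: "w * cnj w = of_real ((norm w)\<^sup>2)" by (rule complex_norm_square[symmetric])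
  have W': "1 + of_real C * (w * cnj w) = of_real W" unfolding wz W_def by simp
  have w\<beta>: "has_wirtinger1 \<beta> (q * of_real W + b * (of_real C * cnj w) + (cnj b * (of_real C * w) + of_real P * of_real C))
     ((hermitian (d_zbar T w) (h w) + hermitian (T w) (k w) + (hermitian (T w) (k w) + hermitian (h w) (d_z k w))) * of_real W
       + b * (of_real C * w) + (b * (of_real C * w) + of_real P * 0)) w"
  proof -
    have 1: "has_wirtinger1 (\<lambda>z. hermitian (T z) (h z) + hermitian (h z) (k z)) q
       (hermitian (d_zbar T w) (h w) + hermitian (T w) (k w) + (hermitian (T w) (k w) + hermitian (h w) (d_z k w))) w"
      using has_wirtinger1_add[OF has_wirtinger1_hermitian[OF wT hw[OF S(2)]] has_wirtinger1_hermitian[OF hw[OF S(2)] wk]]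
      by (simp add: q_def add_ac)
    have 2: "has_wirtinger1 (\<lambda>z. of_real C * z) (of_real C) 0 w"
      using has_wirtinger1_mult[OF has_wirtinger1_const[of "of_real C"] has_wirtinger1_ident] by simp
    have cb: "cnj b = hermitian (h w) (T w) + hermitian (k w) (h w)" by (simp add: b_def hermitian_cnj)
    show ?thesis
      using has_wirtinger1_add[OF has_wirtinger1_mult[OF 1 wt]
          has_wirtinger1_mult[OF has_wirtinger1_hermitian[OF hw[OF S(2)] hw[OF S(2)]] 2]]
      unfolding \<beta>_def W' b_def[symmetric] add.commute[of "hermitian (k w) (h w)"] cb[symmetric]
        hermitian_self[of "h w"] P_def[symmetric] by simp
  qed
  have "\<beta> w = 0" and R: "Re (q * of_real W + b * (of_real C * cnj w) + (cnj b * (of_real C * w) + of_real P * of_real C)) \<le> 0"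
    using wirtinger_max[OF S wU w\<beta> max] by blast+
  \<comment> \<open>The vanishing gradient expresses b through P and w. Each of the two cross terms
    of the Laplacian thereby becomes -P C^2 |w|^2 / W, which is small by \<open>r\<close>.\<close>
  have b: "b * of_real W = - of_real P * (of_real C * w)"
    using \<open>\<beta> w = 0\<close> unfolding \<beta>_def b_def[symmetric] W' hermitian_self[of "h w"] P_def[symmetric]
    by (simp add: eq_neg_iff_add_eq_0)
  have a0: "a \<ge> 0" by (rule order_trans[OF _ a]) simp
  have M0: "M \<ge> 0" by (rule order_trans[OF _ M]) simp
  have C1: "C \<ge> 1" using M0 unfolding C by simp
  have W1: "W \<ge> 1" "W \<le> 9/8" using r C1 unfolding W_def by simp_all
  have bw: "Re (b * (of_real C * cnj w)) = - P * (C * (C * (norm w)\<^sup>2)) / W"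
  proof -
    have "b * (of_real C * cnj w) * of_real W = (b * of_real W) * (of_real C * cnj w)" by (simp add: mult_ac)
    also have "\<dots> = - of_real P * (of_real C * (of_real C * (w * cnj w)))"
      unfolding b by (simp add: mult_ac)
    also have "\<dots> = of_real (- P * (C * (C * (norm w)\<^sup>2)))" unfolding wz by simp
    finally have "b * (of_real C * cnj w) = of_real (- P * (C * (C * (norm w)\<^sup>2)) / W)"
      using W1 by (simp add: field_simps)
    then show ?thesis by (metis Re_complex_of_real)
  qed
  have bw': "Re (cnj b * (of_real C * w)) = Re (b * (of_real C * cnj w))"
    by (simp add: algebra_simps)
  define x where "x = norm (h w)"
  define y where "y = norm (k w)"
  have sn: "norm s \<le> a * y + M * x"
  proof -
    have "has_wirtinger1 (\<lambda>z. hermitian (h z) (X z)) (hermitian (k w) (X w) + hermitian (h w) (d_zbar X w))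
        (hermitian (T w) (X w) + hermitian (h w) (d_z X w)) w"
      by (rule has_wirtinger1_hermitian[OF hw[OF S(2)] smooth_on_has_wirtinger[OF X S(2)]])
    from has_wirtinger_d(1)[OF has_wirtinger_smult[OF this smooth_on_has_wirtinger[OF Y S(2)]]]
    have s': "s = (hermitian (k w) (X w) + hermitian (h w) (d_zbar X w)) *s Y w + hermitian (h w) (X w) *s d_z Y w"
      unfolding s_def T_def .
    have "norm s \<le> (y * norm (X w) + x * norm (d_zbar X w)) * norm (Y w) + (x * norm (X w)) * norm (d_z Y w)"
      unfolding s' x_def y_def
      by (rule order_trans[OF norm_triangle_ineq], unfold norm_vector_scalar)
         (intro add_mono mult_right_mono norm_hermitian_le norm_ge_zero
           order_trans[OF norm_triangle_ineq add_mono[OF norm_hermitian_le norm_hermitian_le]])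
    also have "\<dots> = y * (norm (X w) * norm (Y w)) + x * (norm (d_zbar X w) * norm (Y w) + norm (X w) * norm (d_z Y w))"
      by (simp add: algebra_simps)
    also have "\<dots> \<le> y * a + x * M" using a M by (intro add_mono mult_left_mono) (auto simp: x_def y_def)
    finally show ?thesis by (simp add: mult.commute)
  qed
  have xy: "x > 0" "y \<ge> 0" using h0 by (auto simp: x_def y_def)
  have Px: "P = x * x" by (simp add: P_def x_def power2_eq_square)
  have PC: "P * C > 0" using Pp C1 by simp
  \<comment> \<open>The origin of C. The weight contributes P C. Against it stand A W, with A = (a^2
    + 2 M) P = (P C - P) / 4 and W \<le> 9/8, and twice a term of at most P C / 8. Together these
    stay below 9/32 + 8/32 of P C.\<close>
  have lin: "A2 - 2 * E + PC > 0" if "- A * W \<le> A2" "A * W \<le> A * (9/8)" "E \<le> PC / 8" "A * 4 = PC - P" "PC > 0" "P > 0"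
    for A2 E PC A :: real
    using that by linarith
  have "Re q \<ge> y * y - 2 * (norm s * x)"
  proof -
    have "Re (hermitian s (h w)) \<ge> - (norm s * x)" "Re (hermitian (h w) s) \<ge> - (x * norm s)"
      unfolding x_def by (rule Re_hermitian_ge)+
    moreover have "Re (hermitian (k w) (k w)) = y * y" "Re (hermitian (T w) (T w)) \<ge> 0"
      by (simp_all add: hermitian_self y_def power2_eq_square)
    ultimately show ?thesis unfolding q_def by (simp add: mult.commute)
  qed
  moreover have "norm s * x \<le> (a * y + M * x) * x" using sn xy by (intro mult_right_mono) auto
  \<comment> \<open>Completing the square absorbs the term 2 a x y coming from the derivative of h
    and leaves -(a^2 + 2 M) x^2, a multiple of P = x^2.\<close>
  moreover have "0 \<le> (y - a * x) * (y - a * x)" by simp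
  ultimately have "- ((a * a + 2 * M) * P) \<le> Re q" unfolding Px by (simp add: algebra_simps)
  then have f1: "- ((a * a + 2 * M) * P) * W \<le> Re q * W" using W1 by (intro mult_right_mono) auto
  have f2: "(a * a + 2 * M) * P * W \<le> (a * a + 2 * M) * P * (9/8)"
    using W1 M0 Pp by (intro mult_left_mono) auto
  have f3: "P * (C * (C * (norm w)\<^sup>2)) / W \<le> P * C / 8"
  proof -
    have "P * (C * (C * (norm w)\<^sup>2)) / W \<le> P * (C * (C * (norm w)\<^sup>2)) / 1"
      using W1 Pp C1 by (intro divide_left_mono) auto
    also have "\<dots> \<le> P * (C * (1/8))" using r Pp C1 by (simp add: mult_left_mono)
    finally show ?thesis by simp
  qed
  have f4: "(a * a + 2 * M) * P * 4 = P * C - P" unfolding C by (simp add: power2_eq_square algebra_simps)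
  have "Re q * W - 2 * (P * (C * (C * (norm w)\<^sup>2)) / W) + P * C > 0"
    by (rule lin[OF f1 f2 f3 f4 PC Pp])
  moreover have "Re q * W - 2 * (P * (C * (C * (norm w)\<^sup>2)) / W) + P * C
     = Re (q * of_real W + b * (of_real C * cnj w) + (cnj b * (of_real C * w) + of_real P * of_real C))"
    using bw bw' by (simp del: minus_mult_left)
  ultimately show False using R by linarith
qed

text \<open>The radius depends on X and Y only, so that one bound serves all quotients g / z^N at
  once. The maximum of |h|^2 times the weight lies on the circle or has value 0, and the weight
  stays between 1 and 9/8.\<close>

lemma dbar_eq_boundary_bound:
  fixes X Y :: "complex \<Rightarrow> complex^'n"
  assumes R: "R > 0" and X: "smooth_on (ball 0 R) X" and Y: "smooth_on (ball 0 R) Y"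
  obtains r where "0 < r" "r < R" "\<And>h. dbar_eq (ball 0 R) X Y h \<Longrightarrow>
      \<exists>z1\<in>sphere 0 r. \<forall>z\<in>cball 0 r. (norm (h z))\<^sup>2 \<le> 2 * (norm (h z1))\<^sup>2"
proof -
  have cb: "continuous_on (cball 0 (R/2)) f" if "smooth_on (ball 0 R) f" for f :: "complex \<Rightarrow> complex^'n"
    using smooth_on_imp_continuous_on[OF that] R by (auto intro: continuous_on_subset)
  have "bounded ((\<lambda>z. norm (X z) * norm (Y z)) ` cball 0 (R/2))"
    by (intro compact_imp_bounded compact_continuous_image continuous_intros cb X Y compact_cball)
  then obtain a where a': "\<And>y. y \<in> (\<lambda>z. norm (X z) * norm (Y z)) ` cball 0 (R/2) \<Longrightarrow> norm y \<le> a"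
    unfolding bounded_iff by blast
  have a: "norm (X z) * norm (Y z) \<le> a" if "z \<in> cball 0 (R/2)" for z
    using a'[OF imageI[OF that]] unfolding real_norm_def by (rule abs_le_D1)
  have "bounded ((\<lambda>z. norm (d_zbar X z) * norm (Y z) + norm (X z) * norm (d_z Y z)) ` cball 0 (R/2))"
    by (intro compact_imp_bounded compact_continuous_image continuous_intros cb X Y compact_cball
        smooth_on_d[OF open_ball X] smooth_on_d[OF open_ball Y])
  then obtain M where M': "\<And>y. y \<in> (\<lambda>z. norm (d_zbar X z) * norm (Y z) + norm (X z) * norm (d_z Y z)) ` cball 0 (R/2)
      \<Longrightarrow> norm y \<le> M"
    unfolding bounded_iff by blast
  have M: "norm (d_zbar X z) * norm (Y z) + norm (X z) * norm (d_z Y z) \<le> M" if "z \<in> cball 0 (R/2)" for z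
    using M'[OF imageI[OF that]] unfolding real_norm_def by (rule abs_le_D1)
  define C where "C = 4 * (a\<^sup>2 + 2 * M) + 1"
  have M0: "M \<ge> 0" by (rule order_trans[OF _ M[of 0]]) (use R in auto)
  then have C1: "C \<ge> 1" unfolding C_def by simp
  \<comment> \<open>As C \<ge> 1, this makes r \<le> 1, hence C r^2 \<le> C r \<le> 1/8.\<close>
  define r where "r = min (R/2) (1 / (8 * C))"
  have r: "0 < r" "r < R" "r \<le> R/2" "C * r\<^sup>2 \<le> 1/8"
  proof -
    show "0 < r" "r < R" "r \<le> R/2" using R C1 by (auto simp: r_def)
    have "r \<le> 1 / (8 * C)" by (simp add: r_def)
    moreover have "1 / (8 * C) \<le> 1" using C1 by (simp add: divide_le_eq)
    ultimately have "r \<le> 1" by linarith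
    then have "r * r \<le> 1 / (8 * C) * 1" using \<open>r \<le> 1 / (8 * C)\<close> \<open>0 < r\<close> C1 by (intro mult_mono) auto
    then show "C * r\<^sup>2 \<le> 1/8" using C1 by (simp add: power2_eq_square field_simps)
  qed
  have wt: "C * (norm z)\<^sup>2 \<le> 1/8" if "z \<in> cball 0 r" for z :: complex
  proof -
    have "C * (norm z)\<^sup>2 \<le> C * r\<^sup>2" using that C1 by (intro mult_left_mono power_mono) auto
    then show ?thesis using r by simp
  qed
  show ?thesis
  proof (rule that[OF r(1,2)])
    fix h assume h: "dbar_eq (ball 0 R) X Y h"
    define u where "u = (\<lambda>z. (norm (h z))\<^sup>2 * (1 + C * (norm z)\<^sup>2))"
    have sh: "smooth_on (ball 0 R) h" using h by (simp add: dbar_eq_def)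
    have "continuous_on (cball 0 r) h"
      by (rule continuous_on_subset[OF cb[OF sh]]) (use r(3) in auto)
    then have "continuous_on (cball 0 r) u" unfolding u_def by (intro continuous_intros)
    moreover have "cball (0::complex) r \<noteq> {}" using r by simp
    ultimately obtain w where w: "w \<in> cball 0 r" "\<And>z. z \<in> cball 0 r \<Longrightarrow> u z \<le> u w"
      using continuous_attains_sup[OF compact_cball] by metis
    have bound: "(norm (h z))\<^sup>2 \<le> 2 * (norm (h w))\<^sup>2" if z: "z \<in> cball 0 r" for z
    proof -
      have "(norm (h z))\<^sup>2 * 1 \<le> u z" unfolding u_def using C1 by (intro mult_left_mono) auto
      also have "\<dots> \<le> u w" by (rule w(2)[OF z])
      also have "\<dots> \<le> (norm (h w))\<^sup>2 * 2" unfolding u_def using wt[OF w(1)] by (intro mult_left_mono) auto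
      finally show ?thesis by (simp add: mult.commute)
    qed
    show "\<exists>z1\<in>sphere 0 r. \<forall>z\<in>cball 0 r. (norm (h z))\<^sup>2 \<le> 2 * (norm (h z1))\<^sup>2"
    proof (cases "norm w = r")
      case True
      then show ?thesis using bound by (intro bexI[of _ w]) auto
    next
      case False
      then have wb: "w \<in> ball 0 r" using w(1) by simp
      have sub: "ball 0 r \<subseteq> ball (0::complex) R" using r by auto
      have wc: "w \<in> cball 0 (R/2)" using w(1) r by auto
      have "h w = 0"
        by (rule dbar_eq_no_interior_max[OF open_ball wb smooth_on_subset[OF X sub] smooth_on_subset[OF Y sub] _
              a[OF wc] M[OF wc] C_def wt[OF w(1)]])
           (use h sub w(2) in \<open>auto simp: dbar_eq_def u_def intro: smooth_on_subset\<close>)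
      \<comment> \<open>An interior maximum forces h = 0 on the whole disc, and then any point of
        the circle serves as z1.\<close>
      then have "\<forall>z\<in>cball 0 r. h z = 0" using bound by force
      moreover have "of_real r \<in> sphere (0::complex) r" using r by simp
      ultimately show ?thesis by (intro bexI[of _ "of_real r"]) auto
    qed
  qed
qed

lemma dbar_eq_shift:
  assumes eq: "dbar_eq S X Y g" and T: "open T" "\<And>z. z \<in> T \<Longrightarrow> z + c \<in> S"
  shows "dbar_eq T (\<lambda>z. X (z + c)) (\<lambda>z. Y (z + c)) (\<lambda>z. g (z + c))"
proof -
  have g: "smooth_on S g" using eq by (simp add: dbar_eq_def)
  have "smooth_on T (\<lambda>z. z + c)"
    by (rule smooth_on_add[OF T(1) smooth_on_ident[OF T(1)] smooth_on_const[OF T(1)]])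
  then have "smooth_on T (\<lambda>z. g (z + c))"
    using T(2) by (intro smooth_on_compose[OF T(1) _ _ g]) auto
  moreover have "d_zbar (\<lambda>z. g (z + c)) z = d_zbar g (z + c)" if "z \<in> T" for z
  proof -
    have "((\<lambda>z. z + c) has_field_derivative 1) (at z)" by (auto intro!: derivative_eq_intros)
    from has_wirtinger_d(2)[OF has_wirtinger_compose[OF smooth_on_has_wirtinger[OF g T(2)[OF that]] this]]
    show ?thesis by simp
  qed
  ultimately show ?thesis using eq T(2) by (simp add: dbar_eq_def)
qed

text \<open>If the division never stops, then g = z^N h_N for all N, and comparing h_N with its
  values on the circle of radius r gives |g(z)|^2 \<le> 2 K (|z| / r)^(2 N), which tends to 0. If it
  stops, the last quotient is nonzero at 0, since otherwise it could be divided once more.\<close>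

lemma dbar_eq_zero_0:
  fixes g :: "complex \<Rightarrow> complex^'n"
  assumes R: "R > 0" and X: "smooth_on (ball 0 R) X" and Y: "smooth_on (ball 0 R) Y"
    and eq: "dbar_eq (ball 0 R) X Y g"
  shows "(\<exists>r>0. r \<le> R \<and> (\<forall>z\<in>ball 0 r. g z = 0)) \<or>
    (\<exists>r>0. \<exists>k h. r \<le> R \<and> dbar_eq (ball 0 R) X Y h \<and> (\<forall>z\<in>ball 0 R. g z = z ^ k *s h z) \<and> (\<forall>z\<in>ball 0 r. h z \<noteq> 0))"
proof -
  define Q where "Q = (\<lambda>N h. dbar_eq (ball 0 R) X Y h \<and> (\<forall>z\<in>ball 0 R. g z = z ^ N *s h z))"
  show ?thesis
  proof (cases "\<forall>N. \<exists>h. Q N h")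
    case True
    then obtain h where h: "\<And>N. Q N (h N)" by metis
    obtain r where r: "0 < r" "r < R" "\<And>h. dbar_eq (ball 0 R) X Y h \<Longrightarrow>
      \<exists>z1\<in>sphere 0 r. \<forall>z\<in>cball 0 r. (norm (h z))\<^sup>2 \<le> 2 * (norm (h z1))\<^sup>2"
      using dbar_eq_boundary_bound[OF R X Y] by blast
    have sg: "smooth_on (ball 0 R) g" using eq by (simp add: dbar_eq_def)
    have "continuous_on (sphere 0 r) (\<lambda>z. (norm (g z))\<^sup>2)"
      using r by (intro continuous_intros continuous_on_subset[OF smooth_on_imp_continuous_on[OF sg]]) auto
    then have "bounded ((\<lambda>z. (norm (g z))\<^sup>2) ` sphere 0 r)"
      by (intro compact_imp_bounded compact_continuous_image compact_sphere)
    then obtain K where K: "\<And>z. z \<in> sphere 0 r \<Longrightarrow> (norm (g z))\<^sup>2 \<le> K"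
      unfolding bounded_iff by (metis abs_le_D1 image_eqI real_norm_def)
    have "g z = 0" if z: "z \<in> ball 0 r" for z
    proof -
      define q where "q = (norm z / r)\<^sup>2"
      have q: "0 \<le> q" "q < 1"
        using z r by (auto simp: q_def abs_square_less_1)
      have "(norm (g z))\<^sup>2 \<le> (2 * K) * q ^ N" for N
      proof -
        have e: "dbar_eq (ball 0 R) X Y (h N)" and g: "\<And>z. z \<in> ball 0 R \<Longrightarrow> g z = z ^ N *s h N z"
          using h[of N] by (auto simp: Q_def)
        obtain z1 where z1: "z1 \<in> sphere 0 r" "\<And>z. z \<in> cball 0 r \<Longrightarrow> (norm (h N z))\<^sup>2 \<le> 2 * (norm (h N z1))\<^sup>2"
          using r(3)[OF e] by blast
        have n: "(norm (g z))\<^sup>2 = ((norm z)\<^sup>2) ^ N * (norm (h N z))\<^sup>2" if "z \<in> ball 0 R" for z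
          unfolding g[OF that]
          by (simp add: norm_vector_scalar norm_power power_mult_distrib power_mult[symmetric] mult.commute)
        have "(norm (g z))\<^sup>2 \<le> ((norm z)\<^sup>2) ^ N * (2 * (norm (h N z1))\<^sup>2)"
          using n[of z] z r z1(2)[of z] by (simp add: mult_left_mono)
        also have "\<dots> = 2 * q ^ N * (norm (g z1))\<^sup>2"
          using n[of z1] z1(1) r by (simp add: q_def power_divide)
        also have "\<dots> \<le> 2 * q ^ N * K" using K[OF z1(1)] q by (intro mult_left_mono) auto
        finally show ?thesis by (simp add: mult_ac)
      qed
      moreover have "(\<lambda>N. (2 * K) * q ^ N) \<longlonglongrightarrow> (2 * K) * 0"
        using q by (intro tendsto_mult_left LIMSEQ_realpow_zero)
      ultimately have "(norm (g z))\<^sup>2 \<le> (2 * K) * 0"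
        by (intro LIMSEQ_le_const) auto
      then show ?thesis by simp
    qed
    then show ?thesis using r by (intro disjI1 exI[of _ r]) auto
  next
    case False
    have Q0: "\<exists>h. Q 0 h" using eq by (intro exI[of _ g]) (simp add: Q_def)
    obtain N where "\<exists>h. Q N h" and N: "\<not> (\<exists>h. Q (Suc N) h)"
    proof (rule ccontr)
      assume "\<not> thesis"
      then have step: "(\<exists>h. Q N h) \<Longrightarrow> \<exists>h. Q (Suc N) h" for N using that by blast
      have "\<exists>h. Q N h" for N by (induction N) (use Q0 step in auto)
      then show False using False by blast
    qed
    then obtain h where h: "Q N h" by blast
    have e: "dbar_eq (ball 0 R) X Y h" and g: "\<And>z. z \<in> ball 0 R \<Longrightarrow> g z = z ^ N *s h z"
      using h by (auto simp: Q_def)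
    have "h 0 \<noteq> 0"
    proof
      assume "h 0 = 0"
      from dbar_eq_divide[OF X Y R e this] obtain h' where
        "dbar_eq (ball 0 R) X Y h'" "\<And>z. z \<in> ball 0 R \<Longrightarrow> h z = z *s h' z" by blast
      then have "Q (Suc N) h'" using g by (auto simp: Q_def vec_eq_iff mult_ac)
      then show False using N by blast
    qed
    moreover have "isCont h 0" using e R by (auto simp: dbar_eq_def intro: smooth_on_imp_isCont)
    ultimately obtain d where d: "d > 0" "\<And>z. dist 0 z < d \<Longrightarrow> h z \<noteq> 0"
      using continuous_at_avoid[of 0 h 0] by auto
    show ?thesis
      using e g d R by (intro disjI2 exI[of _ "min d R"]) (auto intro!: exI[of _ N] exI[of _ h])
  qed
qed

text \<open>The cofactor h solves the same equation as g. This is how a frame obtained by division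
  keeps its d_zbar equation at the zero itself.\<close>

lemma dbar_eq_zero:
  fixes g :: "complex \<Rightarrow> complex^'n"
  assumes S: "open S" "w \<in> S" and X: "smooth_on S X" and Y: "smooth_on S Y" and eq: "dbar_eq S X Y g"
  obtains (zero) r where "r > 0" "ball w r \<subseteq> S" "\<And>z. z \<in> ball w r \<Longrightarrow> g z = 0"
    | (order) r k h where "r > 0" "ball w r \<subseteq> S" "dbar_eq (ball w r) X Y h"
      "\<And>z. z \<in> ball w r \<Longrightarrow> g z = (z - w) ^ k *s h z" "\<And>z. z \<in> ball w r \<Longrightarrow> h z \<noteq> 0"
proof -
  obtain R where R: "R > 0" "ball w R \<subseteq> S" using S open_contains_ball by blast
  have s: "z + w \<in> S" if "z \<in> ball 0 R" for z using that R by (auto simp: dist_norm)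
  have sm: "smooth_on (ball 0 R) (\<lambda>z. f (z + w))" if "smooth_on S f" for f :: "complex \<Rightarrow> complex^'n"
    using s smooth_on_add[OF open_ball smooth_on_ident[OF open_ball] smooth_on_const[OF open_ball]]
    by (intro smooth_on_compose[OF open_ball _ _ that]) auto
  have "dbar_eq (ball 0 R) (\<lambda>z. X (z + w)) (\<lambda>z. Y (z + w)) (\<lambda>z. g (z + w))"
    by (rule dbar_eq_shift[OF eq open_ball]) (rule s)
  from dbar_eq_zero_0[OF R(1) sm[OF X] sm[OF Y] this]
  show thesis
  proof (elim disjE exE conjE)
    fix r assume r: "0 < r" "r \<le> R" "\<forall>z\<in>ball 0 r. g (z + w) = 0"
    show thesis
    proof (rule zero[OF r(1)])
      show "ball w r \<subseteq> S" using R r by auto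
      show "g z = 0" if "z \<in> ball w r" for z
        using r(3)[rule_format, of "z - w"] that by (auto simp: dist_norm norm_minus_commute)
    qed
  next
    fix r k h assume r: "0 < r" "r \<le> R" and e: "dbar_eq (ball 0 R) (\<lambda>z. X (z + w)) (\<lambda>z. Y (z + w)) h"
      and g: "\<forall>z\<in>ball 0 R. g (z + w) = z ^ k *s h z" and nz: "\<forall>z\<in>ball 0 r. h z \<noteq> 0"
    have in0: "z - w \<in> ball 0 r" if "z \<in> ball w r" for z
      using that by (auto simp: dist_norm norm_minus_commute)
    show thesis
    proof (rule order[OF r(1)])
      show "ball w r \<subseteq> S" using R r by auto
      have "dbar_eq (ball w r) (\<lambda>z. X (z + - w + w)) (\<lambda>z. Y (z + - w + w)) (\<lambda>z. h (z + - w))"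
        by (rule dbar_eq_shift[OF e open_ball]) (use in0 r in force)
      then show "dbar_eq (ball w r) X Y (\<lambda>z. h (z - w))" by simp
      show "g z = (z - w) ^ k *s h (z - w)" if "z \<in> ball w r" for z
        using g[rule_format, of "z - w"] in0[OF that] r by auto
      show "h (z - w) \<noteq> 0" if "z \<in> ball w r" for z
        using nz in0[OF that] by auto
    qed
  qed
qed

section \<open>Orthogonal projections\<close>

lemma inner_Re_hermitian: "v \<bullet> w = Re (hermitian v (w :: complex^'n))"
  by (simp add: inner_vec_def hermitian_def inner_complex_def)

lemma vec_subspace_imp_subspace: "vec.subspace V \<Longrightarrow> subspace (V :: (complex^'n) set)"
  by (simp add: vec.subspace_def subspace_def scaleR_vector_scalar)

text \<open>The real orthogonal decomposition for the real part of the Hermitian product. Since V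
  contains \<i> w along with w, vanishing real parts imply vanishing products.\<close>

lemma orthogonal_decomposition:
  fixes V :: "(complex^'n) set"
  assumes V: "vec.subspace V"
  obtains y where "y \<in> V" "v - y \<in> orth_compl V"
proof -
  have span: "span V = V" using vec_subspace_imp_subspace[OF V] by (rule span_eq_iff[THEN iffD2])
  obtain y z where yz: "y \<in> span V" "\<And>w. w \<in> span V \<Longrightarrow> orthogonal z w" "v = y + z"
    using orthogonal_subspace_decomp_exists[of V v] by metis
  have "hermitian z w = 0" if w: "w \<in> V" for w
  proof -
    have re: "Re (hermitian z u) = 0" if "u \<in> V" for u
      using yz(2)[of u] that span unfolding orthogonal_def inner_Re_hermitian by simp
    have "\<i> *s w \<in> V" using V w by (simp add: vec.subspace_scale)
    from re[OF this] re[OF w] show ?thesis by (simp add: complex_eq_iff)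
  qed
  then show ?thesis using that[of y] yz(1,3) span by (simp add: orth_compl_def)
qed

lemma orth_proj_eqI:
  assumes V: "vec.subspace V" and w: "w \<in> V" "v - w \<in> orth_compl V"
  shows "orth_proj V v = w"
  unfolding orth_proj_def
proof (rule the_equality)
  fix w' assume w': "w' \<in> V \<and> v - w' \<in> orth_compl V"
  then have d: "w' - w \<in> V" using V w by (simp add: vec.subspace_diff)
  have "hermitian (v - w) (w' - w) = 0" "hermitian (v - w') (w' - w) = 0"
    using w' w d unfolding orth_compl_def by blast+
  moreover have "hermitian ((v - w) - (v - w')) (w' - w) = hermitian (v - w) (w' - w) - hermitian (v - w') (w' - w)"
    by (rule hermitian_linear(3))
  ultimately have "hermitian (w' - w) (w' - w) = 0" by (simp del: hermitian_linear)
  then have "w' - w = 0" by (simp only: hermitian_self_eq_0)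
  then show "w' = w" by simp
qed (use w in simp)

lemma orth_proj:
  assumes "vec.subspace V"
  shows "orth_proj V v \<in> V" "v - orth_proj V v \<in> orth_compl V"
  using orthogonal_decomposition[OF assms, of v] orth_proj_eqI[OF assms] by metis+

lemma subspace_orth_compl: "vec.subspace (orth_compl V)"
  by (auto simp: vec.subspace_def orth_compl_def)

lemma orth_proj_orth_compl:
  assumes V: "vec.subspace V"
  shows "orth_proj (orth_compl V) v = v - orth_proj V v"
proof (rule orth_proj_eqI[OF subspace_orth_compl orth_proj(2)[OF V]])
  show "v - (v - orth_proj V v) \<in> orth_compl (orth_compl V)"
    using orth_proj(1)[OF V, of v] hermitian_zero_commute by (auto simp: orth_compl_def)
qed

lemma orth_compl_orth_compl:
  assumes V: "vec.subspace V"
  shows "orth_compl (orth_compl V) = V"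
proof
  show "V \<subseteq> orth_compl (orth_compl V)" using hermitian_zero_commute by (auto simp: orth_compl_def)
  show "orth_compl (orth_compl V) \<subseteq> V"
  proof
    fix v assume v: "v \<in> orth_compl (orth_compl V)"
    let ?d = "v - orth_proj V v"
    have "hermitian v ?d = 0" using v orth_proj(2)[OF V, of v] unfolding orth_compl_def[of "orth_compl V"] by blast
    moreover have "hermitian ?d (orth_proj V v) = 0"
      using orth_proj[OF V, of v] unfolding orth_compl_def by blast
    then have "hermitian (orth_proj V v) ?d = 0" by (rule hermitian_zero_commute[THEN iffD1])
    moreover have "hermitian ?d ?d = hermitian v ?d - hermitian (orth_proj V v) ?d"
      by (rule hermitian_linear(3))
    ultimately have "hermitian ?d ?d = 0" by simp
    then have "v = orth_proj V v" by (simp only: hermitian_self_eq_0 right_minus_eq)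
    then show "v \<in> V" using orth_proj(1)[OF V, of v] by metis
  qed
qed

lemma orth_proj_ident: "vec.subspace V \<Longrightarrow> v \<in> V \<Longrightarrow> orth_proj V v = v"
  by (rule orth_proj_eqI) (auto simp: orth_compl_def)

lemma orth_proj_zero: "vec.subspace V \<Longrightarrow> v \<in> orth_compl V \<Longrightarrow> orth_proj V v = 0"
  by (rule orth_proj_eqI) (auto simp: vec.subspace_0)

lemma orth_proj_linear:
  assumes V: "vec.subspace V"
  shows "orth_proj V (v + w) = orth_proj V v + orth_proj V w" "orth_proj V (c *s v) = c *s orth_proj V v"
    "orth_proj V (v - w) = orth_proj V v - orth_proj V w"
proof -
  note c = subspace_orth_compl[of V]
  have "v + w - (orth_proj V v + orth_proj V w) \<in> orth_compl V"
    using vec.subspace_add[OF c orth_proj(2)[OF V, of v] orth_proj(2)[OF V, of w]] by (simp add: algebra_simps)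
  then show "orth_proj V (v + w) = orth_proj V v + orth_proj V w"
    using orth_proj(1)[OF V] V by (intro orth_proj_eqI) (auto simp: vec.subspace_add)
  have "v - w - (orth_proj V v - orth_proj V w) \<in> orth_compl V"
    using vec.subspace_diff[OF c orth_proj(2)[OF V, of v] orth_proj(2)[OF V, of w]] by (simp add: algebra_simps)
  then show "orth_proj V (v - w) = orth_proj V v - orth_proj V w"
    using orth_proj(1)[OF V] V by (intro orth_proj_eqI) (auto simp: vec.subspace_diff)
  have "c *s v - c *s orth_proj V v \<in> orth_compl V"
    using vec.subspace_scale[OF c orth_proj(2)[OF V, of v], of c] by (simp add: vector_ssub_ldistrib)
  then show "orth_proj V (c *s v) = c *s orth_proj V v"
    using orth_proj(1)[OF V] V by (intro orth_proj_eqI) (auto simp: vec.subspace_scale)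
qed

lemma proj_matrix_mult: "vec.subspace V \<Longrightarrow> proj_matrix V *v x = orth_proj V x"
  unfolding proj_matrix_def
  by (rule matrix_works) (simp add: Vector_Spaces.linear_iff orth_proj_linear vec.vector_space_axioms)

lemma proj_matrix_eqI:
  assumes "vec.subspace V" "\<And>x. orth_proj V x = A *v x"
  shows "proj_matrix V = A"
  using assms by (simp add: matrix_eq proj_matrix_mult)

lemma subspace_eqI:
  assumes "vec.subspace V" "vec.subspace W" "proj_matrix V = proj_matrix W"
  shows "V = W"
  using assms proj_matrix_mult orth_proj_ident orth_proj(1) by (metis subsetI subset_antisym)

lemma proj_matrix_orth_compl: "vec.subspace V \<Longrightarrow> proj_matrix (orth_compl V) = mat 1 - proj_matrix V"
  by (rule proj_matrix_eqI) (simp_all add: subspace_orth_compl orth_proj_orth_compl proj_matrix_mult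
      matrix_vector_mult_diff_rdistrib)

text \<open>The rank one matrix formed by the column x and the adjoint of y.\<close>

definition outer :: "complex^'n \<Rightarrow> complex^'n \<Rightarrow> complex^'n^'n" where
  "outer x y = (\<chi> i j. x $ i * cnj (y $ j))"

lemma outer_mult: "outer x y *v v = hermitian v y *s x"
  by (simp add: outer_def matrix_vector_mult_def hermitian_def vec_eq_iff sum_distrib_left mult_ac)

lemma bounded_bilinear_outer: "bounded_bilinear (outer :: complex^'n \<Rightarrow> _)"
proof (rule bilinear_conv_bounded_bilinear[THEN iffD1])
  show "bilinear (outer :: complex^'n \<Rightarrow> _)"
    unfolding bilinear_def outer_def
    by (intro conjI allI linearI) (simp_all add: vec_eq_iff algebra_simps)
qed

lemma smooth_on_outer:
  "open S \<Longrightarrow> smooth_on S f \<Longrightarrow> smooth_on S g \<Longrightarrow> smooth_on S (\<lambda>x. outer (f x) (g x))"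
  by (rule smooth_on_bilinear[OF _ _ _ bounded_bilinear_outer])

text \<open>Orthogonal projection onto the line of x, written so that it is visibly smooth in x
  where x is nonzero.\<close>

definition outer_normalized :: "complex^'n \<Rightarrow> complex^'n^'n" where
  "outer_normalized x = outer (inverse (hermitian x x) *s x) x"

lemma smooth_on_outer_normalized:
  assumes "open S" "smooth_on S f" "\<And>x. x \<in> S \<Longrightarrow> f x \<noteq> 0"
  shows "smooth_on S (\<lambda>x. outer_normalized (f x))"
  unfolding outer_normalized_def
  by (rule smooth_on_outer[OF assms(1) smooth_on_vector_scalar[OF assms(1)
        smooth_on_inverse[OF assms(1) smooth_on_hermitian[OF assms(1,2,2)]] assms(2)] assms(2)])
     (use assms(3) in simp)

section \<open>Lines and orthogonal triples\<close>

lemma span_1: "vec.span {L} = {c *s L | c. True}"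
  by (auto simp: vec.span_singleton)

lemma span_3: "vec.span {a, b, c} = {x *s a + y *s b + z *s c | x y z. True}" for a b c :: "complex^'n"
proof -
  have "vec.span {a, b, c} = {v. \<exists>x y z. v - x *s a - y *s b = z *s c}"
    by (auto simp: vec.span_insert vec.span_singleton)
  also have "\<dots> = {x *s a + y *s b + z *s c | x y z. True}"
    by (auto simp: algebra_simps)
  finally show ?thesis .
qed

lemma orth_proj_span_1:
  assumes "L \<noteq> 0"
  shows "orth_proj (vec.span {L}) x = (hermitian x L / hermitian L L) *s L"
  by (rule orth_proj_eqI[OF vec.subspace_span]) (use assms in \<open>auto simp: span_1 orth_compl_def\<close>)

lemma proj_matrix_span_1: "L \<noteq> 0 \<Longrightarrow> proj_matrix (vec.span {L}) = outer_normalized L"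
  by (rule proj_matrix_eqI)
     (simp_all add: orth_proj_span_1 outer_normalized_def outer_mult vec_eq_iff divide_inverse)

lemma orth_compl_span_3:
  "w \<in> orth_compl (vec.span {a, b, c}) \<longleftrightarrow> hermitian w a = 0 \<and> hermitian w b = 0 \<and> hermitian w c = 0"
proof
  assume "w \<in> orth_compl (vec.span {a, b, c})"
  then show "hermitian w a = 0 \<and> hermitian w b = 0 \<and> hermitian w c = 0"
    using vec.span_superset[of "{a, b, c}"] unfolding orth_compl_def by blast
qed (auto simp: orth_compl_def span_3)

lemma orth_proj_span_3:
  assumes "a \<noteq> 0" "b \<noteq> 0" "c \<noteq> 0" "hermitian a b = 0" "hermitian a c = 0" "hermitian b c = 0"
  shows "orth_proj (vec.span {a, b, c}) x = (hermitian x a / hermitian a a) *s a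
    + (hermitian x b / hermitian b b) *s b + (hermitian x c / hermitian c c) *s c"
proof (rule orth_proj_eqI[OF vec.subspace_span])
  have "hermitian b a = 0" "hermitian c a = 0" "hermitian c b = 0" using assms hermitian_zero_commute by blast+
  then show "x - ((hermitian x a / hermitian a a) *s a
    + (hermitian x b / hermitian b b) *s b + (hermitian x c / hermitian c c) *s c) \<in> orth_compl (vec.span {a, b, c})"
    using assms unfolding orth_compl_span_3 by simp
qed (auto simp: span_3)

lemma proj_matrix_span_3:
  assumes "a \<noteq> 0" "b \<noteq> 0" "c \<noteq> 0" "hermitian a b = 0" "hermitian a c = 0" "hermitian b c = 0"
  shows "proj_matrix (vec.span {a, b, c}) = outer_normalized a + outer_normalized b + outer_normalized c"
  by (rule proj_matrix_eqI)
     (simp_all add: orth_proj_span_3[OF assms] outer_normalized_def matrix_vector_mult_add_rdistrib outer_mult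
        vec_eq_iff divide_inverse)

lemma dim_span_1: "L \<noteq> 0 \<Longrightarrow> vec.dim (vec.span {L}) = 1"
  by (simp add: vec.dim_singleton vec.dim_span del: vec.span_insert)

lemma dim_1_span:
  assumes "vec.subspace V" "vec.dim V = 1"
  obtains L where "L \<noteq> 0" "V = vec.span {L}"
proof -
  obtain B where B: "B \<subseteq> V" "vec.independent B" "V \<subseteq> vec.span B" "card B = 1"
    using vec.basis_exists[of V] assms(2) by metis
  then obtain L where L: "B = {L}" by (auto simp: card_1_singleton_iff)
  have "V = vec.span {L}" using B L assms(1) by (metis vec.span_minimal subset_antisym)
  moreover have "L \<noteq> 0" using B(2) L vec.dependent_zero by auto
  ultimately show ?thesis using that by blast
qed

lemma dim_span_3:
  fixes a b c :: "complex^'n"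
  assumes "a \<noteq> 0" "b \<noteq> 0" "c \<noteq> 0" "hermitian a b = 0" "hermitian a c = 0" "hermitian b c = 0"
  shows "vec.dim (vec.span {a, b, c}) = 3"
proof -
  have z: "hermitian b a = 0" "hermitian c a = 0" "hermitian c b = 0" using assms hermitian_zero_commute by blast+
  have ne: "a \<noteq> b" "a \<noteq> c" "b \<noteq> c" using assms by auto
  have "b \<notin> vec.span {c}"
  proof
    assume "b \<in> vec.span {c}"
    then obtain k where "b = k *s c" by (auto simp: span_1)
    then have "hermitian b b = cnj k * hermitian b c" by (metis hermitian_linear(8))
    then show False using assms by simp
  qed
  moreover have "a \<notin> vec.span {b, c}"
  proof
    assume "a \<in> vec.span {b, c}"
    then obtain k l where "a - k *s b = l *s c" by (auto simp: vec.span_insert vec.span_singleton)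
    then have "a = k *s b + l *s c" by (simp add: algebra_simps)
    then have "hermitian a a = cnj k * hermitian a b + cnj l * hermitian a c" by (metis hermitian_linear(2,8))
    then show False using assms by simp
  qed
  ultimately have "vec.independent {a, b, c}"
    using assms ne by (simp add: vec.independent_insert)
  then show ?thesis using ne by (simp add: vec.dim_eq_card_independent vec.dim_span del: vec.span_insert)
qed

lemma dim_orth_compl:
  fixes V :: "(complex^'n) set"
  assumes V: "vec.subspace V"
  shows "vec.dim (orth_compl V) + vec.dim V = CARD('n)"
proof -
  have "{x + y | x y. x \<in> V \<and> y \<in> orth_compl V} = UNIV"
  proof -
    have "v = orth_proj V v + (v - orth_proj V v)" for v by simp
    then show ?thesis using orth_proj[OF V] by blast
  qed
  moreover have "V \<inter> orth_compl V = {0}"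
    using V by (auto simp: orth_compl_def vec.subspace_0)
  ultimately show ?thesis using vec.dim_sums_Int[OF V subspace_orth_compl[of V]]
    by (simp add: card_cart_basis)
qed

section \<open>Complex conjugation of subspaces\<close>

lemma vec_cnj_image_span: "vec_cnj ` vec.span S = vec.span (vec_cnj ` S)"
proof -
  have sub: "vec_cnj ` vec.span S \<subseteq> vec.span (vec_cnj ` S)" for S :: "(complex^'n) set"
  proof
    fix x assume "x \<in> vec_cnj ` vec.span S"
    then obtain y where y: "y \<in> vec.span S" "x = vec_cnj y" by blast
    have "vec_cnj y \<in> vec.span (vec_cnj ` S)" using y(1)
      by (induction rule: vec.span_induct_alt)
         (auto intro: vec.span_zero vec.span_add vec.span_scale vec.span_base)
    then show "x \<in> vec.span (vec_cnj ` S)" using y by simp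
  qed
  have "vec.span (vec_cnj ` S) \<subseteq> vec_cnj ` vec.span S"
  proof
    fix x assume "x \<in> vec.span (vec_cnj ` S)"
    then have "vec_cnj x \<in> vec.span (vec_cnj ` vec_cnj ` S)" using sub[of "vec_cnj ` S"] by blast
    then have "vec_cnj x \<in> vec.span S" by (simp add: image_image)
    then show "x \<in> vec_cnj ` vec.span S" by (metis imageI vec_cnj_simps(1))
  qed
  then show ?thesis using sub[of S] by blast
qed

lemma subspace_vec_cnj: "vec.subspace V \<Longrightarrow> vec.subspace (vec_cnj ` V)"
  using vec_cnj_image_span[of V] vec.subspace_span by (metis vec.span_eq_iff)

lemma orth_compl_vec_cnj: "orth_compl (vec_cnj ` V) = vec_cnj ` orth_compl V"
  for V :: "(complex^'n) set"
proof -
  have "w \<in> orth_compl (vec_cnj ` V) \<longleftrightarrow> vec_cnj w \<in> orth_compl V" for w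
    by (auto simp: orth_compl_def hermitian_vec_cnj'(1))
  moreover have "w \<in> vec_cnj ` W \<longleftrightarrow> vec_cnj w \<in> W" for w and W :: "(complex^'n) set"
    by (auto intro: image_eqI[of w vec_cnj "vec_cnj w"])
  ultimately show ?thesis by blast
qed

lemma orth_proj_vec_cnj:
  assumes V: "vec.subspace V"
  shows "orth_proj (vec_cnj ` V) (vec_cnj x) = vec_cnj (orth_proj V x)"
  using orth_proj[OF V, of x]
  by (intro orth_proj_eqI[OF subspace_vec_cnj[OF V]])
     (auto simp: orth_compl_vec_cnj simp del: vec_cnj_simps(3) simp add: vec_cnj_simps(3)[symmetric])

definition mat_cnj :: "complex^'n^'m \<Rightarrow> complex^'n^'m" where
  "mat_cnj A = (\<chi> i j. cnj (A $ i $ j))"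

lemma bounded_linear_mat_cnj: "bounded_linear (mat_cnj :: complex^'n^'m \<Rightarrow> _)"
  unfolding linear_conv_bounded_linear[symmetric]
  by (rule linearI) (simp_all add: mat_cnj_def vec_eq_iff)

lemma proj_matrix_vec_cnj:
  assumes V: "vec.subspace V"
  shows "proj_matrix (vec_cnj ` V) = mat_cnj (proj_matrix V)"
proof (rule proj_matrix_eqI[OF subspace_vec_cnj[OF V]])
  fix x
  have "mat_cnj A *v x = vec_cnj (A *v vec_cnj x)" for A :: "complex^'a^'a"
    by (simp add: mat_cnj_def vec_cnj_def matrix_vector_mult_def vec_eq_iff)
  then show "orth_proj (vec_cnj ` V) x = mat_cnj (proj_matrix V) *v x"
    using orth_proj_vec_cnj[OF V, of "vec_cnj x"] by (simp add: proj_matrix_mult[OF V])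
qed

lemma bounded_bilinear_matrix_vector_mult:
  "bounded_bilinear (\<lambda>(A :: complex^'n^'m) x. A *v x)"
proof (rule bilinear_conv_bounded_bilinear[THEN iffD1])
  show "bilinear (\<lambda>(A :: complex^'n^'m) x. A *v x)"
    unfolding bilinear_def matrix_vector_mult_def
    by (intro conjI allI linearI)
       (simp_all add: vec_eq_iff algebra_simps sum.distrib scaleR_sum_right)
qed

lemma smooth_on_mult_vector:
  "open S \<Longrightarrow> smooth_on S A \<Longrightarrow> smooth_on S f \<Longrightarrow> smooth_on S (\<lambda>x. (A x :: complex^'n^'m) *v f x)"
  by (rule smooth_on_bilinear[OF _ _ _ bounded_bilinear_matrix_vector_mult])

section \<open>Charts and Gauss bundles\<close>

text \<open>The predicate inside the description \<open>filled_image\<close>, separated so that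
  existence and uniqueness of Gauss bundles can be argued independently.\<close>

definition is_filled ::
    "'a surface \<Rightarrow> ('a \<Rightarrow> (complex^'n) set) \<Rightarrow> ('a chart \<Rightarrow> ('a \<Rightarrow> complex^'n) \<Rightarrow> 'a \<Rightarrow> complex^'n)
      \<Rightarrow> ('a \<Rightarrow> (complex^'n) set) \<Rightarrow> bool" where
  "is_filled M \<phi> A \<psi> \<longleftrightarrow> smooth_subbundle M \<psi> \<and>
     (surf_top M) derived_set_of
        {p \<in> points M. \<exists>c\<in>atlas M. p \<in> fst c \<and> \<psi> p \<noteq> image_at M \<phi> (A c) p} = {}"

text \<open>The image in a plane domain of \<open>A'\<close> (for \<open>D = d_z\<close>) or \<open>A''\<close> (for \<open>D = d_zbar\<close>).\<close>

definition plane_image :: "((complex \<Rightarrow> complex^'n) \<Rightarrow> complex \<Rightarrow> complex^'n) \<Rightarrow>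
    (complex \<Rightarrow> (complex^'n) set) \<Rightarrow> complex \<Rightarrow> (complex^'n) set" where
  "plane_image D \<Phi> w = {orth_proj (orth_compl (\<Phi> w)) (D s w) | s W.
     open W \<and> w \<in> W \<and> smooth_on W s \<and> (\<forall>x\<in>W. s x \<in> \<Phi> x)}"

text \<open>\<open>A'\<close> and \<open>A''\<close> with the differential operator as a parameter,
  so that chart independence and uniqueness are proved once for both.\<close>

definition A_of :: "((complex \<Rightarrow> complex^'n) \<Rightarrow> complex \<Rightarrow> complex^'n) \<Rightarrow>
    ('a \<Rightarrow> (complex^'n) set) \<Rightarrow> 'a chart \<Rightarrow> ('a \<Rightarrow> complex^'n) \<Rightarrow> 'a \<Rightarrow> complex^'n" where
  "A_of D \<phi> c v p = orth_proj (orth_compl (\<phi> p)) (D (in_chart c v) (snd c p))"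

lemma A'_eq: "A' = A_of d_z" and A''_eq: "A'' = A_of d_zbar"
  by (simp_all add: fun_eq_iff A_of_def A'_def A''_def)

definition wirtinger_op :: "((complex \<Rightarrow> complex^'n) \<Rightarrow> complex \<Rightarrow> complex^'n) \<Rightarrow> bool" where
  "wirtinger_op D \<longleftrightarrow> D = d_z \<or> D = d_zbar"

lemma wirtinger_op_cong:
  "wirtinger_op D \<Longrightarrow> open S \<Longrightarrow> w \<in> S \<Longrightarrow> (\<And>z. z \<in> S \<Longrightarrow> f z = g z) \<Longrightarrow> D f w = D g w"
  unfolding wirtinger_op_def using d_cong[of S w f g] by auto

text \<open>A change of coordinate multiplies \<open>d_z\<close> by c and \<open>d_zbar\<close> by
  cnj c. The constant k undoes this, and scaling by it keeps a section inside its fibres.\<close>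

lemma wirtinger_op_compose:
  assumes D: "wirtinger_op D" and h: "(h has_field_derivative c) (at w)" "c \<noteq> 0"
  obtains k where "k \<noteq> 0" "\<And>S s. smooth_on S s \<Longrightarrow> h w \<in> S \<Longrightarrow> D (\<lambda>z. k *s s (h z)) w = D s (h w)"
proof -
  define k where "k = (if D = d_z then inverse c else inverse (cnj c))"
  have "D (\<lambda>z. k *s s (h z)) w = D s (h w)" if "smooth_on S s" "h w \<in> S" for S s
  proof -
    from has_wirtinger_smult[OF has_wirtinger1_const[of k]
        has_wirtinger_compose[OF smooth_on_has_wirtinger[OF that] h(1)]]
    have "has_wirtinger (\<lambda>z. k *s s (h z)) (k *s (c *s d_z s (h w))) (k *s (cnj c *s d_zbar s (h w))) w" by simp
    note d = has_wirtinger_d(1,2)[OF this]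
    show ?thesis
    proof (cases "D = d_z")
      case True
      then show ?thesis using d(1) h(2) by (simp add: k_def vector_smult_assoc)
    next
      case False
      then have "D = d_zbar" using D by (simp add: wirtinger_op_def)
      then show ?thesis using False d(2) h(2) by (simp add: k_def vector_smult_assoc)
    qed
  qed
  moreover have "k \<noteq> 0" using h(2) by (simp add: k_def)
  ultimately show ?thesis by (intro that)
qed

section \<open>Charts and smooth maps on a Riemann surface\<close>

locale rsurface =
  fixes M :: "'a surface"
  assumes RS: "riemann_surface M"
begin

lemma chart:
  assumes "c \<in> atlas M"
  shows "openin (surf_top M) (fst c)" "open (snd c ` fst c)"
    "homeomorphic_map (subtopology (surf_top M) (fst c)) (top_of_set (snd c ` fst c)) (snd c)"
    "fst c \<subseteq> points M" "inj_on (snd c) (fst c)"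
proof -
  show o: "openin (surf_top M) (fst c)" and "open (snd c ` fst c)"
    and h: "homeomorphic_map (subtopology (surf_top M) (fst c)) (top_of_set (snd c ` fst c)) (snd c)"
  proof -
    have "case c of (U, z) \<Rightarrow> openin (surf_top M) U \<and> open (z ` U)
        \<and> homeomorphic_map (subtopology (surf_top M) U) (top_of_set (z ` U)) z"
      using RS assms unfolding riemann_surface_def by blast
    then show "openin (surf_top M) (fst c)" "open (snd c ` fst c)"
      "homeomorphic_map (subtopology (surf_top M) (fst c)) (top_of_set (snd c ` fst c)) (snd c)"
      by (simp_all add: case_prod_beta)
  qed
  show s: "fst c \<subseteq> points M" using o by (rule openin_subset)
  have "topspace (subtopology (surf_top M) (fst c)) = fst c" using s by auto
  then show "inj_on (snd c) (fst c)" using homeomorphic_imp_injective_map[OF h] by simp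
qed

lemma points_nonempty: "points M \<noteq> {}" using RS unfolding riemann_surface_def by blast

lemma ex_chart: "p \<in> points M \<Longrightarrow> \<exists>c\<in>atlas M. p \<in> fst c"
  using RS unfolding riemann_surface_def by auto

lemma chart_open:
  assumes c: "c \<in> atlas M" and U: "openin (surf_top M) U"
  shows "open (snd c ` (U \<inter> fst c))"
proof -
  have "openin (subtopology (surf_top M) (fst c)) (U \<inter> fst c)"
    using U by (auto simp: openin_subtopology)
  then have "openin (top_of_set (snd c ` fst c)) (snd c ` (U \<inter> fst c))"
    using homeomorphic_imp_open_map[OF chart(3)[OF c]] by (simp add: open_map_def)
  then show ?thesis using chart(2)[OF c] openin_open_trans by blast
qed

lemma chart_preimage:
  assumes c: "c \<in> atlas M" and W: "open W"
  shows "openin (surf_top M) {q \<in> fst c. snd c q \<in> W}"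
proof -
  have "continuous_map (subtopology (surf_top M) (fst c)) (top_of_set (snd c ` fst c)) (snd c)"
    by (rule homeomorphic_imp_continuous_map[OF chart(3)[OF c]])
  then have "openin (subtopology (surf_top M) (fst c))
      {q \<in> topspace (subtopology (surf_top M) (fst c)). snd c q \<in> W \<inter> snd c ` fst c}"
    by (rule openin_continuous_map_preimage) (use W in \<open>auto simp: openin_open\<close>)
  moreover have "{q \<in> topspace (subtopology (surf_top M) (fst c)). snd c q \<in> W \<inter> snd c ` fst c} = {q \<in> fst c. snd c q \<in> W}"
    using chart(4)[OF c] by auto
  ultimately show ?thesis using chart(1)[OF c] by (metis openin_trans_full)
qed

definition pt :: "'a chart \<Rightarrow> complex \<Rightarrow> 'a" where "pt c = inv_into (fst c) (snd c)"

lemma in_chart_pt: "in_chart c s w = s (pt c w)"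
  by (simp add: in_chart_def pt_def)

lemma pt_chart [simp]: "c \<in> atlas M \<Longrightarrow> p \<in> fst c \<Longrightarrow> pt c (snd c p) = p"
  unfolding pt_def by (rule inv_into_f_f[OF chart(5)])

lemma chart_pt: "w \<in> snd c ` fst c \<Longrightarrow> snd c (pt c w) = w \<and> pt c w \<in> fst c"
  unfolding pt_def by (simp add: f_inv_into_f inv_into_into)

lemma in_chart_at [simp]: "c \<in> atlas M \<Longrightarrow> p \<in> fst c \<Longrightarrow> in_chart c s (snd c p) = s p"
  by (simp add: in_chart_pt)

text \<open>Neighbourhoods are kept in the coordinate plane, where derivatives and the division of
  zeros take place; \<open>nbd_set\<close> gives the corresponding open set of the surface.\<close>

definition nbd :: "'a chart \<Rightarrow> 'a \<Rightarrow> complex set \<Rightarrow> bool" where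
  "nbd c p B \<longleftrightarrow> c \<in> atlas M \<and> p \<in> fst c \<and> open B \<and> snd c p \<in> B \<and> B \<subseteq> snd c ` fst c"

lemma nbdD:
  assumes "nbd c p B"
  shows "c \<in> atlas M" "p \<in> fst c" "open B" "snd c p \<in> B" "B \<subseteq> snd c ` fst c" "p \<in> points M" "pt c (snd c p) = p"
    "w \<in> B \<Longrightarrow> pt c w \<in> fst c" "w \<in> B \<Longrightarrow> snd c (pt c w) = w" "w \<in> B \<Longrightarrow> pt c w \<in> points M"
proof -
  show 1: "c \<in> atlas M" "p \<in> fst c" "open B" "snd c p \<in> B" "B \<subseteq> snd c ` fst c" using assms by (auto simp: nbd_def)
  show "p \<in> points M" using 1 chart(4)[of c] by blast
  show "pt c (snd c p) = p" using 1 by simp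
  show "pt c w \<in> fst c" "snd c (pt c w) = w" "pt c w \<in> points M" if "w \<in> B"
    using chart_pt[of w c] 1 that chart(4)[of c] by auto
qed

lemma nbd_subset: "nbd c p B \<Longrightarrow> open B' \<Longrightarrow> snd c p \<in> B' \<Longrightarrow> B' \<subseteq> B \<Longrightarrow> nbd c p B'"
  by (auto simp: nbd_def)

lemma nbd_chart: "c \<in> atlas M \<Longrightarrow> p \<in> fst c \<Longrightarrow> nbd c p (snd c ` fst c)"
  using chart(2) by (auto simp: nbd_def)

lemma nbd_exists: "p \<in> points M \<Longrightarrow> \<exists>c. nbd c p (snd c ` fst c)"
  using ex_chart nbd_chart by blast

definition nbd_set :: "'a chart \<Rightarrow> complex set \<Rightarrow> 'a set" where
  "nbd_set c B = {q \<in> fst c. snd c q \<in> B}"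

lemma nbd_set:
  assumes "nbd c p B"
  shows "openin (surf_top M) (nbd_set c B)" "p \<in> nbd_set c B" "nbd_set c B \<subseteq> points M"
    "nbd_set c B \<subseteq> fst c" "snd c ` nbd_set c B = B"
    "q \<in> nbd_set c B \<Longrightarrow> snd c q \<in> B \<and> pt c (snd c q) = q \<and> (snd c q = snd c p \<longleftrightarrow> q = p)"
proof -
  note n = nbdD[OF assms]
  show "openin (surf_top M) (nbd_set c B)" unfolding nbd_set_def by (rule chart_preimage[OF n(1,3)])
  show "p \<in> nbd_set c B" "nbd_set c B \<subseteq> points M" "nbd_set c B \<subseteq> fst c" "snd c ` nbd_set c B = B"
    using n chart(4)[OF n(1)] by (auto simp: nbd_set_def)
  show "snd c q \<in> B \<and> pt c (snd c q) = q \<and> (snd c q = snd c p \<longleftrightarrow> q = p)" if "q \<in> nbd_set c B"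
    using that n chart(5)[OF n(1)] by (auto simp: nbd_set_def inj_on_def)
qed

lemma nbd_inter:
  assumes "nbd c p B" "openin (surf_top M) T" "p \<in> T"
  shows "nbd c p (B \<inter> snd c ` (T \<inter> fst c))" "w \<in> B \<inter> snd c ` (T \<inter> fst c) \<Longrightarrow> pt c w \<in> T"
  using nbdD[OF assms(1)] assms(3) chart_open[OF nbdD(1)[OF assms(1)] assms(2)]
  by (auto simp: nbd_def)

lemma transition:
  assumes c: "c \<in> atlas M" "c' \<in> atlas M"
  shows "in_chart c' (snd c) holomorphic_on snd c' ` (fst c' \<inter> fst c)"
    "open (snd c' ` (fst c' \<inter> fst c))"
proof -
  show "in_chart c' (snd c) holomorphic_on snd c' ` (fst c' \<inter> fst c)"
  proof -
    have "case c' of (U, z) \<Rightarrow> case c of (V, w) \<Rightarrow> in_chart (U, z) w holomorphic_on z ` (U \<inter> V)"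
      using RS c unfolding riemann_surface_def by blast
    then show ?thesis by (simp add: case_prod_beta)
  qed
  show "open (snd c' ` (fst c' \<inter> fst c))"
    using chart_open[OF c(2) chart(1)[OF c(1)]] by (simp add: Int_commute)
qed

text \<open>The opposite transition is an inverse, so the product of the two derivatives is
  1.\<close>

lemma transition_deriv:
  assumes c: "c \<in> atlas M" "c' \<in> atlas M" and p: "p \<in> fst c" "p \<in> fst c'"
  obtains k where "k \<noteq> 0" "(in_chart c' (snd c) has_field_derivative k) (at (snd c' p))"
proof -
  let ?h = "in_chart c' (snd c)" and ?g = "in_chart c (snd c')"
  have w: "snd c' p \<in> snd c' ` (fst c' \<inter> fst c)" "snd c p \<in> snd c ` (fst c \<inter> fst c')" using p by auto
  have h: "(?h has_field_derivative deriv ?h (snd c' p)) (at (snd c' p))"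
    by (rule holomorphic_derivI[OF transition[OF c] w(1)])
  have g: "(?g has_field_derivative deriv ?g (snd c p)) (at (?h (snd c' p)))"
    using holomorphic_derivI[OF transition[OF c(2,1)] w(2)] c p by simp
  have "((\<lambda>z. z) has_field_derivative deriv ?g (snd c p) * deriv ?h (snd c' p)) (at (snd c' p))"
    using DERIV_chain[OF g h]
  proof (rule has_field_derivative_transform_within_open[OF _ transition(2)[OF c] w(1)])
    fix z assume "z \<in> snd c' ` (fst c' \<inter> fst c)"
    then show "(?g \<circ> ?h) z = z" using c by (auto simp: in_chart_pt)
  qed
  then have "deriv ?g (snd c p) * deriv ?h (snd c' p) = 1" using DERIV_unique DERIV_ident by blast
  then have "deriv ?h (snd c' p) \<noteq> 0" by auto
  then show ?thesis using that h by blast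
qed

text \<open>Smoothness in one chart suffices, because transition maps are holomorphic.\<close>

lemma smooth_map_on_chart:
  assumes c: "c \<in> atlas M" and U: "openin (surf_top M) U" "U \<subseteq> fst c" and s: "smooth_on (snd c ` U) (in_chart c s)"
  shows "smooth_map_on M U s"
  unfolding smooth_map_on_def
proof
  fix c' assume c': "c' \<in> atlas M"
  let ?S = "snd c' ` (U \<inter> fst c')" and ?h = "in_chart c' (snd c)"
  have S: "open ?S" by (rule chart_open[OF c' U(1)])
  have "?S \<subseteq> snd c' ` (fst c' \<inter> fst c)" using U by auto
  then have h: "smooth_on ?S ?h"
    by (intro smooth_on_holomorphic S holomorphic_on_subset[OF transition(1)[OF c c']])
  have "smooth_on ?S (\<lambda>z. in_chart c s (?h z))"
    by (rule smooth_on_compose[OF S _ h s]) (use c' in \<open>auto simp: in_chart_pt\<close>)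
  then show "smooth_on ?S (in_chart c' s)"
    by (rule smooth_on_cong[OF S]) (use c c' U in \<open>auto simp: in_chart_pt subset_iff\<close>)
qed

lemma smooth_map_on_local:
  assumes U: "\<And>p. p \<in> U \<Longrightarrow> \<exists>U'. openin (surf_top M) U' \<and> p \<in> U' \<and> smooth_map_on M U' s"
  shows "smooth_map_on M U s"
  unfolding smooth_map_on_def
proof
  fix c assume c: "c \<in> atlas M"
  show "smooth_on (snd c ` (U \<inter> fst c)) (in_chart c s)"
  proof (rule smooth_on_local)
    fix x assume "x \<in> snd c ` (U \<inter> fst c)"
    then obtain p where p: "p \<in> U" "p \<in> fst c" "x = snd c p" by auto
    then obtain U' where "openin (surf_top M) U'" "p \<in> U'" "smooth_map_on M U' s" using U by blast
    then show "\<exists>T. open T \<and> x \<in> T \<and> smooth_on T (in_chart c s)"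
      using p c chart_open[OF c, of U'] by (intro exI[of _ "snd c ` (U' \<inter> fst c)"]) (auto simp: smooth_map_on_def)
  qed
qed

lemma smooth_map_on_nbd:
  assumes "nbd c p B" "smooth_on B (in_chart c s)"
  shows "smooth_map_on M (nbd_set c B) s"
  by (rule smooth_map_on_chart[OF nbdD(1)[OF assms(1)]]) (use nbd_set[OF assms(1)] assms(2) in auto)

lemma smooth_map_on_points:
  assumes "\<And>p. p \<in> points M \<Longrightarrow> \<exists>c B. nbd c p B \<and> smooth_on B (in_chart c s)"
  shows "smooth_map_on M (points M) s"
proof (rule smooth_map_on_local)
  fix p assume "p \<in> points M"
  then obtain c B where n: "nbd c p B" and s: "smooth_on B (in_chart c s)" using assms by blast
  show "\<exists>U'. openin (surf_top M) U' \<and> p \<in> U' \<and> smooth_map_on M U' s"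
    by (intro exI[of _ "nbd_set c B"] conjI nbd_set(1,2)[OF n] smooth_map_on_nbd[OF n s])
qed

lemma smooth_map_on_in_chart:
  "smooth_map_on M (points M) s \<Longrightarrow> c \<in> atlas M \<Longrightarrow> smooth_on (snd c ` fst c) (in_chart c s)"
  unfolding smooth_map_on_def using chart(4)[of c] by (metis inf.absorb_iff2)

section \<open>Gauss bundles: uniqueness and independence of the chart\<close>

lemma smooth_map_on_limit:
  fixes f g :: "'a \<Rightarrow> 'b::real_normed_vector"
  assumes f: "smooth_map_on M U f" and g: "smooth_map_on M U g" and U: "openin (surf_top M) U" "p \<in> U"
    and T: "openin (surf_top M) T" "p \<in> T" "\<And>q. q \<in> T \<Longrightarrow> q \<noteq> p \<Longrightarrow> f q = g q"
  shows "f p = g p"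
proof -
  have "p \<in> points M" using U openin_subset by blast
  then obtain c where c: "c \<in> atlas M" "p \<in> fst c" using ex_chart by blast
  let ?S = "snd c ` (T \<inter> fst c)" and ?U = "snd c ` (U \<inter> fst c)"
  have "in_chart c f (snd c p) = in_chart c g (snd c p)"
  proof (rule continuous_on_punctured_eq[OF chart_open[OF c(1) T(1)]])
    show "snd c p \<in> ?S" using c T by auto
    show "isCont (in_chart c f) (snd c p)" "isCont (in_chart c g) (snd c p)"
      using f g c U unfolding smooth_map_on_def by (auto intro!: smooth_on_imp_isCont[of ?U])
    fix z assume z: "z \<in> ?S" "z \<noteq> snd c p"
    then obtain q where q: "q \<in> T" "q \<in> fst c" "z = snd c q" by auto
    then have "q \<noteq> p" using z by auto
    then show "in_chart c f z = in_chart c g z" using T(3) q c by simp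
  qed
  then show ?thesis using c by simp
qed

text \<open>Having no accumulation point is more than consisting of isolated points: around every
  point of M, exceptional or not, all other nearby points are regular.\<close>

lemma derived_empty_iff:
  "(surf_top M) derived_set_of D = {} \<longleftrightarrow>
    (\<forall>p\<in>points M. \<exists>T. openin (surf_top M) T \<and> p \<in> T \<and> (\<forall>q\<in>T. q \<noteq> p \<longrightarrow> q \<notin> D))"
proof -
  have "(surf_top M) derived_set_of D = {} \<longleftrightarrow>
      (\<forall>p\<in>points M. \<not> (\<forall>T. p \<in> T \<and> openin (surf_top M) T \<longrightarrow> (\<exists>y. y \<noteq> p \<and> y \<in> D \<and> y \<in> T)))"
    by (simp add: derived_set_of_def Ball_def)
  also have "\<dots> \<longleftrightarrow> (\<forall>p\<in>points M. \<exists>T. openin (surf_top M) T \<and> p \<in> T \<and> (\<forall>q\<in>T. q \<noteq> p \<longrightarrow> q \<notin> D))"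
    by (intro ball_cong refl) blast
  finally show ?thesis .
qed

lemma is_filled_nbd:
  assumes "is_filled M \<phi> A \<psi>" "p \<in> points M"
  obtains T where "openin (surf_top M) T" "p \<in> T"
    "\<And>q c. q \<in> T \<Longrightarrow> q \<noteq> p \<Longrightarrow> c \<in> atlas M \<Longrightarrow> q \<in> fst c \<Longrightarrow> \<psi> q = image_at M \<phi> (A c) q"
proof -
  obtain T where T: "openin (surf_top M) T" "p \<in> T"
      "\<And>q. q \<in> T \<Longrightarrow> q \<noteq> p \<Longrightarrow> q \<notin> {p \<in> points M. \<exists>c\<in>atlas M. p \<in> fst c \<and> \<psi> p \<noteq> image_at M \<phi> (A c) p}"
    using assms unfolding is_filled_def derived_empty_iff by meson
  have "\<psi> q = image_at M \<phi> (A c) q" if "q \<in> T" "q \<noteq> p" "c \<in> atlas M" "q \<in> fst c" for q c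
    using T(3)[OF that(1,2)] that chart(4)[OF that(3)] by auto
  with T(1,2) show ?thesis by (rule that)
qed

text \<open>Near p both bundles equal the image except perhaps at p itself, where the continuous
  projection matrices decide.\<close>

lemma is_filled_unique:
  assumes "is_filled M \<phi> A \<psi>" "is_filled M \<phi> A \<psi>'"
  shows "\<psi> = \<psi>'"
proof (rule extensionalityI)
  have s: "smooth_subbundle M \<psi>" "smooth_subbundle M \<psi>'" using assms by (auto simp: is_filled_def)
  then show "\<psi> \<in> extensional (points M)" "\<psi>' \<in> extensional (points M)" by (auto simp: smooth_subbundle_def)
  fix p assume p: "p \<in> points M"
  obtain T where T: "openin (surf_top M) T" "p \<in> T"
      "\<And>q c. q \<in> T \<Longrightarrow> q \<noteq> p \<Longrightarrow> c \<in> atlas M \<Longrightarrow> q \<in> fst c \<Longrightarrow> \<psi> q = image_at M \<phi> (A c) q"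
    by (rule is_filled_nbd[OF assms(1) p]) blast
  obtain T' where T': "openin (surf_top M) T'" "p \<in> T'"
      "\<And>q c. q \<in> T' \<Longrightarrow> q \<noteq> p \<Longrightarrow> c \<in> atlas M \<Longrightarrow> q \<in> fst c \<Longrightarrow> \<psi>' q = image_at M \<phi> (A c) q"
    by (rule is_filled_nbd[OF assms(2) p]) blast
  have "proj_matrix (\<psi> p) = proj_matrix (\<psi>' p)"
  proof (rule smooth_map_on_limit[where U = "points M" and T = "T \<inter> T'"])
    fix q assume q: "q \<in> T \<inter> T'" "q \<noteq> p"
    then obtain c where "c \<in> atlas M" "q \<in> fst c" using T(1) openin_subset ex_chart by blast
    then show "proj_matrix (\<psi> q) = proj_matrix (\<psi>' q)" using T(3) T'(3) q by auto
  qed (use s p T T' in \<open>auto simp: smooth_subbundle_def\<close>)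
  then show "\<psi> p = \<psi>' p" using s p by (intro subspace_eqI) (auto simp: smooth_subbundle_def)
qed

lemma filled_image_eq: "is_filled M \<phi> A \<psi> \<Longrightarrow> filled_image M \<phi> A = \<psi>"
  unfolding filled_image_def is_filled_def[symmetric]
  by (rule the_equality) (auto intro: is_filled_unique)

lemma image_at_plane:
  assumes D: "wirtinger_op D" and c: "c \<in> atlas M" "p \<in> fst c"
  shows "image_at M \<phi> (A_of D \<phi> c) p = plane_image D (in_chart c \<phi>) (snd c p)"
proof
  show "image_at M \<phi> (A_of D \<phi> c) p \<subseteq> plane_image D (in_chart c \<phi>) (snd c p)"
  proof
    fix x assume "x \<in> image_at M \<phi> (A_of D \<phi> c) p"
    then obtain U v where U: "p \<in> U" "smooth_section M \<phi> U v" and x: "x = A_of D \<phi> c v p"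
      by (auto simp: image_at_def)
    let ?W = "snd c ` (U \<inter> fst c)"
    have "open ?W" "smooth_on ?W (in_chart c v)" "snd c p \<in> ?W" "\<forall>y\<in>?W. in_chart c v y \<in> in_chart c \<phi> y"
      using U c chart_open[OF c(1)] by (auto simp: smooth_section_def smooth_map_on_def)
    moreover have "x = orth_proj (orth_compl (in_chart c \<phi> (snd c p))) (D (in_chart c v) (snd c p))"
      using x c by (simp add: A_of_def)
    ultimately show "x \<in> plane_image D (in_chart c \<phi>) (snd c p)"
      unfolding plane_image_def by blast
  qed
  show "plane_image D (in_chart c \<phi>) (snd c p) \<subseteq> image_at M \<phi> (A_of D \<phi> c) p"
  proof
    fix x assume "x \<in> plane_image D (in_chart c \<phi>) (snd c p)"
    then obtain s W where W: "open W" "snd c p \<in> W" "smooth_on W s" "\<forall>x\<in>W. s x \<in> in_chart c \<phi> x"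
      and x: "x = orth_proj (orth_compl (in_chart c \<phi> (snd c p))) (D s (snd c p))"
      unfolding plane_image_def by blast
    let ?B = "W \<inter> snd c ` fst c"
    have n: "nbd c p ?B" using c W chart(2)[OF c(1)] by (auto simp: nbd_def)
    define v where "v = (\<lambda>q. s (snd c q))"
    have v: "in_chart c v z = s z" if "z \<in> ?B" for z
      using nbdD(9)[OF n that] by (simp add: v_def in_chart_pt)
    have "smooth_on ?B (in_chart c v)"
      by (rule smooth_on_cong[OF nbdD(3)[OF n] smooth_on_subset[OF W(3)]]) (auto simp: v)
    then have "smooth_map_on M (nbd_set c ?B) v" by (rule smooth_map_on_nbd[OF n])
    moreover have "v q \<in> \<phi> q" if q: "q \<in> nbd_set c ?B" for q
      using W(4) nbd_set(6)[OF n q] by (auto simp: v_def in_chart_pt)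
    ultimately have "smooth_section M \<phi> (nbd_set c ?B) v"
      using nbd_set(1)[OF n] by (simp add: smooth_section_def)
    moreover have "x = A_of D \<phi> c v p"
      using x wirtinger_op_cong[OF D nbdD(3)[OF n] nbdD(4)[OF n] v] c by (simp add: A_of_def)
    ultimately show "x \<in> image_at M \<phi> (A_of D \<phi> c) p"
      using nbd_set(2)[OF n] unfolding image_at_def by blast
  qed
qed

text \<open>A section is moved by the holomorphic transition and rescaled by the constant of
  \<open>wirtinger_op_compose\<close>; it then yields the same vector in the new chart.\<close>

lemma plane_image_transition:
  assumes D: "wirtinger_op D" and c: "c \<in> atlas M" "p \<in> fst c" and c': "c' \<in> atlas M" "p \<in> fst c'"
    and sub: "\<And>q. q \<in> points M \<Longrightarrow> vec.subspace (\<phi> q)"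
  shows "plane_image D (in_chart c \<phi>) (snd c p) \<subseteq> plane_image D (in_chart c' \<phi>) (snd c' p)"
proof
  fix x assume "x \<in> plane_image D (in_chart c \<phi>) (snd c p)"
  then obtain s W where W: "open W" "snd c p \<in> W" "smooth_on W s" "\<And>x. x \<in> W \<Longrightarrow> s x \<in> in_chart c \<phi> x"
    and x: "x = orth_proj (orth_compl (\<phi> p)) (D s (snd c p))"
    using c unfolding plane_image_def by auto
  let ?h = "in_chart c' (snd c)"
  obtain k where k: "k \<noteq> 0" "(?h has_field_derivative k) (at (snd c' p))"
    using transition_deriv[OF c(1) c'(1) c(2) c'(2)] by blast
  obtain l where l: "l \<noteq> 0" "\<And>S s. smooth_on S s \<Longrightarrow> ?h (snd c' p) \<in> S \<Longrightarrow>
      D (\<lambda>z. l *s s (?h z)) (snd c' p) = D s (?h (snd c' p))"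
    using wirtinger_op_compose[OF D k(2,1)] by blast
  let ?U = "{q \<in> fst c. snd c q \<in> W}"
  let ?S = "snd c' ` (?U \<inter> fst c')"
  have S: "open ?S" by (rule chart_open[OF c'(1) chart_preimage[OF c(1) W(1)]])
  have h: "smooth_on ?S ?h"
    by (rule smooth_on_holomorphic[OF S]) (rule holomorphic_on_subset[OF transition(1)[OF c(1) c'(1)]], auto)
  have "smooth_on ?S (\<lambda>z. s (?h z))"
    by (rule smooth_on_compose[OF S _ h W(3)]) (use c' in \<open>auto simp: in_chart_pt\<close>)
  then have "smooth_on ?S (\<lambda>z. l *s s (?h z))"
    by (rule smooth_on_linear[OF S _ bounded_linear_vector_scalar_right])
  moreover have "l *s s (?h z) \<in> in_chart c' \<phi> z" if z: "z \<in> ?S" for z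
  proof -
    obtain q where q: "q \<in> fst c" "snd c q \<in> W" "q \<in> fst c'" "z = snd c' q" using z by auto
    then have "s (snd c q) \<in> \<phi> q" using W(4)[of "snd c q"] c by simp
    then show ?thesis using q c c' chart(4)[OF c(1)] sub[of q] by (auto intro!: vec.subspace_scale)
  qed
  moreover have "snd c' p \<in> ?S" using c c' W by auto
  moreover have "x = orth_proj (orth_compl (in_chart c' \<phi> (snd c' p))) (D (\<lambda>z. l *s s (?h z)) (snd c' p))"
    using l(2)[OF W(3)] x c c' W(2) by simp
  ultimately show "x \<in> plane_image D (in_chart c' \<phi>) (snd c' p)"
    using S unfolding plane_image_def by blast
qed

lemma plane_image_chart_indep:
  assumes "wirtinger_op D" "c \<in> atlas M" "p \<in> fst c" "c' \<in> atlas M" "p \<in> fst c'"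
    "\<And>q. q \<in> points M \<Longrightarrow> vec.subspace (\<phi> q)"
  shows "plane_image D (in_chart c \<phi>) (snd c p) = plane_image D (in_chart c' \<phi>) (snd c' p)"
  using plane_image_transition[OF assms(1-5)] plane_image_transition[OF assms(1,4,5,2,3)] assms(6) by blast

text \<open>For bundles of subspaces the chosen chart is immaterial, by
  \<open>plane_image_chart_indep\<close>.\<close>

definition bundle_image :: "((complex \<Rightarrow> complex^'n) \<Rightarrow> complex \<Rightarrow> complex^'n) \<Rightarrow>
    ('a \<Rightarrow> (complex^'n) set) \<Rightarrow> 'a \<Rightarrow> (complex^'n) set" where
  "bundle_image D \<phi> p = (let c = (SOME c. c \<in> atlas M \<and> p \<in> fst c) in plane_image D (in_chart c \<phi>) (snd c p))"

lemma bundle_image_eq: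
  assumes D: "wirtinger_op D" and c: "c \<in> atlas M" "p \<in> fst c" and sub: "\<And>q. q \<in> points M \<Longrightarrow> vec.subspace (\<phi> q)"
  shows "bundle_image D \<phi> p = plane_image D (in_chart c \<phi>) (snd c p)"
    "image_at M \<phi> (A_of D \<phi> c) p = bundle_image D \<phi> p"
proof -
  have "(SOME c. c \<in> atlas M \<and> p \<in> fst c) \<in> atlas M \<and> p \<in> fst (SOME c. c \<in> atlas M \<and> p \<in> fst c)"
    by (rule someI[of _ c]) (use c in auto)
  then show "bundle_image D \<phi> p = plane_image D (in_chart c \<phi>) (snd c p)"
    unfolding bundle_image_def Let_def by (intro plane_image_chart_indep[OF D _ _ c] sub) auto
  then show "image_at M \<phi> (A_of D \<phi> c) p = bundle_image D \<phi> p"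
    using image_at_plane[OF D c] by simp
qed

lemma bundle_image_nbd:
  assumes D: "wirtinger_op D" and n: "nbd c p B" and w: "w \<in> B" and sub: "\<And>q. q \<in> points M \<Longrightarrow> vec.subspace (\<phi> q)"
  shows "bundle_image D \<phi> (pt c w) = plane_image D (in_chart c \<phi>) w"
  using bundle_image_eq(1)[OF D nbdD(1)[OF n] nbdD(8)[OF n w] sub] nbdD(9)[OF n w] by simp

lemma is_filled_iff:
  assumes D: "wirtinger_op D" and sub: "\<And>q. q \<in> points M \<Longrightarrow> vec.subspace (\<phi> q)"
  shows "is_filled M \<phi> (A_of D \<phi>) \<psi> \<longleftrightarrow> smooth_subbundle M \<psi> \<and>
    (\<forall>p\<in>points M. \<exists>T. openin (surf_top M) T \<and> p \<in> T \<and> (\<forall>q\<in>T. q \<noteq> p \<longrightarrow> \<psi> q = bundle_image D \<phi> q))"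
proof -
  have "(\<exists>c\<in>atlas M. p \<in> fst c \<and> \<psi> p \<noteq> image_at M \<phi> (A_of D \<phi> c) p) \<longleftrightarrow> \<psi> p \<noteq> bundle_image D \<phi> p"
    if p: "p \<in> points M" for p
    using bundle_image_eq(2)[where \<phi> = \<phi>, OF D _ _ sub] ex_chart[OF p] by auto
  then have 1: "{p \<in> points M. \<exists>c\<in>atlas M. p \<in> fst c \<and> \<psi> p \<noteq> image_at M \<phi> (A_of D \<phi> c) p}
     = {p \<in> points M. \<psi> p \<noteq> bundle_image D \<phi> p}" by auto
  have "(\<forall>q\<in>T. q \<noteq> p \<longrightarrow> q \<notin> {p \<in> points M. \<psi> p \<noteq> bundle_image D \<phi> p}) \<longleftrightarrow>
     (\<forall>q\<in>T. q \<noteq> p \<longrightarrow> \<psi> q = bundle_image D \<phi> q)" if "openin (surf_top M) T" for T p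
    using openin_subset[OF that] by auto
  then show ?thesis unfolding is_filled_def 1 derived_empty_iff by (simp cong: conj_cong)
qed

section \<open>Line subbundles and the use of connectedness\<close>

lemma smooth_subbundleI:
  assumes "\<psi> \<in> extensional (points M)" "\<And>p. p \<in> points M \<Longrightarrow> vec.subspace (\<psi> p)"
    "\<And>p. p \<in> points M \<Longrightarrow> \<exists>c B. nbd c p B \<and> smooth_on B (\<lambda>w. proj_matrix (in_chart c \<psi> w))"
  shows "smooth_subbundle M \<psi>"
  unfolding smooth_subbundle_def using assms
  by (auto intro!: smooth_map_on_points simp: in_chart_def o_def)

lemma smooth_subbundle_in_chart:
  "smooth_subbundle M \<psi> \<Longrightarrow> nbd c p B \<Longrightarrow> smooth_on B (\<lambda>w. proj_matrix (in_chart c \<psi> w))"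
  using smooth_map_on_in_chart[of "\<lambda>p. proj_matrix (\<psi> p)" c] nbdD(1,5)[of c p B] smooth_on_subset
  unfolding smooth_subbundle_def by (auto simp: in_chart_def o_def)

text \<open>Where the image drops to zero the fibre is supplied by the local spanning section, which
  also gives smoothness; elsewhere the fibre is the image, so the local choices fit together.
  \<open>R\<close> carries further properties of the local sections along to the result.\<close>

lemma line_fill:
  fixes I :: "'a \<Rightarrow> (complex^'n) set"
  assumes "\<And>p. p \<in> points M \<Longrightarrow> \<exists>c B L. nbd c p B \<and> smooth_on B L \<and> (\<forall>w\<in>B. L w \<noteq> 0) \<and>
      (\<forall>w\<in>B. w \<noteq> snd c p \<longrightarrow> I (pt c w) = vec.span {L w}) \<and> (I p = vec.span {L (snd c p)} \<or> I p = {0}) \<and> R c B L"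
  shows "\<exists>\<psi>. smooth_subbundle M \<psi> \<and> (\<forall>p\<in>points M. \<exists>c B L. nbd c p B \<and> smooth_on B L \<and> (\<forall>w\<in>B. L w \<noteq> 0) \<and>
      R c B L \<and> (\<forall>w\<in>B. in_chart c \<psi> w = vec.span {L w}) \<and> (\<forall>w\<in>B. w \<noteq> snd c p \<longrightarrow> I (pt c w) = vec.span {L w})) \<and>
      (\<forall>p\<in>points M. I p \<noteq> {0} \<longrightarrow> \<psi> p = I p)"
proof -
  define Q where "Q = (\<lambda>p c B L. nbd c p B \<and> smooth_on B L \<and> (\<forall>w\<in>B. L w \<noteq> 0) \<and>
      (\<forall>w\<in>B. w \<noteq> snd c p \<longrightarrow> I (pt c w) = vec.span {L w}) \<and> (I p = vec.span {L (snd c p)} \<or> I p = {0}) \<and> R c B L)"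
  have "\<And>p. p \<in> points M \<Longrightarrow> \<exists>c B L. Q p c B L" unfolding Q_def by (rule assms)
  then obtain c B L where "\<And>p. p \<in> points M \<Longrightarrow> Q p (c p) (B p) (L p)" by metis
  then have cBL: "\<And>p. p \<in> points M \<Longrightarrow> nbd (c p) p (B p) \<and> smooth_on (B p) (L p) \<and> (\<forall>w\<in>B p. L p w \<noteq> 0) \<and>
      (\<forall>w\<in>B p. w \<noteq> snd (c p) p \<longrightarrow> I (pt (c p) w) = vec.span {L p w}) \<and>
      (I p = vec.span {L p (snd (c p) p)} \<or> I p = {0}) \<and> R (c p) (B p) (L p)"
    unfolding Q_def .
  define \<psi> where "\<psi> = (\<lambda>p\<in>points M. if I p = {0} then vec.span {L p (snd (c p) p)} else I p)"
  have ne: "vec.span {v} \<noteq> {0}" if "v \<noteq> 0" for v :: "complex^'n"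
    using that vec.span_base[of v "{v}"] by auto
  have \<psi>: "in_chart (c p) \<psi> w = vec.span {L p w}" if p: "p \<in> points M" and w: "w \<in> B p" for p w
  proof -
    have n: "nbd (c p) p (B p)" using cBL[OF p] by blast
    show ?thesis
    proof (cases "w = snd (c p) p")
      case True
      then show ?thesis using cBL[OF p] nbdD(7)[OF n] p ne[of "L p w"] w by (auto simp: \<psi>_def in_chart_pt)
    next
      case False
      then show ?thesis using cBL[OF p] nbdD(10)[OF n w] ne[of "L p w"] w by (auto simp: \<psi>_def in_chart_pt)
    qed
  qed
  have "smooth_subbundle M \<psi>"
  proof (rule smooth_subbundleI)
    show "\<psi> \<in> extensional (points M)" by (simp add: \<psi>_def)
    fix p assume p: "p \<in> points M"
    have n: "nbd (c p) p (B p)" using cBL[OF p] by blast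
    have "\<psi> p = vec.span {L p (snd (c p) p)}" using \<psi>[OF p nbdD(4)[OF n]] nbdD(7)[OF n] by (simp add: in_chart_pt)
    then show "vec.subspace (\<psi> p)" by simp
    have "smooth_on (B p) (\<lambda>w. outer_normalized (L p w))"
      by (rule smooth_on_outer_normalized[OF nbdD(3)[OF n]]) (use cBL[OF p] in auto)
    then have "smooth_on (B p) (\<lambda>w. proj_matrix (in_chart (c p) \<psi> w))"
      by (rule smooth_on_cong[OF nbdD(3)[OF n]]) (use cBL[OF p] in \<open>simp add: \<psi>[OF p] proj_matrix_span_1\<close>)
    then show "\<exists>c B. nbd c p B \<and> smooth_on B (\<lambda>w. proj_matrix (in_chart c \<psi> w))" using n by blast
  qed
  show ?thesis
  proof (intro exI[of _ \<psi>] conjI ballI impI)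
    show "smooth_subbundle M \<psi>" by fact
    show "\<psi> p = I p" if "p \<in> points M" "I p \<noteq> {0}" for p using that by (simp add: \<psi>_def)
    fix p assume p: "p \<in> points M"
    show "\<exists>c B L. nbd c p B \<and> smooth_on B L \<and> (\<forall>w\<in>B. L w \<noteq> 0) \<and>
      R c B L \<and> (\<forall>w\<in>B. in_chart c \<psi> w = vec.span {L w}) \<and> (\<forall>w\<in>B. w \<noteq> snd c p \<longrightarrow> I (pt c w) = vec.span {L w})"
      by (intro exI[of _ "c p"] exI[of _ "B p"] exI[of _ "L p"] conjI) (use cBL[OF p] \<psi>[OF p] in auto)
  qed
qed

lemma line_at_center:
  assumes \<psi>: "smooth_subbundle M \<psi>" and n: "nbd c p B" and L: "smooth_on B L" "\<And>w. w \<in> B \<Longrightarrow> L w \<noteq> 0"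
    and eq: "\<And>w. w \<in> B \<Longrightarrow> w \<noteq> snd c p \<Longrightarrow> in_chart c \<psi> w = vec.span {L w}" and w: "w \<in> B"
  shows "in_chart c \<psi> w = vec.span {L w}"
proof (cases "w = snd c p")
  case True
  note nb = nbdD[OF n]
  have "proj_matrix (in_chart c \<psi> w) = outer_normalized (L w)" unfolding True
  proof (rule continuous_on_punctured_eq[OF nb(3,4)])
    show "isCont (\<lambda>w. proj_matrix (in_chart c \<psi> w)) (snd c p)"
      by (rule smooth_on_imp_isCont[OF smooth_subbundle_in_chart[OF \<psi> n] nb(4)])
    show "isCont (\<lambda>w. outer_normalized (L w)) (snd c p)"
      by (rule smooth_on_imp_isCont[OF smooth_on_outer_normalized[OF nb(3) L] nb(4)])
    show "proj_matrix (in_chart c \<psi> z) = outer_normalized (L z)" if "z \<in> B" "z \<noteq> snd c p" for z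
      using eq[OF that] L(2)[OF that(1)] by (simp add: proj_matrix_span_1)
  qed
  then have "proj_matrix (in_chart c \<psi> w) = proj_matrix (vec.span {L w})"
    using L(2)[OF w] by (simp add: proj_matrix_span_1)
  moreover have "vec.subspace (in_chart c \<psi> w)"
    using \<psi> nb(10)[OF w] by (simp add: smooth_subbundle_def in_chart_pt)
  ultimately show ?thesis by (intro subspace_eqI) auto
qed (use eq w in blast)

text \<open>The set E of points near which Z holds throughout is open. If p is outside E, then Z
  fails on a punctured neighbourhood of p, which therefore misses E; so E is closed as well.\<close>

lemma connected_dichotomy:
  assumes "\<And>p. p \<in> points M \<Longrightarrow> \<exists>T. openin (surf_top M) T \<and> p \<in> T \<and>
      ((\<forall>q\<in>T. Z q) \<or> (\<forall>q\<in>T. q \<noteq> p \<longrightarrow> \<not> Z q))"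
  shows "(\<forall>p\<in>points M. Z p) \<or> (\<forall>p\<in>points M. \<not> (\<exists>T. openin (surf_top M) T \<and> p \<in> T \<and> (\<forall>q\<in>T. Z q)))"
proof -
  define E where "E = \<Union>{T. openin (surf_top M) T \<and> (\<forall>q\<in>T. Z q)}"
  define E' where "E' = \<Union>{T. openin (surf_top M) T \<and> T \<inter> E = {}}"
  have o: "openin (surf_top M) E" "openin (surf_top M) E'" unfolding E_def E'_def by (auto intro!: openin_Union)
  have "points M \<subseteq> E \<union> E'"
  proof
    fix p assume p: "p \<in> points M"
    obtain T where T: "openin (surf_top M) T" "p \<in> T" "(\<forall>q\<in>T. Z q) \<or> (\<forall>q\<in>T. q \<noteq> p \<longrightarrow> \<not> Z q)"
      using assms[OF p] by blast
    show "p \<in> E \<union> E'"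
    proof (cases "p \<in> E")
      case False
      then have "\<not> (\<forall>q\<in>T. Z q)" using T by (auto simp: E_def)
      then have nz: "\<forall>q\<in>T. q \<noteq> p \<longrightarrow> \<not> Z q" using T(3) by blast
      have "q \<notin> E" if "q \<in> T" for q
        using that nz False by (cases "q = p") (auto simp: E_def)
      then have "T \<inter> E = {}" by blast
      then show ?thesis using T by (auto simp: E'_def)
    qed simp
  qed
  moreover have "E \<inter> E' = {}" by (auto simp: E'_def)
  ultimately have "E = {} \<or> E' = {}"
    using RS o unfolding riemann_surface_def connected_space_def by blast
  then show ?thesis
  proof
    assume "E' = {}"
    then show ?thesis using \<open>points M \<subseteq> E \<union> E'\<close> by (auto simp: E_def)
  qed (auto simp: E_def)
qed

lemma locally_constant:
  assumes "\<And>p. p \<in> points M \<Longrightarrow> \<exists>T. openin (surf_top M) T \<and> p \<in> T \<and> (\<forall>q\<in>T. g q = g p)"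
  shows "p \<in> points M \<Longrightarrow> q \<in> points M \<Longrightarrow> g p = g q"
proof (rule ccontr)
  assume p: "p \<in> points M" and q: "q \<in> points M" and ne: "g p \<noteq> g q"
  have o: "openin (surf_top M) {x \<in> points M. P (g x)}" for P
  proof (subst openin_subopen, clarify)
    fix x assume x: "x \<in> points M" "P (g x)"
    from assms[OF x(1)] obtain T where T: "openin (surf_top M) T" "x \<in> T" "\<forall>q\<in>T. g q = g x"
      by (elim exE conjE)
    have "T \<subseteq> {x \<in> points M. P (g x)}"
    proof
      fix y assume "y \<in> T"
      moreover from this have "g y = g x" using T(3) by blast
      ultimately show "y \<in> {x \<in> points M. P (g x)}" using openin_subset[OF T(1)] x(2) by (simp add: subset_iff)
    qed
    with T(1,2) show "\<exists>T. openin (surf_top M) T \<and> x \<in> T \<and> T \<subseteq> {x \<in> points M. P (g x)}" by blast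
  qed
  have "closedin (surf_top M) {x \<in> points M. g x = g p}"
  proof -
    have "points M - {x \<in> points M. g x = g p} = {x \<in> points M. g x \<noteq> g p}" by blast
    then show ?thesis using o[of "\<lambda>y. y \<noteq> g p"] by (auto simp: closedin_def)
  qed
  moreover have "connected_space (surf_top M)" using RS by (simp add: riemann_surface_def)
  ultimately have "{x \<in> points M. g x = g p} = {} \<or> {x \<in> points M. g x = g p} = points M"
    using o[of "\<lambda>y. y = g p"] unfolding connected_space_clopen_in by blast
  moreover have "p \<in> {x \<in> points M. g x = g p}" "q \<notin> {x \<in> points M. g x = g p}" using p ne by simp_all
  ultimately show False using q by blast
qed

end

section \<open>Adapted frames\<close>

lemma bilin_simps [simp]:
  fixes u v w :: "complex^7"
  shows "bilin (u + v) w = bilin u w + bilin v w" "bilin w (u + v) = bilin w u + bilin w v"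
  "bilin (k *s v) w = k * bilin v w" "bilin w (k *s v) = k * bilin w v"
  "bilin (- v) w = - bilin v w" "bilin w (- v) = - bilin w v"
  by (simp_all add: bilin_hermitian)

lemma bilin_commute: "bilin v w = bilin w (v :: 'a::comm_ring_1^7)"
  by (simp add: bilin_def mult.commute)

lemma cross7_polarized:
  fixes u v w :: "complex^7"
  shows "cross7 u (cross7 v w) + cross7 v (cross7 u w) = bilin u w *s v + bilin v w *s u - (2 * bilin u v) *s w"
  using cross7_cross7_left[of "u + v" w] cross7_cross7_left[of u w] cross7_cross7_left[of v w]
  by (simp add: vec_eq_iff algebra_simps bilin_commute[of v u])

text \<open>The hypothesis on \<open>a\<close> says that \<open>a\<close> is of type (1,0) at the point \<open>f\<close> of the sphere.\<close>

lemma type10: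
  fixes f a b :: "complex^7"
  assumes f: "vec_cnj f = f" "hermitian f f = 1" and a: "cross7 f a = \<i> *s a" and b: "cross7 f b = \<i> *s b"
  shows "hermitian a f = 0" "hermitian f a = 0" "hermitian (vec_cnj a) f = 0" "hermitian f (vec_cnj a) = 0"
    "hermitian a (vec_cnj b) = 0" "hermitian (vec_cnj a) b = 0"
    "cross7 (vec_cnj a) a = (- \<i> * hermitian a a) *s f"
proof -
  have "bilin f (cross7 f a) = 0" by (rule cross7_orthogonal)
  then have fa: "bilin f a = 0" unfolding a by simp
  then show 1: "hermitian a f = 0" unfolding bilin_commute[of f a] unfolding bilin_hermitian f(1) .
  then show 2: "hermitian f a = 0" by (rule hermitian_zero_commute[THEN iffD1])
  show 3: "hermitian f (vec_cnj a) = 0" using fa by (simp add: bilin_hermitian)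
  then show "hermitian (vec_cnj a) f = 0" by (rule hermitian_zero_commute[THEN iffD1])
  have "\<i> * bilin a b = - (\<i> * bilin a b)"
    using bilin_cross7_swap[of f a b] unfolding a b by simp
  then have ab: "bilin a b = 0" by simp
  then show "hermitian a (vec_cnj b) = 0" by (simp add: bilin_hermitian)
  then show "hermitian (vec_cnj a) b = 0" by (simp add: hermitian_vec_cnj'(1))
  \<comment> \<open>Z changes sign under conjugation. The polarized identity gives \<i> Z + f
    \<times> Z = |a|^2 f, its conjugate is \<i> Z - f \<times> Z = |a|^2 f, and the sum determines
    Z.\<close>
  define Z where "Z = cross7 (vec_cnj a) a"
  have "vec_cnj Z = cross7 a (vec_cnj a)" by (simp add: Z_def vec_cnj_cross7)
  also have "\<dots> = - Z" unfolding Z_def by (rule cross7_commute)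
  finally have cZ: "vec_cnj Z = - Z" .
  have "cross7 (vec_cnj a) (cross7 f a) + cross7 f Z
      = bilin (vec_cnj a) a *s f + bilin f a *s vec_cnj a - (2 * bilin (vec_cnj a) f) *s a"
    unfolding Z_def by (rule cross7_polarized)
  moreover have "bilin (vec_cnj a) f = 0" using 3 by (simp add: bilin_hermitian f(1) hermitian_zero_commute)
  moreover have "bilin (vec_cnj a) a = hermitian a a" unfolding bilin_commute[of "vec_cnj a" a] by (simp add: bilin_hermitian)
  ultimately have e: "\<i> *s Z + cross7 f Z = hermitian a a *s f"
    using fa unfolding a by (simp add: Z_def)
  have e': "\<i> *s Z - cross7 f Z = hermitian a a *s f"
    using arg_cong[OF e, of vec_cnj] by (simp add: vec_cnj_cross7 cZ f(1) hermitian_cnj vec_eq_iff)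
  have "(2 * \<i>) *s Z = 2 *s (hermitian a a *s f)"
  proof -
    have "(2 * \<i>) *s Z = (\<i> *s Z + cross7 f Z) + (\<i> *s Z - cross7 f Z)" by (simp add: vec_eq_iff)
    also have "\<dots> = 2 *s (hermitian a a *s f)" unfolding e e' by (simp add: vec_eq_iff)
    finally show ?thesis .
  qed
  then have "(- \<i> / 2) *s ((2 * \<i>) *s Z) = (- \<i> / 2) *s (2 *s (hermitian a a *s f))" by (rule arg_cong)
  then show "cross7 (vec_cnj a) a = (- \<i> * hermitian a a) *s f" unfolding Z_def[symmetric] by (simp add: vector_smult_assoc)
qed

lemma has_wirtinger1_zero:
  assumes "open S" "w \<in> S" "\<And>z. z \<in> S \<Longrightarrow> h z = c" "has_wirtinger1 h a b w"
  shows "a = 0" "b = 0"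
proof -
  have "has_wirtinger1 (\<lambda>z. c) a b w" by (rule has_wirtinger1_cong[OF assms])
  then show "a = 0" "b = 0" using has_wirtinger1_unique[OF _ has_wirtinger1_const] by blast+
qed

lemma has_wirtinger_eq:
  assumes "open S" "w \<in> S" "\<And>z. z \<in> S \<Longrightarrow> f z = g z" "has_wirtinger f a b w" "has_wirtinger g a' b' w"
  shows "a = a'" "b = b'"
  using has_wirtinger_unique[OF has_wirtinger_cong[OF assms(1-4)] assms(5)] by auto

lemma real_has_wirtinger:
  assumes "open S" "smooth_on S f" "\<And>z. z \<in> S \<Longrightarrow> vec_cnj (f z) = f z" "w \<in> S"
  shows "has_wirtinger f (d_z f w) (vec_cnj (d_z f w)) w"
proof -
  note h = smooth_on_has_wirtinger[OF assms(2,4)]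
  have "d_zbar f w = vec_cnj (d_z f w)"
    using has_wirtinger_eq(2)[OF assms(1,4) assms(3) has_wirtinger_vec_cnj[OF h] h] by simp
  then show ?thesis using h by simp
qed

text \<open>The equation satisfied by \<open>\<partial>F\<close> for an almost complex \<open>F\<close>; it contains the harmonicity of \<open>F\<close>.\<close>

lemma almost_complex_dbar_eq:
  assumes S: "open S" and f: "smooth_on S f" and re: "\<And>z. z \<in> S \<Longrightarrow> vec_cnj (f z) = f z"
    and u: "\<And>z. z \<in> S \<Longrightarrow> hermitian (f z) (f z) = 1"
    and ac: "\<And>z. z \<in> S \<Longrightarrow> cross7 (f z) (d_z f z) = \<i> *s d_z f z"
  shows "dbar_eq S (d_z f) (\<lambda>z. - f z) (d_z f)"
  unfolding dbar_eq_def
proof (intro conjI ballI)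
  define E where "E = d_z f"
  show "smooth_on S (d_z f)" by (rule smooth_on_d(1)[OF S f])
  then have sE: "smooth_on S E" by (simp add: E_def)
  fix w assume w: "w \<in> S"
  define R where "R = d_zbar E w"
  have wf: "has_wirtinger f (E z) (vec_cnj (E z)) z" if "z \<in> S" for z
    unfolding E_def by (rule real_has_wirtinger[OF S f re that])
  have wE: "has_wirtinger E (d_z E w) R w" unfolding R_def by (rule smooth_on_has_wirtinger[OF sE w])
  \<comment> \<open>R is a quarter of the Laplacian of a real map.\<close>
  have rR: "vec_cnj R = R"
  proof -
    have "R = d_z (d_zbar f) w" unfolding R_def E_def by (rule d_zbar_d_z[OF S w f])
    also have "\<dots> = d_z (\<lambda>z. vec_cnj (E z)) w"
      by (rule d_cong(1)[OF S w]) (use wf has_wirtinger_d(2) in blast)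
    also have "\<dots> = vec_cnj R" by (rule has_wirtinger_d(1)[OF has_wirtinger_vec_cnj[OF wE]])
    finally show ?thesis by simp
  qed
  have eq: "cross7 (vec_cnj (E w)) (E w) + cross7 (f w) R = \<i> *s R"
  proof (rule has_wirtinger_eq(2)[OF S w _ has_wirtinger_cross7[OF wf[OF w] wE]])
    show "cross7 (f z) (E z) = \<i> *s E z" if "z \<in> S" for z using ac[OF that] by (simp add: E_def)
    show "has_wirtinger (\<lambda>z. \<i> *s E z) (\<i> *s d_z E w) (\<i> *s R) w"
      using has_wirtinger_smult[OF has_wirtinger1_const wE, of \<i>] by simp
  qed
  have ac': "cross7 (f w) (E w) = \<i> *s E w" using ac[OF w] by (simp add: E_def)
  have Z: "cross7 (vec_cnj (E w)) (E w) = (- \<i> * hermitian (E w) (E w)) *s f w"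
    by (rule type10(7)[OF re[OF w] u[OF w] ac' ac'])
  have e1: "(- \<i> * hermitian (E w) (E w)) *s f w + cross7 (f w) R = \<i> *s R" using eq Z by simp
  \<comment> \<open>Subtracting the conjugate equation removes f \<times> R and leaves R = -|E|^2
    f.\<close>
  have e2: "(\<i> * hermitian (E w) (E w)) *s f w + cross7 (f w) R = - \<i> *s R"
    using arg_cong[OF e1, of vec_cnj] by (simp add: vec_cnj_cross7 rR re[OF w] hermitian_cnj add.commute)
  have "(2 * \<i>) *s R = (- 2 * \<i> * hermitian (E w) (E w)) *s f w"
  proof -
    have "(2 * \<i>) *s R = \<i> *s R - (- \<i> *s R)" by (simp add: vec_eq_iff)
    also have "\<dots> = (- 2 * \<i> * hermitian (E w) (E w)) *s f w"
      unfolding e1[symmetric] e2[symmetric] by (simp add: vec_eq_iff algebra_simps)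
    finally show ?thesis .
  qed
  then have "(- \<i> / 2) *s ((2 * \<i>) *s R) = (- \<i> / 2) *s ((- 2 * \<i> * hermitian (E w) (E w)) *s f w)" by (rule arg_cong)
  then show "d_zbar (d_z f) w = hermitian (d_z f w) (d_z f w) *s - f w"
    unfolding R_def[unfolded E_def] E_def by (simp add: vector_smult_assoc vec_eq_iff R_def E_def)
qed

text \<open>In the application f is F in a chart and L is F_z divided by a power p of the
  coordinate, so p may vanish although L does not. The last assumption is the form in which the
  second-order equation of F survives the division.\<close>

locale frame =
  fixes B :: "complex set" and f L :: "complex \<Rightarrow> complex^7" and p :: "complex \<Rightarrow> complex"
  assumes B: "open B" and f: "smooth_on B f" and L: "smooth_on B L" and L0: "\<And>w. w \<in> B \<Longrightarrow> L w \<noteq> 0"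
    and fr: "\<And>w. w \<in> B \<Longrightarrow> vec_cnj (f w) = f w" and fu: "\<And>w. w \<in> B \<Longrightarrow> hermitian (f w) (f w) = 1"
    and fL: "\<And>w. w \<in> B \<Longrightarrow> cross7 (f w) (L w) = \<i> *s L w" and fz: "\<And>w. w \<in> B \<Longrightarrow> d_z f w = p w *s L w"
    and Lz: "\<And>w. w \<in> B \<Longrightarrow> \<exists>b. d_zbar L w = b *s f w"
begin

text \<open>The structure equations of the frame are L_z = a L + Q and L_zbar = b f. By
  \<open>orthQ\<close>, Q is orthogonal also to f and cnj L, so it is the value of A' on L.\<close>

definition a where "a w = hermitian (d_z L w) (L w) * inverse (hermitian (L w) (L w))"
definition b where "b w = hermitian (d_zbar L w) (f w)"
definition Q where "Q w = d_z L w - a w *s L w"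
definition \<Phi> where "\<Phi> w = vec.span {L w, f w, vec_cnj (L w)}"

lemma LL: "w \<in> B \<Longrightarrow> hermitian (L w) (L w) \<noteq> 0" using L0 by simp

lemma f0: "w \<in> B \<Longrightarrow> f w \<noteq> 0" using fu by force

lemma wf: "w \<in> B \<Longrightarrow> has_wirtinger f (p w *s L w) (cnj (p w) *s vec_cnj (L w)) w"
  using real_has_wirtinger[OF B f fr, of w] fz[of w] by simp

lemma Lzb: "w \<in> B \<Longrightarrow> d_zbar L w = b w *s f w"
  using Lz[of w] fu[of w] by (auto simp: b_def)

lemma dL: "d_z L w = a w *s L w + Q w" by (simp add: Q_def)

lemma wL: "w \<in> B \<Longrightarrow> has_wirtinger L (a w *s L w + Q w) (b w *s f w) w"
  using smooth_on_has_wirtinger[OF L, of w] Lzb[of w] dL[of w] by simp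

lemma wLc: "w \<in> B \<Longrightarrow> has_wirtinger (\<lambda>z. vec_cnj (L z)) (cnj (b w) *s f w)
    (cnj (a w) *s vec_cnj (L w) + vec_cnj (Q w)) w"
  using has_wirtinger_vec_cnj[OF wL[of w]] fr[of w] by simp

lemma orthL:
  assumes "w \<in> B"
  shows "hermitian (L w) (f w) = 0" "hermitian (f w) (L w) = 0" "hermitian (vec_cnj (L w)) (f w) = 0"
    "hermitian (f w) (vec_cnj (L w)) = 0" "hermitian (L w) (vec_cnj (L w)) = 0" "hermitian (vec_cnj (L w)) (L w) = 0"
  using type10[OF fr[OF assms] fu[OF assms] fL[OF assms] fL[OF assms]] by simp_all

text \<open>Differentiate (L, f) = 0 with respect to zbar.\<close>

lemma b_eq:
  assumes w: "w \<in> B"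
  shows "b w = - cnj (p w) * hermitian (L w) (L w)"
  using has_wirtinger1_zero(2)[OF B w orthL(1) has_wirtinger1_hermitian[OF wL[OF w] wf[OF w]]]
  by (simp add: fu[OF w] eq_neg_iff_add_eq_0)

text \<open>Differentiate f \<times> L = \<i> L with respect to z; the term f_z \<times> L drops out
  because f_z is a multiple of L.\<close>

lemma fQ:
  assumes w: "w \<in> B"
  shows "cross7 (f w) (Q w) = \<i> *s Q w"
proof -
  have "cross7 (p w *s L w) (L w) + cross7 (f w) (a w *s L w + Q w) = \<i> *s (a w *s L w + Q w)"
  proof (rule has_wirtinger_eq(1)[OF B w fL has_wirtinger_cross7[OF wf[OF w] wL[OF w]]])
    show "has_wirtinger (\<lambda>z. \<i> *s L z) (\<i> *s (a w *s L w + Q w)) (\<i> *s (b w *s f w)) w"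
      using has_wirtinger_smult[OF has_wirtinger1_const wL[OF w], of \<i>] by simp
  qed
  then show ?thesis using fL[OF w] by (simp add: vec_eq_iff algebra_simps)
qed

lemma orthQ:
  assumes w: "w \<in> B"
  shows "hermitian (Q w) (f w) = 0" "hermitian (f w) (Q w) = 0" "hermitian (vec_cnj (Q w)) (f w) = 0"
    "hermitian (f w) (vec_cnj (Q w)) = 0" "hermitian (Q w) (vec_cnj (Q w)) = 0"
    "hermitian (Q w) (L w) = 0" "hermitian (Q w) (vec_cnj (L w)) = 0"
    "hermitian (vec_cnj (Q w)) (L w) = 0" "hermitian (vec_cnj (Q w)) (vec_cnj (L w)) = 0"
    "hermitian (L w) (Q w) = 0" "hermitian (vec_cnj (Q w)) (Q w) = 0"
proof -
  note t = type10[OF fr[OF w] fu[OF w] fQ[OF w] fQ[OF w]] type10[OF fr[OF w] fu[OF w] fQ[OF w] fL[OF w]]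
  show "hermitian (Q w) (f w) = 0" "hermitian (f w) (Q w) = 0" "hermitian (vec_cnj (Q w)) (f w) = 0"
    "hermitian (f w) (vec_cnj (Q w)) = 0" "hermitian (Q w) (vec_cnj (Q w)) = 0"
    "hermitian (Q w) (vec_cnj (L w)) = 0" "hermitian (vec_cnj (Q w)) (L w) = 0" "hermitian (vec_cnj (Q w)) (Q w) = 0"
    by (fact t)+
  show 1: "hermitian (Q w) (L w) = 0" using LL[OF w] by (simp add: Q_def a_def)
  then show "hermitian (vec_cnj (Q w)) (vec_cnj (L w)) = 0" by (simp add: hermitian_vec_cnj)
  show "hermitian (L w) (Q w) = 0" using 1 by (rule hermitian_zero_commute[THEN iffD1])
qed

lemma sa: "smooth_on B a"
  unfolding a_def[abs_def]
  by (rule smooth_on_mult[OF B smooth_on_hermitian[OF B smooth_on_d(1)[OF B L] L]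
      smooth_on_inverse[OF B smooth_on_hermitian[OF B L L] LL]])

lemma sb: "smooth_on B b"
  unfolding b_def[abs_def] by (rule smooth_on_hermitian[OF B smooth_on_d(2)[OF B L] f])

lemma sQ: "smooth_on B Q"
  unfolding Q_def[abs_def]
  by (rule smooth_on_diff[OF B smooth_on_d(1)[OF B L] smooth_on_vector_scalar[OF B sa L]])

text \<open>Interchanging derivatives, d_zbar of L_z is the z-derivative of b f and lies in the span
  of f and L; hence so does Q_zbar. Differentiating (Q, f) = 0 and (Q, L) = 0 determines the two
  coefficients.\<close>

lemma Q_zbar:
  assumes w: "w \<in> B"
  shows "d_zbar Q w = - (hermitian (Q w) (Q w) / hermitian (L w) (L w)) *s L w"
proof -
  obtain a1 a2 where wa: "has_wirtinger1 a a1 a2 w" using smooth_on_has_wirtinger1[OF sa w] by blast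
  obtain b1 b2 where wb: "has_wirtinger1 b b1 b2 w" using smooth_on_has_wirtinger1[OF sb w] by blast
  have "d_zbar (d_z L) w = d_z (d_zbar L) w" by (rule d_zbar_d_z[OF B w L])
  also have "\<dots> = d_z (\<lambda>z. b z *s f z) w" by (rule d_cong(1)[OF B w Lzb])
  also have "\<dots> = b1 *s f w + b w *s (p w *s L w)" by (rule has_wirtinger_d(1)[OF has_wirtinger_smult[OF wb wf[OF w]]])
  finally have 1: "has_wirtinger (d_z L) (d_z (d_z L) w) (b1 *s f w + b w *s (p w *s L w)) w"
    using smooth_on_has_wirtinger[OF smooth_on_d(1)[OF B L] w] by simp
  have "d_zbar Q w = (b1 *s f w + b w *s (p w *s L w)) - (a2 *s L w + a w *s (b w *s f w))"
    unfolding Q_def[abs_def] by (rule has_wirtinger_d(2)[OF has_wirtinger_diff[OF 1 has_wirtinger_smult[OF wa wL[OF w]]]])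
  then have 2: "d_zbar Q w = (b1 - a w * b w) *s f w + (b w * p w - a2) *s L w"
    by (simp add: vec_eq_iff algebra_simps)
  note wQ = smooth_on_has_wirtinger[OF sQ w]
  have "hermitian (d_zbar Q w) (f w) + hermitian (Q w) (p w *s L w) = 0"
    by (rule has_wirtinger1_zero(2)[OF B w orthQ(1) has_wirtinger1_hermitian[OF wQ wf[OF w]]])
  then have 3: "b1 - a w * b w = 0" unfolding 2 using orthQ(6)[OF w] orthL[OF w] fu[OF w] by simp
  have "hermitian (d_zbar Q w) (L w) + hermitian (Q w) (a w *s L w + Q w) = 0"
    by (rule has_wirtinger1_zero(2)[OF B w orthQ(6) has_wirtinger1_hermitian[OF wQ wL[OF w]]])
  then have "(b w * p w - a2) * hermitian (L w) (L w) + hermitian (Q w) (Q w) = 0"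
    unfolding 2 3 using orthQ(6)[OF w] orthL[OF w] by (simp add: algebra_simps)
  then have "b w * p w - a2 = - (hermitian (Q w) (Q w) / hermitian (L w) (L w))"
    using LL[OF w] by (simp add: field_simps eq_neg_iff_add_eq_0)
  then show ?thesis unfolding 2 3 by simp
qed

text \<open>With one of the two factors Q held fixed as X, the quadratic equation takes the linear
  form in which zeros can be divided out.\<close>

lemma Q_dbar_eq: "dbar_eq B Q (\<lambda>w. (- inverse (hermitian (L w) (L w))) *s L w) Q"
  unfolding dbar_eq_def using sQ by (simp add: Q_zbar divide_inverse vector_smult_assoc vec_eq_iff)

lemma sY: "smooth_on B (\<lambda>w. (- inverse (hermitian (L w) (L w))) *s L w)"
  by (rule smooth_on_vector_scalar[OF B smooth_on_minus[OF B smooth_on_inverse[OF B smooth_on_hermitian[OF B L L] LL]] L])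

lemma proj_\<Phi>:
  assumes w: "w \<in> B"
  shows "proj_matrix (\<Phi> w) = outer_normalized (L w) + outer_normalized (f w) + outer_normalized (vec_cnj (L w))"
    "orth_proj (\<Phi> w) x = (hermitian x (L w) / hermitian (L w) (L w)) *s L w + hermitian x (f w) *s f w
       + (hermitian x (vec_cnj (L w)) / hermitian (L w) (L w)) *s vec_cnj (L w)"
  unfolding \<Phi>_def
  using proj_matrix_span_3[of "L w" "f w" "vec_cnj (L w)"] orth_proj_span_3[of "L w" "f w" "vec_cnj (L w)" x]
    L0[OF w] f0[OF w] fu[OF w] orthL[OF w]
  by (simp_all add: hermitian_vec_cnj hermitian_cnj)

lemma smooth_proj_\<Phi>: "smooth_on B (\<lambda>w. proj_matrix (\<Phi> w))"
proof -
  have "smooth_on B (\<lambda>w. outer_normalized (L w) + outer_normalized (f w) + outer_normalized (vec_cnj (L w)))"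
    by (rule smooth_on_add[OF B smooth_on_add[OF B smooth_on_outer_normalized[OF B L L0] smooth_on_outer_normalized[OF B f f0]]
        smooth_on_outer_normalized[OF B smooth_on_vec_cnj[OF B L]]]) (use L0 in auto)
  then show ?thesis by (rule smooth_on_cong[OF B]) (simp add: proj_\<Phi>)
qed

lemma \<Phi>_in: "w \<in> B \<Longrightarrow> L w \<in> \<Phi> w \<and> f w \<in> \<Phi> w \<and> vec_cnj (L w) \<in> \<Phi> w"
  unfolding \<Phi>_def by (auto intro: vec.span_base)

lemma subspace_\<Phi>: "vec.subspace (\<Phi> w)" unfolding \<Phi>_def by simp

lemma perp_\<Phi>: "x \<in> orth_compl (\<Phi> w) \<longleftrightarrow>
    hermitian x (L w) = 0 \<and> hermitian x (f w) = 0 \<and> hermitian x (vec_cnj (L w)) = 0"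
  unfolding \<Phi>_def by (rule orth_compl_span_3)

lemma Q_perp: "w \<in> B \<Longrightarrow> Q w \<in> orth_compl (\<Phi> w) \<and> vec_cnj (Q w) \<in> orth_compl (\<Phi> w)"
  using orthQ[of w] by (simp add: perp_\<Phi>)

lemma perp_proj:
  assumes w: "w \<in> B"
  shows "orth_proj (orth_compl (\<Phi> w)) (x *s L w + y *s f w + z *s vec_cnj (L w) + c *s Q w) = c *s Q w"
proof (rule orth_proj_eqI[OF subspace_orth_compl])
  show "c *s Q w \<in> orth_compl (\<Phi> w)" using Q_perp[OF w] vec.subspace_scale[OF subspace_orth_compl] by blast
  have "x *s L w + y *s f w + z *s vec_cnj (L w) \<in> \<Phi> w" by (auto simp: \<Phi>_def span_3)
  then show "x *s L w + y *s f w + z *s vec_cnj (L w) + c *s Q w - c *s Q w \<in> orth_compl (orth_compl (\<Phi> w))"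
    by (simp add: orth_compl_orth_compl[OF subspace_\<Phi>])
qed

text \<open>The z-derivatives of f and cnj L stay in \<Phi>, being multiples of L and f; only L
  leaves it, by Q.\<close>

lemma plane_image_\<Phi>:
  assumes w: "w \<in> B"
  shows "plane_image d_z \<Phi> w = vec.span {Q w}"
proof
  show "plane_image d_z \<Phi> w \<subseteq> vec.span {Q w}"
  proof
    fix x assume "x \<in> plane_image d_z \<Phi> w"
    then obtain s W where W: "open W" "w \<in> W" "smooth_on W s" "\<And>z. z \<in> W \<Longrightarrow> s z \<in> \<Phi> z"
      and x: "x = orth_proj (orth_compl (\<Phi> w)) (d_z s w)" unfolding plane_image_def by blast
    let ?S = "W \<inter> B"
    have S: "open ?S" "w \<in> ?S" using W B w by auto
    have sm: "smooth_on ?S s" "smooth_on ?S L" "smooth_on ?S f"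
      using W(3) L f by (auto intro: smooth_on_subset)
    have n: "smooth_on ?S (\<lambda>z. inverse (hermitian (L z) (L z)))"
      by (rule smooth_on_inverse[OF S(1) smooth_on_hermitian[OF S(1) sm(2,2)]]) (use LL in auto)
    have c: "smooth_on ?S (\<lambda>z. hermitian (s z) (L z) * inverse (hermitian (L z) (L z)))"
      "smooth_on ?S (\<lambda>z. hermitian (s z) (f z))"
      "smooth_on ?S (\<lambda>z. hermitian (s z) (vec_cnj (L z)) * inverse (hermitian (L z) (L z)))"
      by (rule smooth_on_mult[OF S(1) smooth_on_hermitian[OF S(1) sm(1,2)] n]
          smooth_on_hermitian[OF S(1) sm(1,3)]
          smooth_on_mult[OF S(1) smooth_on_hermitian[OF S(1) sm(1) smooth_on_vec_cnj[OF S(1) sm(2)]] n])+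
    obtain x1 x2 where 1: "has_wirtinger1 (\<lambda>z. hermitian (s z) (L z) * inverse (hermitian (L z) (L z))) x1 x2 w"
      using smooth_on_has_wirtinger1[OF c(1) S(2)] by blast
    obtain y1 y2 where 2: "has_wirtinger1 (\<lambda>z. hermitian (s z) (f z)) y1 y2 w"
      using smooth_on_has_wirtinger1[OF c(2) S(2)] by blast
    obtain z1 z2 where 3: "has_wirtinger1 (\<lambda>z. hermitian (s z) (vec_cnj (L z)) * inverse (hermitian (L z) (L z))) z1 z2 w"
      using smooth_on_has_wirtinger1[OF c(3) S(2)] by blast
    let ?s = "\<lambda>z. (hermitian (s z) (L z) * inverse (hermitian (L z) (L z))) *s L z + hermitian (s z) (f z) *s f z
       + (hermitian (s z) (vec_cnj (L z)) * inverse (hermitian (L z) (L z))) *s vec_cnj (L z)"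
    have "s z = ?s z" if "z \<in> ?S" for z
      using orth_proj_ident[OF subspace_\<Phi> W(4)[of z]] proj_\<Phi>(2)[of z "s z"] that by (simp add: divide_inverse)
    then have "d_z s w = d_z ?s w" by (rule d_cong(1)[OF S])
    also have "\<dots> = x1 *s L w + (hermitian (s w) (L w) * inverse (hermitian (L w) (L w))) *s (a w *s L w + Q w)
       + (y1 *s f w + hermitian (s w) (f w) *s (p w *s L w))
       + (z1 *s vec_cnj (L w) + (hermitian (s w) (vec_cnj (L w)) * inverse (hermitian (L w) (L w))) *s (cnj (b w) *s f w))"
      by (rule has_wirtinger_d(1)[OF has_wirtinger_add[OF has_wirtinger_add[OF
            has_wirtinger_smult[OF 1 wL[OF w]] has_wirtinger_smult[OF 2 wf[OF w]]] has_wirtinger_smult[OF 3 wLc[OF w]]]])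
    also have "\<dots> = (x1 + hermitian (s w) (L w) * inverse (hermitian (L w) (L w)) * a w + hermitian (s w) (f w) * p w) *s L w
       + (y1 + hermitian (s w) (vec_cnj (L w)) * inverse (hermitian (L w) (L w)) * cnj (b w)) *s f w + z1 *s vec_cnj (L w)
       + (hermitian (s w) (L w) * inverse (hermitian (L w) (L w))) *s Q w"
      by (simp add: vec_eq_iff algebra_simps)
    finally have d: "d_z s w = (x1 + hermitian (s w) (L w) * inverse (hermitian (L w) (L w)) * a w + hermitian (s w) (f w) * p w) *s L w
       + (y1 + hermitian (s w) (vec_cnj (L w)) * inverse (hermitian (L w) (L w)) * cnj (b w)) *s f w + z1 *s vec_cnj (L w)
       + (hermitian (s w) (L w) * inverse (hermitian (L w) (L w))) *s Q w" .
    show "x \<in> vec.span {Q w}" unfolding x d perp_proj[OF w] by (auto simp: span_1)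
  qed
  show "vec.span {Q w} \<subseteq> plane_image d_z \<Phi> w"
  proof
    fix x assume "x \<in> vec.span {Q w}"
    then obtain c where x: "x = c *s Q w" by (auto simp: span_1)
    have "d_z (\<lambda>z. c *s L z) w = (c * a w) *s L w + 0 *s f w + 0 *s vec_cnj (L w) + c *s Q w"
      using has_wirtinger_d(1)[OF has_wirtinger_smult[OF has_wirtinger1_const[of c] wL[OF w]]]
      by (simp add: vec_eq_iff algebra_simps)
    then have "x = orth_proj (orth_compl (\<Phi> w)) (d_z (\<lambda>z. c *s L z) w)"
      unfolding x by (simp only: perp_proj[OF w])
    moreover have "smooth_on B (\<lambda>z. c *s L z)" by (rule smooth_on_linear[OF B L bounded_linear_vector_scalar_right])
    moreover have "\<forall>z\<in>B. c *s L z \<in> \<Phi> z" using \<Phi>_in vec.subspace_scale[OF subspace_\<Phi>] by blast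
    ultimately show "x \<in> plane_image d_z \<Phi> w" using B w unfolding plane_image_def by blast
  qed
qed

text \<open>Differentiating (s, L) = (s, f) = (s, cnj L) = 0 for a section s of the complement
  leaves a derivative along cnj L only, with coefficient proportional to (s, cnj Q). The section cnj
  Q makes it nonzero.\<close>

lemma plane_image_perp:
  assumes w: "w \<in> B" and Q0: "Q w \<noteq> 0"
  shows "plane_image d_z (\<lambda>z. orth_compl (\<Phi> z)) w = vec.span {vec_cnj (L w)}"
proof -
  have key: "orth_proj (orth_compl (orth_compl (\<Phi> w))) (d_z s w)
      = (- hermitian (s w) (vec_cnj (Q w)) / hermitian (L w) (L w)) *s vec_cnj (L w)"
    if W: "open W" "w \<in> W" "smooth_on W s" "\<And>z. z \<in> W \<Longrightarrow> s z \<in> orth_compl (\<Phi> z)" for W s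
  proof -
    let ?S = "W \<inter> B"
    have S: "open ?S" "w \<in> ?S" using W B w by auto
    note ws = smooth_on_has_wirtinger[OF W(3,2)]
    have s: "hermitian (s z) (L z) = 0" "hermitian (s z) (f z) = 0" "hermitian (s z) (vec_cnj (L z)) = 0" if "z \<in> ?S" for z
      using W(4)[of z] that by (auto simp: perp_\<Phi>)
    note z = has_wirtinger1_zero(1)[OF S s(1) has_wirtinger1_hermitian[OF ws wL[OF w]]]
      has_wirtinger1_zero(1)[OF S s(2) has_wirtinger1_hermitian[OF ws wf[OF w]]]
      has_wirtinger1_zero(1)[OF S s(3) has_wirtinger1_hermitian[OF ws wLc[OF w]]]
    have "hermitian (d_z s w) (L w) = 0" "hermitian (d_z s w) (f w) = 0"
      "hermitian (d_z s w) (vec_cnj (L w)) = - hermitian (s w) (vec_cnj (Q w))"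
      using z s[OF S(2)] by (simp_all add: eq_neg_iff_add_eq_0)
    then show ?thesis unfolding orth_compl_orth_compl[OF subspace_\<Phi>] proj_\<Phi>(2)[OF w] by simp
  qed
  show ?thesis
  proof
    show "plane_image d_z (\<lambda>z. orth_compl (\<Phi> z)) w \<subseteq> vec.span {vec_cnj (L w)}"
    proof
      fix x assume "x \<in> plane_image d_z (\<lambda>z. orth_compl (\<Phi> z)) w"
      then obtain s W where W: "open W" "w \<in> W" "smooth_on W s" "\<And>z. z \<in> W \<Longrightarrow> s z \<in> orth_compl (\<Phi> z)"
        and x: "x = orth_proj (orth_compl (orth_compl (\<Phi> w))) (d_z s w)" unfolding plane_image_def by blast
      have "x = (- hermitian (s w) (vec_cnj (Q w)) / hermitian (L w) (L w)) *s vec_cnj (L w)"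
        unfolding x by (rule key[OF W])
      then show "x \<in> vec.span {vec_cnj (L w)}" unfolding span_1 by blast
    qed
    show "vec.span {vec_cnj (L w)} \<subseteq> plane_image d_z (\<lambda>z. orth_compl (\<Phi> z)) w"
    proof
      fix x assume "x \<in> vec.span {vec_cnj (L w)}"
      then obtain c where x: "x = c *s vec_cnj (L w)" by (auto simp: span_1)
      \<comment> \<open>Chosen so that the coefficient in \<open>key\<close> becomes c for the
        section k cnj Q.\<close>
      define k where "k = - c * hermitian (L w) (L w) / hermitian (Q w) (Q w)"
      have sm: "smooth_on B (\<lambda>z. k *s vec_cnj (Q z))"
        by (rule smooth_on_linear[OF B smooth_on_vec_cnj[OF B sQ] bounded_linear_vector_scalar_right])
      have mem: "\<And>z. z \<in> B \<Longrightarrow> k *s vec_cnj (Q z) \<in> orth_compl (\<Phi> z)"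
        using Q_perp vec.subspace_scale[OF subspace_orth_compl] by blast
      have eq: "- hermitian (k *s vec_cnj (Q w)) (vec_cnj (Q w)) / hermitian (L w) (L w) = c"
        using Q0 LL[OF w] by (simp add: k_def hermitian_vec_cnj hermitian_cnj)
      have "x = orth_proj (orth_compl (orth_compl (\<Phi> w))) (d_z (\<lambda>z. k *s vec_cnj (Q z)) w)"
        by (simp only: key[OF B w sm mem] x eq)
      then show "x \<in> plane_image d_z (\<lambda>z. orth_compl (\<Phi> z)) w" using B w sm mem unfolding plane_image_def by blast
    qed
  qed
qed

end

lemma plane_image_line:
  assumes S: "open S" and f: "smooth_on S f" and re: "\<And>z. z \<in> S \<Longrightarrow> vec_cnj (f z) = f z"
    and u: "\<And>z. z \<in> S \<Longrightarrow> hermitian (f z) (f z) = 1" and w: "w \<in> S"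
    and perp: "hermitian (d_z f w) (f w) = 0"
  shows "plane_image d_z (\<lambda>z. vec.span {f z}) w = vec.span {d_z f w}"
proof -
  have f0: "f w \<noteq> 0" using u[OF w] by auto
  have key: "orth_proj (orth_compl (vec.span {f w})) (x *s f w + y *s d_z f w) = y *s d_z f w" for x y
    unfolding orth_proj_orth_compl[OF vec.subspace_span] orth_proj_span_1[OF f0] using u[OF w] perp by simp
  note wf = smooth_on_has_wirtinger[OF f w]
  show ?thesis
  proof
    show "plane_image d_z (\<lambda>z. vec.span {f z}) w \<subseteq> vec.span {d_z f w}"
    proof
      fix x assume "x \<in> plane_image d_z (\<lambda>z. vec.span {f z}) w"
      then obtain s W where W: "open W" "w \<in> W" "smooth_on W s" "\<And>z. z \<in> W \<Longrightarrow> s z \<in> vec.span {f z}"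
        and x: "x = orth_proj (orth_compl (vec.span {f w})) (d_z s w)" unfolding plane_image_def by blast
      have T: "open (W \<inter> S)" "w \<in> W \<inter> S" using W S w by auto
      have "smooth_on (W \<inter> S) s" "smooth_on (W \<inter> S) f" using W(3) f by (auto intro: smooth_on_subset)
      then have "smooth_on (W \<inter> S) (\<lambda>z. hermitian (s z) (f z))" by (rule smooth_on_hermitian[OF T(1)])
      then obtain x1 x2 where 1: "has_wirtinger1 (\<lambda>z. hermitian (s z) (f z)) x1 x2 w"
        using smooth_on_has_wirtinger1 T(2) by metis
      have "s z = hermitian (s z) (f z) *s f z" if z: "z \<in> W \<inter> S" for z
        using W(4)[of z] z u[of z] by (auto simp: span_1)
      then have "d_z s w = d_z (\<lambda>z. hermitian (s z) (f z) *s f z) w" by (rule d_cong(1)[OF T])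
      also have "\<dots> = x1 *s f w + hermitian (s w) (f w) *s d_z f w"
        by (rule has_wirtinger_d(1)[OF has_wirtinger_smult[OF 1 wf]])
      finally have d: "d_z s w = x1 *s f w + hermitian (s w) (f w) *s d_z f w" .
      have "x = hermitian (s w) (f w) *s d_z f w" unfolding x d by (rule key)
      then show "x \<in> vec.span {d_z f w}" unfolding span_1 by blast
    qed
    show "vec.span {d_z f w} \<subseteq> plane_image d_z (\<lambda>z. vec.span {f z}) w"
    proof
      fix x assume "x \<in> vec.span {d_z f w}"
      then obtain c where x: "x = c *s d_z f w" by (auto simp: span_1)
      have "d_z (\<lambda>z. c *s f z) w = 0 *s f w + c *s d_z f w"
        using has_wirtinger_d(1)[OF has_wirtinger_smult[OF has_wirtinger1_const[of c] wf]] by simp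
      then have "x = orth_proj (orth_compl (vec.span {f w})) (d_z (\<lambda>z. c *s f z) w)" unfolding x by (simp only: key)
      moreover have "smooth_on S (\<lambda>z. c *s f z)" by (rule smooth_on_linear[OF S f bounded_linear_vector_scalar_right])
      moreover have "\<forall>z\<in>S. c *s f z \<in> vec.span {f z}" by (auto simp: span_1)
      ultimately show "x \<in> plane_image d_z (\<lambda>z. vec.span {f z}) w" using S w unfolding plane_image_def by blast
    qed
  qed
qed

section \<open>Harmonicity\<close>

text \<open>The Laplacian is 4 d_z d_zbar, and \<beta> is the zbar-derivative of u.\<close>

lemma laplacian_wirtinger:
  fixes u :: "complex \<Rightarrow> real"
  assumes S: "open S" "w \<in> S" and u: "\<And>z. z \<in> S \<Longrightarrow> has_wirtinger1 (\<lambda>z. of_real (u z)) (cnj (\<beta> z)) (\<beta> z) z"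
    and \<beta>: "has_wirtinger1 \<beta> \<gamma> \<delta> w"
  shows "laplacian u w = 4 * Re \<gamma>"
proof -
  have D: "frechet_derivative u (at z) v = 2 * Re (cnj v * \<beta> z)" if z: "z \<in> S" for v z
  proof -
    have "((\<lambda>z. of_real (u z) :: complex) has_derivative (\<lambda>v. v * cnj (\<beta> z) + cnj v * \<beta> z)) (at z)"
      using u[OF z] by (simp add: has_wirtinger1_def)
    from bounded_linear.has_derivative[OF bounded_linear_Re this]
    have "(u has_derivative (\<lambda>v. Re (v * cnj (\<beta> z) + cnj v * \<beta> z))) (at z)" by simp
    from frechet_derivative_at[OF this, symmetric] show ?thesis by simp
  qed
  have D2: "frechet_derivative (\<lambda>z. frechet_derivative u (at z) v) (at w) v = 2 * Re (cnj v * (v * \<gamma> + cnj v * \<delta>))" for v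
  proof -
    have "(\<beta> has_derivative (\<lambda>v. v * \<gamma> + cnj v * \<delta>)) (at w)" using \<beta> by (simp add: has_wirtinger1_def)
    then have h: "((\<lambda>z. 2 * Re (cnj v * \<beta> z)) has_derivative (\<lambda>x. 2 * Re (cnj v * (x * \<gamma> + cnj x * \<delta>)))) (at w)"
      by (intro has_derivative_mult_right bounded_linear.has_derivative[OF bounded_linear_Re])
    have "frechet_derivative (\<lambda>z. frechet_derivative u (at z) v) (at w) = frechet_derivative (\<lambda>z. 2 * Re (cnj v * \<beta> z)) (at w)"
      by (rule frechet_derivative_cong_open[OF S D])
    also have "\<dots> = (\<lambda>x. 2 * Re (cnj v * (x * \<gamma> + cnj x * \<delta>)))"
      by (rule frechet_derivative_at[OF h, symmetric])
    finally show ?thesis by simp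
  qed
  show ?thesis unfolding laplacian_def D2 by (simp add: algebra_simps)
qed

lemma laplacian_linear:
  assumes S: "open S" "w \<in> S" and g: "smooth_on S g" and T: "bounded_linear T"
  shows "laplacian (\<lambda>z. T (g z)) w = T (laplacian g w)"
proof -
  have "frechet_derivative (\<lambda>z. frechet_derivative (\<lambda>z. T (g z)) (at z) v) (at w) x
      = T (frechet_derivative (\<lambda>z. frechet_derivative g (at z) v) (at w) x)" for v x
  proof -
    have "frechet_derivative (\<lambda>z. frechet_derivative (\<lambda>z. T (g z)) (at z) v) (at w)
      = frechet_derivative (\<lambda>z. T (frechet_derivative g (at z) v)) (at w)"
      by (rule frechet_derivative_cong_open[OF S]) (rule frechet_derivative_linear_comp[OF g _ T])
    then show ?thesis using frechet_derivative_linear_comp[OF smooth_on_frechet[OF g] S(2) T] by simp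
  qed
  then show ?thesis unfolding laplacian_def by (simp add: linear_add[OF bounded_linear.linear[OF T]])
qed

lemma laplacian_cong:
  assumes S: "open S" "w \<in> S" "\<And>z. z \<in> S \<Longrightarrow> f z = g z"
  shows "laplacian f w = laplacian g w"
proof -
  have "frechet_derivative (\<lambda>z. frechet_derivative f (at z) v) (at w)
      = frechet_derivative (\<lambda>z. frechet_derivative g (at z) v) (at w)" for v
    by (rule frechet_derivative_cong_open[OF S(1,2)]) (rule fun_cong[OF frechet_derivative_cong_open[OF S(1) _ S(3)]])
  then show ?thesis unfolding laplacian_def by simp
qed

text \<open>Moves the Euclidean metric on matrices to the Hermitian form, where Wirtinger calculus
  applies.\<close>

lemma inner_outer: "outer x y \<bullet> X = Re (hermitian x (X *v y))"
  by (simp add: inner_vec_def outer_def hermitian_def matrix_vector_mult_def inner_complex_def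
      sum_distrib_left algebra_simps sum_subtractf sum.distrib)

lemma bounded_linear_matrix_vector: "bounded_linear (\<lambda>y :: complex^'n. (X :: complex^'n^'m) *v y)"
  by (rule bounded_bilinear.bounded_linear_right[OF bounded_bilinear_matrix_vector_mult])

lemma has_wirtinger_matrix:
  assumes "has_wirtinger g a b w"
  shows "has_wirtinger (\<lambda>z. X *v g z) (X *v a) (X *v b) w"
proof -
  have "((\<lambda>z. X *v g z) has_derivative (\<lambda>v. X *v (v *s a + cnj v *s b))) (at w)"
    using bounded_linear.has_derivative[OF bounded_linear_matrix_vector] assms unfolding has_wirtinger_def by blast
  then show ?thesis unfolding has_wirtinger_def
    by (simp add: matrix_vector_right_distrib vector_scalar_commute)
qed

context frame
begin

text \<open>\<open>proj_form X\<close> is the complex valued pairing of the projection onto \<open>\<Phi>\<close> with \<open>X\<close>. Its derivatives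
  express that \<open>dbar \<pi> = n (L Q* + Qbar Lbar*)\<close> for \<open>n = 1 / |L|^2\<close>.\<close>

definition mform :: "complex^7^7 \<Rightarrow> complex^7 \<Rightarrow> complex^7 \<Rightarrow> complex" where
  "mform X x y = hermitian x (X *v y)"

definition n where "n z = inverse (hermitian (L z) (L z))"

definition proj_form where
  "proj_form X z = n z * (mform X (L z) (L z) + mform X (vec_cnj (L z)) (vec_cnj (L z))) + mform X (f z) (f z)"

definition proj_form_zbar where
  "proj_form_zbar X z = n z * (mform X (L z) (Q z) + mform X (vec_cnj (Q z)) (vec_cnj (L z)))"

definition proj_form_z where
  "proj_form_z X z = n z * (mform X (Q z) (L z) + mform X (vec_cnj (L z)) (vec_cnj (Q z)))"

lemma mform_linear: "mform X (x + y) z = mform X x z + mform X y z" "mform X z (x + y) = mform X z x + mform X z y"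
  "mform X (k *s x) z = k * mform X x z" "mform X z (k *s x) = cnj k * mform X z x"
  "mform X (- x) z = - mform X x z" "mform X z (- x) = - mform X z x"
  by (simp_all add: mform_def matrix_vector_right_distrib vector_scalar_commute
      linear_neg[OF bounded_linear.linear[OF bounded_linear_matrix_vector]])

lemma has_wirtinger1_mform:
  assumes "has_wirtinger g g1 g2 v" "has_wirtinger h h1 h2 v"
  shows "has_wirtinger1 (\<lambda>z. mform X (g z) (h z)) (mform X g1 (h v) + mform X (g v) h2) (mform X g2 (h v) + mform X (g v) h1) v"
  unfolding mform_def by (rule has_wirtinger1_hermitian[OF assms(1) has_wirtinger_matrix[OF assms(2)]])

lemma has_wirtinger1_n:
  assumes z: "z \<in> B"
  shows "has_wirtinger1 n (- a z * n z) (- cnj (a z) * n z) z"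
proof -
  have "has_wirtinger1 (\<lambda>z. hermitian (L z) (L z)) (a z * hermitian (L z) (L z)) (cnj (a z) * hermitian (L z) (L z)) z"
    using has_wirtinger1_hermitian[OF wL[OF z] wL[OF z]] orthL[OF z] orthQ[OF z] by simp
  from has_wirtinger1_inverse[OF this LL[OF z]]
  have "has_wirtinger1 n (- (a z * hermitian (L z) (L z)) * inverse (hermitian (L z) (L z)) ^ 2)
      (- (cnj (a z) * hermitian (L z) (L z)) * inverse (hermitian (L z) (L z)) ^ 2) z"
    unfolding n_def[abs_def] .
  moreover have "- (x * hermitian (L z) (L z)) * inverse (hermitian (L z) (L z)) ^ 2 = - x * n z" for x
    using LL[OF z] by (simp add: n_def power2_eq_square field_simps)
  ultimately show ?thesis by (simp only:)
qed

lemma n_b: "z \<in> B \<Longrightarrow> n z * b z = - cnj (p z)" "z \<in> B \<Longrightarrow> n z * cnj (b z) = - p z"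
  using b_eq[of z] LL[of z] by (simp_all add: n_def hermitian_cnj)

text \<open>The terms with a cancel against the derivative of n = 1 / |L|^2, and those with b
  against those with p because n b = -cnj p. What remains pairs vectors of \<Phi> with vectors of
  its complement.\<close>

lemma has_wirtinger1_proj_form:
  assumes z: "z \<in> B"
  shows "has_wirtinger1 (proj_form X) (proj_form_z X z) (proj_form_zbar X z) z"
proof -
  let ?T = "mform X" and ?Lc = "vec_cnj (L z)" and ?Qc = "vec_cnj (Q z)"
  have 1: "has_wirtinger1 (proj_form X) (- a z * n z * (?T (L z) (L z) + ?T ?Lc ?Lc)
      + n z * ((?T (a z *s L z + Q z) (L z) + ?T (L z) (b z *s f z)) + (?T (cnj (b z) *s f z) ?Lc + ?T ?Lc (cnj (a z) *s ?Lc + ?Qc)))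
      + (?T (p z *s L z) (f z) + ?T (f z) (cnj (p z) *s ?Lc)))
     (- cnj (a z) * n z * (?T (L z) (L z) + ?T ?Lc ?Lc)
      + n z * ((?T (b z *s f z) (L z) + ?T (L z) (a z *s L z + Q z)) + (?T (cnj (a z) *s ?Lc + ?Qc) ?Lc + ?T ?Lc (cnj (b z) *s f z)))
      + (?T (cnj (p z) *s ?Lc) (f z) + ?T (f z) (p z *s L z))) z"
    unfolding proj_form_def[abs_def]
    by (rule has_wirtinger1_add[OF has_wirtinger1_mult[OF has_wirtinger1_n[OF z] has_wirtinger1_add[OF
          has_wirtinger1_mform[OF wL[OF z] wL[OF z]] has_wirtinger1_mform[OF wLc[OF z] wLc[OF z]]]]
          has_wirtinger1_mform[OF wf[OF z] wf[OF z]]])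
  have "- cnj (a z) * n z * (?T (L z) (L z) + ?T ?Lc ?Lc)
      + n z * ((?T (b z *s f z) (L z) + ?T (L z) (a z *s L z + Q z)) + (?T (cnj (a z) *s ?Lc + ?Qc) ?Lc + ?T ?Lc (cnj (b z) *s f z)))
      + (?T (cnj (p z) *s ?Lc) (f z) + ?T (f z) (p z *s L z))
    = proj_form_zbar X z + (n z * b z) * (?T (f z) (L z) + ?T ?Lc (f z)) + cnj (p z) * (?T ?Lc (f z) + ?T (f z) (L z))"
    by (simp add: mform_linear proj_form_zbar_def algebra_simps)
  then have 2: "- cnj (a z) * n z * (?T (L z) (L z) + ?T ?Lc ?Lc)
      + n z * ((?T (b z *s f z) (L z) + ?T (L z) (a z *s L z + Q z)) + (?T (cnj (a z) *s ?Lc + ?Qc) ?Lc + ?T ?Lc (cnj (b z) *s f z)))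
      + (?T (cnj (p z) *s ?Lc) (f z) + ?T (f z) (p z *s L z)) = proj_form_zbar X z"
    unfolding n_b(1)[OF z] by (simp add: algebra_simps)
  have "- a z * n z * (?T (L z) (L z) + ?T ?Lc ?Lc)
      + n z * ((?T (a z *s L z + Q z) (L z) + ?T (L z) (b z *s f z)) + (?T (cnj (b z) *s f z) ?Lc + ?T ?Lc (cnj (a z) *s ?Lc + ?Qc)))
      + (?T (p z *s L z) (f z) + ?T (f z) (cnj (p z) *s ?Lc))
    = proj_form_z X z + (n z * cnj (b z)) * (?T (L z) (f z) + ?T (f z) ?Lc) + p z * (?T (L z) (f z) + ?T (f z) ?Lc)"
    by (simp add: mform_linear proj_form_z_def algebra_simps)
  then have 3: "- a z * n z * (?T (L z) (L z) + ?T ?Lc ?Lc)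
      + n z * ((?T (a z *s L z + Q z) (L z) + ?T (L z) (b z *s f z)) + (?T (cnj (b z) *s f z) ?Lc + ?T ?Lc (cnj (a z) *s ?Lc + ?Qc)))
      + (?T (p z *s L z) (f z) + ?T (f z) (cnj (p z) *s ?Lc)) = proj_form_z X z"
    unfolding n_b(2)[OF z] by (simp add: algebra_simps)
  show ?thesis using 1 unfolding 2 3 .
qed

lemma proj_inner:
  assumes z: "z \<in> B"
  shows "proj_matrix (\<Phi> z) \<bullet> X = Re (proj_form X z)"
proof -
  have "outer_normalized x \<bullet> X = Re (inverse (hermitian x x) * mform X x x)" for x
    unfolding outer_normalized_def inner_outer mform_def by simp
  then show ?thesis
    unfolding proj_\<Phi>(1)[OF z] proj_form_def n_def
    by (simp add: inner_add_left hermitian_vec_cnj hermitian_cnj fu[OF z] algebra_simps)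
qed

text \<open>For Q = 0 both derivatives of every \<open>proj_form X\<close> vanish, and pairing with
  all X determines the projection.\<close>

lemma proj_constant:
  assumes Q: "\<And>w. w \<in> B \<Longrightarrow> Q w = 0" and cv: "convex B" and w: "w \<in> B" "w' \<in> B"
  shows "\<Phi> w = \<Phi> w'"
proof -
  have "proj_matrix (\<Phi> w) \<bullet> X = proj_matrix (\<Phi> w') \<bullet> X" for X
  proof -
    have "(proj_form X has_derivative (\<lambda>v. 0)) (at z within B)" if z: "z \<in> B" for z
    proof -
      have "vec_cnj (Q z) = 0" using Q[OF z] by simp
      then have "proj_form_z X z = 0" "proj_form_zbar X z = 0"
        using Q[OF z] by (simp_all add: proj_form_z_def proj_form_zbar_def mform_def)
      then show ?thesis using has_wirtinger1_proj_form[OF z, of X]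
        by (simp add: has_wirtinger1_def has_derivative_at_withinI)
    qed
    then have "proj_form X w = proj_form X w'" by (metis has_derivative_zero_unique cv w)
    then show ?thesis by (simp add: proj_inner[OF w(1)] proj_inner[OF w(2)])
  qed
  then have "\<forall>X. proj_matrix (\<Phi> w) \<bullet> X = proj_matrix (\<Phi> w') \<bullet> X" by (rule allI)
  then have "proj_matrix (\<Phi> w) = proj_matrix (\<Phi> w')" by (rule vector_eq_rdot[THEN iffD1])
  then show ?thesis by (rule subspace_eqI[OF subspace_\<Phi> subspace_\<Phi>])
qed

text \<open>Tangent vectors of the Grassmannian are off-diagonal with respect to \<open>\<Phi>\<close>, hence the second
  derivative of the projection is orthogonal to them.\<close>

lemma laplacian_proj:
  assumes w: "w \<in> B" and herm: "\<And>x y. hermitian (X *v x) y = hermitian x (X *v y)"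
    and tan: "X = X ** proj_matrix (\<Phi> w) + proj_matrix (\<Phi> w) ** X"
  shows "laplacian (\<lambda>z. proj_matrix (\<Phi> z)) w \<bullet> X = 0"
proof -
  let ?T = "mform X" and ?Lc = "vec_cnj (L w)" and ?Qc = "vec_cnj (Q w)"
  have Tc: "cnj (?T x y) = ?T y x" for x y unfolding mform_def hermitian_cnj by (rule herm)
  have Xy: "X *v y = X *v orth_proj (\<Phi> w) y + orth_proj (\<Phi> w) (X *v y)" for y
  proof -
    have "X *v y = (X ** proj_matrix (\<Phi> w) + proj_matrix (\<Phi> w) ** X) *v y" using tan by simp
    then show ?thesis
      by (simp only: matrix_vector_mult_add_rdistrib matrix_vector_mul_assoc[symmetric] proj_matrix_mult[OF subspace_\<Phi>])
  qed
  \<comment> \<open>\<open>T1\<close> and \<open>T2\<close> express that X maps \<Phi> into its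
    complement and the complement into \<Phi>.\<close>
  have T1: "?T x y = 0" if "x \<in> \<Phi> w" "y \<in> \<Phi> w" for x y
  proof -
    have "orth_proj (\<Phi> w) (X *v y) = 0" using Xy[of y] orth_proj_ident[OF subspace_\<Phi> that(2)] by simp
    then have "X *v y \<in> orth_compl (\<Phi> w)" using orth_proj(2)[OF subspace_\<Phi>, of "X *v y" w] by simp
    then have "hermitian (X *v y) x = 0" using that by (simp add: orth_compl_def)
    then show ?thesis unfolding mform_def by (rule hermitian_zero_commute[THEN iffD1])
  qed
  have T2: "?T x y = 0" if "x \<in> orth_compl (\<Phi> w)" "y \<in> orth_compl (\<Phi> w)" for x y
  proof -
    have "X *v y = orth_proj (\<Phi> w) (X *v y)" using Xy[of y] orth_proj_zero[OF subspace_\<Phi> that(2)] by simp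
    then have "X *v y \<in> \<Phi> w" using orth_proj(1)[OF subspace_\<Phi>, of w "X *v y"] by simp
    then show ?thesis using that unfolding mform_def orth_compl_def by blast
  qed
  have "cnj (proj_form X z) = proj_form X z" for z by (simp add: proj_form_def n_def hermitian_cnj Tc)
  then have re: "of_real (Re (proj_form X z)) = proj_form X z" for z by (intro of_real_Re) (simp add: Reals_cnj_iff)
  have wh: "has_wirtinger1 (\<lambda>z. of_real (Re (proj_form X z))) (cnj (proj_form_zbar X z)) (proj_form_zbar X z) z"
    if z: "z \<in> B" for z
  proof -
    have "cnj (proj_form_zbar X z) = proj_form_z X z"
      by (simp add: proj_form_zbar_def proj_form_z_def n_def hermitian_cnj Tc)
    then show ?thesis using has_wirtinger1_proj_form[OF z, of X] unfolding re by simp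
  qed
  define c where "c = hermitian (Q w) (Q w) / hermitian (L w) (L w)"
  have cc: "cnj c = c" by (simp add: c_def hermitian_cnj)
  have wQ: "has_wirtinger Q (d_z Q w) (- c *s L w) w"
    using smooth_on_has_wirtinger[OF sQ w] Q_zbar[OF w] by (simp add: c_def)
  have wQc: "has_wirtinger (\<lambda>z. vec_cnj (Q z)) (- c *s ?Lc) (vec_cnj (d_z Q w)) w"
    using has_wirtinger_vec_cnj[OF wQ] cc by (simp add: vec_eq_iff)
  \<comment> \<open>Besides terms with a, which cancel, the derivative pairs Q, cnj Q, L and cnj L
    only with themselves, and these diagonal values of \<open>mform X\<close> vanish by
    \<open>T1\<close> and \<open>T2\<close>.\<close>
  have "\<exists>\<delta>. has_wirtinger1 (proj_form_zbar X) (- a w * n w * (?T (L w) (Q w) + ?T ?Qc ?Lc)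
     + n w * ((?T (a w *s L w + Q w) (Q w) + ?T (L w) (- c *s L w)) + (?T (- c *s ?Lc) ?Lc + ?T ?Qc (cnj (a w) *s ?Lc + ?Qc)))) \<delta> w"
    unfolding proj_form_zbar_def[abs_def]
    by (intro exI, rule has_wirtinger1_mult[OF has_wirtinger1_n[OF w] has_wirtinger1_add[OF
          has_wirtinger1_mform[OF wL[OF w] wQ] has_wirtinger1_mform[OF wQc wLc[OF w]]]])
  moreover have "- a w * n w * (?T (L w) (Q w) + ?T ?Qc ?Lc)
     + n w * ((?T (a w *s L w + Q w) (Q w) + ?T (L w) (- c *s L w)) + (?T (- c *s ?Lc) ?Lc + ?T ?Qc (cnj (a w) *s ?Lc + ?Qc))) = 0"
  proof -
    have "?T (Q w) (Q w) = 0" "?T ?Qc ?Qc = 0" using Q_perp[OF w] by (auto intro!: T2)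
    moreover have "?T (L w) (L w) = 0" "?T ?Lc ?Lc = 0" using \<Phi>_in[OF w] by (auto intro!: T1)
    moreover have "- c *s x = - (c *s x)" for x :: "complex^7" by (simp add: vec_eq_iff)
    ultimately show ?thesis by (simp add: mform_linear algebra_simps)
  qed
  ultimately obtain \<delta> where "has_wirtinger1 (proj_form_zbar X) 0 \<delta> w" by (metis (no_types))
  from laplacian_wirtinger[OF B w wh this] have lap: "laplacian (\<lambda>z. Re (proj_form X z)) w = 0" by simp
  have "laplacian (\<lambda>z. proj_matrix (\<Phi> z)) w \<bullet> X = laplacian (\<lambda>z. proj_matrix (\<Phi> z) \<bullet> X) w"
    by (rule laplacian_linear[OF B w smooth_proj_\<Phi> bounded_linear_inner_left, symmetric])
  also have "\<dots> = laplacian (\<lambda>z. Re (proj_form X z)) w"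
    by (rule laplacian_cong[OF B w proj_inner])
  finally show ?thesis using lap by simp
qed

end

text \<open>Differentiate at 0 the two identities of a curve of orthogonal projections: idempotence
  and self-adjointness.\<close>

lemma tangent_proj_matrix:
  fixes P :: "complex^'n^'n"
  assumes N: "\<And>A. A \<in> N \<Longrightarrow> \<exists>V. vec.subspace V \<and> A = proj_matrix V" and X: "X \<in> tangent_vectors N P"
  shows "X = X ** P + P ** X" "hermitian (X *v x) y = hermitian x (X *v y)"
proof -
  obtain \<gamma> e where e: "e > 0" and im: "\<And>t. t \<in> {-e<..<e} \<Longrightarrow> \<gamma> t \<in> N" and P: "\<gamma> 0 = P"
    and D: "(\<gamma> has_vector_derivative X) (at (0::real))"
    using X unfolding tangent_vectors_def by blast
  have D': "(\<gamma> has_derivative (\<lambda>h. h *\<^sub>R X)) (at 0)" using D by (simp add: has_vector_derivative_def)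
  have bl: "bounded_linear (\<lambda>A :: complex^'n^'n. A *v x)" for x
    by (rule bounded_bilinear.bounded_linear_left[OF bounded_bilinear_matrix_vector_mult])
  have ev: "\<forall>\<^sub>F t in nhds 0. Q (\<gamma> t)" if "\<And>V. vec.subspace V \<Longrightarrow> Q (proj_matrix V)" for Q
    unfolding eventually_nhds using im e N that by (intro exI[of _ "{-e<..<e}"]) fastforce
  have Dx: "((\<lambda>t. \<gamma> t *v x) has_derivative (\<lambda>h. h *\<^sub>R (X *v x))) (at 0)" for x
    using bounded_linear.has_derivative[OF bl D', of x]
    by (simp add: linear_scale[OF bounded_linear.linear[OF bl]])
  have "X *v x = (X ** P + P ** X) *v x" for x
  proof -
    have "((\<lambda>t. \<gamma> t *v x - \<gamma> t *v (\<gamma> t *v x)) has_derivative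
        (\<lambda>h. h *\<^sub>R (X *v x) - (\<gamma> 0 *v (h *\<^sub>R (X *v x)) + (h *\<^sub>R X) *v (\<gamma> 0 *v x)))) (at 0)"
      by (intro has_derivative_diff Dx bounded_bilinear.FDERIV[OF bounded_bilinear_matrix_vector_mult D'])
    moreover have "\<forall>\<^sub>F t in nhds 0. \<gamma> t *v x - \<gamma> t *v (\<gamma> t *v x) = 0"
      by (rule ev) (simp add: proj_matrix_mult orth_proj_ident[OF _ orth_proj(1)])
    ultimately have "(\<lambda>h. h *\<^sub>R (X *v x) - (\<gamma> 0 *v (h *\<^sub>R (X *v x)) + (h *\<^sub>R X) *v (\<gamma> 0 *v x))) = (\<lambda>h. 0)"
      by (rule has_derivative_eventually_const)
    from fun_cong[OF this, of 1] show ?thesis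
      by (simp add: P matrix_vector_mult_add_rdistrib matrix_vector_mul_assoc add.commute)
  qed
  then show "X = X ** P + P ** X" by (simp add: matrix_eq)
  have "((\<lambda>t. hermitian (\<gamma> t *v x) y - hermitian x (\<gamma> t *v y)) has_derivative
      (\<lambda>h. hermitian (h *\<^sub>R (X *v x)) y - hermitian x (h *\<^sub>R (X *v y)))) (at 0)"
    by (intro has_derivative_diff bounded_linear.has_derivative[OF bounded_bilinear.bounded_linear_left[OF bounded_bilinear_hermitian] Dx]
        bounded_linear.has_derivative[OF bounded_bilinear.bounded_linear_right[OF bounded_bilinear_hermitian] Dx])
  moreover have "\<forall>\<^sub>F t in nhds 0. hermitian (\<gamma> t *v x) y - hermitian x (\<gamma> t *v y) = 0"
  proof (rule ev)
    fix V :: "(complex^'n) set" assume V: "vec.subspace V"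
    have "hermitian (x - orth_proj V x) (orth_proj V y) = 0" "hermitian (y - orth_proj V y) (orth_proj V x) = 0"
      using orth_proj[OF V] unfolding orth_compl_def by blast+
    moreover from this(2) have "hermitian (orth_proj V x) (y - orth_proj V y) = 0" by (rule hermitian_zero_commute[THEN iffD1])
    ultimately show "hermitian (proj_matrix V *v x) y - hermitian x (proj_matrix V *v y) = 0"
      by (simp add: proj_matrix_mult[OF V])
  qed
  ultimately have "(\<lambda>h. hermitian (h *\<^sub>R (X *v x)) y - hermitian x (h *\<^sub>R (X *v y))) = (\<lambda>h. 0)"
    by (rule has_derivative_eventually_const)
  from fun_cong[OF this, of 1] show "hermitian (X *v x) y = hermitian x (X *v y)" by simp
qed

section \<open>Associative subspaces\<close>

lemma cross7_cross7_real:
  fixes u v :: "real^7"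
  shows "cross7 u (cross7 u v) = (u \<bullet> v) *\<^sub>R u - (u \<bullet> u) *\<^sub>R v"
  using cross7_cross7_left[of u v] unfolding bilin_inner
  by (simp add: vec_eq_iff)

lemma cross7_real_orthogonal: "u \<bullet> cross7 u v = 0" "v \<bullet> cross7 u v = 0" for u v :: "real^7"
  using cross7_orthogonal(1)[of u v] cross7_orthogonal(2)[of v u] by (simp_all add: bilin_inner)

lemma oct_mult_eq:
  fixes x y :: "real octonion"
  shows "oct_mult x y = (fst x * fst y - snd x \<bullet> snd y, fst x *\<^sub>R snd y + fst y *\<^sub>R snd x + cross7 (snd x) (snd y))"
  by (simp add: oct_mult_def cross7_nth vec_eq_iff inner_vec_def)

text \<open>By the alternative law, u, v and u \<times> v multiply like the quaternion
  units.\<close>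

lemma associative_subspaceI:
  fixes u v :: "real^7"
  assumes u: "norm u = 1" and v: "norm v = 1" and uv: "u \<bullet> v = 0"
  shows "associative_subspace (span {u, v, cross7 u v})"
proof -
  define w where "w = cross7 u v"
  have uu: "u \<bullet> u = 1" and vv: "v \<bullet> v = 1" using u v by (simp_all add: dot_square_norm)
  have uw: "cross7 u w = - v" using cross7_cross7_real[of u v] uu uv by (simp add: w_def)
  have vw: "cross7 v w = u"
    using cross7_cross7_real[of v u] cross7_commute[of v u] vv uv by (simp add: w_def inner_commute)
  have wu: "cross7 w u = v" "cross7 w v = - u" "cross7 v u = - w"
    using uw vw cross7_commute[of w u] cross7_commute[of w v] cross7_commute[of v u] by (simp_all add: w_def)
  have i0: "u \<bullet> w = 0" "v \<bullet> w = 0" unfolding w_def by (rule cross7_real_orthogonal)+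
  then have i1: "w \<bullet> u = 0" "w \<bullet> v = 0" "v \<bullet> u = 0" using uv by (simp_all add: inner_commute)
  have ww: "w \<bullet> w = 1"
  proof -
    have "bilin (cross7 u v) w = - bilin v (cross7 u w)" by (rule bilin_cross7_swap)
    then show ?thesis unfolding bilin_inner uw w_def[symmetric] by (simp add: vv)
  qed
  define h :: "quaternion \<Rightarrow> real octonion" where
    "h q = (fst q, (snd q $ 1) *\<^sub>R u + (snd q $ 2) *\<^sub>R v + (snd q $ 3) *\<^sub>R w)" for q
  have lin: "linear h" unfolding h_def by (rule linearI) (simp_all add: algebra_simps)
  have "h (quat_mult x y) = oct_mult (h x) (h y)" for x y
  proof -
    have "cross7 (r *\<^sub>R x) y = r *\<^sub>R cross7 x y" "cross7 x (r *\<^sub>R y) = r *\<^sub>R cross7 x y" for r and x y :: "real^7"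
      by (simp_all add: vec_eq_iff cross7_nth algebra_simps)
    moreover have inner3: "x \<bullet> y = x $ 1 * y $ 1 + x $ 2 * y $ 2 + x $ 3 * y $ 3" for x y :: "real^3"
      by (simp add: inner_vec_def sum_3)
    ultimately show ?thesis
      by (simp add: h_def quat_mult_def oct_mult_eq inner_add_left inner_add_right uu vv ww uv i0 i1
          uw vw wu w_def[symmetric] inner3 cross3_def vector_3 algebra_simps)
  qed
  moreover have "inj h"
  proof (rule injI)
    fix x y assume xy: "h x = h y"
    then have "(snd x $ 1) *\<^sub>R u + (snd x $ 2) *\<^sub>R v + (snd x $ 3) *\<^sub>R w = (snd y $ 1) *\<^sub>R u + (snd y $ 2) *\<^sub>R v + (snd y $ 3) *\<^sub>R w"
      and 0: "fst x = fst y" by (simp_all add: h_def)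
    note e = arg_cong[OF this(1), of "\<lambda>z. u \<bullet> z"] arg_cong[OF this(1), of "\<lambda>z. v \<bullet> z"] arg_cong[OF this(1), of "\<lambda>z. w \<bullet> z"]
    have "snd x $ 1 = snd y $ 1" "snd x $ 2 = snd y $ 2" "snd x $ 3 = snd y $ 3"
      using e by (simp_all add: inner_add_right uu vv ww uv i0 i1)
    then show "x = y" using 0 by (simp add: prod_eq_iff vec_eq_iff forall_3)
  qed
  ultimately have q: "quaternion_subalgebra (range h)" unfolding quaternion_subalgebra_def using lin by blast
  have sp: "span {u, v, w} = {a *\<^sub>R u + b *\<^sub>R v + c *\<^sub>R w | a b c. True}"
  proof -
    have "span {u, v, w} = {x. \<exists>a b c. x - a *\<^sub>R u - b *\<^sub>R v = c *\<^sub>R w}"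
      by (auto simp: span_insert span_singleton)
    then show ?thesis by (auto simp: algebra_simps)
  qed
  have "span {u, v, w} = snd ` range h"
  proof
    show "span {u, v, w} \<subseteq> snd ` range h"
    proof
      fix x assume "x \<in> span {u, v, w}"
      then obtain a b c where x: "x = a *\<^sub>R u + b *\<^sub>R v + c *\<^sub>R w" unfolding sp by blast
      have "x = snd (h (0, vector [a, b, c]))" by (simp add: h_def x)
      then show "x \<in> snd ` range h" by blast
    qed
    show "snd ` range h \<subseteq> span {u, v, w}"
    proof
      fix x assume "x \<in> snd ` range h"
      then obtain q where "x = snd (h q)" by blast
      then have "x = (snd q $ 1) *\<^sub>R u + (snd q $ 2) *\<^sub>R v + (snd q $ 3) *\<^sub>R w" by (simp add: h_def)
      then show "x \<in> span {u, v, w}" unfolding sp by blast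
    qed
  qed
  moreover have "dim (span {u, v, w}) = 3"
  proof -
    have ne: "u \<noteq> v" "u \<noteq> w" "v \<noteq> w" using uu vv ww uv i0 by auto
    have "pairwise orthogonal {u, v, w}"
      using uv i0 by (auto simp: pairwise_def orthogonal_def inner_commute)
    moreover have "0 \<notin> {u, v, w}" using uu vv ww by auto
    ultimately have "independent {u, v, w}" by (rule pairwise_orthogonal_independent)
    then show ?thesis using ne by (simp add: dim_eq_card_independent del: span_insert)
  qed
  ultimately show ?thesis unfolding associative_subspace_def w_def[symmetric] using q by (metis subspace_span)
qed

lemma oct_mult_zero: "oct_mult x y = 0 \<Longrightarrow> x = 0 \<or> y = (0 :: real octonion)"
  by (metis norm_oct_mult norm_eq_zero mult_eq_0_iff)

text \<open>The embedding h sends imaginary quaternions to imaginary octonions, so the vector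
  product of two elements is the imaginary part of a product inside the subalgebra.\<close>

lemma associative_subspace_cross7:
  assumes V: "associative_subspace V" and uv: "u \<in> V" "v \<in> V"
  shows "cross7 u v \<in> V"
proof -
  obtain h :: "quaternion \<Rightarrow> real octonion" where h: "linear h" "inj h" "\<And>x y. h (quat_mult x y) = oct_mult (h x) (h y)"
    and V': "V = snd ` range h"
    using V unfolding associative_subspace_def quaternion_subalgebra_def by blast
  have h0: "h x = 0 \<longleftrightarrow> x = 0" for x using h(1,2) by (metis linear_0 injD)
  have "quat_mult (1, 0) (1, 0) = (1, 0)" by (simp add: quat_mult_def cross_zero_left)
  then have id: "oct_mult (h (1, 0)) (h (1, 0)) = h (1, 0)" using h(3) by metis
  have sub: "oct_mult (x - y) z = oct_mult x z - oct_mult y z" for x y z :: "real octonion"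
    unfolding oct_mult_eq by (simp add: algebra_simps inner_diff_left prod_eq_iff)
  \<comment> \<open>h(1) is a nonzero idempotent; as there are no zero divisors, it is 1.\<close>
  have "oct_mult (h (1, 0) - (1, 0)) (h (1, 0)) = 0"
  proof -
    have "oct_mult (1, 0) x = x" for x :: "real octonion" by (simp add: oct_mult_eq)
    then show ?thesis unfolding sub id by simp
  qed
  moreover have "h (1, 0) \<noteq> 0" unfolding h0 by (simp add: prod_eq_iff)
  ultimately have h1: "h (1, 0) = (1, 0)" using oct_mult_zero by fastforce
  have im: "fst (h (0, q)) = 0" for q :: "real^3"
  proof -
    \<comment> \<open>The square of h(0, q) is the real number -|q|^2. Its imaginary part is twice
      the real part times the imaginary part of h(0, q), so one of the two is zero; if the imaginary
      part is, the square of the real part is nonpositive.\<close>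
    have "quat_mult (0, q) (0, q) = (- (q \<bullet> q)) *\<^sub>R (1, 0)" by (simp add: quat_mult_def cross_refl)
    then have "oct_mult (h (0, q)) (h (0, q)) = (- (q \<bullet> q)) *\<^sub>R (1, 0)"
      using h(3)[of "(0, q)" "(0, q)"] linear_scale[OF h(1), of "- (q \<bullet> q)" "(1, 0)"] h1 by simp
    then have e: "fst (h (0, q)) * fst (h (0, q)) - snd (h (0, q)) \<bullet> snd (h (0, q)) = - (q \<bullet> q)"
      "(2 * fst (h (0, q))) *\<^sub>R snd (h (0, q)) = 0"
      unfolding oct_mult_eq by (simp_all add: prod_eq_iff scaleR_2[symmetric])
    show ?thesis
    proof (cases "snd (h (0, q)) = 0")
      case True
      then have "fst (h (0, q)) * fst (h (0, q)) = - (q \<bullet> q)" using e(1) by simp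
      moreover have "q \<bullet> q \<ge> 0" "fst (h (0, q)) * fst (h (0, q)) \<ge> 0" by simp_all
      ultimately have "fst (h (0, q)) * fst (h (0, q)) = 0" by linarith
      then show ?thesis by simp
    qed (use e(2) in simp)
  qed
  have dec: "h (s, q) = (s, snd (h (0, q)))" for s q
  proof -
    have "(s, q) = s *\<^sub>R (1, 0) + (0, q)" by simp
    then have "h (s, q) = s *\<^sub>R h (1, 0) + h (0, q)" using linear_add[OF h(1)] linear_scale[OF h(1)] by metis
    then show ?thesis using im[of q] h1 by (simp add: prod_eq_iff)
  qed
  have rep: "\<exists>q. x = snd (h (0, q))" if "x \<in> V" for x
  proof -
    obtain y where "x = snd (h y)" using \<open>x \<in> V\<close> V' by blast
    then show ?thesis using dec[of "fst y" "snd y"] by (intro exI[of _ "snd y"]) simp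
  qed
  obtain q r where "u = snd (h (0, q))" "v = snd (h (0, r))" using rep uv by blast
  then have "cross7 u v = snd (oct_mult (h (0, q)) (h (0, r)))" using im by (simp add: oct_mult_eq)
  also have "\<dots> = snd (h (quat_mult (0, q) (0, r)))" using h(3) by simp
  finally show ?thesis unfolding V' by blast
qed

lemma complexification_span:
  fixes u v w :: "real^'n"
  shows "complexification (span {u, v, w}) = vec.span {cvec u, cvec v, cvec w}"
proof -
  have sp: "span {u, v, w} = {a *\<^sub>R u + b *\<^sub>R v + c *\<^sub>R w | a b c. True}"
  proof -
    have "span {u, v, w} = {x. \<exists>a b c. x - a *\<^sub>R u - b *\<^sub>R v = c *\<^sub>R w}"
      by (auto simp: span_insert span_singleton)
    then show ?thesis by (auto simp: algebra_simps)
  qed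
  show ?thesis
  proof
    show "complexification (span {u, v, w}) \<subseteq> vec.span {cvec u, cvec v, cvec w}"
    proof
      fix x assume "x \<in> complexification (span {u, v, w})"
      then obtain a b c a' b' c' where "x = cvec (a *\<^sub>R u + b *\<^sub>R v + c *\<^sub>R w) + \<i> *s cvec (a' *\<^sub>R u + b' *\<^sub>R v + c' *\<^sub>R w)"
        unfolding complexification_def sp by blast
      then have "x = (a + \<i> * a') *s cvec u + (b + \<i> * b') *s cvec v + (c + \<i> * c') *s cvec w"
        by (simp add: vec_eq_iff algebra_simps)
      then show "x \<in> vec.span {cvec u, cvec v, cvec w}" unfolding span_3 by blast
    qed
    show "vec.span {cvec u, cvec v, cvec w} \<subseteq> complexification (span {u, v, w})"
    proof
      fix x assume "x \<in> vec.span {cvec u, cvec v, cvec w}"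
      then obtain a b c where x: "x = a *s cvec u + b *s cvec v + c *s cvec w" unfolding span_3 by blast
      have "k *s y = complex_of_real (Re k) *s y + \<i> *s (complex_of_real (Im k) *s y)" for k and y :: "complex^'n"
        by (simp add: vec_eq_iff complex_eq_iff)
      then have "x = cvec (Re a *\<^sub>R u + Re b *\<^sub>R v + Re c *\<^sub>R w) + \<i> *s cvec (Im a *\<^sub>R u + Im b *\<^sub>R v + Im c *\<^sub>R w)"
        unfolding x by (simp add: vec_eq_iff complex_eq_iff algebra_simps)
      then show "x \<in> complexification (span {u, v, w})" unfolding complexification_def sp by blast
    qed
  qed
qed

lemma complexification_cvec:
  assumes "cvec x \<in> complexification V"
  shows "x \<in> V"
proof -
  obtain u v where uv: "u \<in> V" "cvec x = cvec u + \<i> *s cvec v"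
    using assms unfolding complexification_def by blast
  have "x $ i = u $ i" for i
    using arg_cong[OF uv(2), of "\<lambda>z. Re (z $ i)"] by (simp add: cvec_def)
  then have "x = u" by (simp add: vec_eq_iff)
  then show ?thesis using uv(1) by simp
qed

lemma cross7_scaleR [simp]:
  "cross7 (r *\<^sub>R x) y = r *\<^sub>R cross7 x y" "cross7 x (r *\<^sub>R y) = r *\<^sub>R cross7 x y" for x y :: "real^7"
  by (simp_all add: vec_eq_iff cross7_nth algebra_simps)

lemma cvec_real_imag: "\<exists>u v. L = cvec u + \<i> *s cvec v"
  by (intro exI[of _ "\<chi> i. Re (L $ i)"] exI[of _ "\<chi> i. Im (L $ i)"]) (simp add: vec_eq_iff cvec_def complex_eq_iff)

lemma cvec_eq_imag: "cvec u + \<i> *s cvec v = cvec u' + \<i> *s cvec v' \<Longrightarrow> u = u' \<and> v = v'"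
  by (simp add: vec_eq_iff cvec_def complex_eq_iff)

text \<open>For L = u + \<i> v the hypothesis means F \<times> u = -v and F \<times> v = u. With e =
  u / |u|, the triple F, e, F \<times> e is therefore a basis of an associative subspace whose
  complexification is the given span.\<close>

lemma type10_G2:
  assumes F: "norm F = 1" and L: "L \<noteq> 0" and FL: "cross7 (cvec F) L = \<i> *s L"
  shows "vec.span {L, cvec F, vec_cnj L} \<in> G2_SO4"
proof -
  obtain u v where uv: "L = cvec u + \<i> *s cvec v" using cvec_real_imag by blast
  have "cvec (cross7 F u) + \<i> *s cvec (cross7 F v) = cvec (- v) + \<i> *s cvec u"
    using FL unfolding uv by (simp add: cross7_cvec vec_eq_iff algebra_simps)
  then have Fu: "cross7 F u = - v" and Fv: "cross7 F v = u" using cvec_eq_imag by blast+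
  have "F \<bullet> u = 0" using cross7_real_orthogonal(1)[of F v] unfolding Fv .
  have u0: "u \<noteq> 0"
  proof
    assume "u = 0"
    then have "v = 0" using Fu by (simp add: eq_neg_iff_add_eq_0)
    then show False using L uv \<open>u = 0\<close> by simp
  qed
  define e where "e = (1 / norm u) *\<^sub>R u"
  have "associative_subspace (span {F, e, cross7 F e})"
    by (rule associative_subspaceI) (use F u0 \<open>F \<bullet> u = 0\<close> in \<open>auto simp: e_def\<close>)
  moreover have "vec.span {L, cvec F, vec_cnj L} = complexification (span {F, e, cross7 F e})"
  proof -
    define r where "r = complex_of_real (norm u)"
    have r0: "r \<noteq> 0" using u0 by (simp add: r_def)
    have ce: "cvec u = r *s cvec e" "cvec v = - r *s cvec (cross7 F e)"
      using u0 r0 Fu unfolding r_def e_def by (simp_all add: vec_eq_iff cvec_def)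
    have cL: "vec_cnj L = cvec u - \<i> *s cvec v" unfolding uv by (simp add: vec_eq_iff)
    show ?thesis unfolding complexification_span
    proof (rule equalityI; rule vec.span_minimal; (rule vec.subspace_span)?)
      have "x *s cvec F + y *s cvec e + z *s cvec (cross7 F e) \<in> vec.span {cvec F, cvec e, cvec (cross7 F e)}" for x y z
        unfolding span_3 by blast
      from this[of 0 r "- \<i> * r"] this[of 1 0 0] this[of 0 r "\<i> * r"]
      show "{L, cvec F, vec_cnj L} \<subseteq> vec.span {cvec F, cvec e, cvec (cross7 F e)}"
        unfolding cL unfolding uv ce by (simp add: vec_eq_iff vector_smult_assoc)
      have "x *s L + y *s cvec F + z *s vec_cnj L \<in> vec.span {L, cvec F, vec_cnj L}" for x y z
        unfolding span_3 by blast
      \<comment> \<open>L = r (e - \<i> F \<times> e), so e and F \<times> e are recovered from L +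
        cnj L and L - cnj L.\<close>
      from this[of 0 1 0] this[of "inverse (2 * r)" 0 "inverse (2 * r)"] this[of "\<i> * inverse (2 * r)" 0 "- \<i> * inverse (2 * r)"]
      show "{cvec F, cvec e, cvec (cross7 F e)} \<subseteq> vec.span {L, cvec F, vec_cnj L}"
      proof -
        have "cvec e = inverse (2 * r) *s L + 0 *s cvec F + inverse (2 * r) *s vec_cnj L"
          unfolding cL unfolding uv ce using r0 by (simp add: vec_eq_iff field_simps)
        moreover have "cvec (cross7 F e) = (\<i> * inverse (2 * r)) *s L + 0 *s cvec F + (- \<i> * inverse (2 * r)) *s vec_cnj L"
          unfolding cL unfolding uv ce using r0 by (simp add: vec_eq_iff field_simps)
        moreover have "cvec F = 0 *s L + 1 *s cvec F + 0 *s vec_cnj L" by simp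
        ultimately show ?thesis
          using \<open>0 *s L + 1 *s cvec F + 0 *s vec_cnj L \<in> _\<close>
            \<open>inverse (2 * r) *s L + 0 *s cvec F + inverse (2 * r) *s vec_cnj L \<in> _\<close>
            \<open>(\<i> * inverse (2 * r)) *s L + 0 *s cvec F + (- \<i> * inverse (2 * r)) *s vec_cnj L \<in> _\<close>
          by (simp only: insert_subset empty_subsetI simp_thms)
      qed
    qed
  qed
  ultimately show ?thesis unfolding G2_SO4_def by blast
qed

section \<open>From almost complex maps to harmonic maps\<close>

lemma plane_image_cong:
  assumes S: "open S" "w \<in> S" "\<And>z. z \<in> S \<Longrightarrow> \<Phi> z = \<Psi> z"
  shows "plane_image D \<Phi> w = plane_image D \<Psi> w"
proof -
  have "plane_image D \<Phi> w \<subseteq> plane_image D \<Psi> w" if eq: "\<And>z. z \<in> S \<Longrightarrow> \<Phi> z = \<Psi> z" for \<Phi> \<Psi>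
  proof
    fix x assume "x \<in> plane_image D \<Phi> w"
    then obtain s W where W: "open W" "w \<in> W" "smooth_on W s" "\<forall>z\<in>W. s z \<in> \<Phi> z"
      and x: "x = orth_proj (orth_compl (\<Phi> w)) (D s w)" unfolding plane_image_def by blast
    have "open (W \<inter> S)" "w \<in> W \<inter> S" "smooth_on (W \<inter> S) s" "\<forall>z\<in>W \<inter> S. s z \<in> \<Psi> z"
      using W S(1,2) eq by (auto intro: smooth_on_subset)
    moreover have "x = orth_proj (orth_compl (\<Psi> w)) (D s w)" using x eq[OF S(2)] by simp
    ultimately show "x \<in> plane_image D \<Psi> w" unfolding plane_image_def by blast
  qed
  from this[of \<Phi> \<Psi>] this[of \<Psi> \<Phi>] show ?thesis using S(3) by auto
qed

text \<open>Conjugation preserves sections of a real bundle and exchanges the two Wirtinger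
  derivatives.\<close>

lemma plane_image_cnj:
  fixes \<Phi> :: "complex \<Rightarrow> (complex^'n) set"
  assumes S: "open S" "w \<in> S" and re: "\<And>z. z \<in> S \<Longrightarrow> vec_cnj ` \<Phi> z = \<Phi> z"
  shows "plane_image d_zbar \<Phi> w = vec_cnj ` plane_image d_z \<Phi> w"
proof -
  have V: "orth_proj (orth_compl (\<Phi> w)) (vec_cnj x) = vec_cnj (orth_proj (orth_compl (\<Phi> w)) x)" for x
    using orth_proj_vec_cnj[OF subspace_orth_compl[of "\<Phi> w"], of x] re[OF S(2)] by (simp add: orth_compl_vec_cnj[symmetric])
  have mem: "vec_cnj x \<in> \<Phi> z" if "z \<in> S" "x \<in> \<Phi> z" for x z using re[OF that(1)] that(2) by blast
  have key: "\<exists>s' W'. open W' \<and> w \<in> W' \<and> smooth_on W' s' \<and> (\<forall>z\<in>W'. s' z \<in> \<Phi> z)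
      \<and> d_z s' w = vec_cnj (d_zbar s w) \<and> d_zbar s' w = vec_cnj (d_z s w)"
    if W: "open W" "w \<in> W" "smooth_on W s" "\<forall>z\<in>W. s z \<in> \<Phi> z" for s W
  proof -
    have o: "open (W \<inter> S)" "w \<in> W \<inter> S" using W S by auto
    have "smooth_on (W \<inter> S) (\<lambda>z. vec_cnj (s z))"
      by (rule smooth_on_vec_cnj[OF o(1) smooth_on_subset[OF W(3)]]) simp
    moreover note has_wirtinger_d(1,2)[OF has_wirtinger_vec_cnj[OF smooth_on_has_wirtinger[OF W(3,2)]]]
    ultimately show ?thesis using o W(4) mem by (intro exI[of _ "\<lambda>z. vec_cnj (s z)"] exI[of _ "W \<inter> S"]) auto
  qed
  show ?thesis
  proof
    show "plane_image d_zbar \<Phi> w \<subseteq> vec_cnj ` plane_image d_z \<Phi> w"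
    proof
      fix x assume "x \<in> plane_image d_zbar \<Phi> w"
      then obtain s W where W: "open W" "w \<in> W" "smooth_on W s" "\<forall>z\<in>W. s z \<in> \<Phi> z"
        and x: "x = orth_proj (orth_compl (\<Phi> w)) (d_zbar s w)" unfolding plane_image_def by blast
      obtain s' W' where "open W'" "w \<in> W'" "smooth_on W' s'" "\<forall>z\<in>W'. s' z \<in> \<Phi> z" "d_z s' w = vec_cnj (d_zbar s w)"
        using key[OF W] by blast
      then have "orth_proj (orth_compl (\<Phi> w)) (vec_cnj (d_zbar s w)) \<in> plane_image d_z \<Phi> w"
        unfolding plane_image_def by force
      then show "x \<in> vec_cnj ` plane_image d_z \<Phi> w" unfolding V x by force
    qed
    show "vec_cnj ` plane_image d_z \<Phi> w \<subseteq> plane_image d_zbar \<Phi> w"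
    proof
      fix x assume "x \<in> vec_cnj ` plane_image d_z \<Phi> w"
      then obtain s W where W: "open W" "w \<in> W" "smooth_on W s" "\<forall>z\<in>W. s z \<in> \<Phi> z"
        and x: "x = vec_cnj (orth_proj (orth_compl (\<Phi> w)) (d_z s w))" unfolding plane_image_def by blast
      obtain s' W' where "open W'" "w \<in> W'" "smooth_on W' s'" "\<forall>z\<in>W'. s' z \<in> \<Phi> z" "d_zbar s' w = vec_cnj (d_z s w)"
        using key[OF W] by blast
      then show "x \<in> plane_image d_zbar \<Phi> w" unfolding x V[symmetric] plane_image_def by force
    qed
  qed
qed

lemma span_line_zero: "vec.span {v} = {0} \<longleftrightarrow> v = (0 :: complex^'n)"
proof
  assume "vec.span {v} = {0}"
  then show "v = 0" using vec.span_base[of v "{v}"] by blast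
qed (simp add: vec.span_singleton)

lemma wirtinger_op_d [simp]: "wirtinger_op d_z" "wirtinger_op d_zbar" by (simp_all add: wirtinger_op_def)

section \<open>Conjugate bundles\<close>

context rsurface
begin

definition cnjb :: "('a \<Rightarrow> (complex^'n) set) \<Rightarrow> 'a \<Rightarrow> (complex^'n) set" where
  "cnjb \<psi> = (\<lambda>p\<in>points M. vec_cnj ` \<psi> p)"

lemma bundle_image_cnj:
  assumes sub: "\<And>q. q \<in> points M \<Longrightarrow> vec.subspace (\<phi> q)" and re: "\<And>q. q \<in> points M \<Longrightarrow> vec_cnj ` \<phi> q = \<phi> q"
    and p: "p \<in> points M"
  shows "bundle_image d_zbar \<phi> p = vec_cnj ` bundle_image d_z \<phi> p"
proof -
  obtain c where c: "c \<in> atlas M" "p \<in> fst c" using ex_chart[OF p] by blast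
  note n = nbd_chart[OF c]
  have eq: "bundle_image D \<phi> p = plane_image D (in_chart c \<phi>) (snd c p)" if "wirtinger_op D" for D
    by (rule bundle_image_eq(1)[OF that c]) (rule sub)
  show ?thesis
    unfolding eq[OF wirtinger_op_d(1)] eq[OF wirtinger_op_d(2)]
    by (rule plane_image_cnj[OF nbdD(3,4)[OF n]]) (use nbdD(10)[OF n] re in \<open>simp add: in_chart_pt\<close>)
qed

lemma smooth_subbundle_cnjb:
  assumes "smooth_subbundle M \<psi>"
  shows "smooth_subbundle M (cnjb \<psi>)"
proof (rule smooth_subbundleI)
  have sub: "vec.subspace (\<psi> p)" if "p \<in> points M" for p using assms that by (simp add: smooth_subbundle_def)
  show "cnjb \<psi> \<in> extensional (points M)" by (simp add: cnjb_def)
  fix p assume p: "p \<in> points M"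
  show "vec.subspace (cnjb \<psi> p)" using sub[OF p] p by (simp add: cnjb_def subspace_vec_cnj)
  obtain c where n: "nbd c p (snd c ` fst c)" using nbd_exists[OF p] by blast
  let ?B = "snd c ` fst c"
  have "smooth_on ?B (\<lambda>w. mat_cnj (proj_matrix (in_chart c \<psi> w)))"
    by (rule smooth_on_linear[OF nbdD(3)[OF n] smooth_subbundle_in_chart[OF assms n] bounded_linear_mat_cnj])
  then have "smooth_on ?B (\<lambda>w. proj_matrix (in_chart c (cnjb \<psi>) w))"
    by (rule smooth_on_cong[OF nbdD(3)[OF n]])
       (use nbdD(10)[OF n] sub in \<open>simp add: in_chart_pt cnjb_def proj_matrix_vec_cnj\<close>)
  then show "\<exists>c B. nbd c p B \<and> smooth_on B (\<lambda>w. proj_matrix (in_chart c (cnjb \<psi>) w))" using n by blast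
qed

lemma cnjb_cnjb: "smooth_subbundle M \<psi> \<Longrightarrow> cnjb (cnjb \<psi>) = \<psi>"
  by (rule extensionalityI[of _ "points M"]) (auto simp: cnjb_def smooth_subbundle_def image_image)

text \<open>Thus \<open>G''\<close> of a real bundle is the conjugate of \<open>G'\<close> and need
  not be constructed separately.\<close>

lemma is_filled_cnjb:
  assumes sub: "\<And>q. q \<in> points M \<Longrightarrow> vec.subspace (\<phi> q)" and re: "\<And>q. q \<in> points M \<Longrightarrow> vec_cnj ` \<phi> q = \<phi> q"
  shows "is_filled M \<phi> (A_of d_z \<phi>) \<psi> \<Longrightarrow> is_filled M \<phi> (A_of d_zbar \<phi>) (cnjb \<psi>)"
    "is_filled M \<phi> (A_of d_zbar \<phi>) \<psi> \<Longrightarrow> is_filled M \<phi> (A_of d_z \<phi>) (cnjb \<psi>)"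
proof -
  have iff: "is_filled M \<phi> (A_of D \<phi>) \<psi> \<longleftrightarrow> smooth_subbundle M \<psi> \<and>
    (\<forall>p\<in>points M. \<exists>T. openin (surf_top M) T \<and> p \<in> T \<and> (\<forall>q\<in>T. q \<noteq> p \<longrightarrow> \<psi> q = bundle_image D \<phi> q))"
    if "wirtinger_op D" for D \<psi> by (rule is_filled_iff[OF that]) (rule sub)
  have *: "is_filled M \<phi> (A_of D' \<phi>) (cnjb \<psi>)"
    if D: "wirtinger_op D" "wirtinger_op D'" and f: "is_filled M \<phi> (A_of D \<phi>) \<psi>"
      and eq: "\<And>p. p \<in> points M \<Longrightarrow> bundle_image D' \<phi> p = vec_cnj ` bundle_image D \<phi> p" for D D' \<psi>
    unfolding iff[OF D(2)]
  proof (intro conjI ballI)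
    show "smooth_subbundle M (cnjb \<psi>)" using f iff[OF D(1)] smooth_subbundle_cnjb by blast
    fix p assume "p \<in> points M"
    then obtain T where T: "openin (surf_top M) T" "p \<in> T" "\<forall>q\<in>T. q \<noteq> p \<longrightarrow> \<psi> q = bundle_image D \<phi> q"
      using f unfolding iff[OF D(1)] by blast
    then show "\<exists>T. openin (surf_top M) T \<and> p \<in> T \<and> (\<forall>q\<in>T. q \<noteq> p \<longrightarrow> cnjb \<psi> q = bundle_image D' \<phi> q)"
      using openin_subset[OF T(1)] eq by (intro exI[of _ T]) (auto simp: cnjb_def subset_iff)
  qed
  have bc: "bundle_image d_zbar \<phi> p = vec_cnj ` bundle_image d_z \<phi> p" if "p \<in> points M" for p
    by (rule bundle_image_cnj) (use sub re that in auto)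
  show "is_filled M \<phi> (A_of d_z \<phi>) \<psi> \<Longrightarrow> is_filled M \<phi> (A_of d_zbar \<phi>) (cnjb \<psi>)"
    by (rule *) (simp_all add: bc)
  show "is_filled M \<phi> (A_of d_zbar \<phi>) \<psi> \<Longrightarrow> is_filled M \<phi> (A_of d_z \<phi>) (cnjb \<psi>)"
    by (rule *[OF wirtinger_op_d(2,1)]) (use bc in \<open>auto simp: image_image\<close>)
qed

lemma G'_eq: "is_filled M \<phi> (A_of d_z \<phi>) \<psi> \<Longrightarrow> G' M \<phi> = \<psi>"
  unfolding G'_def A'_eq by (rule filled_image_eq)

lemma G''_eq: "is_filled M \<phi> (A_of d_zbar \<phi>) \<psi> \<Longrightarrow> G'' M \<phi> = \<psi>"
  unfolding G''_def A''_eq by (rule filled_image_eq)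

section \<open>Local frames of an almost complex map\<close>

definition fc :: "('a \<Rightarrow> real^7) \<Rightarrow> 'a chart \<Rightarrow> complex \<Rightarrow> complex^7" where
  "fc F c w = cvec (in_chart c F w)"

lemma fc_unit:
  assumes F: "F \<in> points M \<rightarrow>\<^sub>E sphere 0 1" and c: "c \<in> atlas M" and w: "w \<in> snd c ` fst c"
  shows "vec_cnj (fc F c w) = fc F c w" "hermitian (fc F c w) (fc F c w) = 1"
proof -
  have "pt c w \<in> points M" using chart_pt[OF w] chart(4)[OF c] by blast
  then have "norm (in_chart c F w) = 1" using F by (auto simp: in_chart_pt)
  then show "vec_cnj (fc F c w) = fc F c w" "hermitian (fc F c w) (fc F c w) = 1"
    by (simp_all add: fc_def hermitian_cvec dot_square_norm)
qed

lemma smooth_fc: "smooth_map_on M (points M) F \<Longrightarrow> c \<in> atlas M \<Longrightarrow> smooth_on (snd c ` fst c) (fc F c)"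
  unfolding fc_def[abs_def]
  by (rule smooth_on_linear[OF chart(2) smooth_map_on_in_chart bounded_linear_cvec])

text \<open>With D the differential, F \<times> D(1) = D(\<i>) and F \<times> D(\<i>) = -D(1), so F
  \<times> multiplies D(1) - \<i> D(\<i>) by \<i>.\<close>

lemma ac_chart:
  assumes F: "almost_complex_map M F" and c: "c \<in> atlas M" and w: "w \<in> snd c ` fst c"
  shows "cross7 (fc F c w) (d_z (fc F c) w) = \<i> *s d_z (fc F c) w"
proof -
  let ?D = "frechet_derivative (in_chart c F) (at w)"
  have s: "smooth_on (snd c ` fst c) (in_chart c F)"
    using F c by (auto simp: almost_complex_map_def intro: smooth_map_on_in_chart)
  have D: "frechet_derivative (fc F c) (at w) v = cvec (?D v)" for v
    unfolding fc_def[abs_def] by (rule frechet_derivative_linear_comp[OF s w bounded_linear_cvec])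
  have J: "?D (\<i> * \<xi>) = cross7 (in_chart c F w) (?D \<xi>)" for \<xi>
  proof -
    have "pt c w \<in> fst c" "snd c (pt c w) = w" using chart_pt[OF w] by auto
    then show ?thesis using F c unfolding almost_complex_map_def in_chart_pt by metis
  qed
  have lin: "?D (- 1) = - ?D 1"
    using has_derivative_linear[OF smooth_on_imp_derivative[OF s w]] by (rule linear_neg)
  have 1: "cross7 (fc F c w) (cvec (?D 1)) = cvec (?D \<i>)" using J[of 1] by (simp add: fc_def cross7_cvec)
  have "cross7 (in_chart c F w) (?D \<i>) = - ?D 1" using J[of \<i>] lin by simp
  then have 2: "cross7 (fc F c w) (cvec (?D \<i>)) = - cvec (?D 1)" by (simp add: fc_def cross7_cvec)
  show ?thesis unfolding d_z_def D by (simp add: 1 2 vec_eq_iff algebra_simps)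
qed

text \<open>F_z solves \<open>almost_complex_dbar_eq\<close>, so unless it vanishes near p it is a
  power of the coordinate times a nonvanishing L. Cancelling the power gives F \<times> L = \<i> L
  off p, continuity gives it at p, and the equation for L says that L_zbar is a multiple of
  F.\<close>

lemma frame_local:
  assumes F: "almost_complex_map M F" and c: "c \<in> atlas M" "p \<in> fst c"
  shows "(\<exists>r. nbd c p (ball (snd c p) r) \<and> (\<forall>w\<in>ball (snd c p) r. d_z (fc F c) w = 0)) \<or>
    (\<exists>r L k. nbd c p (ball (snd c p) r) \<and> frame (ball (snd c p) r) (fc F c) L (\<lambda>w. (w - snd c p) ^ k))"
proof -
  let ?S = "snd c ` fst c" and ?f = "fc F c" and ?w = "snd c p"
  have S: "open ?S" "?w \<in> ?S" using chart(2)[OF c(1)] c by auto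
  have PE: "F \<in> points M \<rightarrow>\<^sub>E sphere 0 1" and sm: "smooth_map_on M (points M) F" using F by (auto simp: almost_complex_map_def)
  note f = smooth_fc[OF sm c(1)]
  note u = fc_unit[OF PE c(1)] and ac = ac_chart[OF F c(1)]
  have eq: "dbar_eq ?S (d_z ?f) (\<lambda>z. - ?f z) (d_z ?f)" by (rule almost_complex_dbar_eq[OF S(1) f u ac])
  have nb: "nbd c p (ball ?w r)" if "r > 0" "ball ?w r \<subseteq> ?S" for r
    using that c by (simp add: nbd_def)
  show ?thesis
  proof (rule dbar_eq_zero[OF S smooth_on_d(1)[OF S(1) f] smooth_on_minus[OF S(1) f] eq])
    fix r assume "r > 0" "ball ?w r \<subseteq> ?S" "\<And>z. z \<in> ball ?w r \<Longrightarrow> d_z ?f z = 0"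
    then show ?thesis using nb by blast
  next
    fix r k L assume r: "r > 0" "ball ?w r \<subseteq> ?S" and e: "dbar_eq (ball ?w r) (d_z ?f) (\<lambda>z. - ?f z) L"
      and g: "\<And>z. z \<in> ball ?w r \<Longrightarrow> d_z ?f z = (z - ?w) ^ k *s L z" and L0: "\<And>z. z \<in> ball ?w r \<Longrightarrow> L z \<noteq> 0"
    have sL: "smooth_on (ball ?w r) L" using e by (simp add: dbar_eq_def)
    have sf: "smooth_on (ball ?w r) ?f" by (rule smooth_on_subset[OF f r(2)])
    have off: "cross7 (?f z) (L z) = \<i> *s L z" if z: "z \<in> ball ?w r" "z \<noteq> ?w" for z
    proof -
      have "(z - ?w) ^ k *s cross7 (?f z) (L z) = (z - ?w) ^ k *s (\<i> *s L z)"
        using ac[of z] g[OF z(1)] r z by (auto simp: vector_smult_assoc mult.commute)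
      then have "(z - ?w) ^ k = 0 \<or> cross7 (?f z) (L z) = \<i> *s L z" by (simp only: vector_mul_lcancel)
      then show ?thesis using z(2) by simp
    qed
    have "cross7 (?f ?w) (L ?w) = \<i> *s L ?w"
    proof (rule continuous_on_punctured_eq[where S = "ball ?w r" and f = "\<lambda>z. cross7 (?f z) (L z)" and g = "\<lambda>z. \<i> *s L z"])
      show "isCont (\<lambda>z. cross7 (?f z) (L z)) ?w"
        by (rule smooth_on_imp_isCont[OF smooth_on_cross7[OF open_ball sf sL]]) (use r in simp)
      show "isCont (\<lambda>z. \<i> *s L z) ?w"
        by (rule smooth_on_imp_isCont[OF smooth_on_linear[OF open_ball sL bounded_linear_vector_scalar_right]]) (use r in simp)
    qed (use r off in auto)
    then have fL: "cross7 (?f z) (L z) = \<i> *s L z" if "z \<in> ball ?w r" for z using off that by (cases "z = ?w") auto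
    have "frame (ball ?w r) ?f L (\<lambda>w. (w - ?w) ^ k)"
    proof
      show "vec_cnj (?f w) = ?f w" "hermitian (?f w) (?f w) = 1" if "w \<in> ball ?w r" for w using u[of w] that r by auto
      show "\<exists>b. d_zbar L w = b *s ?f w" if "w \<in> ball ?w r" for w
      proof -
        have "d_zbar L w = (- hermitian (L w) (d_z ?f w)) *s ?f w"
          using e that by (simp add: dbar_eq_def vec_eq_iff)
        then show ?thesis by blast
      qed
    qed (use sf sL L0 fL g in auto)
    then show ?thesis using nb[OF r] by blast
  qed
qed

abbreviation fb where "fb F \<equiv> line_bundle_of M F"

lemma fb_subspace: "q \<in> points M \<Longrightarrow> vec.subspace (fb F q)"
  by (simp add: line_bundle_of_def)

lemma fb_real: "q \<in> points M \<Longrightarrow> vec_cnj ` fb F q = fb F q"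
  by (simp add: line_bundle_of_def vec_cnj_image_span)

lemma fb_chart: "c \<in> atlas M \<Longrightarrow> w \<in> snd c ` fst c \<Longrightarrow> in_chart c (fb F) w = vec.span {fc F c w}"
  using chart_pt[of w c] chart(4)[of c] by (auto simp: line_bundle_of_def in_chart_pt fc_def)

lemma fb_image:
  assumes F: "almost_complex_map M F" and c: "c \<in> atlas M" and w: "w \<in> snd c ` fst c"
  shows "bundle_image d_z (fb F) (pt c w) = vec.span {d_z (fc F c) w}"
proof -
  have PE: "F \<in> points M \<rightarrow>\<^sub>E sphere 0 1" and sm: "smooth_map_on M (points M) F" using F by (auto simp: almost_complex_map_def)
  note u = fc_unit[OF PE c] and f = smooth_fc[OF sm c]
  have n: "nbd c (pt c w) (snd c ` fst c)" using nbd_chart[OF c] chart_pt[OF w] by blast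
  have "bundle_image d_z (fb F) (pt c w) = plane_image d_z (in_chart c (fb F)) w"
    by (rule bundle_image_nbd[OF wirtinger_op_d(1) n w fb_subspace])
  also have "\<dots> = plane_image d_z (\<lambda>z. vec.span {fc F c z}) w"
    by (rule plane_image_cong[OF chart(2)[OF c] w fb_chart[OF c]])
  also have "\<dots> = vec.span {d_z (fc F c) w}"
    by (rule plane_image_line[OF chart(2)[OF c] f u w]) (use type10(1)[OF u[OF w] ac_chart[OF F c w] ac_chart[OF F c w]] in auto)
  finally show ?thesis .
qed

text \<open>Convexity is for \<open>proj_constant\<close>, where zero derivative must imply
  constancy. The last clause says that F_z vanishes at most at the centre, from which the line of F
  will be seen to vary.\<close>

definition framed :: "('a \<Rightarrow> real^7) \<Rightarrow> ('a \<Rightarrow> (complex^7) set) \<Rightarrow> 'a chart \<Rightarrow> 'a \<Rightarrow> complex set \<Rightarrow> (complex \<Rightarrow> complex^7) \<Rightarrow> bool" where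
  "framed F \<alpha> c p B L \<longleftrightarrow> nbd c p B \<and> convex B \<and> (\<exists>P. frame B (fc F c) L P) \<and>
     (\<forall>w\<in>B. in_chart c \<alpha> w = vec.span {L w}) \<and> (\<forall>w\<in>B. w \<noteq> snd c p \<longrightarrow> d_z (fc F c) w \<noteq> 0)"

lemma derivative_zero_constant:
  assumes n: "nbd c p (ball (snd c p) r)" and s: "smooth_on (ball (snd c p) r) (fc F c)"
    and re: "\<And>w. w \<in> ball (snd c p) r \<Longrightarrow> vec_cnj (fc F c w) = fc F c w" and z: "\<And>w. w \<in> ball (snd c p) r \<Longrightarrow> d_z (fc F c) w = 0"
  shows "\<exists>T. openin (surf_top M) T \<and> p \<in> T \<and> (\<forall>q\<in>T. F q = F p)"
proof (intro exI conjI ballI)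
  let ?B = "ball (snd c p) r"
  show "openin (surf_top M) (nbd_set c ?B)" "p \<in> nbd_set c ?B" using nbd_set[OF n] by auto
  fix q assume q: "q \<in> nbd_set c ?B"
  have "(fc F c has_derivative (\<lambda>v. 0)) (at w within ?B)" if w: "w \<in> ?B" for w
    using real_has_wirtinger[OF open_ball s re w] z[OF w] by (simp add: has_wirtinger_def has_derivative_at_withinI)
  then have "fc F c (snd c q) = fc F c (snd c p)"
    using has_derivative_zero_unique[of ?B "fc F c" "snd c q" "snd c p"] nbd_set(6)[OF n q] nbdD(4)[OF n] by auto
  then show "F q = F p" using nbd_set(6)[OF n q] nbdD(7)[OF n] by (simp add: fc_def in_chart_pt)
qed

text \<open>The constant value and any two-dimensional subspace of its orthogonal complement span a
  subspace that cuts out a great sphere.\<close>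

lemma constant_totally_geodesic:
  fixes F :: "'a \<Rightarrow> real^7"
  assumes F: "F \<in> points M \<rightarrow>\<^sub>E sphere 0 1" and c: "\<And>p q. p \<in> points M \<Longrightarrow> q \<in> points M \<Longrightarrow> F p = F q"
  shows "\<exists>S. totally_geodesic_S2 S \<and> F ` points M \<subseteq> S"
proof -
  obtain p where p: "p \<in> points M" using points_nonempty by blast
  have sph: "norm (F q) = 1" if "q \<in> points M" for q using PiE_mem[OF F that] by simp
  have "dim {x. F p \<bullet> x = 0} = 6" using sph[OF p] by (subst dim_hyperplane) auto
  then obtain T where T: "subspace T" "T \<subseteq> span {x. F p \<bullet> x = 0}" "dim T = 2"
    using choose_subspace_of_subspace[of 2 "{x. F p \<bullet> x = 0}"] by auto
  have "F p \<notin> span T"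
  proof
    assume "F p \<in> span T"
    moreover have "span T = T" using T(1) by (rule span_eq_iff[THEN iffD2])
    moreover have "span {x. F p \<bullet> x = 0} = {x. F p \<bullet> x = 0}"
      using subspace_hyperplane by (rule span_eq_iff[THEN iffD2])
    ultimately have "F p \<in> {x. F p \<bullet> x = 0}" using T(2) by blast
    then show False using sph[OF p] by (simp add: dot_square_norm)
  qed
  define V where "V = span (insert (F p) T)"
  have V: "subspace V" "F p \<in> V" "dim V = 3"
    using \<open>F p \<notin> span T\<close> T(3) by (simp_all add: V_def dim_insert span_base)
  have "totally_geodesic_S2 (V \<inter> sphere 0 1)" using V totally_geodesic_S2_iff_great_sphere by blast
  moreover have "F q \<in> V \<inter> sphere 0 1" if "q \<in> points M" for q
    using c[OF that p] sph[OF that] V(2) by simp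
  ultimately show ?thesis by blast
qed

text \<open>The dichotomy is applied to the zeros of F_z: if F_z vanished everywhere, F would be
  constant and hence lie in a great sphere.\<close>

lemma not_locally_zero:
  assumes F: "F \<in> almost_complex_maps M"
  shows "\<forall>p\<in>points M. \<not> (\<exists>T. openin (surf_top M) T \<and> p \<in> T \<and> (\<forall>q\<in>T. bundle_image d_z (fb F) q = {0}))"
proof -
  have ac: "almost_complex_map M F" and ng: "\<not> (\<exists>S. totally_geodesic_S2 S \<and> F ` points M \<subseteq> S)"
    using F by (auto simp: almost_complex_maps_def)
  have PE: "F \<in> points M \<rightarrow>\<^sub>E sphere 0 1" and sm: "smooth_map_on M (points M) F" using ac by (auto simp: almost_complex_map_def)
  let ?Z = "\<lambda>q. bundle_image d_z (fb F) q = {0}"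
  have Zc: "?Z (pt c w) \<longleftrightarrow> d_z (fc F c) w = 0" if "c \<in> atlas M" "w \<in> snd c ` fst c" for c w
    unfolding fb_image[OF ac that] by (rule span_line_zero)
  have "(\<forall>p\<in>points M. ?Z p) \<or> (\<forall>p\<in>points M. \<not> (\<exists>T. openin (surf_top M) T \<and> p \<in> T \<and> (\<forall>q\<in>T. ?Z q)))"
  proof (rule connected_dichotomy)
    fix p assume "p \<in> points M"
    then obtain c where c: "c \<in> atlas M" "p \<in> fst c" using ex_chart by blast
    from frame_local[OF ac c]
    show "\<exists>T. openin (surf_top M) T \<and> p \<in> T \<and> ((\<forall>q\<in>T. ?Z q) \<or> (\<forall>q\<in>T. q \<noteq> p \<longrightarrow> \<not> ?Z q))"
    proof (elim disjE exE conjE)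
      fix r assume n: "nbd c p (ball (snd c p) r)" and z: "\<forall>w\<in>ball (snd c p) r. d_z (fc F c) w = 0"
      have "?Z q" if q: "q \<in> nbd_set c (ball (snd c p) r)" for q
      proof -
        have w: "snd c q \<in> ball (snd c p) r" "pt c (snd c q) = q" using nbd_set(6)[OF n q] by auto
        then have "?Z (pt c (snd c q))" using Zc[OF c(1), of "snd c q"] z nbdD(5)[OF n] by blast
        then show ?thesis unfolding w(2) .
      qed
      then show ?thesis using nbd_set(1,2)[OF n] by blast
    next
      fix r L k assume n: "nbd c p (ball (snd c p) r)" and fr: "frame (ball (snd c p) r) (fc F c) L (\<lambda>w. (w - snd c p) ^ k)"
      have "\<not> ?Z q" if q: "q \<in> nbd_set c (ball (snd c p) r)" "q \<noteq> p" for q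
      proof -
        have w: "snd c q \<in> ball (snd c p) r" "snd c q \<noteq> snd c p" "pt c (snd c q) = q" using nbd_set(6)[OF n q(1)] q(2) by auto
        have "d_z (fc F c) (snd c q) \<noteq> 0"
          using frame.fz[OF fr w(1)] frame.L0[OF fr w(1)] w(2) by (simp add: vector_mul_eq_0)
        then have "\<not> ?Z (pt c (snd c q))" using Zc[OF c(1), of "snd c q"] w(1) nbdD(5)[OF n] by blast
        then show ?thesis unfolding w(3) .
      qed
      then show ?thesis using nbd_set(1,2)[OF n] by blast
    qed
  qed
  then show ?thesis
  proof
    assume Z: "\<forall>p\<in>points M. ?Z p"
    have "\<exists>T. openin (surf_top M) T \<and> p \<in> T \<and> (\<forall>q\<in>T. F q = F p)" if p: "p \<in> points M" for p
    proof -
      obtain c where c: "c \<in> atlas M" "p \<in> fst c" using ex_chart p by blast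
      obtain r where r: "r > 0" "ball (snd c p) r \<subseteq> snd c ` fst c" using chart(2)[OF c(1)] c(2) open_contains_ball by blast
      have n: "nbd c p (ball (snd c p) r)" using r c by (simp add: nbd_def)
      show ?thesis
      proof (rule derivative_zero_constant[OF n])
        show "smooth_on (ball (snd c p) r) (fc F c)" by (rule smooth_on_subset[OF smooth_fc[OF sm c(1)] r(2)])
        show "vec_cnj (fc F c w) = fc F c w" if "w \<in> ball (snd c p) r" for w using fc_unit(1)[OF PE c(1)] r that by blast
        show "d_z (fc F c) w = 0" if w: "w \<in> ball (snd c p) r" for w
          using Zc[OF c(1), of w] Z nbdD(10)[OF n w] r w by blast
      qed
    qed
    from constant_totally_geodesic[OF PE locally_constant[OF this]] ng show ?thesis by blast
  qed
qed

end

lemma span_line_scale: "k \<noteq> 0 \<Longrightarrow> vec.span {k *s v} = vec.span {v :: complex^'n}"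
proof -
  assume k: "k \<noteq> 0"
  have "k *s v \<in> vec.span {v}" by (intro vec.span_scale vec.span_base) simp
  moreover have "v \<in> vec.span {k *s v}"
    using vec.span_scale[OF vec.span_base[of "k *s v" "{k *s v}"], of "inverse k"] k by (simp add: vector_smult_assoc)
  ultimately show ?thesis by (intro equalityI vec.span_minimal vec.subspace_span) auto
qed

lemma frame_restrict: "frame B f L P \<Longrightarrow> open B' \<Longrightarrow> B' \<subseteq> B \<Longrightarrow> frame B' f L P"
  unfolding frame_def by (meson smooth_on_subset subsetD)

lemma type10_center:
  fixes f R :: "complex \<Rightarrow> complex^7"
  assumes B: "open B" and f: "smooth_on B f" and R: "smooth_on B R"
    and off: "\<And>z. z \<in> B \<Longrightarrow> z \<noteq> w \<Longrightarrow> cross7 (f z) (R z) = \<i> *s R z" and z: "z \<in> B"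
  shows "cross7 (f z) (R z) = \<i> *s R z"
proof (cases "z = w")
  case True
  show ?thesis
  proof (rule continuous_on_punctured_eq[where S = B and f = "\<lambda>z. cross7 (f z) (R z)" and g = "\<lambda>z. \<i> *s R z"])
    show "isCont (\<lambda>z. cross7 (f z) (R z)) z" by (rule smooth_on_imp_isCont[OF smooth_on_cross7[OF B f R] z])
    show "isCont (\<lambda>z. \<i> *s R z) z"
      by (rule smooth_on_imp_isCont[OF smooth_on_linear[OF B R bounded_linear_vector_scalar_right] z])
  qed (use B z off True in auto)
qed (use off z in blast)

lemma laplacian_const_minus:
  assumes S: "open S" "w \<in> S" and g: "smooth_on S g"
  shows "laplacian (\<lambda>z. c - g z) w = - laplacian g w"
proof -
  have 1: "frechet_derivative (\<lambda>z. c - g z) (at z) v = - frechet_derivative g (at z) v" if z: "z \<in> S" for z v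
  proof -
    have "((\<lambda>z. c - g z) has_derivative (\<lambda>v. 0 - frechet_derivative g (at z) v)) (at z)"
      by (rule has_derivative_diff[OF has_derivative_const smooth_on_imp_derivative[OF g z]])
    from frechet_derivative_at[OF this, symmetric] show ?thesis by simp
  qed
  have "frechet_derivative (\<lambda>z. frechet_derivative (\<lambda>z. c - g z) (at z) v) (at w) x
      = - frechet_derivative (\<lambda>z. frechet_derivative g (at z) v) (at w) x" for v x
  proof -
    have "frechet_derivative (\<lambda>z. frechet_derivative (\<lambda>z. c - g z) (at z) v) (at w)
        = frechet_derivative (\<lambda>z. - frechet_derivative g (at z) v) (at w)"
      by (rule frechet_derivative_cong_open[OF S 1])
    then show ?thesis
      using frechet_derivative_linear_comp[OF smooth_on_frechet[OF g] S(2) bounded_linear_minus[OF bounded_linear_ident]] by simp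
  qed
  then show ?thesis unfolding laplacian_def by simp
qed

section \<open>The subbundle \<open>G'\<close> of the line of F\<close>

context rsurface
begin

lemma frame_case:
  assumes F: "F \<in> almost_complex_maps M" and c: "c \<in> atlas M" "p \<in> fst c"
  shows "\<exists>B L P. nbd c p B \<and> convex B \<and> frame B (fc F c) L P \<and> (\<forall>w\<in>B. w \<noteq> snd c p \<longrightarrow> P w \<noteq> 0)"
proof -
  have ac: "almost_complex_map M F" using F by (simp add: almost_complex_maps_def)
  from frame_local[OF ac c] show ?thesis
  proof (elim disjE exE conjE)
    fix r assume n: "nbd c p (ball (snd c p) r)" and z: "\<forall>w\<in>ball (snd c p) r. d_z (fc F c) w = 0"
    have "bundle_image d_z (fb F) q = {0}" if q: "q \<in> nbd_set c (ball (snd c p) r)" for q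
    proof -
      have w: "snd c q \<in> ball (snd c p) r" "pt c (snd c q) = q" using nbd_set(6)[OF n q] by auto
      then have "bundle_image d_z (fb F) (pt c (snd c q)) = vec.span {d_z (fc F c) (snd c q)}"
        using nbdD(5)[OF n] by (intro fb_image[OF ac c(1)]) blast
      then show ?thesis using z w by (simp add: span_line_zero)
    qed
    then have "\<exists>T. openin (surf_top M) T \<and> p \<in> T \<and> (\<forall>q\<in>T. bundle_image d_z (fb F) q = {0})"
      using nbd_set(1,2)[OF n] by blast
    then show ?thesis using not_locally_zero[OF F] nbdD(6)[OF n] by blast
  next
    fix r L k assume "nbd c p (ball (snd c p) r)" "frame (ball (snd c p) r) (fc F c) L (\<lambda>w. (w - snd c p) ^ k)"
    then show ?thesis
      by (intro exI[of _ "ball (snd c p) r"] exI[of _ L] exI[of _ "\<lambda>w. (w - snd c p) ^ k"]) auto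
  qed
qed

lemma frame_image:
  assumes F: "F \<in> almost_complex_maps M" and n: "nbd c p B" and fr: "frame B (fc F c) L P" and w: "w \<in> B"
  shows "bundle_image d_z (fb F) (pt c w) = (if P w = 0 then {0} else vec.span {L w})"
proof -
  have ac: "almost_complex_map M F" using F by (simp add: almost_complex_maps_def)
  have "bundle_image d_z (fb F) (pt c w) = vec.span {P w *s L w}"
    using fb_image[OF ac nbdD(1)[OF n], of w] frame.fz[OF fr w] nbdD(5)[OF n] w by auto
  then show ?thesis by (simp add: span_line_zero span_line_scale)
qed

text \<open>The lines of the local L extend the image of A' over the zeros of F_z. Frames are
  provided in every chart, because harmonicity is tested in every chart.\<close>

lemma first_frames:
  assumes F: "F \<in> almost_complex_maps M"
  obtains \<alpha> where "is_filled M (fb F) (A_of d_z (fb F)) \<alpha>" "smooth_subbundle M \<alpha>"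
    "\<And>c p. c \<in> atlas M \<Longrightarrow> p \<in> fst c \<Longrightarrow> \<exists>B L. framed F \<alpha> c p B L"
proof -
  let ?I = "bundle_image d_z (fb F)"
  have ex: "\<exists>c B L. nbd c p B \<and> smooth_on B L \<and> (\<forall>w\<in>B. L w \<noteq> 0) \<and>
      (\<forall>w\<in>B. w \<noteq> snd c p \<longrightarrow> ?I (pt c w) = vec.span {L w}) \<and> (?I p = vec.span {L (snd c p)} \<or> ?I p = {0}) \<and> True"
    if p: "p \<in> points M" for p
  proof -
    obtain c where c: "c \<in> atlas M" "p \<in> fst c" using ex_chart p by blast
    obtain B L P where n: "nbd c p B" and fr: "frame B (fc F c) L P" and P: "\<forall>w\<in>B. w \<noteq> snd c p \<longrightarrow> P w \<noteq> 0"
      using frame_case[OF F c] by blast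
    have 1: "\<forall>w\<in>B. w \<noteq> snd c p \<longrightarrow> ?I (pt c w) = vec.span {L w}"
      using frame_image[OF F n fr] P by simp
    have 2: "?I p = vec.span {L (snd c p)} \<or> ?I p = {0}"
      using frame_image[OF F n fr nbdD(4)[OF n]] unfolding nbdD(7)[OF n] by simp
    show ?thesis using n frame.L[OF fr] frame.L0[OF fr] 1 2 by blast
  qed
  obtain \<alpha> where sm: "smooth_subbundle M \<alpha>" and \<alpha>: "\<forall>p\<in>points M. ?I p \<noteq> {0} \<longrightarrow> \<alpha> p = ?I p"
    using line_fill[where I = ?I and R = "\<lambda>_ _ _. True", OF ex] by blast
  have fr: "\<exists>B L. framed F \<alpha> c p B L" if c: "c \<in> atlas M" "p \<in> fst c" for c p
  proof -
    obtain B L P where n: "nbd c p B" and cv: "convex B" and fr: "frame B (fc F c) L P" and P: "\<forall>w\<in>B. w \<noteq> snd c p \<longrightarrow> P w \<noteq> 0"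
      using frame_case[OF F c] by blast
    have off: "in_chart c \<alpha> w = vec.span {L w}" if "w \<in> B" "w \<noteq> snd c p" for w
    proof -
      have "?I (pt c w) = vec.span {L w}" using frame_image[OF F n fr that(1)] P that by simp
      moreover have "vec.span {L w} \<noteq> {0}" using frame.L0[OF fr that(1)] by (simp add: span_line_zero)
      ultimately show ?thesis using \<alpha> nbdD(10)[OF n that(1)] by (simp add: in_chart_pt)
    qed
    have 1: "in_chart c \<alpha> w = vec.span {L w}" if "w \<in> B" for w
      by (rule line_at_center[OF sm n frame.L[OF fr] frame.L0[OF fr] off that])
    have 2: "d_z (fc F c) w \<noteq> 0" if "w \<in> B" "w \<noteq> snd c p" for w
      using frame.fz[OF fr that(1)] frame.L0[OF fr that(1)] P that by (simp add: vector_mul_eq_0)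
    show ?thesis unfolding framed_def using n cv fr 1 2 by blast
  qed
  have "is_filled M (fb F) (A_of d_z (fb F)) \<alpha> \<longleftrightarrow> smooth_subbundle M \<alpha> \<and>
    (\<forall>p\<in>points M. \<exists>T. openin (surf_top M) T \<and> p \<in> T \<and> (\<forall>q\<in>T. q \<noteq> p \<longrightarrow> \<alpha> q = ?I q))"
    by (rule is_filled_iff[OF wirtinger_op_d(1)]) (rule fb_subspace)
  moreover have "\<exists>T. openin (surf_top M) T \<and> p \<in> T \<and> (\<forall>q\<in>T. q \<noteq> p \<longrightarrow> \<alpha> q = ?I q)" if p: "p \<in> points M" for p
  proof -
    obtain c B L where n: "nbd c p B" and L: "\<forall>w\<in>B. L w \<noteq> 0" and I: "\<forall>w\<in>B. w \<noteq> snd c p \<longrightarrow> ?I (pt c w) = vec.span {L w}"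
      using ex[OF p] by blast
    have "\<alpha> q = ?I q" if q: "q \<in> nbd_set c B" "q \<noteq> p" for q
    proof -
      have w: "snd c q \<in> B" "pt c (snd c q) = q" "snd c q \<noteq> snd c p" using nbd_set(6)[OF n q(1)] q(2) by auto
      then have "?I q = vec.span {L (snd c q)}" using I by metis
      then have "?I q \<noteq> {0}" using L w(1) by (simp add: span_line_zero)
      then show ?thesis using \<alpha> nbd_set(3)[OF n] q(1) by blast
    qed
    then show ?thesis using nbd_set(1,2)[OF n] by blast
  qed
  ultimately have "is_filled M (fb F) (A_of d_z (fb F)) \<alpha>" using sm by blast
  from that[OF this sm fr] show ?thesis by blast
qed

lemma framedD:
  assumes "framed F \<alpha> c p B L"
  shows "nbd c p B" "convex B" "\<exists>P. frame B (fc F c) L P" "\<And>w. w \<in> B \<Longrightarrow> in_chart c \<alpha> w = vec.span {L w}"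
    "\<And>w. w \<in> B \<Longrightarrow> w \<noteq> snd c p \<Longrightarrow> d_z (fc F c) w \<noteq> 0"
  using assms by (auto simp: framed_def)

lemma to_G2_chart:
  assumes \<alpha>: "is_filled M (fb F) (A_of d_z (fb F)) \<alpha>" and fr: "framed F \<alpha> c p B L" and w: "w \<in> B"
  shows "in_chart c (to_G2_map M F) w = vec.span {L w, fc F c w, vec_cnj (L w)}"
proof -
  note n = framedD(1)[OF fr]
  have G: "G' M (fb F) = \<alpha>" "G'' M (fb F) = cnjb \<alpha>"
    using G'_eq[OF \<alpha>] G''_eq[OF is_filled_cnjb(1)[OF fb_subspace fb_real \<alpha>]] by simp_all
  have q: "pt c w \<in> points M" by (rule nbdD(10)[OF n w])
  have a: "\<alpha> (pt c w) = vec.span {L w}" using framedD(4)[OF fr w] by (simp add: in_chart_pt)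
  have "in_chart c (to_G2_map M F) w
      = {v + x | v x. v \<in> {v + x | v x. v \<in> vec_cnj ` \<alpha> (pt c w) \<and> x \<in> fb F (pt c w)} \<and> x \<in> \<alpha> (pt c w)}"
    using q by (simp add: to_G2_map_def Let_def G bundle_sum_def in_chart_pt cnjb_def)
  also have "\<dots> = {v + x | v x. v \<in> {v + x | v x. v \<in> vec.span {vec_cnj (L w)} \<and> x \<in> vec.span {fc F c w}} \<and> x \<in> vec.span {L w}}"
    using q unfolding a vec_cnj_image_span by (simp add: line_bundle_of_def fc_def in_chart_pt)
  also have "\<dots> = vec.span {L w, fc F c w, vec_cnj (L w)}"
  proof
    show "{v + x | v x. v \<in> {v + x | v x. v \<in> vec.span {vec_cnj (L w)} \<and> x \<in> vec.span {fc F c w}} \<and> x \<in> vec.span {L w}}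
        \<subseteq> vec.span {L w, fc F c w, vec_cnj (L w)}"
    proof
      fix y assume "y \<in> {v + x | v x. v \<in> {v + x | v x. v \<in> vec.span {vec_cnj (L w)} \<and> x \<in> vec.span {fc F c w}} \<and> x \<in> vec.span {L w}}"
      then obtain k l m where "y = (k *s vec_cnj (L w) + l *s fc F c w) + m *s L w" unfolding span_1 by blast
      then have "y = m *s L w + l *s fc F c w + k *s vec_cnj (L w)" by (simp add: algebra_simps)
      then show "y \<in> vec.span {L w, fc F c w, vec_cnj (L w)}" unfolding span_3 by blast
    qed
    show "vec.span {L w, fc F c w, vec_cnj (L w)}
        \<subseteq> {v + x | v x. v \<in> {v + x | v x. v \<in> vec.span {vec_cnj (L w)} \<and> x \<in> vec.span {fc F c w}} \<and> x \<in> vec.span {L w}}"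
    proof
      fix y assume "y \<in> vec.span {L w, fc F c w, vec_cnj (L w)}"
      then obtain k l m where "y = m *s L w + l *s fc F c w + k *s vec_cnj (L w)" unfolding span_3 by blast
      then have "y = (k *s vec_cnj (L w) + l *s fc F c w) + m *s L w" by (simp add: algebra_simps)
      then show "y \<in> {v + x | v x. v \<in> {v + x | v x. v \<in> vec.span {vec_cnj (L w)} \<and> x \<in> vec.span {fc F c w}} \<and> x \<in> vec.span {L w}}"
        unfolding span_1 by blast
    qed
  qed
  finally show ?thesis .
qed

end

lemma vec_subspace_complexification:
  assumes W: "subspace W"
  shows "vec.subspace (complexification W)"
  unfolding vec.subspace_def complexification_def
proof (intro conjI ballI allI)
  show "0 \<in> {cvec u + \<i> *s cvec v | u v. u \<in> W \<and> v \<in> W}"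
    using subspace_0[OF W] by (intro CollectI exI[of _ 0]) simp
  fix x y assume "x \<in> {cvec u + \<i> *s cvec v | u v. u \<in> W \<and> v \<in> W}" "y \<in> {cvec u + \<i> *s cvec v | u v. u \<in> W \<and> v \<in> W}"
  then obtain u v u' v' where uv: "u \<in> W" "v \<in> W" "u' \<in> W" "v' \<in> W" "x = cvec u + \<i> *s cvec v" "y = cvec u' + \<i> *s cvec v'" by blast
  have "x + y = cvec (u + u') + \<i> *s cvec (v + v')" unfolding uv by (simp add: vec_eq_iff algebra_simps)
  then show "x + y \<in> {cvec u + \<i> *s cvec v | u v. u \<in> W \<and> v \<in> W}" using uv subspace_add[OF W] by blast
next
  fix k x assume "x \<in> {cvec u + \<i> *s cvec v | u v. u \<in> W \<and> v \<in> W}"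
  then obtain u v where uv: "u \<in> W" "v \<in> W" "x = cvec u + \<i> *s cvec v" by blast
  have "k *s x = cvec (Re k *\<^sub>R u - Im k *\<^sub>R v) + \<i> *s cvec (Im k *\<^sub>R u + Re k *\<^sub>R v)"
    unfolding uv by (simp add: vec_eq_iff complex_eq_iff cvec_def)
  then show "k *s x \<in> {cvec u + \<i> *s cvec v | u v. u \<in> W \<and> v \<in> W}"
    using uv subspace_add[OF W] subspace_diff[OF W] subspace_scale[OF W] by blast
qed

lemma G2_subspace: "V \<in> G2_SO4 \<Longrightarrow> vec.subspace V"
  by (auto simp: G2_SO4_def associative_subspace_def vec_subspace_complexification)

text \<open>The data attached to an almost complex map: \<open>\<alpha>\<close> is the subbundle \<open>G'(f)\<close>.\<close>

locale ac_surface = rsurface M for M :: "'a surface" +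
  fixes F :: "'a \<Rightarrow> real^7" and \<alpha> :: "'a \<Rightarrow> (complex^7) set"
  assumes F: "F \<in> almost_complex_maps M" and \<alpha>: "is_filled M (fb F) (A_of d_z (fb F)) \<alpha>"
    and \<alpha>s: "smooth_subbundle M \<alpha>" and fr_ex: "\<And>c p. c \<in> atlas M \<Longrightarrow> p \<in> fst c \<Longrightarrow> \<exists>B L. framed F \<alpha> c p B L"
begin

definition \<phi> where "\<phi> = to_G2_map M F"

lemma ac: "almost_complex_map M F" using F by (simp add: almost_complex_maps_def)

lemma PE: "F \<in> points M \<rightarrow>\<^sub>E sphere 0 1" and smF: "smooth_map_on M (points M) F"
  using ac by (auto simp: almost_complex_map_def)

lemma framed_point:
  assumes "p \<in> points M"
  obtains c B L P where "framed F \<alpha> c p B L" "frame B (fc F c) L P"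
  using ex_chart[OF assms] fr_ex framedD(3) by metis

lemma \<phi>_frame:
  assumes "framed F \<alpha> c p B L" "frame B (fc F c) L P" "w \<in> B"
  shows "in_chart c \<phi> w = frame.\<Phi> (fc F c) L w"
  unfolding \<phi>_def frame.\<Phi>_def[OF assms(2)] by (rule to_G2_chart[OF \<alpha> assms(1,3)])

lemma at_point:
  assumes p: "p \<in> points M"
  obtains L where "L \<noteq> 0" "cross7 (cvec (F p)) L = \<i> *s L" "\<alpha> p = vec.span {L}" "\<phi> p = vec.span {L, cvec (F p), vec_cnj L}"
proof -
  obtain c B L P where fr: "framed F \<alpha> c p B L" and f: "frame B (fc F c) L P" using framed_point[OF p] by blast
  note n = nbdD[OF framedD(1)[OF fr]]
  have fp: "fc F c (snd c p) = cvec (F p)" using n(7) by (simp add: fc_def in_chart_pt)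
  show ?thesis
  proof (rule that[of "L (snd c p)"])
    show "L (snd c p) \<noteq> 0" by (rule frame.L0[OF f n(4)])
    show "cross7 (cvec (F p)) (L (snd c p)) = \<i> *s L (snd c p)" using frame.fL[OF f n(4)] fp by simp
    show "\<alpha> p = vec.span {L (snd c p)}" using framedD(4)[OF fr n(4)] n(7) by (simp add: in_chart_pt)
    show "\<phi> p = vec.span {L (snd c p), cvec (F p), vec_cnj (L (snd c p))}"
      using to_G2_chart[OF \<alpha> fr n(4)] n(7) fp by (simp add: \<phi>_def in_chart_pt)
  qed
qed

lemma \<phi>_sub: "p \<in> points M \<Longrightarrow> vec.subspace (\<phi> p)"
  by (erule at_point) simp

lemma \<phi>_real: "p \<in> points M \<Longrightarrow> vec_cnj ` \<phi> p = \<phi> p"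
  by (erule at_point) (simp add: vec_cnj_image_span insert_commute)

lemma \<phi>_G2: "p \<in> points M \<Longrightarrow> \<phi> p \<in> G2_SO4"
proof -
  assume p: "p \<in> points M"
  obtain L where L: "L \<noteq> 0" "cross7 (cvec (F p)) L = \<i> *s L" "\<phi> p = vec.span {L, cvec (F p), vec_cnj L}"
    using at_point[OF p] by metis
  have "norm (F p) = 1" using PiE_mem[OF PE p] by simp
  from type10_G2[OF this L(1,2)] show "\<phi> p \<in> G2_SO4" unfolding L(3) .
qed

lemma \<phi>_ext: "\<phi> \<in> extensional (points M)"
  by (simp add: \<phi>_def to_G2_map_def Let_def bundle_sum_def)

lemma orthogonal_at_point:
  assumes "p \<in> points M" "cross7 (cvec (F p)) L = \<i> *s L"
  shows "hermitian L (cvec (F p)) = 0" "hermitian L (vec_cnj L) = 0" "hermitian (cvec (F p)) (vec_cnj L) = 0"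
    "cross7 (vec_cnj L) L = (- \<i> * hermitian L L) *s cvec (F p)" "hermitian (cvec (F p)) (cvec (F p)) = 1"
proof -
  have u: "hermitian (cvec (F p)) (cvec (F p)) = 1" using PiE_mem[OF PE assms(1)] by (simp add: hermitian_cvec dot_square_norm)
  from u type10[OF vec_cnj_cvec u assms(2,2)]
  show "hermitian L (cvec (F p)) = 0" "hermitian L (vec_cnj L) = 0" "hermitian (cvec (F p)) (vec_cnj L) = 0"
    "cross7 (vec_cnj L) L = (- \<i> * hermitian L L) *s cvec (F p)" "hermitian (cvec (F p)) (cvec (F p)) = 1" by simp_all
qed

lemma dim_\<phi>:
  assumes p: "p \<in> points M"
  shows "vec.dim (\<phi> p) = 3"
proof -
  obtain L where L: "L \<noteq> 0" "cross7 (cvec (F p)) L = \<i> *s L" "\<phi> p = vec.span {L, cvec (F p), vec_cnj L}"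
    using at_point[OF p] by metis
  have "cvec (F p) \<noteq> 0" using orthogonal_at_point(5)[OF p L(2)] by auto
  then show ?thesis unfolding L(3)
    using orthogonal_at_point[OF p L(2)] L(1) by (intro dim_span_3) auto
qed

lemma laplacian_\<phi>:
  assumes c: "c \<in> atlas M" "p \<in> fst c" and herm: "\<And>x y. hermitian (X *v x) y = hermitian x (X *v y)"
    and tan: "X = X ** proj_matrix (\<phi> p) + proj_matrix (\<phi> p) ** X"
  shows "laplacian (in_chart c (\<lambda>p. proj_matrix (\<phi> p))) (snd c p) \<bullet> X = 0"
    "laplacian (in_chart c (\<lambda>p. mat 1 - proj_matrix (\<phi> p))) (snd c p) \<bullet> X = 0"
proof -
  obtain B L P where fr: "framed F \<alpha> c p B L" and f: "frame B (fc F c) L P" using fr_ex[OF c] framedD(3) by metis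
  note n = nbdD[OF framedD(1)[OF fr]]
  note ch = \<phi>_frame[OF fr f]
  have pp: "frame.\<Phi> (fc F c) L (snd c p) = \<phi> p" using ch[OF n(4)] n(7) by (simp add: in_chart_pt)
  have l0: "laplacian (\<lambda>z. proj_matrix (frame.\<Phi> (fc F c) L z)) (snd c p) \<bullet> X = 0"
    by (rule frame.laplacian_proj[OF f n(4) herm]) (use tan pp in simp)
  have 1: "laplacian (in_chart c (\<lambda>p. proj_matrix (\<phi> p))) (snd c p) = laplacian (\<lambda>z. proj_matrix (frame.\<Phi> (fc F c) L z)) (snd c p)"
    by (rule laplacian_cong[OF n(3,4)]) (use ch in \<open>simp add: in_chart_pt\<close>)
  show "laplacian (in_chart c (\<lambda>p. proj_matrix (\<phi> p))) (snd c p) \<bullet> X = 0" unfolding 1 by (rule l0)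
  have "laplacian (in_chart c (\<lambda>p. mat 1 - proj_matrix (\<phi> p))) (snd c p)
      = laplacian (\<lambda>z. mat 1 - proj_matrix (frame.\<Phi> (fc F c) L z)) (snd c p)"
    by (rule laplacian_cong[OF n(3,4)]) (use ch in \<open>simp add: in_chart_pt\<close>)
  also have "\<dots> = - laplacian (\<lambda>z. proj_matrix (frame.\<Phi> (fc F c) L z)) (snd c p)"
    by (rule laplacian_const_minus[OF n(3,4) frame.smooth_proj_\<Phi>[OF f]])
  finally show "laplacian (in_chart c (\<lambda>p. mat 1 - proj_matrix (\<phi> p))) (snd c p) \<bullet> X = 0"
    using l0 by simp
qed

lemma smooth_\<phi>: "smooth_subbundle M \<phi>"
proof (rule smooth_subbundleI[OF \<phi>_ext \<phi>_sub])
  fix p assume "p \<in> points M"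
  then obtain c B L P where fr: "framed F \<alpha> c p B L" and f: "frame B (fc F c) L P" by (rule framed_point)
  have "smooth_on B (\<lambda>w. proj_matrix (in_chart c \<phi> w))"
    by (rule smooth_on_cong[OF frame.B[OF f] frame.smooth_proj_\<Phi>[OF f]]) (simp add: \<phi>_frame[OF fr f])
  then show "\<exists>c B. nbd c p B \<and> smooth_on B (\<lambda>w. proj_matrix (in_chart c \<phi> w))" using framedD(1)[OF fr] by blast
qed

lemma harmonic_\<phi>: "harmonic_bundle M G2_SO4 \<phi>"
  unfolding harmonic_bundle_def harmonic_map_def
proof (intro conjI ballI)
  show "\<phi> \<in> points M \<rightarrow>\<^sub>E G2_SO4" using \<phi>_G2 \<phi>_ext by (auto simp: PiE_iff)
  show "smooth_map_on M (points M) (\<lambda>p. proj_matrix (\<phi> p))" using smooth_\<phi> by (simp add: smooth_subbundle_def)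
  show "(\<lambda>p. proj_matrix (\<phi> p)) ` points M \<subseteq> proj_matrix ` G2_SO4" using \<phi>_G2 by auto
  fix c p X assume c: "c \<in> atlas M" "p \<in> fst c" and X: "X \<in> tangent_vectors (proj_matrix ` G2_SO4) (proj_matrix (\<phi> p))"
  have N: "\<And>A. A \<in> proj_matrix ` G2_SO4 \<Longrightarrow> \<exists>V. vec.subspace V \<and> A = proj_matrix V" using G2_subspace by blast
  show "laplacian (in_chart c (\<lambda>p. proj_matrix (\<phi> p))) (snd c p) \<bullet> X = 0"
    by (rule laplacian_\<phi>(1)[OF c tangent_proj_matrix(2)[OF N X] tangent_proj_matrix(1)[OF N X]])
qed

definition \<phi>p where "\<phi>p = perp_bundle M \<phi>"

lemma \<phi>p_at: "p \<in> points M \<Longrightarrow> \<phi>p p = orth_compl (\<phi> p)" by (simp add: \<phi>p_def perp_bundle_def)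

lemma \<phi>p_sub: "p \<in> points M \<Longrightarrow> vec.subspace (\<phi>p p)" by (simp add: \<phi>p_at subspace_orth_compl)

lemma \<phi>p_real: "p \<in> points M \<Longrightarrow> vec_cnj ` \<phi>p p = \<phi>p p"
  using \<phi>_real by (simp add: \<phi>p_at orth_compl_vec_cnj[symmetric])

text \<open>Passing from P to 1 - P changes the sign of the Laplacian, and the off-diagonal
  condition X = X P + P X is the same for both projections.\<close>

lemma harmonic_\<phi>p: "harmonic_bundle M (Grassmannian 4) \<phi>p"
  unfolding harmonic_bundle_def harmonic_map_def
proof (intro conjI ballI)
  have Gr: "\<phi>p p \<in> Grassmannian 4" if p: "p \<in> points M" for p
    using dim_orth_compl[OF \<phi>_sub[OF p]] dim_\<phi>[OF p] \<phi>p_sub[OF p] by (simp add: Grassmannian_def \<phi>p_at[OF p])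
  show "\<phi>p \<in> points M \<rightarrow>\<^sub>E Grassmannian 4" using Gr by (simp add: PiE_iff \<phi>p_def perp_bundle_def)
  show "(\<lambda>p. proj_matrix (\<phi>p p)) ` points M \<subseteq> proj_matrix ` Grassmannian 4" using Gr by auto
  have pm: "proj_matrix (\<phi>p p) = mat 1 - proj_matrix (\<phi> p)" if "p \<in> points M" for p
    using proj_matrix_orth_compl[OF \<phi>_sub[OF that]] by (simp add: \<phi>p_at[OF that])
  show "smooth_map_on M (points M) (\<lambda>p. proj_matrix (\<phi>p p))"
  proof (rule smooth_map_on_points)
    fix p assume "p \<in> points M"
    then obtain c where n: "nbd c p (snd c ` fst c)" using nbd_exists by blast
    let ?B = "snd c ` fst c"
    have "smooth_on ?B (\<lambda>w. mat 1 - proj_matrix (in_chart c \<phi> w))"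
      by (rule smooth_on_diff[OF nbdD(3)[OF n] smooth_on_const[OF nbdD(3)[OF n]] smooth_subbundle_in_chart[OF smooth_\<phi> n]])
    then have "smooth_on ?B (in_chart c (\<lambda>p. proj_matrix (\<phi>p p)))"
      by (rule smooth_on_cong[OF nbdD(3)[OF n]]) (use pm nbdD(10)[OF n] in \<open>simp add: in_chart_pt\<close>)
    then show "\<exists>c B. nbd c p B \<and> smooth_on B (in_chart c (\<lambda>p. proj_matrix (\<phi>p p)))" using n by blast
  qed
  fix c p X assume c: "c \<in> atlas M" "p \<in> fst c" and X: "X \<in> tangent_vectors (proj_matrix ` Grassmannian 4) (proj_matrix (\<phi>p p))"
  have p: "p \<in> points M" using c chart(4) by blast
  have N: "\<And>A. A \<in> proj_matrix ` Grassmannian 4 \<Longrightarrow> \<exists>V. vec.subspace V \<and> A = proj_matrix V"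
    by (auto simp: Grassmannian_def)
  have "X = X ** (mat 1 - proj_matrix (\<phi> p)) + (mat 1 - proj_matrix (\<phi> p)) ** X"
    using tangent_proj_matrix(1)[OF N X] pm[OF p] by simp
  then have "X *v x = (X ** (mat 1 - proj_matrix (\<phi> p)) + (mat 1 - proj_matrix (\<phi> p)) ** X) *v x" for x by simp
  then have tan: "X = X ** proj_matrix (\<phi> p) + proj_matrix (\<phi> p) ** X"
    by (simp add: matrix_eq matrix_vector_mult_add_rdistrib matrix_vector_mul_assoc[symmetric]
        matrix_vector_mult_diff_rdistrib matrix_vector_mult_diff_distrib algebra_simps)
  have n: "nbd c p (snd c ` fst c)" by (rule nbd_chart[OF c])
  have "laplacian (in_chart c (\<lambda>p. proj_matrix (\<phi>p p))) (snd c p) = laplacian (in_chart c (\<lambda>p. mat 1 - proj_matrix (\<phi> p))) (snd c p)"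
    by (rule laplacian_cong[OF nbdD(3,4)[OF n]]) (use pm nbdD(10)[OF n] in \<open>simp add: in_chart_pt\<close>)
  then show "laplacian (in_chart c (\<lambda>p. proj_matrix (\<phi>p p))) (snd c p) \<bullet> X = 0"
    using laplacian_\<phi>(2)[OF c tangent_proj_matrix(2)[OF N X] tan] by simp
qed

end

lemma span_cross7_type10:
  assumes f: "vec_cnj f = f" "hermitian f f = 1" and L: "L \<noteq> 0" "cross7 f L = \<i> *s L"
  shows "vec.span {cross7 v w | v w. v \<in> vec.span {vec_cnj L} \<and> w \<in> vec.span {L}} = vec.span {f}"
proof (intro equalityI vec.span_minimal vec.subspace_span)
  let ?S = "{cross7 v w | v w. v \<in> vec.span {vec_cnj L} \<and> w \<in> vec.span {L}}" and ?k = "- \<i> * hermitian L L"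
  have o: "cross7 (vec_cnj L) L = ?k *s f" using type10(7)[OF f L(2) L(2)] by simp
  show "?S \<subseteq> vec.span {f}"
  proof
    fix y assume "y \<in> ?S"
    then obtain k l where "y = cross7 (k *s vec_cnj L) (l *s L)" unfolding span_1 by blast
    then have "y = (l * (k * ?k)) *s f" using o by (simp add: vector_smult_assoc)
    then show "y \<in> vec.span {f}" unfolding span_1 by blast
  qed
  have "cross7 (vec_cnj L) L \<in> vec.span ?S" by (rule vec.span_base) (auto intro!: exI vec.span_base)
  then have "inverse ?k *s cross7 (vec_cnj L) L \<in> vec.span ?S" by (rule vec.span_scale)
  moreover have "inverse ?k *s cross7 (vec_cnj L) L = f"
  proof -
    have "?k \<noteq> 0" using L(1) by simp
    then have "inverse ?k * ?k = 1" by (rule left_inverse)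
    then show ?thesis unfolding o vector_smult_assoc by (simp only: vector_smult_lid)
  qed
  ultimately show "{f} \<subseteq> vec.span ?S" by simp
qed

text \<open>The constant projection onto W fixes g, hence also its derivative.\<close>

lemma derivative_in_subspace:
  assumes S: "open S" "w \<in> S" and W: "vec.subspace W" and g: "\<And>z. z \<in> S \<Longrightarrow> g z \<in> W" and h: "has_wirtinger g a b w"
  shows "a \<in> W"
proof -
  from has_wirtinger_eq(1)[OF S _ has_wirtinger_matrix[OF h, of "proj_matrix W"] h]
  have "proj_matrix W *v a = a" using g by (simp add: proj_matrix_mult[OF W] orth_proj_ident[OF W])
  then show ?thesis using orth_proj(1)[OF W] by (metis proj_matrix_mult[OF W])
qed

section \<open>The Gauss bundles of \<phi> and of its complement\<close>

context ac_surface
begin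

lemma \<phi>_image:
  assumes fr: "framed F \<alpha> c p B L" and f: "frame B (fc F c) L P" and w: "w \<in> B"
  shows "bundle_image d_z \<phi> (pt c w) = vec.span {frame.Q L w}"
    "frame.Q L w \<noteq> 0 \<Longrightarrow> bundle_image d_z \<phi>p (pt c w) = vec.span {vec_cnj (L w)}"
proof -
  note n = framedD(1)[OF fr]
  have "bundle_image d_z \<phi> (pt c w) = plane_image d_z (in_chart c \<phi>) w"
    by (rule bundle_image_nbd[OF wirtinger_op_d(1) n w \<phi>_sub])
  also have "\<dots> = plane_image d_z (frame.\<Phi> (fc F c) L) w"
    by (rule plane_image_cong[OF nbdD(3)[OF n] w \<phi>_frame[OF fr f]])
  also have "\<dots> = vec.span {frame.Q L w}" by (rule frame.plane_image_\<Phi>[OF f w])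
  finally show "bundle_image d_z \<phi> (pt c w) = vec.span {frame.Q L w}" .
  assume Q: "frame.Q L w \<noteq> 0"
  have "bundle_image d_z \<phi>p (pt c w) = plane_image d_z (in_chart c \<phi>p) w"
    by (rule bundle_image_nbd[OF wirtinger_op_d(1) n w \<phi>p_sub])
  also have "\<dots> = plane_image d_z (\<lambda>z. orth_compl (frame.\<Phi> (fc F c) L z)) w"
  proof (rule plane_image_cong[OF nbdD(3)[OF n] w])
    fix z assume z: "z \<in> B"
    show "in_chart c \<phi>p z = orth_compl (frame.\<Phi> (fc F c) L z)"
      using \<phi>_frame[OF fr f z] \<phi>p_at[OF nbdD(10)[OF n z]] by (simp add: in_chart_pt)
  qed
  also have "\<dots> = vec.span {vec_cnj (L w)}" by (rule frame.plane_image_perp[OF f w Q])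
  finally show "bundle_image d_z \<phi>p (pt c w) = vec.span {vec_cnj (L w)}" .
qed

lemma Q_cases:
  assumes fr: "framed F \<alpha> c p B L" and f: "frame B (fc F c) L P"
  shows "(\<exists>B'\<subseteq>B. nbd c p B' \<and> (\<forall>w\<in>B'. frame.Q L w = 0)) \<or>
    (\<exists>B'\<subseteq>B. \<exists>R k. nbd c p B' \<and> smooth_on B' R \<and> (\<forall>w\<in>B'. frame.Q L w = (w - snd c p) ^ k *s R w) \<and> (\<forall>w\<in>B'. R w \<noteq> 0))"
proof -
  note n = framedD(1)[OF fr]
  show ?thesis
  proof (rule dbar_eq_zero[OF nbdD(3,4)[OF n] frame.sQ[OF f] frame.sY[OF f] frame.Q_dbar_eq[OF f]])
    fix r assume r: "r > 0" "ball (snd c p) r \<subseteq> B" and z: "\<And>z. z \<in> ball (snd c p) r \<Longrightarrow> frame.Q L z = 0"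
    then show ?thesis using nbd_subset[OF n open_ball _ r(2)] by (intro disjI1 exI[of _ "ball (snd c p) r"]) auto
  next
    fix r k R assume r: "r > 0" "ball (snd c p) r \<subseteq> B"
      and R: "dbar_eq (ball (snd c p) r) (frame.Q L) (\<lambda>w. (- inverse (hermitian (L w) (L w))) *s L w) R"
      "\<And>z. z \<in> ball (snd c p) r \<Longrightarrow> frame.Q L z = (z - snd c p) ^ k *s R z" "\<And>z. z \<in> ball (snd c p) r \<Longrightarrow> R z \<noteq> 0"
    have "smooth_on (ball (snd c p) r) R" using R(1) by (simp add: dbar_eq_def)
    then show ?thesis using nbd_subset[OF n open_ball _ r(2)] r R(2,3)
      by (intro disjI2 exI[of _ "ball (snd c p) r"] conjI exI[of _ R] exI[of _ k]) auto
  qed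
qed

text \<open>If \<open>Q\<close> vanished identically, \<open>\<phi>\<close> would be constant and \<open>F\<close> would map into the great sphere of
  \<open>\<phi>\<close>.\<close>

lemma Q_not_locally_zero:
  "\<forall>p\<in>points M. \<not> (\<exists>T. openin (surf_top M) T \<and> p \<in> T \<and> (\<forall>q\<in>T. bundle_image d_z \<phi> q = {0}))"
proof -
  let ?Z = "\<lambda>q. bundle_image d_z \<phi> q = {0}"
  have "(\<forall>p\<in>points M. ?Z p) \<or> (\<forall>p\<in>points M. \<not> (\<exists>T. openin (surf_top M) T \<and> p \<in> T \<and> (\<forall>q\<in>T. ?Z q)))"
  proof (rule connected_dichotomy)
    fix p assume "p \<in> points M"
    then obtain c B L P where fr: "framed F \<alpha> c p B L" and f: "frame B (fc F c) L P" by (rule framed_point)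
    have Z: "?Z q \<longleftrightarrow> frame.Q L (snd c q) = 0" if n: "nbd c p B'" "B' \<subseteq> B" and q: "q \<in> nbd_set c B'" for B' q
    proof -
      have "snd c q \<in> B" "pt c (snd c q) = q" using nbd_set(6)[OF n(1) q] n(2) by auto
      then show ?thesis using \<phi>_image(1)[OF fr f, of "snd c q"] by (simp add: span_line_zero)
    qed
    from Q_cases[OF fr f]
    show "\<exists>T. openin (surf_top M) T \<and> p \<in> T \<and> ((\<forall>q\<in>T. ?Z q) \<or> (\<forall>q\<in>T. q \<noteq> p \<longrightarrow> \<not> ?Z q))"
    proof (elim disjE exE conjE)
      fix B' assume B': "B' \<subseteq> B" and n: "nbd c p B'" and z: "\<forall>w\<in>B'. frame.Q L w = 0"
      have "\<forall>q\<in>nbd_set c B'. ?Z q" using Z[OF n B'] z nbd_set(6)[OF n] by blast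
      then show ?thesis using nbd_set(1,2)[OF n] by blast
    next
      fix B' R k assume B': "B' \<subseteq> B" and n: "nbd c p B'" and R: "\<forall>w\<in>B'. frame.Q L w = (w - snd c p) ^ k *s R w" "\<forall>w\<in>B'. R w \<noteq> 0"
      have "\<not> ?Z q" if q: "q \<in> nbd_set c B'" "q \<noteq> p" for q
      proof -
        have w: "snd c q \<in> B'" "snd c q \<noteq> snd c p" using nbd_set(6)[OF n q(1)] q(2) by auto
        then have "frame.Q L (snd c q) \<noteq> 0" using R by (simp add: vector_mul_eq_0)
        then show ?thesis using Z[OF n B' q(1)] by simp
      qed
      then show ?thesis using nbd_set(1,2)[OF n] by blast
    qed
  qed
  then show ?thesis
  proof
    assume Z: "\<forall>p\<in>points M. ?Z p"
    have lc: "\<exists>T. openin (surf_top M) T \<and> p \<in> T \<and> (\<forall>q\<in>T. \<phi> q = \<phi> p)" if p: "p \<in> points M" for p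
    proof -
      obtain c B L P where fr: "framed F \<alpha> c p B L" and f: "frame B (fc F c) L P" by (rule framed_point[OF p])
      note n = framedD(1)[OF fr]
      have "frame.Q L w = 0" if "w \<in> B" for w
        using \<phi>_image(1)[OF fr f that] Z nbdD(10)[OF n that] by (simp add: span_line_zero[symmetric])
      then have "frame.\<Phi> (fc F c) L w = frame.\<Phi> (fc F c) L (snd c p)" if "w \<in> B" for w
        by (intro frame.proj_constant[OF f _ framedD(2)[OF fr] that nbdD(4)[OF n]])
      then have ch: "\<phi> (pt c w) = \<phi> p" if "w \<in> B" for w
        using \<phi>_frame[OF fr f that] \<phi>_frame[OF fr f nbdD(4)[OF n]] that nbdD(7)[OF n] by (simp add: in_chart_pt)
      have "\<phi> q = \<phi> p" if q: "q \<in> nbd_set c B" for q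
      proof -
        have "snd c q \<in> B" "pt c (snd c q) = q" using nbd_set(6)[OF n q] by auto
        then show ?thesis using ch[of "snd c q"] by simp
      qed
      then show ?thesis using nbd_set(1,2)[OF n] by blast
    qed
    obtain p where p: "p \<in> points M" using points_nonempty by blast
    obtain V where V: "associative_subspace V" "\<phi> p = complexification V" using \<phi>_G2[OF p] by (auto simp: G2_SO4_def)
    have "totally_geodesic_S2 (V \<inter> sphere 0 1)"
      using V(1) totally_geodesic_S2_iff_great_sphere unfolding associative_subspace_def by blast
    moreover have "F q \<in> V \<inter> sphere 0 1" if q: "q \<in> points M" for q
    proof -
      obtain L where "\<phi> q = vec.span {L, cvec (F q), vec_cnj L}" using at_point[OF q] by metis
      then have "cvec (F q) \<in> \<phi> q" by (auto intro: vec.span_base)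
      also have "\<phi> q = \<phi> p" by (rule locally_constant[OF lc q p])
      finally have "F q \<in> V" unfolding V(2) by (rule complexification_cvec)
      then show ?thesis using PiE_mem[OF PE q] by simp
    qed
    ultimately show ?thesis using F unfolding almost_complex_maps_def by blast
  qed
qed

lemma second_frames:
  assumes p: "p \<in> points M"
  shows "\<exists>c B L P R k. framed F \<alpha> c p B L \<and> frame B (fc F c) L P \<and> smooth_on B R \<and>
    (\<forall>w\<in>B. frame.Q L w = (w - snd c p) ^ k *s R w) \<and> (\<forall>w\<in>B. R w \<noteq> 0)"
proof -
  obtain c B L P where fr: "framed F \<alpha> c p B L" and f: "frame B (fc F c) L P" by (rule framed_point[OF p])
  from Q_cases[OF fr f] show ?thesis
  proof (elim disjE exE conjE)
    fix B' assume B': "B' \<subseteq> B" and n: "nbd c p B'" and z: "\<forall>w\<in>B'. frame.Q L w = 0"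
    have "bundle_image d_z \<phi> q = {0}" if q: "q \<in> nbd_set c B'" for q
    proof -
      have "snd c q \<in> B'" "pt c (snd c q) = q" using nbd_set(6)[OF n q] by auto
      then show ?thesis using \<phi>_image(1)[OF fr f, of "snd c q"] z B' by (auto simp: span_line_zero)
    qed
    then have "\<exists>T. openin (surf_top M) T \<and> p \<in> T \<and> (\<forall>q\<in>T. bundle_image d_z \<phi> q = {0})" using nbd_set(1,2)[OF n] by blast
    then show ?thesis using bspec[OF Q_not_locally_zero p] by simp
  next
    fix B' R k assume B': "B' \<subseteq> B" and n: "nbd c p B'" and sR: "smooth_on B' R"
      and R: "\<forall>w\<in>B'. frame.Q L w = (w - snd c p) ^ k *s R w" "\<forall>w\<in>B'. R w \<noteq> 0"
    obtain r where r: "r > 0" "ball (snd c p) r \<subseteq> B'" using nbdD(3,4)[OF n] open_contains_ball by blast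
    let ?B = "ball (snd c p) r"
    have sub: "?B \<subseteq> B" using r B' by blast
    have "framed F \<alpha> c p ?B L"
      unfolding framed_def using nbd_subset[OF n open_ball _ r(2)] r(1) frame_restrict[OF f open_ball sub] framedD(4,5)[OF fr] sub
      by (auto simp del: mem_ball)
    moreover have "smooth_on ?B R" by (rule smooth_on_subset[OF sR r(2)])
    ultimately show ?thesis using frame_restrict[OF f open_ball sub] R r(2) by blast
  qed
qed

text \<open>R is Q divided by a power of the coordinate. The relation F \<times> R = \<i> R is
  carried through \<open>line_fill\<close>, since it makes R isotropic and thereby \<phi> strongly
  conformal.\<close>

lemma second_bundle:
  obtains \<gamma> where "is_filled M \<phi> (A_of d_z \<phi>) \<gamma>"
    "\<And>p. p \<in> points M \<Longrightarrow> \<exists>R. R \<noteq> 0 \<and> \<gamma> p = vec.span {R} \<and> cross7 (cvec (F p)) R = \<i> *s R"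
proof -
  let ?I = "bundle_image d_z \<phi>"
  let ?R = "\<lambda>c B R. \<forall>w\<in>B. cross7 (fc F c w) (R w) = \<i> *s R w"
  have ex: "\<exists>c B R. nbd c p B \<and> smooth_on B R \<and> (\<forall>w\<in>B. R w \<noteq> 0) \<and>
      (\<forall>w\<in>B. w \<noteq> snd c p \<longrightarrow> ?I (pt c w) = vec.span {R w}) \<and> (?I p = vec.span {R (snd c p)} \<or> ?I p = {0}) \<and> ?R c B R"
    if p: "p \<in> points M" for p
  proof -
    obtain c B L P R k where fr: "framed F \<alpha> c p B L" and f: "frame B (fc F c) L P" and sR: "smooth_on B R"
      and Q: "\<And>w. w \<in> B \<Longrightarrow> frame.Q L w = (w - snd c p) ^ k *s R w" and R0: "\<forall>w\<in>B. R w \<noteq> 0"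
      using second_frames[OF p] by blast
    note n = framedD(1)[OF fr]
    have I: "?I (pt c w) = vec.span {(w - snd c p) ^ k *s R w}" if "w \<in> B" for w
      using \<phi>_image(1)[OF fr f that] Q[OF that] by simp
    have off: "cross7 (fc F c w) (R w) = \<i> *s R w" if w: "w \<in> B" "w \<noteq> snd c p" for w
    proof -
      have "(w - snd c p) ^ k *s cross7 (fc F c w) (R w) = (w - snd c p) ^ k *s (\<i> *s R w)"
        using frame.fQ[OF f w(1)] Q[OF w(1)] by (simp add: vector_smult_assoc mult.commute)
      then have "(w - snd c p) ^ k = 0 \<or> cross7 (fc F c w) (R w) = \<i> *s R w" by (simp only: vector_mul_lcancel)
      then show ?thesis using w(2) by simp
    qed
    have "?R c B R" using type10_center[OF nbdD(3)[OF n] frame.f[OF f] sR off] by blast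
    moreover have "\<forall>w\<in>B. w \<noteq> snd c p \<longrightarrow> ?I (pt c w) = vec.span {R w}" using I by (simp add: span_line_scale)
    moreover have "?I p = vec.span {R (snd c p)} \<or> ?I p = {0}"
      using I[OF nbdD(4)[OF n]] unfolding nbdD(7)[OF n] by (cases k) (auto simp: span_line_zero)
    ultimately show ?thesis using n sR R0 by blast
  qed
  obtain \<gamma> where sm: "smooth_subbundle M \<gamma>" and \<gamma>: "\<forall>p\<in>points M. \<exists>c B R. nbd c p B \<and> smooth_on B R \<and> (\<forall>w\<in>B. R w \<noteq> 0) \<and>
      ?R c B R \<and> (\<forall>w\<in>B. in_chart c \<gamma> w = vec.span {R w}) \<and> (\<forall>w\<in>B. w \<noteq> snd c p \<longrightarrow> ?I (pt c w) = vec.span {R w})"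
    using line_fill[where I = ?I and R = ?R, OF ex] by blast
  have "is_filled M \<phi> (A_of d_z \<phi>) \<gamma> \<longleftrightarrow> smooth_subbundle M \<gamma> \<and>
    (\<forall>p\<in>points M. \<exists>T. openin (surf_top M) T \<and> p \<in> T \<and> (\<forall>q\<in>T. q \<noteq> p \<longrightarrow> \<gamma> q = ?I q))"
    by (rule is_filled_iff[OF wirtinger_op_d(1)]) (rule \<phi>_sub)
  moreover have "\<exists>T. openin (surf_top M) T \<and> p \<in> T \<and> (\<forall>q\<in>T. q \<noteq> p \<longrightarrow> \<gamma> q = ?I q)" if p: "p \<in> points M" for p
  proof -
    obtain c B R where *: "nbd c p B \<and> smooth_on B R \<and> (\<forall>w\<in>B. R w \<noteq> 0) \<and>
      ?R c B R \<and> (\<forall>w\<in>B. in_chart c \<gamma> w = vec.span {R w}) \<and> (\<forall>w\<in>B. w \<noteq> snd c p \<longrightarrow> ?I (pt c w) = vec.span {R w})"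
      using bspec[OF \<gamma> p] by (elim exE)
    then have n: "nbd c p B" and g: "\<forall>w\<in>B. in_chart c \<gamma> w = vec.span {R w}"
      and I: "\<forall>w\<in>B. w \<noteq> snd c p \<longrightarrow> ?I (pt c w) = vec.span {R w}" by simp_all
    have "\<gamma> q = ?I q" if q: "q \<in> nbd_set c B" "q \<noteq> p" for q
    proof -
      have w: "snd c q \<in> B" "pt c (snd c q) = q" "snd c q \<noteq> snd c p" using nbd_set(6)[OF n q(1)] q(2) by auto
      then show ?thesis using g I by (metis in_chart_pt)
    qed
    then show ?thesis using nbd_set(1,2)[OF n] by blast
  qed
  ultimately have fil: "is_filled M \<phi> (A_of d_z \<phi>) \<gamma>" using sm by blast
  have pt: "\<exists>R. R \<noteq> 0 \<and> \<gamma> p = vec.span {R} \<and> cross7 (cvec (F p)) R = \<i> *s R" if p: "p \<in> points M" for p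
  proof -
    obtain c B R where *: "nbd c p B \<and> smooth_on B R \<and> (\<forall>w\<in>B. R w \<noteq> 0) \<and>
      ?R c B R \<and> (\<forall>w\<in>B. in_chart c \<gamma> w = vec.span {R w}) \<and> (\<forall>w\<in>B. w \<noteq> snd c p \<longrightarrow> ?I (pt c w) = vec.span {R w})"
      using bspec[OF \<gamma> p] by (elim exE)
    then have n: "nbd c p B" and R: "\<forall>w\<in>B. R w \<noteq> 0" "?R c B R" and g: "\<forall>w\<in>B. in_chart c \<gamma> w = vec.span {R w}" by simp_all
    have "fc F c (snd c p) = cvec (F p)" "in_chart c \<gamma> (snd c p) = \<gamma> p"
      using nbdD(7)[OF n] by (simp_all add: fc_def in_chart_pt)
    then show ?thesis using R g nbdD(4)[OF n] by (intro exI[of _ "R (snd c p)"]) metis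
  qed
  from that[OF fil pt] show ?thesis by blast
qed

text \<open>Where Q is nonzero the image on the complement is the line of cnj L, and the zeros of Q
  are isolated.\<close>

lemma \<phi>p_filled: "is_filled M \<phi>p (A_of d_z \<phi>p) (cnjb \<alpha>)"
proof -
  let ?I = "bundle_image d_z \<phi>p"
  have "is_filled M \<phi>p (A_of d_z \<phi>p) (cnjb \<alpha>) \<longleftrightarrow> smooth_subbundle M (cnjb \<alpha>) \<and>
    (\<forall>p\<in>points M. \<exists>T. openin (surf_top M) T \<and> p \<in> T \<and> (\<forall>q\<in>T. q \<noteq> p \<longrightarrow> cnjb \<alpha> q = ?I q))"
    by (rule is_filled_iff[OF wirtinger_op_d(1)]) (rule \<phi>p_sub)
  moreover have "\<exists>T. openin (surf_top M) T \<and> p \<in> T \<and> (\<forall>q\<in>T. q \<noteq> p \<longrightarrow> cnjb \<alpha> q = ?I q)" if p: "p \<in> points M" for p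
  proof -
    obtain c B L P R k where fr: "framed F \<alpha> c p B L" and f: "frame B (fc F c) L P"
      and Q: "\<And>w. w \<in> B \<Longrightarrow> frame.Q L w = (w - snd c p) ^ k *s R w" and R0: "\<forall>w\<in>B. R w \<noteq> 0"
      using second_frames[OF p] by blast
    note n = framedD(1)[OF fr]
    have "cnjb \<alpha> q = ?I q" if q: "q \<in> nbd_set c B" "q \<noteq> p" for q
    proof -
      have w: "snd c q \<in> B" "pt c (snd c q) = q" "snd c q \<noteq> snd c p" using nbd_set(6)[OF n q(1)] q(2) by auto
      have "frame.Q L (snd c q) \<noteq> 0" using Q[OF w(1)] R0 w by (simp add: vector_mul_eq_0)
      then have "?I q = vec.span {vec_cnj (L (snd c q))}" using \<phi>_image(2)[OF fr f w(1)] w(2) by simp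
      moreover have "\<alpha> q = vec.span {L (snd c q)}" using framedD(4)[OF fr w(1)] w(2) by (simp add: in_chart_pt)
      ultimately show ?thesis using nbd_set(3)[OF n] q(1) by (auto simp: cnjb_def vec_cnj_image_span)
    qed
    then show ?thesis using nbd_set(1,2)[OF n] by blast
  qed
  ultimately show ?thesis using smooth_subbundle_cnjb[OF \<alpha>s] by blast
qed

lemma G_\<phi>p: "G' M \<phi>p = cnjb \<alpha>" "G'' M \<phi>p = \<alpha>"
  using G'_eq[OF \<phi>p_filled] G''_eq[OF is_filled_cnjb(1)[OF \<phi>p_sub \<phi>p_real \<phi>p_filled]] cnjb_cnjb[OF \<alpha>s] by simp_all

lemma bundle_cross_eq: "bundle_cross M (cnjb \<alpha>) \<alpha> = fb F"
proof (rule extensionalityI[of _ "points M"])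
  fix p assume p: "p \<in> points M"
  obtain L where L: "L \<noteq> 0" "cross7 (cvec (F p)) L = \<i> *s L" "\<alpha> p = vec.span {L}" using at_point[OF p] by metis
  show "bundle_cross M (cnjb \<alpha>) \<alpha> p = fb F p"
    using p span_cross7_type10[OF vec_cnj_cvec orthogonal_at_point(5)[OF p L(2)] L(1,2)]
    by (simp add: bundle_cross_def cnjb_def line_bundle_of_def L(3) vec_cnj_image_span)
qed (simp_all add: bundle_cross_def line_bundle_of_def)

lemma smooth_fb: "smooth_subbundle M (fb F)"
proof (rule smooth_subbundleI)
  show "fb F \<in> extensional (points M)" by (simp add: line_bundle_of_def)
  fix p assume p: "p \<in> points M"
  show "vec.subspace (fb F p)" by (rule fb_subspace[OF p])
  obtain c where n: "nbd c p (snd c ` fst c)" using nbd_exists[OF p] by blast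
  note c = nbdD(1)[OF n]
  have f0: "fc F c w \<noteq> 0" if "w \<in> snd c ` fst c" for w using fc_unit(2)[OF PE c that] by auto
  have "smooth_on (snd c ` fst c) (\<lambda>w. proj_matrix (in_chart c (fb F) w))"
    by (rule smooth_on_cong[OF nbdD(3)[OF n] smooth_on_outer_normalized[OF nbdD(3)[OF n] smooth_fc[OF smF c] f0]])
       (simp_all add: fb_chart[OF c] proj_matrix_span_1 f0)
  then show "\<exists>c B. nbd c p B \<and> smooth_on B (\<lambda>w. proj_matrix (in_chart c (fb F) w))" using n by blast
qed

text \<open>If the line were a fixed W, then F_z would lie in W and so be a multiple of F; but F_z
  is orthogonal to F, hence zero, against the last clause of \<open>framed\<close>.\<close>

lemma fb_nonconstant: "\<not> (\<exists>W. \<forall>p\<in>points M. fb F p = W)"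
proof
  assume "\<exists>W. \<forall>p\<in>points M. fb F p = W"
  then obtain W where W: "\<And>p. p \<in> points M \<Longrightarrow> fb F p = W" by blast
  obtain p where p: "p \<in> points M" using points_nonempty by blast
  obtain c B L P where fr: "framed F \<alpha> c p B L" and f: "frame B (fc F c) L P" by (rule framed_point[OF p])
  note n = framedD(1)[OF fr]
  have "\<not> (B \<subseteq> {snd c p})"
  proof
    assume "B \<subseteq> {snd c p}"
    then have "B = {snd c p}" using nbdD(4)[OF n] by blast
    then show False using nbdD(3)[OF n] not_open_singleton[of "snd c p"] by simp
  qed
  then obtain w where w: "w \<in> B" "w \<noteq> snd c p" by blast
  have sW: "vec.subspace W" using W[OF p] fb_subspace[OF p, of F] by simp
  have mem: "in_chart c (fb F) z = W" if "z \<in> B" for z using W nbdD(10)[OF n that] by (simp add: in_chart_pt)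
  have fW: "fc F c z \<in> W" if "z \<in> B" for z
  proof -
    have "in_chart c (fb F) z = vec.span {fc F c z}" using nbdD(5)[OF n] that by (intro fb_chart[OF nbdD(1)[OF n]]) blast
    then show ?thesis using mem[OF that] by (auto intro: vec.span_base)
  qed
  have "has_wirtinger (fc F c) (d_z (fc F c) w) (d_zbar (fc F c) w) w"
    by (rule smooth_on_has_wirtinger[OF frame.f[OF f] w(1)])
  from derivative_in_subspace[OF nbdD(3)[OF n] w(1) sW _ this] have "d_z (fc F c) w \<in> W" using fW by simp
  then have "d_z (fc F c) w \<in> vec.span {fc F c w}"
    using mem[OF w(1)] fb_chart[OF nbdD(1)[OF n], of w] nbdD(5)[OF n] w(1) by auto
  then obtain k where k: "d_z (fc F c) w = k *s fc F c w" unfolding span_1 by blast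
  have "hermitian (d_z (fc F c) w) (fc F c w) = 0"
    using frame.fz[OF f w(1)] frame.orthL(1)[OF f w(1)] by simp
  then have "k = 0" unfolding k using frame.fu[OF f w(1)] by simp
  then show False using framedD(5)[OF fr w] k by simp
qed

lemma \<phi>_conformal: "\<phi> \<in> conformal_G2_maps M"
proof -
  obtain \<gamma> where \<gamma>: "is_filled M \<phi> (A_of d_z \<phi>) \<gamma>"
    and g: "\<And>p. p \<in> points M \<Longrightarrow> \<exists>R. R \<noteq> 0 \<and> \<gamma> p = vec.span {R} \<and> cross7 (cvec (F p)) R = \<i> *s R"
    using second_bundle by blast
  have G: "G' M \<phi> = \<gamma>" "G'' M \<phi> = cnjb \<gamma>"
    using G'_eq[OF \<gamma>] G''_eq[OF is_filled_cnjb(1)[OF \<phi>_sub \<phi>_real \<gamma>]] by simp_all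
  \<comment> \<open>Isotropy of vectors of type (1,0) serves for both conformality claims: R spans
    \<open>G'\<close> of \<phi>, and L spans \<open>G''\<close> of the complement.\<close>
  have o: "hermitian v w = 0" if p: "p \<in> points M" and R: "cross7 (cvec (F p)) R = \<i> *s R"
      and v: "v \<in> vec.span {R}" and w: "w \<in> vec_cnj ` vec.span {R}" for p R v w
    using v w orthogonal_at_point(2)[OF p R] unfolding vec_cnj_image_span by (auto simp: span_1)
  have "hermitian v w = 0" if "p \<in> points M" "v \<in> \<gamma> p" "w \<in> cnjb \<gamma> p" for p v w
    using g[OF that(1)] o[OF that(1)] that by (auto simp: cnjb_def)
  then have 1: "strongly_conformal M G2_SO4 \<phi>" unfolding strongly_conformal_def G using harmonic_\<phi> by blast
  have "hermitian w v = 0" if p: "p \<in> points M" and v: "v \<in> \<alpha> p" and w: "w \<in> cnjb \<alpha> p" for p v w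
  proof -
    obtain L where L: "cross7 (cvec (F p)) L = \<i> *s L" "\<alpha> p = vec.span {L}" using at_point[OF p] by metis
    have "w \<in> vec_cnj ` vec.span {L}" using w p by (simp add: cnjb_def L(2))
    from o[OF p L(1) _ this] have "hermitian v w = 0" using v by (simp add: L(2))
    then show ?thesis by (simp only: hermitian_zero_commute)
  qed
  then have 2: "strongly_conformal M (Grassmannian 4) \<phi>p" unfolding strongly_conformal_def G_\<phi>p using harmonic_\<phi>p by blast
  have "vec.dim (\<gamma> p) = 1" if "p \<in> points M" for p using g[OF that] dim_span_1 by fastforce
  then have 3: "has_rank M (G' M \<phi>) 1" by (simp add: has_rank_def G)
  have 4: "nonconstant_subbundle M (bundle_cross M (G' M \<phi>p) (G'' M \<phi>p))"
    unfolding G_\<phi>p bundle_cross_eq nonconstant_subbundle_def using smooth_fb fb_nonconstant by blast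
  show ?thesis unfolding conformal_G2_maps_def using 1 2 3 4 by (simp add: \<phi>p_def)
qed

text \<open>Every L in the fibre is a multiple of a frame vector, so F \<times> L = \<i> L holds for
  it, and \<open>type10\<close> evaluates cnj L \<times> L.\<close>

lemma section_formula:
  assumes q: "q \<in> points M" and L: "L \<in> G'' M (perp_bundle M \<phi>) q" "L \<noteq> 0"
  shows "cvec (F q) = (\<i> / complex_of_real ((norm L)\<^sup>2)) *s cross7 (vec_cnj L) L"
proof -
  have "L \<in> \<alpha> q" using L(1) G_\<phi>p(2) by (simp add: \<phi>p_def)
  moreover obtain L' where L': "cross7 (cvec (F q)) L' = \<i> *s L'" "\<alpha> q = vec.span {L'}" using at_point[OF q] by metis
  ultimately obtain k where "L = k *s L'" by (auto simp: span_1)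
  then have "cross7 (cvec (F q)) L = \<i> *s L" using L'(1) by (simp add: vector_smult_assoc mult.commute)
  from orthogonal_at_point(4)[OF q this] have e: "cross7 (vec_cnj L) L = (- \<i> * complex_of_real ((norm L)\<^sup>2)) *s cvec (F q)"
    by (simp add: hermitian_self)
  show ?thesis unfolding e using L(2) by (simp add: vector_smult_assoc)
qed

lemma section_exists:
  assumes p: "p \<in> points M"
  shows "\<exists>U L. p \<in> U \<and> nonvanishing_section M (G'' M (perp_bundle M \<phi>)) U L"
proof -
  obtain c B L P where fr: "framed F \<alpha> c p B L" and f: "frame B (fc F c) L P" by (rule framed_point[OF p])
  note n = framedD(1)[OF fr]
  have "smooth_on B (in_chart c (\<lambda>q. L (snd c q)))"
    by (rule smooth_on_cong[OF nbdD(3)[OF n] frame.L[OF f]]) (simp add: in_chart_pt nbdD(9)[OF n])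
  then have "smooth_map_on M (nbd_set c B) (\<lambda>q. L (snd c q))" by (rule smooth_map_on_nbd[OF n])
  moreover have "L (snd c q) \<in> \<alpha> q \<and> L (snd c q) \<noteq> 0" if q: "q \<in> nbd_set c B" for q
  proof -
    have w: "snd c q \<in> B" "pt c (snd c q) = q" using nbd_set(6)[OF n q] by auto
    then have "\<alpha> q = vec.span {L (snd c q)}" using framedD(4)[OF fr w(1)] by (simp add: in_chart_pt)
    then show ?thesis using frame.L0[OF f w(1)] by (simp add: vec.span_base)
  qed
  ultimately have "nonvanishing_section M \<alpha> (nbd_set c B) (\<lambda>q. L (snd c q))"
    using nbd_set(1)[OF n] by (simp add: nonvanishing_section_def smooth_section_def)
  then show ?thesis using nbd_set(2)[OF n] G_\<phi>p(2) by (auto simp: \<phi>p_def)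
qed

end

lemma (in rsurface) ac_surface_exists:
  assumes "F \<in> almost_complex_maps M"
  obtains \<alpha> where "ac_surface M F \<alpha>"
proof -
  obtain \<alpha> where "is_filled M (fb F) (A_of d_z (fb F)) \<alpha>" "smooth_subbundle M \<alpha>"
    "\<And>c p. c \<in> atlas M \<Longrightarrow> p \<in> fst c \<Longrightarrow> \<exists>B L. framed F \<alpha> c p B L"
    using first_frames[OF assms] by blast
  then have "ac_surface M F \<alpha>" using assms by unfold_locales
  then show ?thesis by (rule that)
qed

section \<open>From harmonic maps to almost complex maps\<close>

lemma vec_cnj_complexification:
  assumes W: "subspace W"
  shows "vec_cnj ` complexification W = complexification W"
proof -
  have "vec_cnj x \<in> complexification W" if x: "x \<in> complexification W" for x
  proof -
    obtain u v where uv: "u \<in> W" "v \<in> W" "x = cvec u + \<i> *s cvec v" using x unfolding complexification_def by blast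
    have "vec_cnj x = cvec u + \<i> *s cvec (- v)" unfolding uv by (simp add: vec_eq_iff)
    then show ?thesis using uv subspace_neg[OF W] unfolding complexification_def by blast
  qed
  then show ?thesis by (auto intro!: image_eqI[of x vec_cnj "vec_cnj x" for x])
qed

lemma dim_complexification_le:
  assumes W: "subspace (W :: (real^'n) set)" "dim W = 3"
  shows "vec.dim (complexification W) \<le> 3"
proof -
  obtain B where B: "B \<subseteq> W" "W \<subseteq> span B" "card B = 3" using basis_exists[of W] W(2) by metis
  obtain x y z where "B = {x, y, z}" using B(3) by (auto simp: card_3_iff)
  moreover have "W = span B" using B W(1) by (metis span_minimal subset_antisym)
  ultimately have "complexification W = vec.span {cvec x, cvec y, cvec z}" by (simp add: complexification_span)
  then have "vec.dim (complexification W) \<le> card {cvec x, cvec y, cvec z}"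
    by (intro vec.dim_le_card) auto
  also have "\<dots> \<le> 3" by (auto simp: card_insert_if)
  finally show ?thesis .
qed

text \<open>For the dimension an upper bound suffices: three independent vectors will be exhibited
  in V, and V is then their span.\<close>

lemma G2_facts:
  assumes V: "V \<in> G2_SO4"
  shows "vec_cnj ` V = V" "\<And>x y. x \<in> V \<Longrightarrow> y \<in> V \<Longrightarrow> cross7 x y \<in> V" "vec.dim V \<le> 3"
proof -
  obtain W where W: "associative_subspace W" "V = complexification W" using V by (auto simp: G2_SO4_def)
  have sW: "subspace W" "dim W = 3" using W(1) by (auto simp: associative_subspace_def)
  show "vec_cnj ` V = V" "vec.dim V \<le> 3" unfolding W(2)
    by (rule vec_cnj_complexification[OF sW(1)], rule dim_complexification_le[OF sW])
  fix x y assume "x \<in> V" "y \<in> V"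
  then obtain u v u' v' where uv: "u \<in> W" "v \<in> W" "u' \<in> W" "v' \<in> W" "x = cvec u + \<i> *s cvec v" "y = cvec u' + \<i> *s cvec v'"
    unfolding W(2) complexification_def by blast
  have "cross7 x y = cvec (cross7 u u' - cross7 v v') + \<i> *s cvec (cross7 u v' + cross7 v u')"
    unfolding uv by (simp add: cross7_cvec vec_eq_iff algebra_simps)
  moreover have "cross7 u u' - cross7 v v' \<in> W" "cross7 u v' + cross7 v u' \<in> W"
    using associative_subspace_cross7[OF W(1)] uv subspace_add[OF sW(1)] subspace_diff[OF sW(1)] by auto
  ultimately show "cross7 x y \<in> V" unfolding W(2) complexification_def by blast
qed

text \<open>Isotropy of L = u + \<i> v means |u| = |v| and u orthogonal to v. The unit vector x =
  -(u \<times> v) / |u|^2 then satisfies x \<times> u = -v and x \<times> v = u, which is the claim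
  on real and imaginary parts.\<close>

lemma isotropic_type10:
  assumes L0: "L \<noteq> 0" and iso: "hermitian L (vec_cnj L) = 0"
  obtains x :: "real^7" where "norm x = 1" "cross7 (cvec x) L = \<i> *s L"
proof -
  obtain u v where L: "L = cvec u + \<i> *s cvec v" using cvec_real_imag by blast
  have "hermitian L (vec_cnj L) = complex_of_real (u \<bullet> u - v \<bullet> v) + \<i> * complex_of_real (2 * (u \<bullet> v))"
    unfolding L by (simp add: hermitian_cvec inner_commute algebra_simps)
  then have uv: "u \<bullet> u = v \<bullet> v" "u \<bullet> v = 0" using iso by (simp_all add: complex_eq_iff)
  have u0: "u \<bullet> u \<noteq> 0"
  proof
    assume "u \<bullet> u = 0"
    then have "u = 0" "v = 0" using uv(1) by simp_all
    then show False using L0 by (simp add: L)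
  qed
  have 1: "cross7 (cross7 u v) u = (u \<bullet> u) *\<^sub>R v"
    using cross7_commute[of "cross7 u v" u] cross7_cross7_real[of u v] uv by simp
  have "cross7 (cross7 u v) v = cross7 v (cross7 v u)"
    using cross7_commute[of "cross7 u v" v] cross7_commute[of u v] by simp
  then have 2: "cross7 (cross7 u v) v = - (u \<bullet> u) *\<^sub>R u"
    using cross7_cross7_real[of v u] uv by (simp add: inner_commute)
  let ?x = "(- inverse (u \<bullet> u)) *\<^sub>R cross7 u v"
  have "cross7 u v \<bullet> cross7 u v = (u \<bullet> u)\<^sup>2"
  proof -
    have "cross7 u v \<bullet> cross7 u v = - (v \<bullet> cross7 u (cross7 u v))"
      using bilin_cross7_swap[of u v "cross7 u v"] by (simp add: bilin_inner)
    then show ?thesis using cross7_cross7_real[of u v] uv by (simp add: power2_eq_square)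
  qed
  then have "?x \<bullet> ?x = 1" using u0 by (simp add: power2_eq_square field_simps)
  then have "norm ?x = 1" by (simp only: norm_eq_1)
  moreover have "cross7 ?x u = - v" "cross7 ?x v = u" using u0 by (simp_all only: cross7_scaleR 1 2) simp_all
  then have "cross7 (cvec ?x) L = \<i> *s L" unfolding L by (simp only: cross7_simps cross7_cvec) (simp add: vec_eq_iff algebra_simps)
  ultimately show ?thesis by (rule that)
qed

text \<open>The bundle maps \<open>A'\<close> of \<open>\<Phi>\<close> and \<open>-A''\<close> of its complement are adjoint to each other.\<close>

lemma adjoint_rank_one:
  fixes \<Phi> :: "complex \<Rightarrow> (complex^'n) set"
  assumes S: "open S" "w \<in> S" and sub: "\<And>z. z \<in> S \<Longrightarrow> vec.subspace (\<Phi> z)"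
    and sm: "smooth_on S (\<lambda>z. proj_matrix (\<Phi> z))"
    and im: "plane_image d_z \<Phi> w = vec.span {r}" "r \<noteq> 0"
    and A: "plane_image d_zbar (\<lambda>z. orth_compl (\<Phi> z)) w = A" "vec.subspace A"
  shows "A \<subseteq> \<Phi> w" "\<exists>a. a \<noteq> 0 \<and> A = vec.span {a}"
    "\<And>W s. open W \<Longrightarrow> w \<in> W \<Longrightarrow> smooth_on W s \<Longrightarrow> (\<And>z. z \<in> W \<Longrightarrow> s z \<in> \<Phi> z) \<Longrightarrow>
      (\<forall>a\<in>A. hermitian (s w) a = 0) \<longleftrightarrow> d_z s w \<in> \<Phi> w"
proof -
  note \<Phi>w = sub[OF S(2)]
  note occ = orth_compl_orth_compl[OF \<Phi>w]
  have Adef: "A = {orth_proj (\<Phi> w) (d_zbar x w) | x W. open W \<and> w \<in> W \<and> smooth_on W x \<and> (\<forall>z\<in>W. x z \<in> orth_compl (\<Phi> z))}"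
    unfolding A(1)[symmetric] plane_image_def occ ..
  show A\<Phi>: "A \<subseteq> \<Phi> w" unfolding Adef using orth_proj(1)[OF \<Phi>w] by blast
  \<comment> \<open>Projecting a constant vector to each fibre extends a vector of one fibre to a
    smooth section.\<close>
  have ext: "\<exists>s. smooth_on S s \<and> (\<forall>z\<in>S. s z \<in> \<Phi> z) \<and> s w = x" if "x \<in> \<Phi> w" for x
    by (rule exI[of _ "\<lambda>z. proj_matrix (\<Phi> z) *v x"])
       (use that \<Phi>w sub orth_proj(1)[OF sub] smooth_on_mult_vector[OF S(1) sm smooth_on_const[OF S(1)]]
         in \<open>auto simp: proj_matrix_mult orth_proj_ident\<close>)
  have ext': "\<exists>s. smooth_on S s \<and> (\<forall>z\<in>S. s z \<in> orth_compl (\<Phi> z)) \<and> s w = x" if x: "x \<in> orth_compl (\<Phi> w)" for x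
  proof (intro exI[of _ "\<lambda>z. x - proj_matrix (\<Phi> z) *v x"] conjI ballI)
    show "smooth_on S (\<lambda>z. x - proj_matrix (\<Phi> z) *v x)"
      by (rule smooth_on_diff[OF S(1) smooth_on_const[OF S(1)] smooth_on_mult_vector[OF S(1) sm smooth_on_const[OF S(1)]]])
    show "x - proj_matrix (\<Phi> z) *v x \<in> orth_compl (\<Phi> z)" if "z \<in> S" for z
      using orth_proj(2)[OF sub[OF that]] by (simp add: proj_matrix_mult sub that)
    show "x - proj_matrix (\<Phi> w) *v x = x" using orth_proj_zero[OF \<Phi>w x] by (simp add: proj_matrix_mult \<Phi>w)
  qed
  \<comment> \<open>Adjointness comes from differentiating (s, x) = 0 for sections of the bundle and
    its complement.\<close>
  have pairing: "hermitian (s w) (orth_proj (\<Phi> w) (d_zbar x w)) = - hermitian (d_z s w) (x w)"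
    if s: "open W" "w \<in> W" "smooth_on W s" "\<And>z. z \<in> W \<Longrightarrow> s z \<in> \<Phi> z"
      and x: "open W'" "w \<in> W'" "smooth_on W' x" "\<And>z. z \<in> W' \<Longrightarrow> x z \<in> orth_compl (\<Phi> z)" for s x W W'
  proof -
    have "hermitian (d_z s w) (x w) + hermitian (s w) (d_zbar x w) = 0"
    proof (rule has_wirtinger1_zero(1)[OF _ _ _ has_wirtinger1_hermitian[OF smooth_on_has_wirtinger[OF s(3,2)] smooth_on_has_wirtinger[OF x(3,2)]]])
      show "open (W \<inter> W')" "w \<in> W \<inter> W'" using s x by auto
      fix z assume "z \<in> W \<inter> W'"
      then show "hermitian (s z) (x z) = 0" using s(4)[of z] x(4)[of z] hermitian_zero_commute[of "s z" "x z"]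
        by (auto simp: orth_compl_def)
    qed
    moreover have "hermitian (d_zbar x w - orth_proj (\<Phi> w) (d_zbar x w)) (s w) = 0"
      using orth_proj(2)[OF \<Phi>w, of "d_zbar x w"] s(4)[OF s(2)] unfolding orth_compl_def by blast
    then have "hermitian (s w) (d_zbar x w - orth_proj (\<Phi> w) (d_zbar x w)) = 0" by (rule hermitian_zero_commute[THEN iffD1])
    ultimately show ?thesis by (simp add: eq_neg_iff_add_eq_0 add.commute)
  qed
  show ker: "(\<forall>a\<in>A. hermitian (s w) a = 0) \<longleftrightarrow> d_z s w \<in> \<Phi> w"
    if s: "open W" "w \<in> W" "smooth_on W s" "\<And>z. z \<in> W \<Longrightarrow> s z \<in> \<Phi> z" for W s
  proof
    assume d: "d_z s w \<in> \<Phi> w"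
    show "\<forall>a\<in>A. hermitian (s w) a = 0"
    proof
      fix a assume "a \<in> A"
      then obtain x W' where x: "open W'" "w \<in> W'" "smooth_on W' x" "\<forall>z\<in>W'. x z \<in> orth_compl (\<Phi> z)"
        and a: "a = orth_proj (\<Phi> w) (d_zbar x w)" unfolding Adef by blast
      have "hermitian (x w) (d_z s w) = 0" using x d by (auto simp: orth_compl_def)
      then have "hermitian (d_z s w) (x w) = 0" by (simp only: hermitian_zero_commute)
      then show "hermitian (s w) a = 0" unfolding a using pairing[OF s x(1-3)] x(4) by simp
    qed
  next
    assume k: "\<forall>a\<in>A. hermitian (s w) a = 0"
    have "hermitian (d_z s w) x = 0" if xx: "x \<in> orth_compl (\<Phi> w)" for x
    proof -
      obtain y where y: "smooth_on S y" "\<And>z. z \<in> S \<Longrightarrow> y z \<in> orth_compl (\<Phi> z)" "y w = x" using ext'[OF xx] by blast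
      have "orth_proj (\<Phi> w) (d_zbar y w) \<in> A" unfolding Adef using y S by blast
      then show ?thesis using k pairing[OF s S y(1,2)] y(3) by simp
    qed
    then have "d_z s w \<in> orth_compl (orth_compl (\<Phi> w))" unfolding orth_compl_def[of "orth_compl (\<Phi> w)"] by blast
    then show "d_z s w \<in> \<Phi> w" using occ by simp
  qed
  have img: "orth_proj (orth_compl (\<Phi> w)) (d_z s w) \<in> vec.span {r}"
    if "smooth_on S s" "\<forall>z\<in>S. s z \<in> \<Phi> z" for s
    unfolding im(1)[symmetric] plane_image_def using S that by blast
  have zero: "orth_proj (orth_compl (\<Phi> w)) y = 0 \<longleftrightarrow> y \<in> \<Phi> w" for y
    using orth_proj_orth_compl[OF \<Phi>w, of y] orth_proj(1)[OF \<Phi>w, of y] orth_proj_ident[OF \<Phi>w, of y] by auto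
  have "r \<in> plane_image d_z \<Phi> w" unfolding im(1) by (simp add: vec.span_base)
  then obtain s W where s: "open W" "w \<in> W" "smooth_on W s" "\<And>z. z \<in> W \<Longrightarrow> s z \<in> \<Phi> z" "r = orth_proj (orth_compl (\<Phi> w)) (d_z s w)"
    unfolding plane_image_def by blast
  have "d_z s w \<notin> \<Phi> w" using zero[of "d_z s w"] s(5) im(2) by simp
  then obtain a where a: "a \<in> A" "hermitian (s w) a \<noteq> 0" using ker[OF s(1-4)] by blast
  then have a0: "a \<noteq> 0" by auto
  obtain sa where sa: "smooth_on S sa" "\<forall>z\<in>S. sa z \<in> \<Phi> z" "sa w = a" using ext a(1) A\<Phi> by blast
  obtain ka where ka: "orth_proj (orth_compl (\<Phi> w)) (d_z sa w) = ka *s r" using img[OF sa(1,2)] unfolding span_1 by blast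
  have ka0: "ka \<noteq> 0"
  proof
    assume "ka = 0"
    then have "d_z sa w \<in> \<Phi> w" using ka zero by simp
    then have "hermitian a a = 0" using ker[OF S sa(1)] sa(2,3) a(1) by auto
    then show False using a0 by simp
  qed
  have "b \<in> vec.span {a}" if b: "b \<in> A" for b
  proof -
    obtain sb where sb: "smooth_on S sb" "\<forall>z\<in>S. sb z \<in> \<Phi> z" "sb w = b" using ext b A\<Phi> by blast
    obtain kb where kb: "orth_proj (orth_compl (\<Phi> w)) (d_z sb w) = kb *s r" using img[OF sb(1,2)] unfolding span_1 by blast
    \<comment> \<open>The combination is made so that A' annihilates it at w. Its value kb a - ka b
      then lies in A and is orthogonal to A, so b is a multiple of a.\<close>
    let ?s = "\<lambda>z. kb *s sa z - ka *s sb z" and ?x = "kb *s a - ka *s b"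
    have ss: "smooth_on S ?s"
      by (rule smooth_on_diff[OF S(1) smooth_on_vector_scalar[OF S(1) smooth_on_const[OF S(1)] sa(1)]
            smooth_on_vector_scalar[OF S(1) smooth_on_const[OF S(1)] sb(1)]])
    have si: "?s z \<in> \<Phi> z" if "z \<in> S" for z
      using sa(2) sb(2) that vec.subspace_diff[OF sub] vec.subspace_scale[OF sub] by blast
    have "has_wirtinger ?s (kb *s d_z sa w - ka *s d_z sb w) (kb *s d_zbar sa w - ka *s d_zbar sb w) w"
      using has_wirtinger_diff[OF has_wirtinger_smult[OF has_wirtinger1_const smooth_on_has_wirtinger[OF sa(1) S(2)]]
          has_wirtinger_smult[OF has_wirtinger1_const smooth_on_has_wirtinger[OF sb(1) S(2)]], of kb ka] by simp
    then have d: "d_z ?s w = kb *s d_z sa w - ka *s d_z sb w" by (rule has_wirtinger_d(1))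
    have "orth_proj (orth_compl (\<Phi> w)) (d_z ?s w + ka *s d_z sb w) = kb *s (ka *s r)"
      unfolding d using orth_proj_linear(2)[OF subspace_orth_compl, of "\<Phi> w" kb "d_z sa w"] ka by simp
    then have "orth_proj (orth_compl (\<Phi> w)) (d_z ?s w) + ka *s (kb *s r) = kb *s (ka *s r)"
      using orth_proj_linear[OF subspace_orth_compl, of "\<Phi> w"] kb by simp
    then have "orth_proj (orth_compl (\<Phi> w)) (d_z ?s w) = 0" by (simp add: vector_smult_assoc mult.commute)
    then have "\<forall>y\<in>A. hermitian (?s w) y = 0" using ker[OF S ss si] zero by simp
    moreover have "?x \<in> A" using a(1) b A(2) by (simp add: vec.subspace_diff vec.subspace_scale)
    ultimately have "hermitian (?s w) ?x = 0" by (rule bspec)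
    then have "hermitian ?x ?x = 0" unfolding sa(3) sb(3) .
    then have "ka *s b = kb *s a" by (simp only: hermitian_self_eq_0) simp
    then have "b = (inverse ka * kb) *s a" using ka0
      by (metis left_inverse vector_smult_assoc vector_smult_lid)
    then show ?thesis unfolding span_1 by blast
  qed
  moreover have "vec.span {a} \<subseteq> A" using a(1) A(2) by (intro vec.span_minimal) auto
  ultimately show "\<exists>a. a \<noteq> 0 \<and> A = vec.span {a}" using a0 by blast
qed

section \<open>Limits of subspaces at exceptional points\<close>

lemma smooth_on_punctured_eq:
  fixes f g :: "complex \<Rightarrow> 'b::real_normed_vector"
  assumes "open S" "w \<in> S" "smooth_on S f" "smooth_on S g" "\<And>z. z \<in> S \<Longrightarrow> z \<noteq> w \<Longrightarrow> f z = g z"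
  shows "f w = g w"
  by (rule continuous_on_punctured_eq[OF assms(1,2) smooth_on_imp_isCont[OF assms(3,2)] smooth_on_imp_isCont[OF assms(4,2)]])
     (rule assms(5))

lemma bounded_linear_trace: "bounded_linear (trace :: complex^'n^'n \<Rightarrow> complex)"
  unfolding trace_def[abs_def] linear_conv_bounded_linear[symmetric]
  by (rule linearI) (simp_all add: sum.distrib scaleR_sum_right)

lemma trace_outer_normalized: "L \<noteq> 0 \<Longrightarrow> trace (outer_normalized L) = 1"
proof -
  assume "L \<noteq> 0"
  have "trace (outer_normalized L) = inverse (hermitian L L) * hermitian L L"
    by (simp add: trace_def outer_normalized_def outer_def hermitian_def sum_distrib_left mult.assoc)
  then show ?thesis using \<open>L \<noteq> 0\<close> by simp
qed

text \<open>The trace of the projection stays 1 in the limit, so the fibre at w is nonzero. Any two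
  projected vectors are proportional off w; written as (P x, P x) P y = (P y, P x) P x, this
  persists at w.\<close>

lemma line_limit:
  fixes \<Psi> :: "complex \<Rightarrow> (complex^'n) set"
  assumes B: "open B" "w \<in> B" and sub: "\<And>z. z \<in> B \<Longrightarrow> vec.subspace (\<Psi> z)" and sm: "smooth_on B (\<lambda>z. proj_matrix (\<Psi> z))"
    and line: "\<And>z. z \<in> B \<Longrightarrow> z \<noteq> w \<Longrightarrow> \<exists>a. a \<noteq> 0 \<and> \<Psi> z = vec.span {a}"
  shows "\<exists>a. a \<noteq> 0 \<and> \<Psi> w = vec.span {a}"
proof -
  let ?P = "\<lambda>z. proj_matrix (\<Psi> z)"
  have sP: "smooth_on B (\<lambda>z. ?P z *v x)" for x by (rule smooth_on_mult_vector[OF B(1) sm smooth_on_const[OF B(1)]])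
  have sH: "smooth_on B (\<lambda>z. hermitian (?P z *v x) (?P z *v y))" for x y by (rule smooth_on_hermitian[OF B(1) sP sP])
  have "trace (?P w) = 1"
  proof (rule smooth_on_punctured_eq[OF B smooth_on_linear[OF B(1) sm bounded_linear_trace] smooth_on_const[OF B(1)]])
    fix z assume "z \<in> B" "z \<noteq> w"
    then show "trace (?P z) = 1" using line by (metis proj_matrix_span_1 trace_outer_normalized)
  qed
  have "\<exists>x. ?P w *v x \<noteq> 0"
  proof (rule ccontr)
    assume "\<not> ?thesis"
    then have "?P w *v x = 0 *v x" for x by simp
    then have "?P w = 0" by (simp only: matrix_eq) simp
    then show False using \<open>trace (?P w) = 1\<close> by (simp add: trace_def)
  qed
  then obtain x where x: "?P w *v x \<noteq> 0" by blast
  let ?a = "?P w *v x"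
  have aw: "?a \<in> \<Psi> w" using orth_proj(1)[OF sub[OF B(2)]] by (simp add: proj_matrix_mult sub B)
  have "y \<in> vec.span {?a}" if y: "y \<in> \<Psi> w" for y
  proof -
    have "hermitian ?a ?a *s (?P w *v y) = hermitian (?P w *v y) ?a *s ?a"
    proof (rule smooth_on_punctured_eq[OF B, where f = "\<lambda>z. hermitian (?P z *v x) (?P z *v x) *s (?P z *v y)"
            and g = "\<lambda>z. hermitian (?P z *v y) (?P z *v x) *s (?P z *v x)"])
      show "smooth_on B (\<lambda>z. hermitian (?P z *v x) (?P z *v x) *s (?P z *v y))"
        "smooth_on B (\<lambda>z. hermitian (?P z *v y) (?P z *v x) *s (?P z *v x))"
        by (rule smooth_on_vector_scalar[OF B(1) sH sP])+
      fix z assume z: "z \<in> B" "z \<noteq> w"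
      then obtain a where a: "\<Psi> z = vec.span {a}" using line by blast
      have "?P z *v u \<in> vec.span {a}" for u using orth_proj(1)[OF sub[OF z(1)]] a by (simp add: proj_matrix_mult sub z)
      then obtain k l where kl: "?P z *v x = k *s a" "?P z *v y = l *s a" unfolding span_1 by blast
      show "hermitian (?P z *v x) (?P z *v x) *s (?P z *v y) = hermitian (?P z *v y) (?P z *v x) *s (?P z *v x)"
        unfolding kl by (simp add: vector_smult_assoc mult_ac)
    qed
    moreover have "?P w *v y = y" using orth_proj_ident[OF sub[OF B(2)] y] by (simp add: proj_matrix_mult sub B)
    ultimately have e: "hermitian ?a ?a *s y = hermitian y ?a *s ?a" by simp
    have "hermitian ?a ?a \<noteq> 0" using x by simp
    then have "y = inverse (hermitian ?a ?a) *s (hermitian ?a ?a *s y)"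
      by (simp only: vector_smult_assoc left_inverse vector_smult_lid not_False_eq_True)
    then have "y = (inverse (hermitian ?a ?a) * hermitian y ?a) *s ?a" unfolding e vector_smult_assoc .
    then show ?thesis unfolding span_1 by blast
  qed
  moreover have "vec.span {?a} \<subseteq> \<Psi> w" using aw sub[OF B(2)] by (intro vec.span_minimal) auto
  ultimately show ?thesis using x by blast
qed

text \<open>Inclusion of fibres says that the projection onto \<Phi> fixes projected vectors of
  \<Psi>, which is a closed condition.\<close>

lemma subset_limit:
  fixes \<Psi> \<Phi> :: "complex \<Rightarrow> (complex^'n) set"
  assumes B: "open B" "w \<in> B" and sub: "\<And>z. z \<in> B \<Longrightarrow> vec.subspace (\<Psi> z)" "\<And>z. z \<in> B \<Longrightarrow> vec.subspace (\<Phi> z)"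
    and sm: "smooth_on B (\<lambda>z. proj_matrix (\<Psi> z))" "smooth_on B (\<lambda>z. proj_matrix (\<Phi> z))"
    and le: "\<And>z. z \<in> B \<Longrightarrow> z \<noteq> w \<Longrightarrow> \<Psi> z \<subseteq> \<Phi> z"
  shows "\<Psi> w \<subseteq> \<Phi> w"
proof
  fix y assume y: "y \<in> \<Psi> w"
  let ?g = "\<lambda>z. proj_matrix (\<Psi> z) *v y"
  have s: "smooth_on B ?g" by (rule smooth_on_mult_vector[OF B(1) sm(1) smooth_on_const[OF B(1)]])
  have "proj_matrix (\<Phi> w) *v ?g w = ?g w"
  proof (rule smooth_on_punctured_eq[OF B smooth_on_mult_vector[OF B(1) sm(2) s] s])
    fix z assume z: "z \<in> B" "z \<noteq> w"
    then have "?g z \<in> \<Phi> z" using le[OF z] orth_proj(1)[OF sub(1)[OF z(1)], of y] by (auto simp: proj_matrix_mult sub)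
    then show "proj_matrix (\<Phi> z) *v ?g z = ?g z" using z by (simp add: proj_matrix_mult sub orth_proj_ident)
  qed
  moreover have "?g w = y" using y B by (simp add: proj_matrix_mult sub orth_proj_ident)
  ultimately show "y \<in> \<Phi> w" using orth_proj(1)[OF sub(2)[OF B(2)], of y] B by (simp add: proj_matrix_mult sub)
qed

context rsurface
begin

text \<open>If neither Gauss bundle existed, both would be the same arbitrary value of \<open>THE\<close>.\<close>

lemma filled_or_junk:
  assumes sub: "\<And>q. q \<in> points M \<Longrightarrow> vec.subspace (\<phi> q)" and re: "\<And>q. q \<in> points M \<Longrightarrow> vec_cnj ` \<phi> q = \<phi> q"
  shows "(\<exists>\<psi>. is_filled M \<phi> (A_of d_z \<phi>) \<psi> \<and> G' M \<phi> = \<psi> \<and> G'' M \<phi> = cnjb \<psi>) \<or> G' M \<phi> = G'' M \<phi>"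
proof (cases "\<exists>\<psi>. is_filled M \<phi> (A_of d_z \<phi>) \<psi>")
  case True
  then obtain \<psi> where \<psi>: "is_filled M \<phi> (A_of d_z \<phi>) \<psi>" by blast
  have "is_filled M \<phi> (A_of d_zbar \<phi>) (cnjb \<psi>)" by (rule is_filled_cnjb(1)[OF _ _ \<psi>]) (rule sub, assumption, rule re, assumption)
  then show ?thesis using G'_eq[OF \<psi>] G''_eq \<psi> by blast
next
  case False
  have "\<not> is_filled M \<phi> (A_of d_zbar \<phi>) \<psi>" for \<psi>
  proof
    assume f: "is_filled M \<phi> (A_of d_zbar \<phi>) \<psi>"
    have "is_filled M \<phi> (A_of d_z \<phi>) (cnjb \<psi>)" by (rule is_filled_cnjb(2)[OF _ _ f]) (rule sub, assumption, rule re, assumption)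
    then show False using False by blast
  qed
  then have "filled_image M \<phi> (A_of d_z \<phi>) = filled_image M \<phi> (A_of d_zbar \<phi>)"
    using False unfolding filled_image_def is_filled_def[symmetric] by simp
  then show ?thesis by (simp add: G'_def G''_def A'_eq A''_eq)
qed

end

section \<open>The map F attached to a conformal harmonic \<phi>\<close>

locale conformal_surface = rsurface M for M :: "'a surface" +
  fixes \<phi> :: "'a \<Rightarrow> (complex^7) set"
  assumes \<phi>: "\<phi> \<in> conformal_G2_maps M"
begin

definition \<phi>p where "\<phi>p = perp_bundle M \<phi>"

definition \<gamma> where "\<gamma> = G' M \<phi>"

definition \<alpha> where "\<alpha> = G'' M \<phi>p"

lemma G2: "p \<in> points M \<Longrightarrow> \<phi> p \<in> G2_SO4"
  using \<phi> by (auto simp: conformal_G2_maps_def strongly_conformal_def harmonic_bundle_def)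

lemma sub: "p \<in> points M \<Longrightarrow> vec.subspace (\<phi> p)" by (rule G2_subspace[OF G2])

lemma real: "p \<in> points M \<Longrightarrow> vec_cnj ` \<phi> p = \<phi> p" by (rule G2_facts(1)[OF G2])

lemma ext: "\<phi> \<in> extensional (points M)"
proof -
  have "\<phi> \<in> points M \<rightarrow>\<^sub>E G2_SO4" using \<phi> by (auto simp: conformal_G2_maps_def strongly_conformal_def harmonic_bundle_def)
  then show ?thesis by (simp add: PiE_iff)
qed

lemma smooth: "smooth_subbundle M \<phi>"
  using \<phi> ext sub by (auto simp: conformal_G2_maps_def strongly_conformal_def harmonic_bundle_def harmonic_map_def smooth_subbundle_def)

lemma \<phi>p_at: "p \<in> points M \<Longrightarrow> \<phi>p p = orth_compl (\<phi> p)" by (simp add: \<phi>p_def perp_bundle_def)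

lemma \<phi>p_sub: "p \<in> points M \<Longrightarrow> vec.subspace (\<phi>p p)" by (simp add: \<phi>p_at subspace_orth_compl)

lemma \<phi>p_real: "p \<in> points M \<Longrightarrow> vec_cnj ` \<phi>p p = \<phi>p p"
  by (simp add: \<phi>p_at orth_compl_vec_cnj[symmetric] real)

lemma conformal: "p \<in> points M \<Longrightarrow> v \<in> G' M \<phi> p \<Longrightarrow> w \<in> G'' M \<phi> p \<Longrightarrow> hermitian v w = 0"
  and conformal_perp: "p \<in> points M \<Longrightarrow> v \<in> G' M \<phi>p p \<Longrightarrow> w \<in> G'' M \<phi>p p \<Longrightarrow> hermitian v w = 0"
  and rank: "p \<in> points M \<Longrightarrow> vec.dim (\<gamma> p) = 1"
  and nonconst: "\<not> (\<exists>W. \<forall>p\<in>points M. bundle_cross M (G' M \<phi>p) (G'' M \<phi>p) p = W)"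
  using \<phi> by (auto simp: conformal_G2_maps_def strongly_conformal_def has_rank_def nonconstant_subbundle_def \<gamma>_def \<phi>p_def)

text \<open>If \<open>G'\<close> and \<open>G''\<close> were the same default value, strong
  conformality would make its fibres orthogonal to themselves and hence zero, against rank
  one.\<close>

lemma \<gamma>_filled: "is_filled M \<phi> (A_of d_z \<phi>) \<gamma>" "G'' M \<phi> = cnjb \<gamma>"
proof -
  have "G' M \<phi> \<noteq> G'' M \<phi>"
  proof
    assume e: "G' M \<phi> = G'' M \<phi>"
    obtain p where p: "p \<in> points M" using points_nonempty by blast
    have "\<gamma> p \<subseteq> {0}" using conformal[OF p] e unfolding \<gamma>_def by (metis hermitian_self_eq_0 singleton_iff subsetI)
    then have "vec.dim (\<gamma> p) = 0" by (simp only: vec.dim_eq_0)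
    then show False using rank[OF p] by simp
  qed
  moreover have "(\<exists>\<psi>. is_filled M \<phi> (A_of d_z \<phi>) \<psi> \<and> G' M \<phi> = \<psi> \<and> G'' M \<phi> = cnjb \<psi>) \<or> G' M \<phi> = G'' M \<phi>"
    by (rule filled_or_junk) (rule sub, assumption, rule real, assumption)
  ultimately show "is_filled M \<phi> (A_of d_z \<phi>) \<gamma>" "G'' M \<phi> = cnjb \<gamma>" unfolding \<gamma>_def by auto
qed

text \<open>As for \<phi>, except that zero fibres are excluded here by (c): the product bundle
  would be constantly zero.\<close>

lemma \<alpha>_filled: "is_filled M \<phi>p (A_of d_zbar \<phi>p) \<alpha>" "G' M \<phi>p = cnjb \<alpha>"
proof -
  have "G' M \<phi>p \<noteq> G'' M \<phi>p"
  proof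
    assume e: "G' M \<phi>p = G'' M \<phi>p"
    have "bundle_cross M (G' M \<phi>p) (G'' M \<phi>p) p = {0}" if p: "p \<in> points M" for p
    proof -
      have "G' M \<phi>p p \<subseteq> {0}" using conformal_perp[OF p] e by (metis hermitian_self_eq_0 singleton_iff subsetI)
      then have "{cross7 v w | v w. v \<in> G' M \<phi>p p \<and> w \<in> G'' M \<phi>p p} \<subseteq> {0}" by auto
      then have "vec.span {cross7 v w | v w. v \<in> G' M \<phi>p p \<and> w \<in> G'' M \<phi>p p} = {0}"
        using vec.span_mono[of "{cross7 v w | v w. v \<in> G' M \<phi>p p \<and> w \<in> G'' M \<phi>p p}" "{0}"] vec.span_zero by (auto simp del: vec.span_insert)
      then show ?thesis using p by (simp add: bundle_cross_def)
    qed
    then show False using nonconst by blast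
  qed
  moreover have "(\<exists>\<psi>. is_filled M \<phi>p (A_of d_z \<phi>p) \<psi> \<and> G' M \<phi>p = \<psi> \<and> G'' M \<phi>p = cnjb \<psi>) \<or> G' M \<phi>p = G'' M \<phi>p"
    by (rule filled_or_junk) (rule \<phi>p_sub, assumption, rule \<phi>p_real, assumption)
  ultimately obtain \<psi> where \<psi>: "is_filled M \<phi>p (A_of d_z \<phi>p) \<psi>" "G' M \<phi>p = \<psi>" "G'' M \<phi>p = cnjb \<psi>" by blast
  have "smooth_subbundle M \<psi>" using \<psi>(1) by (simp add: is_filled_def)
  then show "G' M \<phi>p = cnjb \<alpha>" using \<psi> cnjb_cnjb[of \<psi>] by (simp add: \<alpha>_def)
  show "is_filled M \<phi>p (A_of d_zbar \<phi>p) \<alpha>" unfolding \<alpha>_def \<psi>(3)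
    by (rule is_filled_cnjb(1)[OF _ _ \<psi>(1)]) (rule \<phi>p_sub, assumption, rule \<phi>p_real, assumption)
qed

lemma \<alpha>s: "smooth_subbundle M \<alpha>" using \<alpha>_filled(1) by (simp add: is_filled_def)

lemma \<alpha>_sub: "p \<in> points M \<Longrightarrow> vec.subspace (\<alpha> p)" using \<alpha>s by (simp add: smooth_subbundle_def)

lemma \<gamma>_line: "p \<in> points M \<Longrightarrow> \<exists>r. r \<noteq> 0 \<and> \<gamma> p = vec.span {r}"
proof -
  assume p: "p \<in> points M"
  have "vec.subspace (\<gamma> p)" using \<gamma>_filled(1) p by (simp add: is_filled_def smooth_subbundle_def)
  then show ?thesis by (rule dim_1_span[OF _ rank[OF p]]) blast
qed

text \<open>In a chart disc about \<open>p\<close>, all points except possibly \<open>p\<close> are generic.\<close>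

definition generic where
  "generic c p B \<longleftrightarrow> nbd c p B \<and> (\<forall>w\<in>B. w \<noteq> snd c p \<longrightarrow>
     \<gamma> (pt c w) = plane_image d_z (in_chart c \<phi>) w \<and>
     \<alpha> (pt c w) = plane_image d_zbar (\<lambda>z. orth_compl (in_chart c \<phi> z)) w)"

lemma generic_exists:
  assumes c: "c \<in> atlas M" "p \<in> fst c"
  shows "\<exists>B. generic c p B"
proof -
  note n = nbd_chart[OF c]
  note p = nbdD(6)[OF n]
  have 1: "is_filled M \<phi> (A_of d_z \<phi>) \<gamma> \<longleftrightarrow> smooth_subbundle M \<gamma> \<and>
    (\<forall>p\<in>points M. \<exists>T. openin (surf_top M) T \<and> p \<in> T \<and> (\<forall>q\<in>T. q \<noteq> p \<longrightarrow> \<gamma> q = bundle_image d_z \<phi> q))"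
    by (rule is_filled_iff[OF wirtinger_op_d(1)]) (rule sub)
  obtain T where T: "openin (surf_top M) T" "p \<in> T" "\<forall>q\<in>T. q \<noteq> p \<longrightarrow> \<gamma> q = bundle_image d_z \<phi> q"
    using bspec[OF conjunct2[OF iffD1[OF 1 \<gamma>_filled(1)]] p] by (elim exE conjE)
  have 2: "is_filled M \<phi>p (A_of d_zbar \<phi>p) \<alpha> \<longleftrightarrow> smooth_subbundle M \<alpha> \<and>
    (\<forall>p\<in>points M. \<exists>T. openin (surf_top M) T \<and> p \<in> T \<and> (\<forall>q\<in>T. q \<noteq> p \<longrightarrow> \<alpha> q = bundle_image d_zbar \<phi>p q))"
    by (rule is_filled_iff[OF wirtinger_op_d(2)]) (rule \<phi>p_sub)
  obtain T' where T': "openin (surf_top M) T'" "p \<in> T'" "\<forall>q\<in>T'. q \<noteq> p \<longrightarrow> \<alpha> q = bundle_image d_zbar \<phi>p q"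
    using bspec[OF conjunct2[OF iffD1[OF 2 \<alpha>_filled(1)]] p] by (elim exE conjE)
  define B where "B = snd c ` fst c \<inter> snd c ` ((T \<inter> T') \<inter> fst c)"
  have TT: "openin (surf_top M) (T \<inter> T')" "p \<in> T \<inter> T'" using T T' by auto
  have nB: "nbd c p B" and BT: "\<And>w. w \<in> B \<Longrightarrow> pt c w \<in> T \<inter> T'" unfolding B_def by (rule nbd_inter[OF n TT], rule nbd_inter(2)[OF n TT])
  have "generic c p B" unfolding generic_def
  proof (intro conjI ballI impI nB)
    fix w assume w: "w \<in> B" "w \<noteq> snd c p"
    have q: "pt c w \<noteq> p" using w nbdD(9)[OF nB w(1)] by auto
    have "bundle_image d_z \<phi> (pt c w) = plane_image d_z (in_chart c \<phi>) w"
      by (rule bundle_image_nbd[OF wirtinger_op_d(1) nB w(1) sub])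
    then show "\<gamma> (pt c w) = plane_image d_z (in_chart c \<phi>) w" using T(3) q BT[OF w(1)] by simp
    have "bundle_image d_zbar \<phi>p (pt c w) = plane_image d_zbar (in_chart c \<phi>p) w"
      by (rule bundle_image_nbd[OF wirtinger_op_d(2) nB w(1) \<phi>p_sub])
    also have "\<dots> = plane_image d_zbar (\<lambda>z. orth_compl (in_chart c \<phi> z)) w"
      by (rule plane_image_cong[OF nbdD(3)[OF nB] w(1)]) (simp add: in_chart_pt \<phi>p_at nbdD(10)[OF nB])
    finally show "\<alpha> (pt c w) = plane_image d_zbar (\<lambda>z. orth_compl (in_chart c \<phi> z)) w" using T'(3) q BT[OF w(1)] by simp
  qed
  then show ?thesis by blast
qed

lemma generic_adjoint:
  assumes g: "generic c p B" and w: "w \<in> B" "w \<noteq> snd c p"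
  shows "\<alpha> (pt c w) \<subseteq> in_chart c \<phi> w" "\<exists>a. a \<noteq> 0 \<and> \<alpha> (pt c w) = vec.span {a}"
    "\<And>W s. open W \<Longrightarrow> w \<in> W \<Longrightarrow> smooth_on W s \<Longrightarrow> (\<And>z. z \<in> W \<Longrightarrow> s z \<in> in_chart c \<phi> z) \<Longrightarrow>
      (\<forall>a\<in>\<alpha> (pt c w). hermitian (s w) a = 0) \<longleftrightarrow> d_z s w \<in> in_chart c \<phi> w"
proof -
  have n: "nbd c p B" using g by (simp add: generic_def)
  have P: "pt c z \<in> points M" if "z \<in> B" for z by (rule nbdD(10)[OF n that])
  obtain r where r: "r \<noteq> 0" "\<gamma> (pt c w) = vec.span {r}" using \<gamma>_line[OF P[OF w(1)]] by blast
  have s: "vec.subspace (in_chart c \<phi> z)" if "z \<in> B" for z using sub[OF P[OF that]] by (simp add: in_chart_pt)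
  have 1: "plane_image d_z (in_chart c \<phi>) w = vec.span {r}" and
    2: "plane_image d_zbar (\<lambda>z. orth_compl (in_chart c \<phi> z)) w = \<alpha> (pt c w)" using g w r by (simp_all add: generic_def)
  note adj = adjoint_rank_one[OF nbdD(3)[OF n] w(1) s smooth_subbundle_in_chart[OF smooth n] 1 r(1) 2 \<alpha>_sub[OF P[OF w(1)]]]
  show "\<alpha> (pt c w) \<subseteq> in_chart c \<phi> w" "\<exists>a. a \<noteq> 0 \<and> \<alpha> (pt c w) = vec.span {a}" by (rule adj(1), assumption) (rule adj(2))
  show "(\<forall>a\<in>\<alpha> (pt c w). hermitian (s w) a = 0) \<longleftrightarrow> d_z s w \<in> in_chart c \<phi> w"
    if "open W" "w \<in> W" "smooth_on W s" "\<And>z. z \<in> W \<Longrightarrow> s z \<in> in_chart c \<phi> z" for W s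
    by (rule adj(3)[OF _ that])
qed

text \<open>At generic points this is adjointness; the remaining points are limits of generic
  ones.\<close>

lemma \<alpha>_point:
  assumes p: "p \<in> points M"
  shows "\<alpha> p \<subseteq> \<phi> p" "\<exists>a. a \<noteq> 0 \<and> \<alpha> p = vec.span {a}"
proof -
  obtain c B where g: "generic c p B" using ex_chart[OF p] generic_exists by blast
  then have n: "nbd c p B" by (simp add: generic_def)
  note B = nbdD(3,4)[OF n] and i = in_chart_pt
  have s: "vec.subspace (in_chart c \<alpha> z)" "vec.subspace (in_chart c \<phi> z)" if "z \<in> B" for z
    using sub \<alpha>_sub nbdD(10)[OF n that] by (simp_all add: i)
  have "in_chart c \<alpha> (snd c p) \<subseteq> in_chart c \<phi> (snd c p)"
    by (rule subset_limit[OF B s smooth_subbundle_in_chart[OF \<alpha>s n] smooth_subbundle_in_chart[OF smooth n]])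
       (use generic_adjoint(1)[OF g] in \<open>auto simp: i\<close>)
  then show "\<alpha> p \<subseteq> \<phi> p" using nbdD(7)[OF n] by (simp add: i)
  have "\<exists>a. a \<noteq> 0 \<and> in_chart c \<alpha> (snd c p) = vec.span {a}"
    by (rule line_limit[OF B s(1) smooth_subbundle_in_chart[OF \<alpha>s n]]) (use generic_adjoint(2)[OF g] in \<open>auto simp: i\<close>)
  then show "\<exists>a. a \<noteq> 0 \<and> \<alpha> p = vec.span {a}" using nbdD(7)[OF n] by (simp add: i)
qed

text \<open>Chosen by a property of the whole line, so that no section has to be fixed;
  \<open>\<phi>_span\<close> recovers the formula in a section, which also shows uniqueness and
  smoothness.\<close>

definition F where "F = (\<lambda>p\<in>points M. SOME x. norm x = 1 \<and> (\<forall>L\<in>\<alpha> p. cross7 (cvec x) L = \<i> *s L))"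

lemma F_at:
  assumes p: "p \<in> points M"
  shows "norm (F p) = 1" "L \<in> \<alpha> p \<Longrightarrow> cross7 (cvec (F p)) L = \<i> *s L"
proof -
  obtain a where a: "a \<noteq> 0" "\<alpha> p = vec.span {a}" using \<alpha>_point[OF p] by blast
  have "a \<in> \<alpha> p" "vec_cnj a \<in> cnjb \<alpha> p" using p by (auto simp: a(2) cnjb_def vec.span_base)
  then have "hermitian (vec_cnj a) a = 0" using conformal_perp[OF p] \<alpha>_filled(2) by (simp add: \<alpha>_def)
  then have "hermitian a (vec_cnj a) = 0" by (rule hermitian_zero_commute[THEN iffD1])
  then obtain x :: "real^7" where x: "norm x = 1" "cross7 (cvec x) a = \<i> *s a" by (rule isotropic_type10[OF a(1)])
  have "norm x = 1 \<and> (\<forall>L\<in>\<alpha> p. cross7 (cvec x) L = \<i> *s L)"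
    using x by (auto simp: a(2) span_1 vector_smult_assoc mult.commute)
  from someI[of "\<lambda>x. norm x = 1 \<and> (\<forall>L\<in>\<alpha> p. cross7 (cvec x) L = \<i> *s L)", OF this]
  show "norm (F p) = 1" "L \<in> \<alpha> p \<Longrightarrow> cross7 (cvec (F p)) L = \<i> *s L" using p by (auto simp: F_def)
qed

lemma F_PE: "F \<in> points M \<rightarrow>\<^sub>E sphere 0 1" using F_at(1) by (auto simp: F_def)

lemma F_unit: "p \<in> points M \<Longrightarrow> hermitian (cvec (F p)) (cvec (F p)) = 1"
  using F_at(1) by (simp add: hermitian_cvec dot_square_norm)

text \<open>F is a multiple of cnj L \<times> L by \<open>type10\<close>. The fibre contains L and
  cnj L and is closed under the vector product, so it contains F too, and three orthogonal vectors
  exhaust its dimension.\<close>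

lemma \<phi>_span:
  assumes p: "p \<in> points M" and L: "L \<in> \<alpha> p" "L \<noteq> 0"
  shows "cvec (F p) = (\<i> * inverse (hermitian L L)) *s cross7 (vec_cnj L) L"
    "\<phi> p = vec.span {L, cvec (F p), vec_cnj L}" "vec.dim (vec.span {L, cvec (F p), vec_cnj L}) = 3"
proof -
  note t = type10[OF vec_cnj_cvec F_unit[OF p] F_at(2)[OF p L(1)] F_at(2)[OF p L(1)]]
  have h: "hermitian L L \<noteq> 0" using L(2) by simp
  have "\<i> * inverse (hermitian L L) * (- \<i> * hermitian L L) = inverse (hermitian L L) * hermitian L L" by (simp add: algebra_simps)
  then have "(\<i> * inverse (hermitian L L)) *s cross7 (vec_cnj L) L = (inverse (hermitian L L) * hermitian L L) *s cvec (F p)"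
    unfolding t(7) vector_smult_assoc by (simp only:)
  then show f: "cvec (F p) = (\<i> * inverse (hermitian L L)) *s cross7 (vec_cnj L) L" using h by simp
  have Lc: "L \<in> \<phi> p" "vec_cnj L \<in> \<phi> p" using L(1) \<alpha>_point(1)[OF p] real[OF p] by blast+
  have "cvec (F p) \<in> \<phi> p" unfolding f by (intro vec.subspace_scale sub[OF p] G2_facts(2)[OF G2[OF p]] Lc)
  then have le: "vec.span {L, cvec (F p), vec_cnj L} \<subseteq> \<phi> p" using Lc by (intro vec.span_minimal sub[OF p]) auto
  have "cvec (F p) \<noteq> 0" using F_unit[OF p] by auto
  then show d: "vec.dim (vec.span {L, cvec (F p), vec_cnj L}) = 3" using t L(2) by (intro dim_span_3) auto
  show "\<phi> p = vec.span {L, cvec (F p), vec_cnj L}"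
    using vec.subspace_dim_equal[OF vec.subspace_span sub[OF p] le] d G2_facts(3)[OF G2[OF p]] by simp
qed

definition line_frame where
  "line_frame c p B L \<longleftrightarrow> generic c p B \<and> smooth_on B L \<and> (\<forall>w\<in>B. L w \<noteq> 0 \<and> in_chart c \<alpha> w = vec.span {L w})"

text \<open>The projection to \<alpha> of a vector spanning the fibre at p is a smooth section that
  stays nonzero near p.\<close>

lemma line_frame_exists:
  assumes c: "c \<in> atlas M" "p \<in> fst c"
  shows "\<exists>B L. line_frame c p B L"
proof -
  obtain B where g: "generic c p B" using generic_exists[OF c] by blast
  then have n: "nbd c p B" by (simp add: generic_def)
  obtain a where a: "a \<noteq> 0" "\<alpha> p = vec.span {a}" using \<alpha>_point[OF nbdD(6)[OF n]] by blast
  let ?L = "\<lambda>w. proj_matrix (in_chart c \<alpha> w) *v a"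
  have s: "smooth_on B ?L" by (rule smooth_on_mult_vector[OF nbdD(3)[OF n] smooth_subbundle_in_chart[OF \<alpha>s n] smooth_on_const[OF nbdD(3)[OF n]]])
  have sb: "vec.subspace (in_chart c \<alpha> z)" if "z \<in> B" for z
    using \<alpha>_sub nbdD(10)[OF n that] by (simp add: in_chart_pt)
  have "in_chart c \<alpha> (snd c p) = vec.span {a}" using a(2) nbdD(7)[OF n] by (simp add: in_chart_pt)
  then have "?L (snd c p) = a" using sb[OF nbdD(4)[OF n]] by (simp add: proj_matrix_mult orth_proj_ident vec.span_base)
  define B' where "B' = B \<inter> ?L -` (- {0})"
  have "open B'" unfolding B'_def by (rule continuous_open_preimage[OF smooth_on_imp_continuous_on[OF s] nbdD(3)[OF n]]) auto
  moreover have "snd c p \<in> B'" "B' \<subseteq> B" using \<open>?L (snd c p) = a\<close> a(1) nbdD(4)[OF n] by (auto simp: B'_def)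
  ultimately have n': "nbd c p B'" by (rule nbd_subset[OF n])
  have "?L w \<noteq> 0 \<and> in_chart c \<alpha> w = vec.span {?L w}" if w: "w \<in> B'" for w
  proof -
    have wB: "w \<in> B" and nz: "?L w \<noteq> 0" using w by (auto simp: B'_def)
    have "?L w \<in> in_chart c \<alpha> w" using orth_proj(1)[OF sb[OF wB]] by (simp add: proj_matrix_mult sb wB)
    moreover obtain b where b: "in_chart c \<alpha> w = vec.span {b}" using \<alpha>_point(2)[OF nbdD(10)[OF n wB]] by (auto simp: in_chart_pt)
    ultimately obtain k where k: "?L w = k *s b" unfolding span_1 by blast
    then have "k \<noteq> 0" using nz by auto
    then have "vec.span {?L w} = vec.span {b}" unfolding k by (rule span_line_scale)
    with nz b show ?thesis by metis
  qed
  moreover have "generic c p B'" using g n' \<open>B' \<subseteq> B\<close> by (auto simp: generic_def)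
  moreover have "smooth_on B' ?L" by (rule smooth_on_subset[OF s \<open>B' \<subseteq> B\<close>])
  ultimately have "line_frame c p B' ?L" unfolding line_frame_def by blast
  then show ?thesis by blast
qed

lemma line_frameD:
  assumes l: "line_frame c p B L"
  shows "nbd c p B" "generic c p B" "smooth_on B L" "smooth_on B (fc F c)"
    "\<And>w. w \<in> B \<Longrightarrow> L w \<noteq> 0" "\<And>w. w \<in> B \<Longrightarrow> \<alpha> (pt c w) = vec.span {L w}"
    "\<And>w. w \<in> B \<Longrightarrow> vec_cnj (fc F c w) = fc F c w" "\<And>w. w \<in> B \<Longrightarrow> hermitian (fc F c w) (fc F c w) = 1"
    "\<And>w. w \<in> B \<Longrightarrow> cross7 (fc F c w) (L w) = \<i> *s L w"
    "\<And>w. w \<in> B \<Longrightarrow> in_chart c \<phi> w = vec.span {L w, fc F c w, vec_cnj (L w)}"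
proof -
  show g: "generic c p B" and s: "smooth_on B L" and L0: "\<And>w. w \<in> B \<Longrightarrow> L w \<noteq> 0"
    using l by (auto simp: line_frame_def)
  then show n: "nbd c p B" by (simp add: generic_def)
  show a: "\<alpha> (pt c w) = vec.span {L w}" if "w \<in> B" for w using l that by (simp add: line_frame_def in_chart_pt)
  have La: "L w \<in> \<alpha> (pt c w)" if "w \<in> B" for w unfolding a[OF that] by (simp add: vec.span_base)
  have fcp: "fc F c w = cvec (F (pt c w))" for w by (simp add: fc_def in_chart_pt)
  note P = nbdD(10)[OF n]
  show "vec_cnj (fc F c w) = fc F c w" for w by (simp add: fcp)
  show "hermitian (fc F c w) (fc F c w) = 1" "cross7 (fc F c w) (L w) = \<i> *s L w"
    "in_chart c \<phi> w = vec.span {L w, fc F c w, vec_cnj (L w)}" if w: "w \<in> B" for w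
    unfolding fcp in_chart_pt by (rule F_unit[OF P[OF w]], rule F_at(2)[OF P[OF w] La[OF w]], rule \<phi>_span(2)[OF P[OF w] La[OF w] L0[OF w]])
  note B = nbdD(3)[OF n]
  have "smooth_on B (\<lambda>w. (\<i> * inverse (hermitian (L w) (L w))) *s cross7 (vec_cnj (L w)) (L w))"
    by (rule smooth_on_vector_scalar[OF B smooth_on_mult[OF B smooth_on_const[OF B] smooth_on_inverse[OF B smooth_on_hermitian[OF B s s]]]
          smooth_on_cross7[OF B smooth_on_vec_cnj[OF B s] s]]) (simp add: L0)
  then show "smooth_on B (fc F c)"
    by (rule smooth_on_cong[OF B]) (simp add: fcp \<phi>_span(1)[OF P La L0])
qed

lemma F_smooth: "smooth_map_on M (points M) F"
proof (rule smooth_map_on_points)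
  fix p assume "p \<in> points M"
  then obtain c B L where l: "line_frame c p B L" using ex_chart line_frame_exists by blast
  let ?R = "\<lambda>v :: complex^7. \<chi> i. Re (v $ i)"
  have "bounded_linear ?R"
    unfolding linear_conv_bounded_linear[symmetric] by (rule linearI) (simp_all add: vec_eq_iff)
  from smooth_on_linear[OF nbdD(3)[OF line_frameD(1)[OF l]] line_frameD(4)[OF l] this]
  have "smooth_on B (in_chart c F)" by (simp add: fc_def cvec_def)
  then show "\<exists>c B. nbd c p B \<and> smooth_on B (in_chart c F)" using line_frameD(1)[OF l] by blast
qed

text \<open>By adjointness, A' annihilates exactly the values orthogonal to L. Among the frame
  vectors f and cnj L are orthogonal to L, while L is not.\<close>

lemma line_frame_generic:
  assumes l: "line_frame c p B L" and w: "w \<in> B" "w \<noteq> snd c p"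
  shows "d_z (fc F c) w \<in> in_chart c \<phi> w" "d_z (\<lambda>z. vec_cnj (L z)) w \<in> in_chart c \<phi> w" "d_z L w \<notin> in_chart c \<phi> w"
proof -
  note D = line_frameD[OF l]
  note B = nbdD(3)[OF D(1)]
  note t = type10[OF D(7)[OF w(1)] D(8)[OF w(1)] D(9)[OF w(1)] D(9)[OF w(1)]]
  have ker: "hermitian (s w) (L w) = 0 \<longleftrightarrow> d_z s w \<in> in_chart c \<phi> w"
    if s: "smooth_on B s" "\<And>z. z \<in> B \<Longrightarrow> s z \<in> {L z, fc F c z, vec_cnj (L z)}" for s
  proof -
    have "s z \<in> in_chart c \<phi> z" if "z \<in> B" for z unfolding D(10)[OF that] using s(2)[OF that] by (rule vec.span_base)
    from generic_adjoint(3)[OF D(2) w B w(1) s(1) this]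
    have "(\<forall>a\<in>vec.span {L w}. hermitian (s w) a = 0) \<longleftrightarrow> d_z s w \<in> in_chart c \<phi> w" unfolding D(6)[OF w(1)] .
    moreover have "(\<forall>a\<in>vec.span {L w}. hermitian (s w) a = 0) \<longleftrightarrow> hermitian (s w) (L w) = 0"
      by (auto simp: span_1)
    ultimately show ?thesis by simp
  qed
  show "d_z (fc F c) w \<in> in_chart c \<phi> w" using ker[OF D(4)] t(2) by simp
  show "d_z (\<lambda>z. vec_cnj (L z)) w \<in> in_chart c \<phi> w" using ker[OF smooth_on_vec_cnj[OF B D(3)]] t(6) by simp
  show "d_z L w \<notin> in_chart c \<phi> w" using ker[OF D(3)] D(5)[OF w(1)] by simp
qed

text \<open>Writing \<open>F_z = p L + q cnj L\<close>, the components of \<open>d_zbar d_z F = d_z d_zbar F\<close> orthogonal to \<open>\<phi>\<close>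
  give \<open>q cnj R = cnj q R\<close> with \<open>R = A' L\<close>, and \<open>R\<close> is isotropic as \<open>\<phi>\<close> is strongly conformal.\<close>

lemma dF_line:
  assumes l: "line_frame c p B L" and w: "w \<in> B" "w \<noteq> snd c p"
  shows "d_z (fc F c) w \<in> vec.span {L w}"
proof -
  note D = line_frameD[OF l]
  note n = D(1)
  note B = nbdD(3)[OF n] and P = nbdD(10)[OF n]
  let ?f = "fc F c" and ?h = "\<lambda>z. inverse (hermitian (L z) (L z))"
  \<comment> \<open>u and v are the coefficients of F_z along L and cnj L; the component along f is
    zero because (F, F) = 1.\<close>
  define u where "u = (\<lambda>z. hermitian (d_z ?f z) (L z) * ?h z)"
  define v where "v = (\<lambda>z. hermitian (d_z ?f z) (vec_cnj (L z)) * ?h z)"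
  define S where "S = B - {snd c p}"
  have S: "open S" "w \<in> S" "S \<subseteq> B" using B w by (auto simp: S_def)
  note sf = D(4)
  note sdf = smooth_on_d(1)[OF B sf]
  have sh: "smooth_on B ?h" by (rule smooth_on_inverse[OF B smooth_on_hermitian[OF B D(3,3)]]) (simp add: D(5))
  note sLc = smooth_on_vec_cnj[OF B D(3)]
  have su: "smooth_on B u" unfolding u_def by (rule smooth_on_mult[OF B smooth_on_hermitian[OF B sdf D(3)] sh])
  have sv: "smooth_on B v" unfolding v_def by (rule smooth_on_mult[OF B smooth_on_hermitian[OF B sdf sLc] sh])
  have re: "has_wirtinger ?f (d_z ?f z) (vec_cnj (d_z ?f z)) z" if "z \<in> B" for z by (rule real_has_wirtinger[OF B sf D(7) that])
  have dec: "d_z ?f z = u z *s L z + v z *s vec_cnj (L z)" if z: "z \<in> S" for z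
  proof -
    have zB: "z \<in> B" "z \<noteq> snd c p" using z by (auto simp: S_def)
    note t = type10[OF D(7)[OF zB(1)] D(8)[OF zB(1)] D(9)[OF zB(1)] D(9)[OF zB(1)]]
    have "hermitian (d_z ?f z) (?f z) + hermitian (?f z) (vec_cnj (d_z ?f z)) = 0"
      by (rule has_wirtinger1_zero(1)[OF B zB(1) D(8) has_wirtinger1_hermitian[OF re[OF zB(1)] re[OF zB(1)]]])
    moreover have "hermitian (?f z) (vec_cnj (d_z ?f z)) = hermitian (d_z ?f z) (?f z)"
      using hermitian_cnj[of "vec_cnj (d_z ?f z)" "?f z"] hermitian_vec_cnj'[of "d_z ?f z" "?f z"] D(7)[OF zB(1)] by simp
    ultimately have o: "hermitian (d_z ?f z) (?f z) = 0" by simp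
    have ne: "L z \<noteq> 0" "?f z \<noteq> 0" "vec_cnj (L z) \<noteq> 0" using D(5,8)[OF zB(1)] by auto
    have "orth_proj (in_chart c \<phi> z) (d_z ?f z) = d_z ?f z"
      by (rule orth_proj_ident) (use line_frame_generic(1)[OF l zB] sub[OF P[OF zB(1)]] in \<open>auto simp: in_chart_pt\<close>)
    then have "d_z ?f z = (hermitian (d_z ?f z) (L z) / hermitian (L z) (L z)) *s L z
        + (hermitian (d_z ?f z) (vec_cnj (L z)) / hermitian (vec_cnj (L z)) (vec_cnj (L z))) *s vec_cnj (L z)"
      unfolding D(10)[OF zB(1)] using orth_proj_span_3[OF ne, of "d_z ?f z"] t o by simp
    moreover have "hermitian (vec_cnj (L z)) (vec_cnj (L z)) = hermitian (L z) (L z)"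
      by (simp add: hermitian_vec_cnj hermitian_cnj)
    ultimately show ?thesis by (simp add: u_def v_def divide_inverse)
  qed
  obtain u1 u2 where wu: "has_wirtinger1 u u1 u2 w" by (rule smooth_on_has_wirtinger1[OF su w(1)])
  obtain v1 v2 where wv: "has_wirtinger1 v v1 v2 w" by (rule smooth_on_has_wirtinger1[OF sv w(1)])
  define a where "a = d_z L w"
  define b where "b = d_zbar L w"
  have wL: "has_wirtinger L a b w" unfolding a_def b_def by (rule smooth_on_has_wirtinger[OF D(3) w(1)])
  note wLc = has_wirtinger_vec_cnj[OF wL]
  let ?Lc = "vec_cnj (L w)"
  have 1: "d_zbar (d_z ?f) w = (u2 *s L w + u w *s b) + (v2 *s ?Lc + v w *s vec_cnj a)"
    by (rule has_wirtinger_d(2), rule has_wirtinger_cong[OF S(1,2) dec[symmetric]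
          has_wirtinger_add[OF has_wirtinger_smult[OF wu wL] has_wirtinger_smult[OF wv wLc]]])
  have "d_z (d_zbar ?f) w = (cnj u2 *s ?Lc + cnj (u w) *s vec_cnj b) + (cnj v2 *s L w + cnj (v w) *s a)"
  proof (rule has_wirtinger_d(1), rule has_wirtinger_cong[OF S(1,2) _
        has_wirtinger_add[OF has_wirtinger_smult[OF has_wirtinger1_cnj[OF wu] wLc] has_wirtinger_smult[OF has_wirtinger1_cnj[OF wv] wL]]])
    fix z assume z: "z \<in> S"
    have "d_zbar ?f z = vec_cnj (d_z ?f z)" using has_wirtinger_d(2)[OF re] z S(3) by blast
    then show "cnj (u z) *s vec_cnj (L z) + cnj (v z) *s L z = d_zbar ?f z" by (simp add: dec[OF z])
  qed
  then have eq: "(u2 *s L w + u w *s b) + (v2 *s ?Lc + v w *s vec_cnj a)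
      = (cnj u2 *s ?Lc + cnj (u w) *s vec_cnj b) + (cnj v2 *s L w + cnj (v w) *s a)"
    using d_zbar_d_z[OF B w(1) sf] 1 by simp
  let ?V = "in_chart c \<phi> w"
  let ?pr = "orth_proj (orth_compl ?V)"
  have sV: "vec.subspace ?V" using sub[OF P[OF w(1)]] by (simp add: in_chart_pt)
  have rV: "vec_cnj ` ?V = ?V" using real[OF P[OF w(1)]] by (simp add: in_chart_pt)
  have z: "?pr x = 0 \<longleftrightarrow> x \<in> ?V" for x
    using orth_proj_orth_compl[OF sV, of x] orth_proj(1)[OF sV, of x] orth_proj_ident[OF sV, of x] by auto
  have V: "L w \<in> ?V" "?Lc \<in> ?V" unfolding D(10)[OF w(1)] by (auto intro: vec.span_base)
  \<comment> \<open>As A' annihilates cnj L, the conjugate of L_zbar stays in the fibre, and by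
    reality so does L_zbar. Hence the projection of the mixed derivatives retains only R and its
    conjugate.\<close>
  have bc: "vec_cnj b \<in> ?V" using line_frame_generic(2)[OF l w] has_wirtinger_d(1)[OF wLc] by simp
  then have b: "b \<in> ?V" using rV by (metis image_eqI vec_cnj_simps)
  have pc: "?pr (vec_cnj x) = vec_cnj (?pr x)" for x
    using orth_proj_vec_cnj[OF subspace_orth_compl, of ?V x] by (simp add: orth_compl_vec_cnj[symmetric] rV)
  define R where "R = ?pr a"
  have lin: "?pr (x + y) = ?pr x + ?pr y" "?pr (k *s x) = k *s ?pr x" for x y k
    by (rule orth_proj_linear[OF subspace_orth_compl])+
  have zero: "?pr (L w) = 0" "?pr ?Lc = 0" "?pr b = 0" "?pr (vec_cnj b) = 0" using z V b bc by blast+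
  have e: "v w *s vec_cnj R = cnj (v w) *s R"
    using arg_cong[OF eq, of ?pr] unfolding lin zero pc R_def by simp
  have R0: "R \<noteq> 0" using z[of a] line_frame_generic(3)[OF l w] by (simp add: R_def a_def)
  have "R \<in> plane_image d_z (in_chart c \<phi>) w"
    unfolding plane_image_def R_def a_def
    using B w(1) D(3) D(10) by (intro CollectI exI[of _ L] exI[of _ B]) (auto intro: vec.span_base)
  then have R\<gamma>: "R \<in> \<gamma> (pt c w)" using D(2) w by (simp add: generic_def)
  then have "vec_cnj R \<in> G'' M \<phi> (pt c w)" using P[OF w(1)] by (simp add: \<gamma>_filled(2) cnjb_def)
  then have "hermitian R (vec_cnj R) = 0" using conformal[OF P[OF w(1)] R\<gamma>[unfolded \<gamma>_def]] by blast
  then have "hermitian (vec_cnj R) R = 0" by (rule hermitian_zero_commute[THEN iffD1])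
  then have "cnj (v w) * hermitian R R = 0" using arg_cong[OF e, of "\<lambda>x. hermitian x R"] by simp
  then have "v w = 0" using R0 by simp
  then show ?thesis using dec[OF S(2)] by (auto simp: span_1)
qed

lemma F_cross:
  assumes l: "line_frame c p B L" and w: "w \<in> B"
  shows "cross7 (fc F c w) (d_z (fc F c) w) = \<i> *s d_z (fc F c) w"
proof -
  note D = line_frameD[OF l]
  note B = nbdD(3)[OF D(1)]
  have "cross7 (fc F c z) (d_z (fc F c) z) = \<i> *s d_z (fc F c) z" if z: "z \<in> B" "z \<noteq> snd c p" for z
  proof -
    obtain k where "d_z (fc F c) z = k *s L z" using dF_line[OF l z] unfolding span_1 by blast
    then show ?thesis using D(9)[OF z(1)] by (simp add: vector_smult_assoc mult.commute)
  qed
  from type10_center[OF B D(4) smooth_on_d(1)[OF B D(4)] this w] show ?thesis .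
qed

text \<open>The complexified differential is \<xi> F_z + cnj \<xi> cnj F_z, and F \<times> acts on
  the two parts by \<i> and -\<i>.\<close>

lemma F_almost_complex: "almost_complex_map M F"
  unfolding almost_complex_map_def
proof (intro conjI F_PE F_smooth ballI allI)
  fix c p \<xi> assume c: "c \<in> atlas M" "p \<in> fst c"
  let ?w = "snd c p" and ?f = "fc F c"
  obtain B L where l: "line_frame c p B L" using line_frame_exists[OF c] by blast
  note D = line_frameD[OF l]
  note w = nbdD(4)[OF D(1)]
  let ?a = "d_z ?f ?w"
  have fw: "?f ?w = cvec (F p)" using c by (simp add: fc_def)
  have 1: "cross7 (cvec (F p)) ?a = \<i> *s ?a" using F_cross[OF l w] fw by simp
  have 2: "cross7 (cvec (F p)) (vec_cnj ?a) = - \<i> *s vec_cnj ?a"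
    using arg_cong[OF 1, of vec_cnj] by (simp add: vec_cnj_cross7)
  have s: "smooth_on (snd c ` fst c) (in_chart c F)" by (rule smooth_map_on_in_chart[OF F_smooth c(1)])
  have "frechet_derivative ?f (at ?w) v = cvec (frechet_derivative (in_chart c F) (at ?w) v)" for v
    unfolding fc_def[abs_def] by (rule frechet_derivative_linear_comp[OF s _ bounded_linear_cvec]) (use c in blast)
  moreover have "frechet_derivative ?f (at ?w) = (\<lambda>v. v *s ?a + cnj v *s vec_cnj ?a)"
    by (rule has_wirtinger_d(4)[OF real_has_wirtinger[OF nbdD(3)[OF D(1)] D(4,7) w]])
  ultimately have d: "cvec (frechet_derivative (in_chart c F) (at ?w) v) = v *s ?a + cnj v *s vec_cnj ?a" for v by metis
  have "cvec (frechet_derivative (in_chart c F) (at ?w) (\<i> * \<xi>)) = cvec (cross7 (F p) (frechet_derivative (in_chart c F) (at ?w) \<xi>))"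
    unfolding cross7_cvec[symmetric] d by (simp add: 1 2 vector_smult_assoc mult.commute)
  then show "frechet_derivative (in_chart c F) (at ?w) (\<i> * \<xi>) = cross7 (F p) (frechet_derivative (in_chart c F) (at ?w) \<xi>)"
    by (simp only: cvec_eq_iff)
qed

lemma bundle_cross_eq: "bundle_cross M (cnjb \<alpha>) \<alpha> = fb F"
proof (rule extensionalityI[of _ "points M"])
  fix p assume p: "p \<in> points M"
  obtain L where L: "L \<noteq> 0" "\<alpha> p = vec.span {L}" using \<alpha>_point[OF p] by blast
  have "cross7 (cvec (F p)) L = \<i> *s L" by (rule F_at(2)[OF p]) (simp add: L(2) vec.span_base)
  then show "bundle_cross M (cnjb \<alpha>) \<alpha> p = fb F p"
    using p span_cross7_type10[OF vec_cnj_cvec F_unit[OF p] L(1)]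
    by (simp add: bundle_cross_def cnjb_def line_bundle_of_def L(2) vec_cnj_image_span)
qed (simp_all add: bundle_cross_def line_bundle_of_def)

text \<open>The line of F is the product bundle of (c), which is assumed to vary.\<close>

lemma F_not_constant: "\<not> (\<forall>p\<in>points M. \<forall>q\<in>points M. F p = F q)"
proof
  assume c: "\<forall>p\<in>points M. \<forall>q\<in>points M. F p = F q"
  obtain p where p: "p \<in> points M" using points_nonempty by blast
  have "fb F q = fb F p" if q: "q \<in> points M" for q
  proof -
    have e: "F q = F p" using c p q by blast
    show ?thesis using p q by (simp add: line_bundle_of_def e)
  qed
  moreover have "bundle_cross M (G' M \<phi>p) (G'' M \<phi>p) = fb F"
    using bundle_cross_eq \<alpha>_filled(2) by (simp add: \<alpha>_def)
  ultimately show False using nonconst by metis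
qed

text \<open>If \<open>F\<close> maps into the great sphere of \<open>W\<close> and is not locally constant, then \<open>\<phi>\<close> is locally the complexification of
  \<open>W\<close>, hence \<open>A' = 0\<close>.\<close>

lemma F_not_geodesic: "\<not> (\<exists>S. totally_geodesic_S2 S \<and> F ` points M \<subseteq> S)"
proof
  assume "\<exists>S. totally_geodesic_S2 S \<and> F ` points M \<subseteq> S"
  then obtain W where W: "subspace W" "dim W = 3" and FW: "\<And>p. p \<in> points M \<Longrightarrow> F p \<in> W"
    unfolding totally_geodesic_S2_iff_great_sphere by blast
  let ?W = "complexification W"
  note sW = vec_subspace_complexification[OF W(1)]
  have "\<exists>T. openin (surf_top M) T \<and> p \<in> T \<and> (\<forall>q\<in>T. F q = F p)" if p: "p \<in> points M" for p
  proof -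
    obtain c B L where l: "line_frame c p B L" using ex_chart[OF p] line_frame_exists by blast
    note D = line_frameD[OF l]
    note n = D(1)
    note B = nbdD(3,4)[OF n]
    let ?f = "fc F c"
    have fW: "?f z \<in> ?W" if "z \<in> B" for z
    proof -
      have "F (pt c z) \<in> W" using FW nbdD(10)[OF n that] by blast
      then have "cvec (F (pt c z)) + \<i> *s cvec 0 \<in> ?W" using subspace_0[OF W(1)] unfolding complexification_def by blast
      then show ?thesis by (simp add: fc_def in_chart_pt)
    qed
    have dW: "d_z ?f z \<in> ?W" if "z \<in> B" for z
      by (rule derivative_in_subspace[OF B(1) that sW fW smooth_on_has_wirtinger[OF D(4) that]])
    have off: "d_z ?f z = 0" if z: "z \<in> B" "z \<noteq> snd c p" for z
    proof (rule ccontr)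
      assume nz: "d_z ?f z \<noteq> 0"
      \<comment> \<open>Where F_z is nonzero, L is a multiple of F_z and so lies in the complexified
        W, as then does L_z.\<close>
      define S where "S = (B \<inter> d_z ?f -` (- {0})) - {snd c p}"
      have "open (B \<inter> d_z ?f -` (- {0}))"
        by (rule continuous_open_preimage[OF smooth_on_imp_continuous_on[OF smooth_on_d(1)[OF B(1) D(4)]] B(1)]) auto
      then have S: "open S" "z \<in> S" using z nz by (auto simp: S_def)
      have LW: "L y \<in> ?W" if "y \<in> S" for y
      proof -
        have y: "y \<in> B" "y \<noteq> snd c p" "d_z ?f y \<noteq> 0" using that by (auto simp: S_def)
        obtain k where k: "d_z ?f y = k *s L y" using dF_line[OF l y(1,2)] unfolding span_1 by blast
        have "inverse k *s d_z ?f y = L y" unfolding k using k y(3) by (auto simp: vector_smult_assoc)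
        then show ?thesis using vec.subspace_scale[OF sW dW[OF y(1)], of "inverse k"] by simp
      qed
      have 1: "d_z L z \<in> ?W"
        by (rule derivative_in_subspace[OF S sW LW smooth_on_has_wirtinger[OF D(3) z(1)]])
      have "vec_cnj (L z) \<in> ?W" using LW[OF S(2)] vec_cnj_complexification[OF W(1)] by blast
      then have le: "vec.span {L z, ?f z, vec_cnj (L z)} \<subseteq> ?W"
        using LW[OF S(2)] fW[OF z(1)] by (intro vec.span_minimal sW) auto
      have "L z \<in> \<alpha> (pt c z)" by (simp add: D(6)[OF z(1)] vec.span_base)
      from \<phi>_span(3)[OF nbdD(10)[OF n z(1)] this D(5)[OF z(1)]]
      have "vec.dim (vec.span {L z, ?f z, vec_cnj (L z)}) = 3" by (simp only: fc_def in_chart_pt)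
      \<comment> \<open>By dimension the fibre of \<phi> is the complexified W. It then contains
        L_z, although A' does not annihilate L.\<close>
      then have "vec.span {L z, ?f z, vec_cnj (L z)} = ?W"
        using vec.subspace_dim_equal[OF vec.subspace_span sW le] dim_complexification_le[OF W] by simp
      then show False using line_frame_generic(3)[OF l z] D(10)[OF z(1)] 1 by simp
    qed
    have z: "d_z ?f z = 0" if zB: "z \<in> B" for z
      using off[OF zB] smooth_on_punctured_eq[OF B smooth_on_d(1)[OF B(1) D(4)] smooth_on_const[OF B(1)] off] by blast
    obtain r where r: "r > 0" "ball (snd c p) r \<subseteq> B" using B open_contains_ball by blast
    show ?thesis
      by (rule derivative_zero_constant[OF nbd_subset[OF n open_ball _ r(2)] smooth_on_subset[OF D(4) r(2)]])
         (use r z D(7) in auto)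
  qed
  then have "F p = F q" if "p \<in> points M" "q \<in> points M" for p q by (rule locally_constant[OF _ that])
  then show False using F_not_constant by blast
qed

lemma F_mem: "F \<in> almost_complex_maps M"
  using F_almost_complex F_not_geodesic by (simp add: almost_complex_maps_def)

text \<open>It suffices that \<alpha> is the bundle \<open>G'\<close> of the line of F. Off isolated
  points F_z is a nonzero multiple of L, so the two lines agree there, and uniqueness of filled
  images does the rest; both maps then have the fibre spanned by L, F and cnj L.\<close>

lemma to_G2_F: "to_G2_map M F = \<phi>"
proof -
  obtain \<beta> where "ac_surface M F \<beta>" by (rule ac_surface_exists[OF F_mem])
  then interpret ac: ac_surface M F \<beta> .
  have 1: "is_filled M (fb F) (A_of d_z (fb F)) \<psi> \<longleftrightarrow> smooth_subbundle M \<psi> \<and>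
    (\<forall>p\<in>points M. \<exists>T. openin (surf_top M) T \<and> p \<in> T \<and> (\<forall>q\<in>T. q \<noteq> p \<longrightarrow> \<psi> q = bundle_image d_z (fb F) q))" for \<psi>
    by (rule is_filled_iff[OF wirtinger_op_d(1) fb_subspace])
  have "\<exists>T. openin (surf_top M) T \<and> p \<in> T \<and> (\<forall>q\<in>T. q \<noteq> p \<longrightarrow> \<alpha> q = bundle_image d_z (fb F) q)" if p: "p \<in> points M" for p
  proof -
    obtain T where T: "openin (surf_top M) T" "p \<in> T" "\<forall>q\<in>T. q \<noteq> p \<longrightarrow> \<beta> q = bundle_image d_z (fb F) q"
      using bspec[OF conjunct2[OF iffD1[OF 1 ac.\<alpha>]] p] by (elim exE conjE)
    obtain c B L where l: "line_frame c p B L" using ex_chart[OF p] line_frame_exists by blast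
    note D = line_frameD[OF l]
    note n = D(1)
    have "\<alpha> q = bundle_image d_z (fb F) q" if q: "q \<in> T \<inter> nbd_set c B" "q \<noteq> p" for q
    proof -
      have w: "snd c q \<in> B" "pt c (snd c q) = q" "snd c q \<noteq> snd c p" using nbd_set(6)[OF n, of q] q by auto
      have qM: "q \<in> points M" using q nbd_set(3)[OF n] by blast
      have im: "bundle_image d_z (fb F) q = vec.span {d_z (fc F c) (snd c q)}"
        using fb_image[OF F_almost_complex nbdD(1)[OF n], of "snd c q"] nbdD(5)[OF n] w by auto
      obtain k where k: "d_z (fc F c) (snd c q) = k *s L (snd c q)" using dF_line[OF l w(1,3)] unfolding span_1 by blast
      have "bundle_image d_z (fb F) q \<noteq> {0}"
      proof -
        obtain L' where "L' \<noteq> 0" "\<beta> q = vec.span {L'}" using ac.at_point[OF qM] by metis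
        then show ?thesis using T(3) q by (simp add: span_line_zero)
      qed
      then have "k \<noteq> 0" unfolding im k by (auto simp: span_line_zero)
      then show ?thesis unfolding im k using D(6)[OF w(1)] w(2) by (simp only: span_line_scale not_False_eq_True)
    qed
    then show ?thesis using T(1,2) nbd_set(1,2)[OF n] by (intro exI[of _ "T \<inter> nbd_set c B"]) auto
  qed
  then have "is_filled M (fb F) (A_of d_z (fb F)) \<alpha>" using 1[of \<alpha>] \<alpha>s by blast
  then have \<beta>: "\<alpha> = \<beta>" by (rule is_filled_unique[OF _ ac.\<alpha>])
  have "ac.\<phi> = \<phi>"
  proof (rule extensionalityI[OF ac.\<phi>_ext ext])
    fix p assume p: "p \<in> points M"
    obtain L where "L \<noteq> 0" "\<beta> p = vec.span {L}" "ac.\<phi> p = vec.span {L, cvec (F p), vec_cnj L}" using ac.at_point[OF p] by metis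
    then show "ac.\<phi> p = \<phi> p" using \<phi>_span(2)[OF p, of L] \<beta> by (simp add: vec.span_base)
  qed
  then show ?thesis by (simp add: ac.\<phi>_def)
qed

end

theorem theorem5p8:
  fixes M :: "'a surface"
  assumes "riemann_surface M"
  shows "bij_betw (to_G2_map M) (almost_complex_maps M) (conformal_G2_maps M)
    \<and> (\<forall>\<phi>\<in>conformal_G2_maps M.
         (\<forall>p\<in>points M. \<exists>U L. p \<in> U \<and> nonvanishing_section M (G'' M (perp_bundle M \<phi>)) U L)
       \<and> (\<forall>U L. nonvanishing_section M (G'' M (perp_bundle M \<phi>)) U L \<longrightarrow>
            (\<forall>q\<in>U. cvec (the_inv_into (almost_complex_maps M) (to_G2_map M) \<phi> q)
               = (\<i> / complex_of_real ((norm (L q))\<^sup>2)) *s cross7 (vec_cnj (L q)) (L q))))"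
proof -
  interpret rsurface M by unfold_locales (rule assms)
  let ?A = "almost_complex_maps M" and ?C = "conformal_G2_maps M"
  let ?s = "\<lambda>\<phi>. \<forall>p\<in>points M. \<exists>U L. p \<in> U \<and> nonvanishing_section M (G'' M (perp_bundle M \<phi>)) U L"
  let ?f = "\<lambda>\<phi> F. \<forall>U L. nonvanishing_section M (G'' M (perp_bundle M \<phi>)) U L \<longrightarrow>
            (\<forall>q\<in>U. cvec (F q) = (\<i> / complex_of_real ((norm (L q))\<^sup>2)) *s cross7 (vec_cnj (L q)) (L q))"
  \<comment> \<open>The formula for F in a section is proved on this side of the correspondence. As
    the section depends on \<phi> alone, it gives injectivity as well as the description of the
    inverse.\<close>
  have fwd: "to_G2_map M F \<in> ?C \<and> ?s (to_G2_map M F) \<and> ?f (to_G2_map M F) F" if F: "F \<in> ?A" for F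
  proof -
    obtain \<alpha> where "ac_surface M F \<alpha>" by (rule ac_surface_exists[OF F])
    then interpret ac: ac_surface M F \<alpha> .
    have "?f ac.\<phi> F"
    proof (intro allI impI ballI)
      fix U L q assume L: "nonvanishing_section M (G'' M (perp_bundle M ac.\<phi>)) U L" and q: "q \<in> U"
      then have "q \<in> points M" using openin_subset unfolding nonvanishing_section_def smooth_section_def by blast
      moreover have "L q \<in> G'' M (perp_bundle M ac.\<phi>) q" "L q \<noteq> 0"
        using L q by (auto simp: nonvanishing_section_def smooth_section_def)
      ultimately show "cvec (F q) = (\<i> / complex_of_real ((norm (L q))\<^sup>2)) *s cross7 (vec_cnj (L q)) (L q)"
        by (rule ac.section_formula)
    qed
    then show ?thesis using ac.\<phi>_conformal ac.section_exists unfolding ac.\<phi>_def by blast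
  qed
  have inj: "inj_on (to_G2_map M) ?A"
  proof (rule inj_onI)
    fix F F' assume F: "F \<in> ?A" "F' \<in> ?A" and e: "to_G2_map M F = to_G2_map M F'"
    have ext: "F \<in> extensional (points M)" "F' \<in> extensional (points M)"
      using F by (auto simp: almost_complex_maps_def almost_complex_map_def PiE_iff)
    show "F = F'"
    proof (rule extensionalityI[OF ext])
      fix p assume "p \<in> points M"
      then obtain U L where p: "p \<in> U" and L: "nonvanishing_section M (G'' M (perp_bundle M (to_G2_map M F))) U L"
        using fwd[OF F(1)] by blast
      have "cvec (F p) = cvec (F' p)" using fwd[OF F(1)] fwd[OF F(2)] L p e by metis
      then show "F p = F' p" by simp
    qed
  qed
  have surj: "\<exists>F\<in>?A. to_G2_map M F = \<phi>" if \<phi>: "\<phi> \<in> ?C" for \<phi>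
  proof -
    interpret conformal_surface M \<phi> by unfold_locales (rule \<phi>)
    show ?thesis using F_mem to_G2_F by blast
  qed
  have "to_G2_map M ` ?A = ?C" using fwd surj by blast
  moreover have "?s \<phi> \<and> ?f \<phi> (the_inv_into ?A (to_G2_map M) \<phi>)" if \<phi>: "\<phi> \<in> ?C" for \<phi>
  proof -
    obtain F where F: "F \<in> ?A" "to_G2_map M F = \<phi>" using surj[OF \<phi>] by blast
    then have "the_inv_into ?A (to_G2_map M) \<phi> = F" using the_inv_into_f_f[OF inj F(1)] by simp
    then show ?thesis using fwd[OF F(1)] F(2) by simp
  qed
  ultimately show ?thesis using inj unfolding bij_betw_def by blast
qed

end
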